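(* There exist a prime $p\ge 12$ and a group $G$ of order $p^{10}$ and exponent $p$ such that there is no injective group homomorphism $G\hookrightarrow GL_{11}(\mathbb{F}_p)$.
   Context: $GL_{11}(\mathbb{F}_p)$ is the group of invertible $11\times 11$ matrices over the field with $p$ elements. *)

theory Defs
  imports "HOL-Algebra.Coset" "Jordan_Normal_Form.Matrix"
begin

text \<open>n x n matrices over the prime field F_p, represented by integer matrices
  whose entries are the canonical residues 0..p-1; arithmetic is reduced mod p.\<close>

definition mat_modp :: "nat \<Rightarrow> nat \<Rightarrow> int mat set" where
  "mat_modp n p = {A. A \<in> carrier_mat n n \<and> (\<forall>i<n. \<forall>j<n. A $$ (i,j) \<in> {0..<int p})}"

definition mult_modp :: "nat \<Rightarrow> int mat \<Rightarrow> int mat \<Rightarrow> int mat" where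
  "mult_modp p A B = map_mat (\<lambda>x. x mod int p) (A * B)"

definition GL_modp :: "nat \<Rightarrow> nat \<Rightarrow> int mat monoid" where
  "GL_modp n p = \<lparr> carrier = {A \<in> mat_modp n p. \<exists>B \<in> mat_modp n p.
        mult_modp p A B = 1\<^sub>m n \<and> mult_modp p B A = 1\<^sub>m n},
     monoid.mult = mult_modp p,
     monoid.one = 1\<^sub>m n \<rparr>"

definition group_exponent :: "('a, 'b) monoid_scheme \<Rightarrow> nat" where
  "group_exponent G = (LEAST n. 0 < n \<and> (\<forall>x\<in>carrier G. x [^]\<^bsub>G\<^esub> n = \<one>\<^bsub>G\<^esub>))"

end

theory Submission
  imports Defs "HOL-Algebra.Generated_Groups" "HOL-Algebra.Weak_Morphisms"
    "HOL-Library.Product_Plus" "HOL-Library.Function_Algebras" "Berlekamp_Zassenhaus.Finite_Field"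
begin

text \<open>
  We take \<open>p = 13\<close> and a group generated by two unipotent \<open>12 \<times> 12\<close> matrices \<open>g 1\<close>, \<open>g 2\<close>, with
  \<open>g (k + 1)\<close> the commutator of \<open>g 1\<close> and \<open>g k\<close> for \<open>2 \<le> k \<le> 8\<close> and with the central element \<open>g 10\<close>
  the commutator of \<open>g 2\<close> and \<open>g 9\<close>.  A faithful representation of degree at most 11 has a
  subquotient \<open>V\<close> of minimal dimension on which \<open>g 10\<close> acts non-trivially.  Let \<open>L k\<close> be the span of the
  images of words of length \<open>k\<close> in \<open>u x = x - 1\<close>, \<open>x \<in> {g 1, g 2}\<close>.  Since \<open>g 10\<close> is a commutator of
  weight 9, all layers \<open>L k / L (k + 1)\<close> with \<open>k \<le> 9\<close> are non-zero, so at most one of them has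
  dimension 2.  The leading parts of the group relations, for this filtration and for the finer ones
  in which \<open>g 2\<close> has a larger weight than \<open>g 1\<close>, are polynomial equations between the structure
  constants on the layers; modulo 13 they have no solution unless \<open>dim V = 11\<close> and the
  two-dimensional layer lies in degree at least 5, that is \<open>dim (L 5) = 6\<close>.  The same applies to the
  dual representation.  But words of length 10 act as zero, so \<open>L 5\<close> of \<open>V\<close> and of its dual are
  orthogonal, and \<open>6 + 6 > 11\<close>.
\<close>

section \<open>Filtrations and symbols of linear operators\<close>

text \<open>The group has maximal class: \<open>g 3\<close>, ..., \<open>g 9\<close> arise by
  bracketing with \<open>g 1\<close>, but \<open>g 10\<close> by bracketing \<open>g 9\<close> with
  \<open>g 2\<close>. In weights (1,1) every bracket among \<open>g 2\<close>, \<open>g 3\<close>,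
  ... that does not end in \<open>g 10\<close> vanishes at leading order. This limits the steps
  between neighbouring layers on which \<open>g 2\<close> can be non-zero. Once \<open>g 2\<close>
  vanishes on almost all steps, it can be given weight 2; then \<open>g k\<close> has degree
  \<open>k\<close> for \<open>k \<le> 9\<close>, \<open>g 10\<close> has degree 11, degree 10 is
  empty, and the brackets [2,3] = 5, [3,4] = -7, [4,5] = 3 * 9 survive. Their coefficients are what
  is inconsistent modulo 13. For a double layer in degree 1 the leading equations still leave a
  candidate, so there the next order is compared, with a truncated logarithm. Two devices make
  layers computable: \<open>u (g 1)\<close> is replaced by \<open>u (g 1) + c * u (g 2)\<close> with
  \<open>c\<close> avoiding ten bad values, and double layers are split according to whether some
  \<open>w\<close> in them is sent two layers down by both generators. The prime 13 exceeds the
  matrix size 12, so the exponent is 13 and 1, ..., 12 are invertible.\<close>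

definition raises :: "(nat \<Rightarrow> 'b set) \<Rightarrow> nat \<Rightarrow> ('b \<Rightarrow> 'b) \<Rightarrow> bool" where
 "raises F n Y \<longleftrightarrow> (\<forall>k. \<forall>x\<in>F k. Y x \<in> F (k + n))"

definition cm :: "('b::ab_group_add \<Rightarrow> 'b) \<Rightarrow> ('b \<Rightarrow> 'b) \<Rightarrow> 'b \<Rightarrow> 'b" where
 "cm A B = (\<lambda>x. A (B x) - B (A x))"

fun adp :: "('b::ab_group_add \<Rightarrow> 'b) \<Rightarrow> ('b \<Rightarrow> 'b) \<Rightarrow> nat \<Rightarrow> 'b \<Rightarrow> 'b" where
 "adp T B 0 = B"
| "adp T B (Suc n) = cm T (adp T B n)"

text \<open>The leading part of \<open>adp\<close>. A symbol depends on the degree at which it is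
  applied, so in each composition the outer factor is evaluated at the degree reached by the inner
  one; \<open>a\<close> and \<open>b\<close> are the degrees of \<open>t\<close> and
  \<open>y\<close>.\<close>

fun sadp :: "nat \<Rightarrow> nat \<Rightarrow> (nat \<Rightarrow> 's::minus \<Rightarrow> 's) \<Rightarrow> (nat \<Rightarrow> 's \<Rightarrow> 's) \<Rightarrow> nat \<Rightarrow> nat \<Rightarrow> 's \<Rightarrow> 's" where
 "sadp a b t y 0 k s = y k s"
| "sadp a b t y (Suc n) k s = t (k + (n * a + b)) (sadp a b t y n k s) - sadp a b t y n (k + a) (t k s)"

definition phi_add :: "(nat \<Rightarrow> 's::ab_group_add \<Rightarrow> 'b::ab_group_add) \<Rightarrow> bool" where
 "phi_add \<phi> \<longleftrightarrow> (\<forall>k s t. \<phi> k (s - t) = \<phi> k s - \<phi> k t)"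

locale fvs = finite_dimensional_vector_space scale Basis
 for scale :: "'a::field \<Rightarrow> 'b::ab_group_add \<Rightarrow> 'b" (infixr "*s" 75) and Basis :: "'b set"
begin

definition lin :: "('b \<Rightarrow> 'b) \<Rightarrow> bool" where
 "lin f \<longleftrightarrow> (\<forall>x y. f (x + y) = f x + f y) \<and> (\<forall>c x. f (scale c x) = scale c (f x))"

definition filt :: "(nat \<Rightarrow> 'b set) \<Rightarrow> bool" where
 "filt F \<longleftrightarrow> (\<forall>k. subspace (F k)) \<and> (\<forall>k. F (Suc k) \<subseteq> F k)"

lemma linI: "(\<And>x y. f (x + y) = f x + f y) ==> (\<And>c x. f (scale c x) = scale c (f x)) ==> lin f"
 by (simp add: lin_def)

lemma lin_add: "lin f ==> f (x + y) = f x + f y"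
 and lin_scale: "lin f ==> f (scale c x) = scale c (f x)"
 by (simp_all add: lin_def)

lemma lin_0: "lin f ==> f 0 = 0"
 using lin_scale[of f 0 0] by simp

lemma lin_uminus: "lin f ==> f (- x) = - f x"
 using lin_scale[of f "- 1" x] by simp

lemma lin_diff: "lin f ==> f (x - y) = f x - f y"
 using lin_add[of f x "- y"] lin_uminus[of f y] by simp

lemma lin_id: "lin (\<lambda>x. x)"
 by (rule linI) simp_all

lemma lin_comp: "lin f ==> lin g ==> lin (\<lambda>x. f (g x))"
 by (rule linI) (simp_all only: lin_add[of f] lin_add[of g] lin_scale[of f] lin_scale[of g])

lemma lin_plus: "lin f ==> lin g ==> lin (\<lambda>x. f x + g x)"
 by (rule linI) (simp_all add: lin_add[of f] lin_add[of g] lin_scale[of f] lin_scale[of g] scale_right_distrib)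

lemma lin_minus: "lin f ==> lin g ==> lin (\<lambda>x. f x - g x)"
 by (rule linI) (simp_all add: lin_add[of f] lin_add[of g] lin_scale[of f] lin_scale[of g] scale_right_diff_distrib)

lemma lin_scl: "lin f ==> lin (\<lambda>x. c *s f x)"
 by (rule linI) (simp_all add: lin_add[of f] lin_scale[of f] scale_right_distrib mult.commute)

lemma lin_cm: "lin f ==> lin g ==> lin (cm f g)"
 unfolding cm_def by (rule lin_minus[OF lin_comp[of f g] lin_comp[of g f]])

lemma lin_adp: "lin f ==> lin g ==> lin (adp f g n)"
 by (induction n) (simp_all add: lin_cm)

lemma lin_sum: "lin f ==> f (sum h A) = (\<Sum>a\<in>A. f (h a))"
 by (induction A rule: infinite_finite_induct) (simp_all add: lin_0[of f] lin_add[of f])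

lemma filt_sub: "filt F ==> subspace (F k)"
 by (simp add: filt_def)

lemma filt_mono: "filt F ==> k \<le> l ==> F l \<subseteq> F k"
 by (rule lift_Suc_antimono_le[of F]) (auto simp: filt_def)

lemma filt_monoD: "filt F ==> x \<in> F l ==> k \<le> l ==> x \<in> F k"
 using filt_mono by blast

lemma filt_add: "filt F ==> x \<in> F k ==> y \<in> F k ==> x + y \<in> F k"
 and filt_diff: "filt F ==> x \<in> F k ==> y \<in> F k ==> x - y \<in> F k"
 and filt_scale: "filt F ==> x \<in> F k ==> scale c x \<in> F k"
 and filt_0: "filt F ==> 0 \<in> F k"
 by (auto simp: filt_def intro: subspace_add subspace_diff subspace_scale subspace_0)

lemma raisesD: "raises F n Y ==> x \<in> F k ==> Y x \<in> F (k + n)"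
 by (simp add: raises_def)

lemma raises_mono: "filt F ==> raises F n Y ==> m \<le> n ==> raises F m Y"
 unfolding raises_def by (meson filt_monoD nat_add_left_cancel_le)

lemma raises_add: "filt F ==> raises F n Y ==> raises F n Y' ==> raises F n (\<lambda>x. Y x + Y' x)"
 and raises_diff: "filt F ==> raises F n Y ==> raises F n Y' ==> raises F n (\<lambda>x. Y x - Y' x)"
 and raises_scale: "filt F ==> raises F n Y ==> raises F n (\<lambda>x. scale c (Y x))"
 unfolding raises_def using filt_add[of F] filt_diff[of F] filt_scale[of F] by blast+

lemma raises_comp: "raises F m Y ==> raises F n Y' ==> raises F (m + n) (\<lambda>x. Y (Y' x))"
proof -
 assume a: "raises F m Y" "raises F n Y'"
 show ?thesis unfolding raises_def
 proof (intro allI ballI)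
 fix k x assume "x \<in> F k"
 then have "Y (Y' x) \<in> F (k + n + m)"
  using raisesD[OF a(1)] raisesD[OF a(2)] by blast
 then show "Y (Y' x) \<in> F (k + (m + n))"
  by (simp add: ac_simps)
 qed
qed

lemma raises_cm: "filt F ==> raises F m Y ==> raises F n Y' ==> raises F (m + n) (cm Y Y')"
 using raises_diff[of F "m + n" "\<lambda>x. Y (Y' x)" "\<lambda>x. Y' (Y x)"]
  raises_comp[of F m Y n Y'] raises_comp[of F n Y' m Y]
 by (simp add: cm_def add.commute)

lemma raises_trans:
 assumes "filt F" "raises F n (\<lambda>x. A x - B x)" "raises F n (\<lambda>x. B x - C x)"
 shows "raises F n (\<lambda>x. A x - C x)"
 using raises_add[OF assms] by simp

lemma raises_sym: "filt F ==> raises F n (\<lambda>x. A x - B x) ==> raises F n (\<lambda>x. B x - A x)"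
 using raises_scale[of F n "\<lambda>x. A x - B x" "-1"] by simp

text \<open>The difference of the brackets is \<open>[A, B - B'] + [A - A', B']\<close>, so one size
  bound and one error bound are combined in each summand.\<close>

lemma cm_cong:
 assumes "filt F" "lin A" "lin B" "lin A'" "lin B'"
  "raises F m A" "raises F n B'"
  "raises F m' (\<lambda>x. A x - A' x)" "raises F n' (\<lambda>x. B x - B' x)"
  "l \<le> m + n'" "l \<le> m' + n"
 shows "raises F l (\<lambda>x. cm A B x - cm A' B' x)"
proof -
 have eq: "cm A B x - cm A' B' x
   = cm A (\<lambda>x. B x - B' x) x + cm (\<lambda>x. A x - A' x) B' x" for x
  using assms(2-5) by (simp add: cm_def lin_diff[of A] lin_diff[of B'])
 have "raises F l (cm A (\<lambda>x. B x - B' x))"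
  using raises_mono[OF assms(1) raises_cm[OF assms(1,6,9)] assms(10)] .
 moreover have "raises F l (cm (\<lambda>x. A x - A' x) B')"
  using raises_mono[OF assms(1) raises_cm[OF assms(1,8,7)] assms(11)] .
 ultimately show ?thesis
  unfolding eq by (rule raises_add[OF assms(1)])
qed

lemma raises_adp:
 assumes "filt F" "raises F a T" "raises F b B"
 shows "raises F (n * a + b) (adp T B n)"
proof (induction n)
 case (Suc n)
 show ?case
  using raises_cm[OF assms(1,2) Suc] by (simp add: algebra_simps)
qed (simp add: assms)

text \<open>\<open>sym E \<phi> n Y y\<close>: on the graded pieces parametrised by \<open>\<phi>\<close>, the operator \<open>Y\<close> of degree \<open>n\<close>
 acts as \<open>y\<close>, up to the error spaces \<open>E\<close>.\<close>

definition sym :: "(nat \<Rightarrow> 'b set) \<Rightarrow> (nat \<Rightarrow> 's \<Rightarrow> 'b) \<Rightarrow> nat \<Rightarrow> ('b \<Rightarrow> 'b) \<Rightarrow> (nat \<Rightarrow> 's \<Rightarrow> 's) \<Rightarrow> bool" where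
 "sym E \<phi> n Y y \<longleftrightarrow> lin Y \<and> (\<forall>k. subspace (E k)) \<and> raises E n Y \<and>
   (\<forall>k s. Y (\<phi> k s) - \<phi> (k + n) (y k s) \<in> E (k + n))"

lemma symD: "sym E \<phi> n Y y ==> Y (\<phi> k s) - \<phi> (k + n) (y k s) \<in> E (k + n)"
 and sym_lin: "sym E \<phi> n Y y ==> lin Y"
 and sym_raises: "sym E \<phi> n Y y ==> raises E n Y"
 and sym_sub: "sym E \<phi> n Y y ==> subspace (E k)"
 by (auto simp: sym_def)

text \<open>The clause \<open>raises E n Y\<close> of \<open>sym\<close> is what carries the error
  of the inner operator into the error space of the composition.\<close>

lemma sym_comp:
 assumes "sym E \<phi> n Y y" "sym E \<phi> n' Y' y'"
 shows "sym E \<phi> (n + n') (\<lambda>x. Y (Y' x)) (\<lambda>k s. y (k + n') (y' k s))"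
proof -
 have "Y (Y' (\<phi> k s)) - \<phi> (k + (n + n')) (y (k + n') (y' k s)) \<in> E (k + (n + n'))" for k s
 proof -
  have 1: "Y' (\<phi> k s) - \<phi> (k + n') (y' k s) \<in> E (k + n')"
   using symD[OF assms(2)] .
  have 2: "Y (Y' (\<phi> k s) - \<phi> (k + n') (y' k s)) \<in> E (k + (n + n'))"
   using raisesD[OF sym_raises[OF assms(1)] 1] by (simp add: algebra_simps)
  have 3: "Y (\<phi> (k + n') (y' k s)) - \<phi> (k + (n + n')) (y (k + n') (y' k s)) \<in> E (k + (n + n'))"
   using symD[OF assms(1), of "k + n'" "y' k s"] by (simp add: algebra_simps)
  from subspace_add[OF sym_sub[OF assms(1)] 2 3] show ?thesis
   by (simp add: lin_diff[OF sym_lin[OF assms(1)]])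
 qed
 then show ?thesis
  using assms lin_comp[of Y Y'] raises_comp[of E n Y n' Y'] unfolding sym_def by simp
qed

lemma sym_diff:
 assumes "phi_add \<phi>" "sym E \<phi> n Y y" "sym E \<phi> n Y' y'"
 shows "sym E \<phi> n (\<lambda>x. Y x - Y' x) (\<lambda>k s. y k s - y' k s)"
proof -
 have "Y (\<phi> k s) - Y' (\<phi> k s) - \<phi> (k + n) (y k s - y' k s) \<in> E (k + n)" for k s
 proof -
  have "\<phi> (k + n) (y k s - y' k s) = \<phi> (k + n) (y k s) - \<phi> (k + n) (y' k s)"
   using assms(1) by (simp add: phi_add_def)
  then have "Y (\<phi> k s) - Y' (\<phi> k s) - \<phi> (k + n) (y k s - y' k s) =
    (Y (\<phi> k s) - \<phi> (k + n) (y k s)) - (Y' (\<phi> k s) - \<phi> (k + n) (y' k s))"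
   by simp
  with subspace_diff[OF sym_sub[OF assms(2)] symD[OF assms(2), of k s] symD[OF assms(3), of k s]]
  show ?thesis by (simp only:)
 qed
 moreover have "raises E n (\<lambda>x. Y x - Y' x)"
  unfolding raises_def
  using subspace_diff[OF sym_sub[OF assms(2)]] raisesD[OF sym_raises[OF assms(2)]]
   raisesD[OF sym_raises[OF assms(3)]] by blast
 ultimately show ?thesis
  using assms lin_minus[of Y Y'] unfolding sym_def by simp
qed

lemma sym_cm:
 assumes "phi_add \<phi>" "sym E \<phi> n Y y" "sym E \<phi> n' Y' y'"
 shows "sym E \<phi> (n + n') (cm Y Y') (\<lambda>k s. y (k + n') (y' k s) - y' (k + n) (y k s))"
 using sym_diff[OF assms(1) sym_comp[OF assms(2,3)]] sym_comp[OF assms(3,2)]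
 unfolding cm_def by (simp add: add.commute)

lemma sym_adp:
 assumes "phi_add \<phi>" "sym E \<phi> a T t" "sym E \<phi> b B y"
 shows "sym E \<phi> (n * a + b) (adp T B n) (sadp a b t y n)"
proof (induction n)
 case 0
 have "sadp a b t y 0 = y" by (intro ext) simp
 then show ?case using assms(3) by simp
next
 case (Suc n)
 have "sym E \<phi> (a + (n * a + b)) (cm T (adp T B n))
   (\<lambda>k s. t (k + (n * a + b)) (sadp a b t y n k s) - sadp a b t y n (k + a) (t k s))"
  by (rule sym_cm[OF assms(1,2) Suc])
 moreover have "sadp a b t y (Suc n) =
   (\<lambda>k s. t (k + (n * a + b)) (sadp a b t y n k s) - sadp a b t y n (k + a) (t k s))"
  by (intro ext) simp
 ultimately show ?case by (simp add: algebra_simps)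
qed

end

text \<open>Relations are written \<open>x \<otimes> y = c \<otimes> (y \<otimes> x)\<close>, which
  gives \<open>c\<close> the role of the commutator without inverses. The exponents 12, 9 and 3
  stand for -1, 5/2 and 3 modulo 13. Tails that matter only in higher degree are left as an
  unspecified \<open>s\<close> in a generated subgroup.\<close>

locale pgrp = group G for G (structure) +
 fixes g :: "nat \<Rightarrow> 'a"
 assumes g_closed [simp]: "g k \<in> carrier G"
  and pow13: "x \<in> carrier G ==> x [^] (13::nat) = \<one>"
  and gen: "carrier G = generate G {g 1, g 2}"
  and r1: "2 \<le> k ==> k \<le> 8 ==> g 1 \<otimes> g k = g (Suc k) \<otimes> (g k \<otimes> g 1)"
  and r19: "g 1 \<otimes> g 9 = g 9 \<otimes> g 1"
  and r2: "3 \<le> k ==> k \<le> 8 ==> \<exists>s\<in>generate G (g ` {k + 2..10}). g 2 \<otimes> g k = s \<otimes> (g k \<otimes> g 2)"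
  and r23: "\<exists>s\<in>generate G (g ` {7..10}). g 2 \<otimes> g 3 = (g 5 \<otimes> (g 6 [^] (12::nat) \<otimes> s)) \<otimes> (g 3 \<otimes> g 2)"
  and r34: "\<exists>s\<in>generate G (g ` {9..10}). g 3 \<otimes> g 4 = (g 7 [^] (12::nat) \<otimes> (g 8 [^] (9::nat) \<otimes> s)) \<otimes> (g 4 \<otimes> g 3)"
  and r45: "\<exists>s\<in>generate G (g ` {10..10}). g 4 \<otimes> g 5 = (g 9 [^] (3::nat) \<otimes> s) \<otimes> (g 5 \<otimes> g 4)"
  and r29: "g 2 \<otimes> g 9 = g 10 \<otimes> (g 9 \<otimes> g 2)"
  and r24: "\<exists>s\<in>generate G (g ` {7..10}). g 2 \<otimes> g 4 = (g 6 \<otimes> s) \<otimes> (g 4 \<otimes> g 2)"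
  and r35: "\<exists>s\<in>generate G (g ` {9..10}). g 3 \<otimes> g 5 = (g 8 [^] (12::nat) \<otimes> s) \<otimes> (g 5 \<otimes> g 3)"
  and r47: "g 4 \<otimes> g 7 = g 10 \<otimes> (g 7 \<otimes> g 4)"
  and r110: "g 1 \<otimes> g 10 = g 10 \<otimes> g 1"
  and r210: "g 2 \<otimes> g 10 = g 10 \<otimes> g 2"
begin

lemma inv_pow12: "x \<in> carrier G ==> inv x = x [^] (12::nat)"
proof -
 assume x: "x \<in> carrier G"
 have "x [^] (12::nat) \<otimes> x = x [^] (13::nat)"
  using nat_pow_Suc[of x 12] by simp
 with x show ?thesis
  using pow13[OF x] by (intro inv_equality) auto
qed

end

section \<open>Representations in characteristic 13 and the induced filtration of the group\<close>

locale prep = fvs scale Basis + pgrp G g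
 for scale :: "'a::field \<Rightarrow> 'b::ab_group_add \<Rightarrow> 'b" (infixr "*s" 75) and Basis :: "'b set"
  and G :: "('g, 'm) monoid_scheme" (structure) and g :: "nat \<Rightarrow> 'g" +
 assumes char13: "(13::'a) = 0"
  and char_ne: "0 < n ==> n \<le> 12 ==> of_nat n \<noteq> (0::'a)"
begin

definition isrep :: "'b set \<Rightarrow> ('g \<Rightarrow> 'b \<Rightarrow> 'b) \<Rightarrow> bool" where
 "isrep V \<rho> \<longleftrightarrow> subspace V \<and> (\<forall>x\<in>carrier G. lin (\<rho> x) \<and> \<rho> x ` V \<subseteq> V) \<and>
   (\<forall>x\<in>carrier G. \<forall>y\<in>carrier G. \<forall>v\<in>V. \<rho> (x \<otimes> y) v = \<rho> x (\<rho> y v)) \<and> (\<forall>v\<in>V. \<rho> \<one> v = v)"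

definition U :: "('g \<Rightarrow> 'b \<Rightarrow> 'b) \<Rightarrow> 'g \<Rightarrow> 'b \<Rightarrow> 'b" where
 "U \<rho> x = (\<lambda>v. \<rho> x v - v)"

text \<open>An analogue of the dimension subgroups: the elements that act as 1 up to
  \<open>n\<close> degrees. \<open>D_comm\<close> below gives the expected behaviour under
  commutators.\<close>

definition D :: "('g \<Rightarrow> 'b \<Rightarrow> 'b) \<Rightarrow> (nat \<Rightarrow> 'b set) \<Rightarrow> nat \<Rightarrow> 'g set" where
 "D \<rho> F n = {x \<in> carrier G. raises F n (U \<rho> x)}"

end

locale prep_filt = prep scale Basis G g
 for scale :: "'a::field \<Rightarrow> 'b::ab_group_add \<Rightarrow> 'b" (infixr "*s" 75) and Basis :: "'b set"
  and G :: "('g, 'm) monoid_scheme" (structure) and g :: "nat \<Rightarrow> 'g" +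
 fixes V \<rho> and F :: "nat \<Rightarrow> 'b set"
 assumes rep: "isrep V \<rho>" and filtF: "filt F" and FV: "F 0 \<subseteq> V"
begin

abbreviation "u x \<equiv> U \<rho> x"

lemma FkV: "x \<in> F k ==> x \<in> V"
 using filt_monoD[OF filtF, of x k 0] FV by auto

lemma lin_rho: "x \<in> carrier G ==> lin (\<rho> x)"
 and rho_V: "x \<in> carrier G ==> v \<in> V ==> \<rho> x v \<in> V"
 and rho_mult: "x \<in> carrier G ==> y \<in> carrier G ==> v \<in> V ==> \<rho> (x \<otimes> y) v = \<rho> x (\<rho> y v)"
 and rho_one: "v \<in> V ==> \<rho> \<one> v = v"
 using rep unfolding isrep_def by auto

lemma lin_u: "x \<in> carrier G ==> lin (u x)"
 unfolding U_def by (rule lin_minus[OF lin_rho lin_id])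

lemma D_carrier: "x \<in> D \<rho> F n ==> x \<in> carrier G"
 and D_raises: "x \<in> D \<rho> F n ==> raises F n (u x)"
 and D_I: "x \<in> carrier G ==> raises F n (u x) ==> x \<in> D \<rho> F n"
 by (auto simp: D_def)

lemma D_mono: "x \<in> D \<rho> F n ==> m \<le> n ==> x \<in> D \<rho> F m"
 using raises_mono[OF filtF] by (auto simp: D_def)

lemma u_mult:
 assumes "x \<in> carrier G" "y \<in> carrier G" "v \<in> V"
 shows "u (x \<otimes> y) v = u x (u y v) + u x v + u y v"
 using assms by (simp add: U_def rho_mult lin_diff[OF lin_rho])

lemma raises_cong: "(\<And>v. v \<in> V ==> Y v = Y' v) ==> raises F n Y \<longleftrightarrow> raises F n Y'"
 using FkV by (simp add: raises_def)

text \<open>From \<open>xy - 1 = (x - 1)(y - 1) + (x - 1) + (y - 1)\<close>: the defect of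
  additivity is a composition, so the degrees add.\<close>

lemma u_mult_diff:
 assumes "x \<in> D \<rho> F m" "y \<in> D \<rho> F n"
 shows "raises F (m + n) (\<lambda>v. u (x \<otimes> y) v - (u x v + u y v))"
proof -
 have "raises F (m + n) (\<lambda>v. u x (u y v))"
  using raises_comp[OF D_raises[OF assms(1)] D_raises[OF assms(2)]] .
 then show ?thesis
  by (subst raises_cong[where Y' = "\<lambda>v. u x (u y v)"])
   (use assms in \<open>auto simp: u_mult D_carrier algebra_simps\<close>)
qed

lemma D_one: "\<one> \<in> D \<rho> F n"
 using FkV filt_0[OF filtF] by (auto simp: D_def raises_def U_def rho_one)

lemma D_mult:
 assumes "x \<in> D \<rho> F n" "y \<in> D \<rho> F n" shows "x \<otimes> y \<in> D \<rho> F n"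
proof (rule D_I)
 have "raises F n (\<lambda>v. u (x \<otimes> y) v - (u x v + u y v))"
  using raises_mono[OF filtF u_mult_diff[OF assms]] by simp
 moreover have "raises F n (\<lambda>v. u x v + u y v)"
  using raises_add[OF filtF] assms D_raises by blast
 ultimately have "raises F n (\<lambda>v. (u (x \<otimes> y) v - (u x v + u y v)) + (u x v + u y v))"
  by (rule raises_add[OF filtF])
 then show "raises F n (u (x \<otimes> y))" by (simp add: U_def)
qed (use assms D_carrier in auto)

lemma D_pow: "x \<in> D \<rho> F n ==> x [^] (k::nat) \<in> D \<rho> F n"
 by (induction k) (auto simp: D_one D_mult)

text \<open>Exponent 13 turns inverses into 12th powers, so closure under products is
  enough.\<close>

lemma D_inv: "x \<in> D \<rho> F n ==> inv x \<in> D \<rho> F n"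
 using D_pow[of x n 12] D_carrier by (simp add: inv_pow12)

lemma D_generate: "H \<subseteq> D \<rho> F n ==> generate G H \<subseteq> D \<rho> F n"
proof
 fix x assume "H \<subseteq> D \<rho> F n" "x \<in> generate G H"
 from this(2,1) show "x \<in> D \<rho> F n"
  by (induction rule: generate.induct) (auto simp: D_one D_mult D_inv)
qed

lemma u_pow_diff:
 assumes "x \<in> D \<rho> F n"
 shows "raises F (2 * n) (\<lambda>v. u (x [^] (k::nat)) v - of_nat k *s u x v)"
proof (induction k)
 case 0
 then show ?case
  using FkV filt_0[OF filtF] by (auto simp: raises_def U_def rho_one)
next
 case (Suc k)
 have "raises F (n + n) (\<lambda>v. u (x [^] k \<otimes> x) v - (u (x [^] k) v + u x v))"
  using u_mult_diff[OF D_pow[OF assms] assms] .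
 from raises_add[OF filtF this Suc[unfolded mult_2]]
 have "raises F (2 * n) (\<lambda>v. (u (x [^] k \<otimes> x) v - (u (x [^] k) v + u x v)) + (u (x [^] k) v - of_nat k *s u x v))"
  by (simp add: mult_2)
 then show ?case by (simp add: algebra_simps)
qed

lemma rho_pres: "x \<in> D \<rho> F n ==> v \<in> F k ==> \<rho> x v \<in> F k"
proof -
 assume "x \<in> D \<rho> F n" "v \<in> F k"
 then have "u x v \<in> F k"
  using raisesD[OF D_raises[OF D_mono[of x n 0]]] by simp
 from filt_add[OF filtF this \<open>v \<in> F k\<close>] show ?thesis by (simp add: U_def)
qed

text \<open>The bracket of \<open>x - 1\<close> and \<open>y - 1\<close> is
  \<open>xy - yx = (c - 1) yx\<close>. This identity is the only bridge from group commutators to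
  operator brackets.\<close>

lemma cm_u:
 assumes "x \<in> carrier G" "y \<in> carrier G" "c \<in> carrier G" "x \<otimes> y = c \<otimes> (y \<otimes> x)" "v \<in> V"
 shows "cm (u x) (u y) v = u c (\<rho> (y \<otimes> x) v)"
proof -
 have "\<rho> (x \<otimes> y) v = \<rho> c (\<rho> (y \<otimes> x) v)"
  unfolding assms(4) using assms by (intro rho_mult) auto
 moreover have "cm (u x) (u y) v = \<rho> (x \<otimes> y) v - \<rho> (y \<otimes> x) v"
  using assms(1,2,3,5) by (simp add: cm_def U_def rho_mult lin_diff[OF lin_rho])
 ultimately show ?thesis by (simp add: U_def)
qed

text \<open>In \<open>cm_u\<close> the factor \<open>\<rho> (y \<otimes> x)\<close> preserves the
  filtration; replacing it by the identity costs \<open>u (y \<otimes> x)\<close>, hence gains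
  \<open>k\<close> degrees.\<close>

lemma cm_u_raises:
 assumes "x \<in> D \<rho> F m" "y \<in> D \<rho> F n" "c \<in> D \<rho> F l" "x \<otimes> y = c \<otimes> (y \<otimes> x)"
 shows "raises F l (cm (u x) (u y))"
  and "k \<le> m ==> k \<le> n ==> raises F (l + k) (\<lambda>v. cm (u x) (u y) v - u c v)"
proof -
 have car: "x \<in> carrier G" "y \<in> carrier G" "c \<in> carrier G"
  using assms D_carrier by auto
 have yx: "y \<otimes> x \<in> D \<rho> F k" if "k \<le> m" "k \<le> n" for k
  using D_mult[OF D_mono[OF assms(2) that(2)] D_mono[OF assms(1) that(1)]] .
 have "u c (\<rho> (y \<otimes> x) v) \<in> F (i + l)" if "v \<in> F i" for v i
  using raisesD[OF D_raises[OF assms(3)] rho_pres[OF yx[of 0] that]] by simp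
 then show "raises F l (cm (u x) (u y))"
  using cm_u[OF car assms(4)] FkV by (simp add: raises_def)
 assume k: "k \<le> m" "k \<le> n"
 have "cm (u x) (u y) v - u c v = u c (u (y \<otimes> x) v)" if "v \<in> V" for v
  unfolding cm_u[OF car assms(4) that]
  using lin_diff[OF lin_u[OF car(3)]] by (simp add: U_def[of _ "y \<otimes> x"])
 then show "raises F (l + k) (\<lambda>v. cm (u x) (u y) v - u c v)"
  using raises_comp[OF D_raises[OF assms(3)] D_raises[OF yx[OF k]]]
  by (subst raises_cong) auto
qed

text \<open>\<open>cm_u\<close> is solved for \<open>u c\<close> by inserting
  \<open>\<rho> (inv (y \<otimes> x)) v\<close>, which stays in the same \<open>F k\<close>; so
  nothing about the degree of \<open>c\<close> has to be known beforehand.\<close>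

lemma D_comm:
 assumes "x \<in> D \<rho> F m" "y \<in> D \<rho> F n" "c \<in> carrier G" "x \<otimes> y = c \<otimes> (y \<otimes> x)"
 shows "c \<in> D \<rho> F (m + n)"
proof (rule D_I[OF assms(3)], unfold raises_def, intro allI ballI)
 fix k v assume v: "v \<in> F k"
 have car: "x \<in> carrier G" "y \<in> carrier G" using assms D_carrier by auto
 have "inv (y \<otimes> x) \<in> D \<rho> F 0"
  by (intro D_inv D_mult) (use assms D_mono in auto)
 then have w: "\<rho> (inv (y \<otimes> x)) v \<in> F k"
  using rho_pres v by blast
 have "cm (u x) (u y) (\<rho> (inv (y \<otimes> x)) v) = u c (\<rho> (y \<otimes> x) (\<rho> (inv (y \<otimes> x)) v))"
  by (rule cm_u) (use assms car w FkV in auto)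
 also have "\<rho> (y \<otimes> x) (\<rho> (inv (y \<otimes> x)) v) = v"
  using car FkV[OF v] by (simp add: rho_mult[symmetric] rho_one del: inv_mult_group)
 finally have "u c v = cm (u x) (u y) (\<rho> (inv (y \<otimes> x)) v)" by simp
 also have "\<dots> \<in> F (k + (m + n))"
  using raisesD[OF raises_cm[OF filtF D_raises[OF assms(1)] D_raises[OF assms(2)]] w] .
 finally show "u c v \<in> F (k + (m + n))" .
qed

end

text \<open>The commutator weight of \<open>g k\<close> when \<open>g 1\<close> has weight
  \<open>wa\<close> and \<open>g 2\<close> has weight \<open>wb\<close>. The element
  \<open>g 10\<close> contains \<open>g 2\<close> twice and so breaks the progression.\<close>

definition hgt :: "nat \<Rightarrow> nat \<Rightarrow> nat \<Rightarrow> nat" where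
 "hgt wa wb k = (if k = 10 then 7 * wa + 2 * wb else wa * (k - 2) + wb)"

section \<open>Weighted filtrations and the leading parts of the group relations\<close>

locale prep_adm = prep_filt scale Basis G g V \<rho> F
 for scale :: "'a::field \<Rightarrow> 'b::ab_group_add \<Rightarrow> 'b" (infixr "*s" 75) and Basis :: "'b set"
  and G :: "('g, 'm) monoid_scheme" (structure) and g :: "nat \<Rightarrow> 'g" and V \<rho> F +
 fixes wa wb :: nat
 assumes wa: "1 \<le> wa" and wab: "wa \<le> wb"
  and g1D: "raises F wa (U \<rho> (g 1))" and g2D: "raises F wb (U \<rho> (g 2))"
begin

abbreviation "ht \<equiv> hgt wa wb"

lemma g1_D: "g 1 \<in> D \<rho> F wa" and g2_D: "g 2 \<in> D \<rho> F wb"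
 using g1D g2D by (auto intro: D_I)

lemma D_g9: "n \<le> 7 ==> g (n + 2) \<in> D \<rho> F (wa * n + wb)"
proof (induction n)
 case 0
 show ?case using g2_D by (simp add: numeral_2_eq_2)
next
 case (Suc n)
 then have "g (n + 2) \<in> D \<rho> F (wa * n + wb)" by simp
 moreover have "g 1 \<otimes> g (n + 2) = g (Suc (n + 2)) \<otimes> (g (n + 2) \<otimes> g 1)"
  using Suc by (intro r1) auto
 ultimately have "g (Suc (n + 2)) \<in> D \<rho> F (wa + (wa * n + wb))"
  by (intro D_comm[OF g1_D]) auto
 then show ?case by (simp add: algebra_simps)
qed

lemma D_g: "2 \<le> k ==> k \<le> 10 ==> g k \<in> D \<rho> F (ht k)"
proof (cases "k = 10")
 case True
 have "g 10 \<in> D \<rho> F (wb + (wa * 7 + wb))"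
  using D_g9[of 7] r29 by (intro D_comm[OF g2_D]) auto
 with True show ?thesis by (simp add: hgt_def algebra_simps)
next
 case False
 assume "2 \<le> k" "k \<le> 10"
 with False have "k - 2 \<le> 7" "k - 2 + 2 = k" by auto
 with D_g9[of "k - 2"] False show ?thesis by (simp add: hgt_def)
qed

lemma ht_mono: "2 \<le> k ==> k \<le> l ==> l \<le> 10 ==> ht k \<le> ht l"
proof -
 assume a: "2 \<le> k" "k \<le> l" "l \<le> 10"
 have "wa * (k - 2) \<le> wa * (l - 2)" using a by (intro mult_le_mono2 diff_le_mono)
 moreover have "wa * (k - 2) \<le> 7 * wa" if "k \<noteq> 10"
 proof -
  have "k - 2 \<le> 7" using a that by simp
  from mult_le_mono2[OF this, of wa] show ?thesis by (simp only: mult.commute)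
 qed
 ultimately show ?thesis using a unfolding hgt_def by (cases "k = 10"; cases "l = 10"; simp; linarith)
qed

lemma D_S: "2 \<le> m ==> s \<in> generate G (g ` {m..10}) ==> m \<le> 10 ==> s \<in> D \<rho> F (ht m)"
 using D_generate[of "g ` {m..10}" "ht m"] D_mono[OF D_g ht_mono] by fastforce

abbreviation "X T n \<equiv> adp T (u (g 2)) n"

lemma lin_X: "lin T ==> lin (X T n)"
 by (simp add: lin_adp lin_u)

text \<open>The free parameter \<open>c\<close> later makes this operator non-zero on all
  one-dimensional layers. For \<open>wa < wb\<close> the added term has higher degree; for equal
  weights it is a real change of generator, harmless because \<open>g 2\<close> commutes with
  \<open>g 3\<close>, ..., \<open>g 8\<close> at leading order.\<close>

definition Tc :: "'a \<Rightarrow> 'b \<Rightarrow> 'b" where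
 "Tc c = (\<lambda>v. u (g 1) v + c *s u (g 2) v)"

lemma lin_Tc: "lin (Tc c)"
 unfolding Tc_def by (intro lin_plus lin_scl lin_u g_closed)

lemma raises_Tc: "raises F wa (Tc c)"
 unfolding Tc_def
 by (intro raises_add[OF filtF] raises_scale[OF filtF] g1D raises_mono[OF filtF g2D wab])

lemma cm_Tc: "lin Y ==> cm (Tc c) Y v = cm (u (g 1)) Y v + c *s cm (u (g 2)) Y v"
 by (simp add: cm_def Tc_def lin_add[of Y] lin_scale[of Y] scale_right_diff_distrib)

lemma cm_self: "cm Y Y = (\<lambda>v. 0)"
 by (simp add: cm_def)

text \<open>Induction over \<open>r1\<close>: each bracket with \<open>Tc c\<close> moves from
  \<open>g (n + 2)\<close> to the next generator, and the \<open>c\<close>-part drops out by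
  \<open>hyp\<close>. Hence all relations can be expressed in the two operators \<open>Tc c\<close>
  and \<open>u (g 2)\<close>.\<close>

lemma X_u:
 assumes hyp: "\<And>n. 1 \<le> n ==> n \<le> 6 \<Longrightarrow>
   raises F (wa * Suc n + wb + 1) (cm (u (g 2)) (u (g (n + 2))))"
 shows "n \<le> 7 ==> raises F (wa * n + wb + 1) (\<lambda>v. X (Tc c) n v - u (g (n + 2)) v)"
proof (induction n)
 case 0
 show ?case using filt_0[OF filtF] by (simp add: raises_def numeral_2_eq_2)
next
 case (Suc n)
 let ?l = "wa * Suc n + wb + 1"
 have IH: "raises F (wa * n + wb + 1) (\<lambda>v. X (Tc c) n v - u (g (n + 2)) v)"
  using Suc by simp
 have gn: "g (n + 2) \<in> D \<rho> F (wa * n + wb)" and gn1: "g (Suc (n + 2)) \<in> D \<rho> F (wa * Suc n + wb)"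
  using D_g9[of n] D_g9[of "Suc n"] Suc.prems by auto
 have 1: "raises F ?l (\<lambda>v. cm (Tc c) (X (Tc c) n) v - cm (Tc c) (u (g (n + 2))) v)"
  by (rule cm_cong[OF filtF lin_Tc lin_X[OF lin_Tc] lin_Tc lin_u raises_Tc D_raises[OF gn] _ IH,
     where m' = ?l])
   (use filt_0[OF filtF] in \<open>auto simp: raises_def\<close>)
 have "cm (Tc c) (u (g (n + 2))) v - cm (u (g 1)) (u (g (n + 2))) v
   = c *s cm (u (g 2)) (u (g (n + 2))) v" for v
  by (simp add: cm_Tc[OF lin_u])
 moreover have "raises F ?l (cm (u (g 2)) (u (g (n + 2))))"
 proof (cases "n = 0")
  case True
  then show ?thesis using filt_0[OF filtF] by (simp add: cm_self raises_def numeral_2_eq_2)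
 qed (use hyp Suc.prems in auto)
 ultimately have 2: "raises F ?l (\<lambda>v. cm (Tc c) (u (g (n + 2))) v - cm (u (g 1)) (u (g (n + 2))) v)"
  using raises_scale[OF filtF] by simp
 have "g 1 \<otimes> g (n + 2) = g (Suc (n + 2)) \<otimes> (g (n + 2) \<otimes> g 1)"
  using Suc.prems by (intro r1) auto
 from cm_u_raises(2)[OF g1_D gn gn1 this, of 1]
 have 3: "raises F ?l (\<lambda>v. cm (u (g 1)) (u (g (n + 2))) v - u (g (Suc (n + 2))) v)"
  using wa wab by simp
 show ?case
  using raises_trans[OF filtF raises_trans[OF filtF 1 2] 3] by simp
qed

lemma cm_u2:
 assumes "1 \<le> n" "n \<le> 6" "l \<le> ht (n + 4)"
 shows "raises F l (cm (u (g 2)) (u (g (n + 2))))"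
proof -
 have "3 \<le> n + 2" "n + 2 \<le> 8" and e: "n + 2 + 2 = n + 4" using assms by auto
 from r2[OF this(1,2), unfolded e] obtain s where s: "s \<in> generate G (g ` {n + 4..10})"
  "g 2 \<otimes> g (n + 2) = s \<otimes> (g (n + 2) \<otimes> g 2)"
  by blast
 have "s \<in> D \<rho> F (ht (n + 4))" using D_S[OF _ s(1)] assms by simp
 from cm_u_raises(1)[OF g2_D D_g9[of n] this s(2)] assms show ?thesis
  by (auto intro: raises_mono[OF filtF])
qed

lemma u_prod_diff:
 assumes "x \<in> D \<rho> F m" "y \<in> D \<rho> F n"
 shows "raises F n (\<lambda>v. u (x \<otimes> y) v - u x v)"
proof -
 have "raises F n (\<lambda>v. (u (x \<otimes> y) v - (u x v + u y v)) + u y v)"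
  using raises_mono[OF filtF u_mult_diff[OF assms]] D_raises[OF assms(2)]
  by (intro raises_add[OF filtF]) auto
 then show ?thesis by (simp add: algebra_simps)
qed

end

context prep_adm
begin

lemma raises_X:
 assumes "\<And>n. 1 \<le> n ==> n \<le> 6 \<Longrightarrow>
   raises F (wa * Suc n + wb + 1) (cm (u (g 2)) (u (g (n + 2))))" "n \<le> 7"
 shows "raises F (wa * n + wb) (X (Tc c) n)"
 using raises_adp[OF filtF raises_Tc g2D, of n] by (simp add: mult.commute)

lemma cm_X_u:
 assumes hyp: "\<And>n. 1 \<le> n ==> n \<le> 6 \<Longrightarrow>
   raises F (wa * Suc n + wb + 1) (cm (u (g 2)) (u (g (n + 2))))" "n \<le> 7" "m \<le> 7"
 shows "raises F (wa * (n + m) + 2 * wb + 1)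
  (\<lambda>v. cm (X (Tc c) n) (X (Tc c) m) v - cm (u (g (n + 2))) (u (g (m + 2))) v)"
 by (rule cm_cong[OF filtF lin_X[OF lin_Tc] lin_X[OF lin_Tc] lin_u lin_u raises_X[OF assms(1,2)]
    D_raises[OF D_g9[OF assms(3)]] X_u[OF assms(1,2)] X_u[OF assms(1,3)]])
  (auto simp: algebra_simps)

lemma cm_u34: "l \<le> ht 7 ==> raises F l (cm (u (g 3)) (u (g 4)))"
proof -
 assume l: "l \<le> ht 7"
 from r34 obtain s where s: "s \<in> generate G (g ` {9..10})"
  "g 3 \<otimes> g 4 = (g 7 [^] (12::nat) \<otimes> (g 8 [^] (9::nat) \<otimes> s)) \<otimes> (g 4 \<otimes> g 3)" by blast
 have "g 7 \<in> D \<rho> F (ht 7)" "g 8 \<in> D \<rho> F (ht 7)" "s \<in> D \<rho> F (ht 7)"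
  using D_g[of 7] D_mono[OF D_g[of 8] ht_mono[of 7 8]] D_mono[OF D_S[OF _ s(1)] ht_mono[of 7 9]]
  by auto
 then have "g 7 [^] (12::nat) \<otimes> (g 8 [^] (9::nat) \<otimes> s) \<in> D \<rho> F (ht 7)"
  by (intro D_mult D_pow)
 from cm_u_raises(1)[OF D_g[of 3] D_g[of 4] this s(2)] l show ?thesis
  by (auto intro: raises_mono[OF filtF])
qed

lemma cm_u45: "l \<le> ht 9 ==> raises F l (cm (u (g 4)) (u (g 5)))"
proof -
 assume l: "l \<le> ht 9"
 from r45 obtain s where s: "s \<in> generate G (g ` {10..10})"
  "g 4 \<otimes> g 5 = (g 9 [^] (3::nat) \<otimes> s) \<otimes> (g 5 \<otimes> g 4)" by blast
 have "g 9 \<in> D \<rho> F (ht 9)" "s \<in> D \<rho> F (ht 9)"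
  using D_g[of 9] D_mono[OF D_S[OF _ s(1)] ht_mono[of 9 10]] by auto
 then have "g 9 [^] (3::nat) \<otimes> s \<in> D \<rho> F (ht 9)"
  by (intro D_mult D_pow)
 from cm_u_raises(1)[OF D_g[of 4] D_g[of 5] this s(2)] l show ?thesis
  by (auto intro: raises_mono[OF filtF])
qed

lemma z_u29: "raises F (ht 10 + wa) (\<lambda>v. cm (u (g 2)) (u (g 9)) v - u (g 10) v)"
 by (rule cm_u_raises(2)[OF D_g[of 2] D_g[of 9] D_g[of 10] r29]) (use wab in \<open>auto simp: hgt_def\<close>)

lemma rel_transfer:
 assumes "raises F l (\<lambda>v. cm (X (Tc c) n) (X (Tc c) m) v - cm (u (g (n + 2))) (u (g (m + 2))) v)"
  "raises F l (\<lambda>v. cm (u (g (n + 2))) (u (g (m + 2))) v - C v)"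
 shows "raises F l (\<lambda>v. cm (X (Tc c) n) (X (Tc c) m) v - C v)"
 using raises_trans[OF filtF assms] .

end

locale prep11 = prep_adm scale Basis G g V \<rho> F 1 1
 for scale :: "'a::field \<Rightarrow> 'b::ab_group_add \<Rightarrow> 'b" (infixr "*s" 75) and Basis :: "'b set"
  and G :: "('g, 'm) monoid_scheme" (structure) and g :: "nat \<Rightarrow> 'g" and V \<rho> F
begin

lemma hyp11: "1 \<le> n ==> n \<le> 6 ==> raises F (1 * Suc n + 1 + 1) (cm (u (g 2)) (u (g (n + 2))))"
 by (rule cm_u2) (auto simp: hgt_def)

text \<open>The commutators of \<open>g 2, g 3\<close>, of \<open>g 3, g 4\<close> and of
  \<open>g 4, g 5\<close> lie one degree deeper than the weights (1,1) predict, so their brackets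
  disappear at leading order. The bracket that produces \<open>g 10\<close> has exactly the
  predicted degree 9.\<close>

lemma rel11_23: "raises F 4 (cm (X (Tc c) 0) (X (Tc c) 1))"
 and rel11_34: "raises F 6 (cm (X (Tc c) 1) (X (Tc c) 2))"
 and rel11_45: "raises F 8 (cm (X (Tc c) 2) (X (Tc c) 3))"
 and rel11_z: "raises F 10 (\<lambda>v. cm (X (Tc c) 0) (X (Tc c) 7) v - u (g 10) v)"
proof -
 have 1: "raises F l (cm (X (Tc c) n) (X (Tc c) m))"
  if "raises F l (\<lambda>v. cm (X (Tc c) n) (X (Tc c) m) v - C v)" "raises F l C" for l n m C
  using raises_add[OF filtF that] by simp
 show "raises F 4 (cm (X (Tc c) 0) (X (Tc c) 1))"
  using 1[of 4 0 1 "cm (u (g 2)) (u (g 3))"] cm_u2[of 1 4] cm_X_u[OF hyp11, of 0 1 c] by (simp add: hgt_def eval_nat_numeral)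
 show "raises F 6 (cm (X (Tc c) 1) (X (Tc c) 2))"
  using 1[of 6 1 2 "cm (u (g 3)) (u (g 4))"] cm_u34[of 6] cm_X_u[OF hyp11, of 1 2 c] by (simp add: hgt_def eval_nat_numeral)
 show "raises F 8 (cm (X (Tc c) 2) (X (Tc c) 3))"
  using 1[of 8 2 3 "cm (u (g 4)) (u (g 5))"] cm_u45[of 8] cm_X_u[OF hyp11, of 2 3 c] by (simp add: hgt_def eval_nat_numeral)
 show "raises F 10 (\<lambda>v. cm (X (Tc c) 0) (X (Tc c) 7) v - u (g 10) v)"
  using rel_transfer[of 10 c 0 7 "u (g 10)"] cm_X_u[OF hyp11, of 0 7 c] z_u29
  by (simp add: hgt_def eval_nat_numeral)
qed

lemma rel11_2n:
 assumes "1 \<le> n" "n \<le> 6"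
 shows "raises F (n + 3) (cm (X (Tc c) 0) (X (Tc c) n))"
proof -
 have e: "g (0 + 2) = g 2" by (simp only: add_0_left)
 have 1: "raises F (n + 3) (\<lambda>v. cm (X (Tc c) 0) (X (Tc c) n) v - cm (u (g 2)) (u (g (n + 2))) v)"
  using cm_X_u[OF hyp11, of 0 n c] assms unfolding e by (simp add: eval_nat_numeral)
 have 2: "raises F (n + 3) (cm (u (g 2)) (u (g (n + 2))))"
  using hyp11[OF assms] by (simp add: eval_nat_numeral)
 show ?thesis
  using raises_add[OF filtF 1 2] by simp
qed

text \<open>Since \<open>g 9\<close> commutes with \<open>g 1\<close>, the bracket with
  \<open>Tc c\<close> sees only the summand \<open>c *s u (g 2)\<close>, and there the result is
  \<open>g 10\<close>.\<close>

lemma rel11_19: "raises F 10 (\<lambda>v. cm (Tc c) (X (Tc c) 7) v - c *s u (g 10) v)"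
proof -
 have g9: "raises F 8 (u (g 9))" using D_raises[OF D_g[of 9]] by (simp add: hgt_def)
 have d: "raises F 9 (\<lambda>v. X (Tc c) 7 v - u (g 9) v)"
  using X_u[OF hyp11, of 7 c] by (simp add: eval_nat_numeral)
 have 1: "raises F 10 (\<lambda>v. cm (Tc c) (X (Tc c) 7) v - cm (Tc c) (u (g 9)) v)"
  by (rule cm_cong[OF filtF lin_Tc lin_X[OF lin_Tc] lin_Tc lin_u raises_Tc g9 _ d, where m' = 10])
   (use filt_0[OF filtF] in \<open>auto simp: raises_def\<close>)
 have c1: "cm (u (g 1)) (u (g 9)) v = 0" if "v \<in> V" for v
 proof -
  have "cm (u (g 1)) (u (g 9)) v = u \<one> (\<rho> (g 9 \<otimes> g 1) v)"
   by (rule cm_u) (use r19 that in \<open>simp_all del: One_nat_def\<close>)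
  also have "\<dots> = 0" using rho_V[OF _ that, of "g 9 \<otimes> g 1"] rho_one by (simp add: U_def del: One_nat_def)
  finally show ?thesis .
 qed
 have 2: "raises F 10 (\<lambda>v. cm (Tc c) (u (g 9)) v - c *s u (g 10) v)"
 proof (subst raises_cong[where Y' = "\<lambda>v. c *s (cm (u (g 2)) (u (g 9)) v - u (g 10) v)"])
  show "raises F 10 (\<lambda>v. c *s (cm (u (g 2)) (u (g 9)) v - u (g 10) v))"
   using raises_scale[OF filtF z_u29] by (simp add: hgt_def eval_nat_numeral)
 qed (simp add: cm_Tc[OF lin_u] c1 scale_right_diff_distrib del: One_nat_def)
 show ?thesis using raises_trans[OF filtF 1 2] .
qed

end

locale prep23 = prep_adm scale Basis G g V \<rho> F 2 3
 for scale :: "'a::field \<Rightarrow> 'b::ab_group_add \<Rightarrow> 'b" (infixr "*s" 75) and Basis :: "'b set"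
  and G :: "('g, 'm) monoid_scheme" (structure) and g :: "nat \<Rightarrow> 'g" and V \<rho> F
begin

lemma hyp23: "1 \<le> n ==> n \<le> 6 ==> raises F (2 * Suc n + 3 + 1) (cm (u (g 2)) (u (g (n + 2))))"
 using raises_cm[OF filtF g2D D_raises[OF D_g9[of n]]] by (simp add: algebra_simps)

text \<open>In weights (2,3) the elements \<open>g 2\<close> and \<open>g 3\<close> have degrees 3
  and 5, while their commutator involves only \<open>g 5\<close> and later elements, of degree at
  least 9 instead of 8.\<close>

lemma rel23_23: "raises F 9 (cm (X (Tc c) 0) (X (Tc c) 1))"
proof -
 have "raises F 9 (\<lambda>v. cm (X (Tc c) 0) (X (Tc c) 1) v - cm (u (g 2)) (u (g 3)) v)"
  using cm_X_u[OF hyp23, of 0 1 c] by (simp add: eval_nat_numeral)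
 moreover have "raises F 9 (cm (u (g 2)) (u (g 3)))"
  using cm_u2[of 1 9] by (simp add: hgt_def eval_nat_numeral)
 ultimately show ?thesis
  using raises_add[OF filtF, of 9 "\<lambda>v. cm (X (Tc c) 0) (X (Tc c) 1) v - cm (u (g 2)) (u (g 3)) v" "cm (u (g 2)) (u (g 3))"]
  by simp
qed

end

locale prep12 = prep_adm scale Basis G g V \<rho> F 1 2
 for scale :: "'a::field \<Rightarrow> 'b::ab_group_add \<Rightarrow> 'b" (infixr "*s" 75) and Basis :: "'b set"
  and G :: "('g, 'm) monoid_scheme" (structure) and g :: "nat \<Rightarrow> 'g" and V \<rho> F
begin

lemma hyp12: "1 \<le> n ==> n \<le> 6 ==> raises F (1 * Suc n + 2 + 1) (cm (u (g 2)) (u (g (n + 2))))"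
 using raises_cm[OF filtF g2D D_raises[OF D_g9[of n]]] by (simp add: algebra_simps)

lemma gD12: "2 \<le> k ==> k \<le> 9 ==> g k \<in> D \<rho> F k"
proof -
 assume k: "2 \<le> k" "k \<le> 9"
 then have "hgt 1 2 k = k" by (simp add: hgt_def)
 with D_g[of k] k show ?thesis by simp
qed

lemma SD12: "2 \<le> m ==> s \<in> generate G (g ` {m..10}) ==> m \<le> 10 ==> s \<in> D \<rho> F m"
proof -
 assume m: "2 \<le> m" "s \<in> generate G (g ` {m..10})" "m \<le> 10"
 then have "m \<le> hgt 1 2 m" by (simp add: hgt_def) arith
 with D_mono[OF D_S[OF m]] show ?thesis by blast
qed

text \<open>Kept to degree 7, one more than the leading relation uses, because the second-order
  comparison also needs the term with \<open>g 6\<close>.\<close>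

lemma comm12_23: "\<exists>c. raises F 7 (\<lambda>v. u c v - (u (g 5) v - u (g 6) v)) \<and> c \<in> D \<rho> F 5 \<and> g 2 \<otimes> g 3 = c \<otimes> (g 3 \<otimes> g 2)"
proof -
 from r23 obtain s where s: "s \<in> generate G (g ` {7..10})"
  "g 2 \<otimes> g 3 = (g 5 \<otimes> (g 6 [^] (12::nat) \<otimes> s)) \<otimes> (g 3 \<otimes> g 2)" by blast
 let ?c = "g 5 \<otimes> (g 6 [^] (12::nat) \<otimes> s)"
 have D: "g 5 \<in> D \<rho> F 5" "g 6 \<in> D \<rho> F 6" "s \<in> D \<rho> F 7" using gD12 SD12 s(1) by auto
 have m12: "of_nat 12 = (- 1 :: 'a)"
 proof -
  have "(12::'a) + 1 = 0" using char13 by simp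
  then show ?thesis by (simp add: eq_neg_iff_add_eq_0)
 qed
 have 1: "raises F 7 (\<lambda>v. u ?c v - (u (g 5) v + u (g 6 [^] (12::nat) \<otimes> s) v))"
  by (rule raises_mono[OF filtF u_mult_diff[OF D(1) D_mult[OF D_pow[OF D(2)] D_mono[OF D(3), of 6]]]]) auto
 have 2: "raises F 7 (\<lambda>v. u (g 6 [^] (12::nat) \<otimes> s) v - u (g 6 [^] (12::nat)) v)"
  using u_prod_diff[OF D_pow[OF D(2)] D(3)] .
 have 3: "raises F 7 (\<lambda>v. u (g 6 [^] (12::nat)) v + u (g 6) v)"
  using raises_mono[OF filtF u_pow_diff[OF D(2), of 12], of 7] by (simp only: m12) simp
 have "raises F 7 (\<lambda>v. u ?c v - (u (g 5) v - u (g 6) v))"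
  using raises_add[OF filtF raises_add[OF filtF 1 2] 3] by (simp add: algebra_simps)
 moreover have "?c \<in> D \<rho> F 5"
  by (intro D_mult D_pow D_mono[OF D(1)] D_mono[OF D(2)] D_mono[OF D(3)]) auto
 ultimately show ?thesis using s(2) by blast
qed

lemma comm12_34: "\<exists>c. raises F 9 (\<lambda>v. u c v - (9 *s u (g 8) v - u (g 7) v)) \<and> c \<in> D \<rho> F 7 \<and> g 3 \<otimes> g 4 = c \<otimes> (g 4 \<otimes> g 3)"
proof -
 from r34 obtain s where s: "s \<in> generate G (g ` {9..10})"
  "g 3 \<otimes> g 4 = (g 7 [^] (12::nat) \<otimes> (g 8 [^] (9::nat) \<otimes> s)) \<otimes> (g 4 \<otimes> g 3)" by blast
 let ?c = "g 7 [^] (12::nat) \<otimes> (g 8 [^] (9::nat) \<otimes> s)"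
 have D: "g 7 \<in> D \<rho> F 7" "g 8 \<in> D \<rho> F 8" "s \<in> D \<rho> F 9" using gD12 SD12 s(1) by auto
 have m12: "of_nat 12 = (- 1 :: 'a)"
 proof -
  have "(12::'a) + 1 = 0" using char13 by simp
  then show ?thesis by (simp add: eq_neg_iff_add_eq_0)
 qed
 have 1: "raises F 9 (\<lambda>v. u ?c v - (u (g 7 [^] (12::nat)) v + u (g 8 [^] (9::nat) \<otimes> s) v))"
  by (rule raises_mono[OF filtF u_mult_diff[OF D_pow[OF D(1)] D_mult[OF D_pow[OF D(2)] D_mono[OF D(3), of 8]]]]) auto
 have 2: "raises F 9 (\<lambda>v. u (g 8 [^] (9::nat) \<otimes> s) v - u (g 8 [^] (9::nat)) v)"
  using u_prod_diff[OF D_pow[OF D(2)] D(3)] .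
 have 3: "raises F 9 (\<lambda>v. u (g 7 [^] (12::nat)) v + u (g 7) v)"
  using raises_mono[OF filtF u_pow_diff[OF D(1), of 12], of 9] by (simp only: m12) simp
 have 4: "raises F 9 (\<lambda>v. u (g 8 [^] (9::nat)) v - 9 *s u (g 8) v)"
  using raises_mono[OF filtF u_pow_diff[OF D(2), of 9], of 9] by simp
 have "raises F 9 (\<lambda>v. u ?c v - (9 *s u (g 8) v - u (g 7) v))"
  using raises_add[OF filtF raises_add[OF filtF 1 2] raises_add[OF filtF 3 4]] by (simp add: algebra_simps)
 moreover have "?c \<in> D \<rho> F 7"
  by (intro D_mult D_pow D_mono[OF D(1)] D_mono[OF D(2)] D_mono[OF D(3)]) auto
 ultimately show ?thesis using s(2) by blast
qed

lemma comm12_45: "\<exists>c. raises F 10 (\<lambda>v. u c v - 3 *s u (g 9) v) \<and> c \<in> D \<rho> F 9 \<and> g 4 \<otimes> g 5 = c \<otimes> (g 5 \<otimes> g 4)"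
proof -
 from r45 obtain s where s: "s \<in> generate G (g ` {10..10})"
  "g 4 \<otimes> g 5 = (g 9 [^] (3::nat) \<otimes> s) \<otimes> (g 5 \<otimes> g 4)" by blast
 let ?c = "g 9 [^] (3::nat) \<otimes> s"
 have D: "g 9 \<in> D \<rho> F 9" "s \<in> D \<rho> F 10" using gD12 SD12[OF _ s(1)] by auto
 have 2: "raises F 10 (\<lambda>v. u ?c v - u (g 9 [^] (3::nat)) v)"
  using u_prod_diff[OF D_pow[OF D(1)] D(2)] .
 have 4: "raises F 10 (\<lambda>v. u (g 9 [^] (3::nat)) v - 3 *s u (g 9) v)"
  using raises_mono[OF filtF u_pow_diff[OF D(1), of 3], of 10] by simp
 have "?c \<in> D \<rho> F 9"
  by (intro D_mult D_pow D_mono[OF D(1)] D_mono[OF D(2)]) auto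
 then show ?thesis using s(2) raises_trans[OF filtF 2 4] by blast
qed

lemma rel12_23: "raises F 6 (\<lambda>v. cm (X (Tc c) 0) (X (Tc c) 1) v - X (Tc c) 3 v)"
proof -
 obtain d where d: "raises F 7 (\<lambda>v. u d v - (u (g 5) v - u (g 6) v))" "d \<in> D \<rho> F 5"
  "g 2 \<otimes> g 3 = d \<otimes> (g 3 \<otimes> g 2)" using comm12_23 by blast
 have 1: "raises F 6 (\<lambda>v. cm (X (Tc c) 0) (X (Tc c) 1) v - cm (u (g 2)) (u (g 3)) v)"
  using cm_X_u[OF hyp12, of 0 1 c] by (simp add: eval_nat_numeral)
 have 2: "raises F 6 (\<lambda>v. cm (u (g 2)) (u (g 3)) v - u d v)"
  using raises_mono[OF filtF cm_u_raises(2)[OF gD12[of 2] gD12[of 3] d(2,3), of 2], of 6] by simp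
 have "raises F 6 (\<lambda>v. (u d v - (u (g 5) v - u (g 6) v)) - u (g 6) v)"
  by (intro raises_diff[OF filtF] raises_mono[OF filtF d(1)] D_raises gD12) auto
 then have 3: "raises F 6 (\<lambda>v. u d v - u (g 5) v)" by simp
 have 4: "raises F 6 (\<lambda>v. u (g 5) v - X (Tc c) 3 v)"
  using raises_sym[OF filtF X_u[OF hyp12, of 3 c]] by (simp add: eval_nat_numeral)
 show ?thesis
  using raises_trans[OF filtF raises_trans[OF filtF raises_trans[OF filtF 1 2] 3] 4] .
qed

lemma rel12_34: "raises F 8 (\<lambda>v. cm (X (Tc c) 1) (X (Tc c) 2) v + X (Tc c) 5 v)"
proof -
 obtain d where d: "raises F 9 (\<lambda>v. u d v - (9 *s u (g 8) v - u (g 7) v))" "d \<in> D \<rho> F 7"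
  "g 3 \<otimes> g 4 = d \<otimes> (g 4 \<otimes> g 3)" using comm12_34 by blast
 have 1: "raises F 8 (\<lambda>v. cm (X (Tc c) 1) (X (Tc c) 2) v - cm (u (g 3)) (u (g 4)) v)"
  using cm_X_u[OF hyp12, of 1 2 c] by (simp add: eval_nat_numeral)
 have 2: "raises F 8 (\<lambda>v. cm (u (g 3)) (u (g 4)) v - u d v)"
  using raises_mono[OF filtF cm_u_raises(2)[OF gD12[of 3] gD12[of 4] d(2,3), of 3], of 8] by simp
 have "raises F 8 (\<lambda>v. (u d v - (9 *s u (g 8) v - u (g 7) v)) + 9 *s u (g 8) v)"
  by (intro raises_add[OF filtF] raises_scale[OF filtF] raises_mono[OF filtF d(1)] D_raises gD12) auto
 then have 3: "raises F 8 (\<lambda>v. u d v + u (g 7) v)" by simp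
 have 4: "raises F 8 (\<lambda>v. X (Tc c) 5 v - u (g 7) v)"
  using X_u[OF hyp12, of 5 c] by (simp add: eval_nat_numeral)
 show ?thesis
  using raises_add[OF filtF raises_trans[OF filtF 1 2] raises_add[OF filtF 3 4]] by simp
qed

lemma rel12_45: "raises F 10 (\<lambda>v. cm (X (Tc c) 2) (X (Tc c) 3) v - 3 *s X (Tc c) 7 v)"
proof -
 obtain d where d: "raises F 10 (\<lambda>v. u d v - 3 *s u (g 9) v)" "d \<in> D \<rho> F 9"
  "g 4 \<otimes> g 5 = d \<otimes> (g 5 \<otimes> g 4)" using comm12_45 by blast
 have 1: "raises F 10 (\<lambda>v. cm (X (Tc c) 2) (X (Tc c) 3) v - cm (u (g 4)) (u (g 5)) v)"
  using cm_X_u[OF hyp12, of 2 3 c] by (simp add: eval_nat_numeral)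
 have 2: "raises F 10 (\<lambda>v. cm (u (g 4)) (u (g 5)) v - u d v)"
  using raises_mono[OF filtF cm_u_raises(2)[OF gD12[of 4] gD12[of 5] d(2,3), of 4], of 10] by simp
 have 4: "raises F 10 (\<lambda>v. 3 *s (u (g 9) v - X (Tc c) 7 v))"
  using raises_scale[OF filtF raises_sym[OF filtF X_u[OF hyp12, of 7 c]]] by (simp add: eval_nat_numeral)
 show ?thesis
  using raises_add[OF filtF raises_trans[OF filtF raises_trans[OF filtF 1 2] d(1)] 4]
  by (simp add: scale_right_diff_distrib)
qed

end

declare One_nat_def [simp del]

section \<open>Quotient modules, nilpotency and the layers of a representation\<close>

context fvs
begin

text \<open>Quotients are modelled inside the given space: a linear map that kills \<open>N\<close>
  and is the identity modulo \<open>N\<close> identifies \<open>V / N\<close> with its image. It is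
  built by sending a basis of \<open>N\<close> to 0 and fixing the rest of a basis of
  \<open>V\<close>.\<close>

lemma proj_exists:
 assumes "subspace V" "subspace N" "N \<subseteq> V"
 shows "\<exists>\<pi>. lin \<pi> \<and> (\<forall>v\<in>V. \<pi> v \<in> V \<and> \<pi> v - v \<in> N) \<and> (\<forall>n\<in>N. \<pi> n = 0)"
proof -
 interpret vp: vector_space_pair scale scale by unfold_locales
 obtain B where B: "B \<subseteq> N" "independent B" "N \<subseteq> span B"
  by (rule basis_exists[of N])
 obtain A where A: "B \<subseteq> A" "A \<subseteq> V" "independent A" "V \<subseteq> span A"
  by (rule maximal_independent_subset_extend[OF subset_trans[OF B(1) assms(3)] B(2)])
 obtain \<pi> where p: "Vector_Spaces.linear scale scale \<pi>" "\<forall>x\<in>A. \<pi> x = (if x \<in> B then 0 else x)"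
  using vp.linear_independent_extend[OF A(3), of "\<lambda>x. if x \<in> B then 0 else x"] by auto
 have lp: "lin \<pi>"
  using p(1) by (intro linI) (simp_all add: vp.linear_add vp.linear_scale)
 have "\<pi> v \<in> V \<and> \<pi> v - v \<in> N" if "v \<in> V" for v
 proof -
  have "v \<in> span A" using that A(4) by blast
  then show ?thesis
  proof (induction rule: span_induct_alt)
   case base
   then show ?case using assms lin_0[OF lp] by (simp add: subspace_0)
  next
   case (step c x y)
   have "\<pi> x \<in> V \<and> \<pi> x - x \<in> N"
    using step p(2) A(2) B(1) assms by (auto simp: subspace_0 subspace_neg)
   then have "c *s \<pi> x \<in> V" "c *s (\<pi> x - x) \<in> N"
    using assms by (auto intro: subspace_scale)
   then have "c *s \<pi> x + \<pi> y \<in> V" "c *s (\<pi> x - x) + (\<pi> y - y) \<in> N"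
    using step assms by (auto intro: subspace_add)
   then show ?case
    by (simp add: lin_add[OF lp] lin_scale[OF lp] scale_right_diff_distrib algebra_simps)
  qed
 qed
 moreover have "\<pi> n = 0" if "n \<in> N" for n
 proof -
  have "n \<in> span B" using that B(3) by blast
  then show ?thesis
  proof (induction rule: span_induct_alt)
   case base
   then show ?case using lin_0[OF lp] by simp
  next
   case (step c x y)
   then have "\<pi> x = 0" using p(2) A(1) by auto
   with step show ?case by (simp add: lin_add[OF lp] lin_scale[OF lp])
  qed
 qed
 ultimately show ?thesis using lp by blast
qed

end

context prep
begin

definition inv_sub :: "'b set \<Rightarrow> ('g \<Rightarrow> 'b \<Rightarrow> 'b) \<Rightarrow> 'b set \<Rightarrow> bool" where
 "inv_sub V \<rho> S \<longleftrightarrow> subspace S \<and> S \<subseteq> V \<and> (\<forall>s\<in>S. U \<rho> (g 1) s \<in> S \<and> U \<rho> (g 2) s \<in> S)"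

lemma isrep_sub: "isrep V \<rho> ==> subspace V"
 and isrep_lin: "isrep V \<rho> ==> x \<in> carrier G ==> lin (\<rho> x)"
 and isrep_V: "isrep V \<rho> ==> x \<in> carrier G ==> v \<in> V ==> \<rho> x v \<in> V"
 and isrep_mult: "isrep V \<rho> ==> x \<in> carrier G ==> y \<in> carrier G ==> v \<in> V ==> \<rho> (x \<otimes> y) v = \<rho> x (\<rho> y v)"
 and isrep_one: "isrep V \<rho> ==> v \<in> V ==> \<rho> \<one> v = v"
 unfolding isrep_def by auto

lemma isrep_linU: "isrep V \<rho> ==> x \<in> carrier G ==> lin (U \<rho> x)"
 unfolding U_def by (rule lin_minus[OF isrep_lin lin_id])

lemma isrep_UV: "isrep V \<rho> ==> x \<in> carrier G ==> v \<in> V ==> U \<rho> x v \<in> V"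
 unfolding U_def by (rule subspace_diff[OF isrep_sub isrep_V])

text \<open>For the constant filtration with value \<open>S\<close>, membership in
  \<open>D \<rho> F 0\<close> means preserving \<open>S\<close>; this set is closed under
  generation, so the two generators suffice.\<close>

lemma inv_sub_all:
 assumes "isrep V \<rho>" "inv_sub V \<rho> S" "x \<in> carrier G" "s \<in> S"
 shows "\<rho> x s \<in> S"
proof -
 interpret f: prep_filt scale Basis G g V \<rho> "\<lambda>_. S"
  by unfold_locales (use assms in \<open>auto simp: filt_def inv_sub_def\<close>)
 have "{g 1, g 2} \<subseteq> D \<rho> (\<lambda>_. S) 0"
  using assms(2) by (auto simp: D_def raises_def inv_sub_def)
 then have "x \<in> D \<rho> (\<lambda>_. S) 0"
  using f.D_generate gen assms(3) by blast
 from f.rho_pres[OF this assms(4)] show ?thesis .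
qed

lemma inv_sub_U:
 assumes "isrep V \<rho>" "inv_sub V \<rho> S" "x \<in> carrier G" "s \<in> S"
 shows "U \<rho> x s \<in> S"
 using inv_sub_all[OF assms] assms(2,4) by (auto simp: U_def inv_sub_def intro: subspace_diff)

lemma sub_rep:
 assumes r: "isrep V \<rho>" and S: "inv_sub V \<rho> S"
 shows "isrep S \<rho>"
proof -
 have S': "subspace S" "S \<subseteq> V" using S by (auto simp: inv_sub_def)
 show ?thesis
  unfolding isrep_def
 proof (intro conjI ballI S'(1))
  show "lin (\<rho> x)" if "x \<in> carrier G" for x using isrep_lin[OF r that] .
  show "\<rho> x ` S \<subseteq> S" if "x \<in> carrier G" for x by (rule image_subsetI) (rule inv_sub_all[OF r S that])
  show "\<rho> (x \<otimes> y) v = \<rho> x (\<rho> y v)" if "x \<in> carrier G" "y \<in> carrier G" "v \<in> S" for x y v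
   by (rule isrep_mult[OF r that(1,2) subsetD[OF S'(2) that(3)]])
  show "\<rho> \<one> v = v" if "v \<in> S" for v by (rule isrep_one[OF r subsetD[OF S'(2) that]])
 qed
qed

lemma quot_rep:
 assumes r: "isrep V \<rho>" and N: "inv_sub V \<rho> N"
 obtains \<pi> where "lin \<pi>" "\<And>v. v \<in> V ==> \<pi> v \<in> V \<and> \<pi> v - v \<in> N" "\<And>n. n \<in> N ==> \<pi> n = 0"
  "isrep (\<pi> ` V) (\<lambda>x v. \<pi> (\<rho> x v))"
  "\<And>x v. x \<in> carrier G ==> v \<in> V ==> U (\<lambda>x v. \<pi> (\<rho> x v)) x (\<pi> v) = \<pi> (U \<rho> x v)"
  "N \<noteq> {0} ==> dim (\<pi> ` V) < dim V"
proof -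
 have sN: "subspace N" "N \<subseteq> V" using N by (auto simp: inv_sub_def)
 obtain \<pi> where p: "lin \<pi>" "\<And>v. v \<in> V ==> \<pi> v \<in> V \<and> \<pi> v - v \<in> N" "\<And>n. n \<in> N ==> \<pi> n = 0"
  using proj_exists[OF isrep_sub[OF r] sN] by blast
 have pp: "\<pi> (\<pi> v) = \<pi> v" if "v \<in> V" for v
  using p(3)[of "\<pi> v - v"] p(2)[OF that] by (simp add: lin_diff[OF p(1)])
 have prp: "\<pi> (\<rho> x (\<pi> v)) = \<pi> (\<rho> x v)" if "x \<in> carrier G" "v \<in> V" for x v
 proof -
  have "\<rho> x (\<pi> v - v) \<in> N" using p(2)[OF that(2)] by (intro inv_sub_all[OF r N that(1)]) simp
  from p(3)[OF this] show ?thesis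
   by (simp add: lin_diff[OF p(1)] lin_diff[OF isrep_lin[OF r that(1)]])
 qed
 have sC: "subspace (\<pi> ` V)"
 proof (rule subspaceI)
  show "0 \<in> \<pi> ` V" using imageI[OF subspace_0[OF isrep_sub[OF r]], of \<pi>] lin_0[OF p(1)] by simp
  show "x + y \<in> \<pi> ` V" if "x \<in> \<pi> ` V" "y \<in> \<pi> ` V" for x y
   using that subspace_add[OF isrep_sub[OF r]] by (auto simp: lin_add[OF p(1), symmetric])
  show "c *s x \<in> \<pi> ` V" if "x \<in> \<pi> ` V" for c x
   using that subspace_scale[OF isrep_sub[OF r]] by (auto simp: lin_scale[OF p(1), symmetric])
 qed
 have rep: "isrep (\<pi> ` V) (\<lambda>x v. \<pi> (\<rho> x v))"
  unfolding isrep_def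
 proof (intro conjI ballI sC)
  show "lin (\<lambda>v. \<pi> (\<rho> x v))" if "x \<in> carrier G" for x
   using lin_comp[OF p(1) isrep_lin[OF r that]] .
  show "(\<lambda>v. \<pi> (\<rho> x v)) ` \<pi> ` V \<subseteq> \<pi> ` V" if x: "x \<in> carrier G" for x
  proof (rule image_subsetI)
   fix v assume "v \<in> \<pi> ` V"
   then have "v \<in> V" using p(2) by auto
   then show "\<pi> (\<rho> x v) \<in> \<pi> ` V" using isrep_V[OF r x] by (intro imageI)
  qed
  show "\<pi> (\<rho> (x \<otimes> y) v) = \<pi> (\<rho> x (\<pi> (\<rho> y v)))"
   if "x \<in> carrier G" "y \<in> carrier G" "v \<in> \<pi> ` V" for x y v
  proof -
   have "v \<in> V" using that p(2) by auto
   then show ?thesis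
    using prp[OF that(1), of "\<rho> y v"] isrep_V[OF r that(2)] isrep_mult[OF r that(1,2)] by simp
  qed
  show "\<pi> (\<rho> \<one> v) = v" if vV: "v \<in> \<pi> ` V" for v
  proof -
   obtain w where w: "w \<in> V" "v = \<pi> w" using vV by auto
   then have "v \<in> V" using p(2)[OF w(1)] by simp
   then show ?thesis using pp[OF w(1)] w(2) isrep_one[OF r] by simp
  qed
 qed
 have U': "U (\<lambda>x v. \<pi> (\<rho> x v)) x (\<pi> v) = \<pi> (U \<rho> x v)" if "x \<in> carrier G" "v \<in> V" for x v
  using prp[OF that] by (simp add: U_def lin_diff[OF p(1)])
 have "dim (\<pi> ` V) < dim V" if ne: "N \<noteq> {0}"
 proof -
  obtain n where n: "n \<in> N" "n \<noteq> 0" using ne subspace_0[OF sN(1)] by auto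
  have "n \<notin> \<pi> ` V"
  proof
   assume "n \<in> \<pi> ` V"
   then obtain v where "v \<in> V" "n = \<pi> v" by auto
   with pp[of v] p(3)[OF n(1)] n(2) show False by simp
  qed
  moreover have "\<pi> ` V \<subseteq> V" using p(2) by auto
  ultimately have "\<pi> ` V \<subset> V" using n(1) sN(2) by auto
  then have "span (\<pi> ` V) \<subset> span V"
   using sC isrep_sub[OF r] by (simp add: span_eq_iff[THEN iffD2])
  then show ?thesis by (rule dim_psubset)
 qed
 note dl = this
 show thesis
 proof (rule that)
  show "lin \<pi>" by (rule p(1))
  show "\<pi> v \<in> V \<and> \<pi> v - v \<in> N" if "v \<in> V" for v by (rule p(2)[OF that])
  show "\<pi> n = 0" if "n \<in> N" for n by (rule p(3)[OF that])
  show "isrep (\<pi> ` V) (\<lambda>x v. \<pi> (\<rho> x v))" by (rule rep)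
  show "U (\<lambda>x v. \<pi> (\<rho> x v)) x (\<pi> v) = \<pi> (U \<rho> x v)" if "x \<in> carrier G" "v \<in> V" for x v
   by (rule U'[OF that])
  show "dim (\<pi> ` V) < dim V" if "N \<noteq> {0}" by (rule dl[OF that])
 qed
qed

lemma binomial_step:
 "(\<Sum>k\<le>n. of_nat (n choose k) *s a k) + (\<Sum>k\<le>n. of_nat (n choose k) *s a (Suc k))
  = (\<Sum>k\<le>Suc n. of_nat (Suc n choose k) *s a k)" for a :: "nat \<Rightarrow> 'b"
proof -
 have "(\<Sum>k\<le>Suc n. of_nat (n choose k) *s a k) = (\<Sum>k\<le>n. of_nat (n choose k) *s a k)"
  by (simp add: binomial_eq_0)
 moreover have "(\<Sum>k\<le>Suc n. of_nat (n choose k) *s a k)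
   = a 0 + (\<Sum>k\<le>n. of_nat (n choose Suc k) *s a (Suc k))"
  by (subst sum.atMost_Suc_shift) simp
 ultimately have e1: "(\<Sum>k\<le>n. of_nat (n choose k) *s a k)
   = a 0 + (\<Sum>k\<le>n. of_nat (n choose Suc k) *s a (Suc k))"
  by (simp only:)
 have e2: "(\<Sum>k\<le>Suc n. of_nat (Suc n choose k) *s a k)
   = a 0 + (\<Sum>k\<le>n. of_nat (Suc n choose Suc k) *s a (Suc k))"
  by (subst sum.atMost_Suc_shift) simp
 have e3: "(\<Sum>k\<le>n. of_nat (Suc n choose Suc k) *s a (Suc k))
   = (\<Sum>k\<le>n. of_nat (n choose k) *s a (Suc k)) + (\<Sum>k\<le>n. of_nat (n choose Suc k) *s a (Suc k))"
  by (simp add: scale_left_distrib sum.distrib)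
 show ?thesis
  unfolding e2 e3 e1 by (simp only: ac_simps)
qed

text \<open>In the binomial expansion of \<open>(1 + u x)^13\<close> the inner coefficients are
  divisible by 13, which leaves \<open>1 = 1 + (u x)^13\<close>.\<close>

lemma U_pow13:
 assumes r: "isrep V \<rho>" and x: "x \<in> carrier G" and v: "v \<in> V"
 shows "(U \<rho> x ^^ 13) v = 0"
proof -
 have UV: "(U \<rho> x ^^ k) v \<in> V" for k
  by (induction k) (use v isrep_UV[OF r x] in auto)
 have "\<rho> (x [^] n) v = (\<Sum>k\<le>n. of_nat (n choose k) *s (U \<rho> x ^^ k) v)" for n :: nat
 proof (induction n)
  case 0
  show ?case using isrep_one[OF r v] by simp
 next
  case (Suc n)
  have "\<rho> (x [^] Suc n) v = \<rho> x (\<rho> (x [^] n) v)"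
   unfolding nat_pow_Suc2[OF x] using x v by (intro isrep_mult[OF r]) auto
  also have "\<dots> = \<rho> (x [^] n) v + U \<rho> x (\<rho> (x [^] n) v)"
   by (simp add: U_def)
  also have "\<dots> = (\<Sum>k\<le>n. of_nat (n choose k) *s (U \<rho> x ^^ k) v)
    + (\<Sum>k\<le>n. of_nat (n choose k) *s (U \<rho> x ^^ Suc k) v)"
   unfolding Suc by (simp add: lin_sum[OF isrep_linU[OF r x]] lin_scale[OF isrep_linU[OF r x]])
  also have "\<dots> = (\<Sum>k\<le>Suc n. of_nat (Suc n choose k) *s (U \<rho> x ^^ k) v)"
   by (rule binomial_step)
  finally show ?case .
 qed
 from this[of 13] have "v = (\<Sum>k\<le>13. of_nat (13 choose k) *s (U \<rho> x ^^ k) v)"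
  using pow13[OF x] isrep_one[OF r v] by simp
 also have "\<dots> = (\<Sum>k\<in>{0,13}. of_nat (13 choose k) *s (U \<rho> x ^^ k) v)"
 proof (rule sum.mono_neutral_right)
  show "\<forall>k\<in>{..13} - {0, 13}. of_nat (13 choose k) *s (U \<rho> x ^^ k) v = 0"
  proof
   fix k :: nat assume k: "k \<in> {..13} - {0, 13}"
   then obtain j where j: "k = Suc j" by (cases k) auto
   have "of_nat k * of_nat (13 choose k) = (of_nat (13 * (12 choose j)) :: 'a)"
   proof -
    have e: "Suc 12 = 13" by simp
    show ?thesis
     using Suc_times_binomial[of j 12] unfolding e j of_nat_mult[symmetric] by (simp only:)
   qed
   then have "of_nat k * of_nat (13 choose k) = (0 :: 'a)" using char13 by simp
   with char_ne[of k] k show "of_nat (13 choose k) *s (U \<rho> x ^^ k) v = 0" by auto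
  qed
 qed auto
 also have "\<dots> = v + (U \<rho> x ^^ 13) v" by simp
 finally show ?thesis by simp
qed

text \<open>The fixed-point property of a p-group in characteristic p, over a field that may be
  infinite, so without orbit counting: on a minimal non-zero invariant subspace \<open>S\<close> the
  elements \<open>g 10\<close>, \<open>g 9\<close>, ..., \<open>g 1\<close> are shown in turn to act
  trivially.\<close>

lemma fixed_vector:
 assumes r: "isrep W \<sigma>" and W: "W \<noteq> {0}"
 shows "\<exists>w\<in>W. w \<noteq> 0 \<and> U \<sigma> (g 1) w = 0 \<and> U \<sigma> (g 2) w = 0"
proof -
 have "inv_sub W \<sigma> W"
  using isrep_sub[OF r] isrep_UV[OF r] by (auto simp: inv_sub_def)
 then have "\<exists>S. (inv_sub W \<sigma> S \<and> S \<noteq> {0}) \<and> (\<forall>S'. inv_sub W \<sigma> S' \<and> S' \<noteq> {0} \<longrightarrow> dim S \<le> dim S')"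
  using ex_has_least_nat[of "\<lambda>S. inv_sub W \<sigma> S \<and> S \<noteq> {0}" W dim] W by blast
 then obtain S where S: "inv_sub W \<sigma> S" "S \<noteq> {0}"
  and min: "\<And>S'. inv_sub W \<sigma> S' ==> S' \<noteq> {0} ==> dim S \<le> dim S'" by blast
 have sS: "subspace S" "S \<subseteq> W" using S by (auto simp: inv_sub_def)
 have rS: "isrep S \<sigma>" using sub_rep[OF r S(1)] .
 \<comment> \<open>If \<open>u x\<close> commutes with both generators on \<open>S\<close>, its
   image is invariant, hence 0 or \<open>S\<close>; the latter would make \<open>u x\<close>
   surjective on \<open>S\<close>, against nilpotency.\<close>
 have key: "\<forall>s\<in>S. U \<sigma> x s = 0"
  if x: "x \<in> carrier G" and c: "\<And>i s. i \<in> {1, 2} ==> s \<in> S ==> cm (U \<sigma> (g i)) (U \<sigma> x) s = 0" for x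
 proof -
  let ?N = "U \<sigma> x ` S"
  have l: "lin (U \<sigma> x)" using isrep_linU[OF r x] .
  have NS: "?N \<subseteq> S" by (rule image_subsetI) (rule inv_sub_U[OF r S(1) x])
  have "subspace ?N"
  proof (rule subspaceI)
   show "0 \<in> ?N" using imageI[OF subspace_0[OF sS(1)], of "U \<sigma> x"] lin_0[OF l] by simp
   show "a + b \<in> ?N" if "a \<in> ?N" "b \<in> ?N" for a b
    using that subspace_add[OF sS(1)] by (auto simp: lin_add[OF l, symmetric])
   show "c *s a \<in> ?N" if "a \<in> ?N" for c a
    using that subspace_scale[OF sS(1)] by (auto simp: lin_scale[OF l, symmetric])
  qed
  moreover have "U \<sigma> (g i) a \<in> ?N" if ia: "i \<in> {1, 2}" "a \<in> ?N" for i a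
  proof -
   obtain s where s: "s \<in> S" "a = U \<sigma> x s" using ia(2) by blast
   have "U \<sigma> (g i) a = U \<sigma> x (U \<sigma> (g i) s)" using c[OF ia(1) s(1)] s(2) by (simp add: cm_def)
   moreover have "U \<sigma> (g i) s \<in> S" using inv_sub_U[OF r S(1) g_closed s(1)] .
   ultimately show ?thesis by blast
  qed
  ultimately have N: "inv_sub W \<sigma> ?N" using NS sS(2) by (auto simp: inv_sub_def)
  have "?N = {0}"
  proof (rule ccontr)
   assume "?N \<noteq> {0}"
   from min[OF N this] have "dim S \<le> dim ?N" .
   then have eqN: "?N = S"
    using subspace_dim_equal[of ?N S] N NS sS by (auto simp: inv_sub_def)
   have sur: "s \<in> S ==> \<exists>t\<in>S. (U \<sigma> x ^^ k) t = s" for s k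
   proof (induction k arbitrary: s)
    case 0
    then show ?case by (intro bexI[of _ s]) simp_all
   next
    case (Suc k)
    have "s \<in> ?N" unfolding eqN by (rule Suc.prems)
    then obtain t where t: "t \<in> S" "s = U \<sigma> x t" by (rule imageE)
    obtain t' where t': "t' \<in> S" "(U \<sigma> x ^^ k) t' = t" using Suc.IH[OF t(1)] by (rule bexE)
    have "(U \<sigma> x ^^ Suc k) t' = s" using t t' by simp
    then show ?case by (rule bexI) (rule t'(1))
   qed
   have "s = 0" if sS': "s \<in> S" for s
   proof -
    obtain t where "t \<in> S" "(U \<sigma> x ^^ 13) t = s" using sur[OF sS', of 13] by (rule bexE)
    with U_pow13[OF rS x] show ?thesis by simp
   qed
   then have "S \<subseteq> {0}" by blast
   then show False using S(2) subspace_0[OF sS(1)] by blast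
  qed
  then show ?thesis by blast
 qed
 interpret f: prep_filt scale Basis G g S \<sigma> "\<lambda>_. S"
  by unfold_locales (use rS sS in \<open>auto simp: filt_def\<close>)
 \<comment> \<open>Descending induction on \<open>k\<close>, run on \<open>10 - k\<close>: the
   commutators of \<open>g k\<close> with \<open>g 1\<close> and \<open>g 2\<close> are words in
   later elements, which already act trivially, so \<open>key\<close> applies.\<close>
 have triv: "\<forall>s\<in>S. U \<sigma> (g k) s = 0" if "1 \<le> k" "k \<le> 10" for k
 proof -
  have "\<forall>k. 1 \<le> k \<and> k \<le> 10 \<and> 10 - k = n \<longrightarrow> (\<forall>s\<in>S. U \<sigma> (g k) s = 0)" for n
  proof (induction n rule: less_induct)
   case (less n)
   show ?case
   proof (intro allI impI, elim conjE)
    fix k :: nat assume k: "1 \<le> k" "k \<le> 10" "10 - k = n"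
    have IH: "U \<sigma> (g m) s = 0" if "k < m" "m \<le> 10" "s \<in> S" for m s
     using less[of "10 - m"] that k by auto
    let ?E = "{x \<in> carrier G. \<forall>s\<in>S. U \<sigma> x s = 0}"
    have E: "x \<in> ?E" if "x \<in> generate G (g ` {m..10})" "k < m" for x m
    proof -
     from that(1) show ?thesis
     proof (induction rule: generate.induct)
      case one
      then show ?case by (auto simp: U_def f.rho_one)
     next
      case (incl h)
      then show ?case using IH that(2) by auto
     next
      case (inv h)
      then have h: "h \<in> carrier G" "\<And>s. s \<in> S ==> \<sigma> h s = s" using IH that(2) by (auto simp: U_def)
      have "\<sigma> (inv h) s = s" if "s \<in> S" for s
      proof -
       have "\<sigma> (inv h \<otimes> h) s = \<sigma> (inv h) (\<sigma> h s)" by (rule f.rho_mult) (use h that in auto)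
       then show ?thesis using h that f.rho_one[OF that] by simp
      qed
      then show ?case using h by (auto simp: U_def)
     next
      case (eng a b)
      then show ?case by (auto simp: f.u_mult lin_0[OF f.lin_u])
     qed
    qed
    have com: "cm (U \<sigma> (g i)) (U \<sigma> (g k)) s = 0"
     if "c \<in> ?E" "g i \<otimes> g k = c \<otimes> (g k \<otimes> g i)" "s \<in> S" for i c s
     using f.cm_u[OF g_closed g_closed _ that(2,3)] that f.rho_V by auto
    have ginc: "g m \<in> ?E" if "k < m" "m \<le> 10" for m using IH that by auto
    have suc23: "Suc 2 = 3" by simp
    have one: "\<one> \<in> ?E" by (auto simp: U_def f.rho_one)
    have self: "cm Y Y s = 0" for Y :: "'b \<Rightarrow> 'b" and s by (simp add: cm_def)
    have flip: "cm (U \<sigma> (g 2)) (U \<sigma> (g 1)) s = - cm (U \<sigma> (g 1)) (U \<sigma> (g 2)) s" for s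
     by (simp add: cm_def)
    have "cm (U \<sigma> (g i)) (U \<sigma> (g k)) s = 0" if i: "i \<in> {1, 2}" and s: "s \<in> S" for i s
    proof -
     consider "k = 10" | "k = 9" | "3 \<le> k \<and> k \<le> 8" | "k = 2" | "k = 1" using k by linarith
     then show ?thesis
     proof cases
      case 1
      then show ?thesis
       using i com[OF one, of i s] r110 r210 s by auto
     next
      case 2
      then show ?thesis
       using i com[OF one, of 1 s] com[OF ginc[of 10], of 2 s] r19 r29 s by auto
     next
      case 3
      obtain t where t: "t \<in> generate G (g ` {k + 2..10})" "g 2 \<otimes> g k = t \<otimes> (g k \<otimes> g 2)"
       using r2[of k] 3 by blast
      show ?thesis
       using i com[OF ginc[of "Suc k"] r1[of k] s] com[OF E[OF t(1)] t(2) s] 3 by auto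
     next
      case 4
      then show ?thesis
       using i com[OF ginc[of 3], of 1 s] r1[of 2] s self suc23 by auto
     next
      case 5
      have "cm (U \<sigma> (g 1)) (U \<sigma> (g 2)) s = 0"
       using f.cm_u[OF g_closed g_closed g_closed r1[of 2] s] IH[of 3 "\<sigma> (g 2 \<otimes> g 1) s"] 5
        f.rho_V[OF _ s, of "g 2 \<otimes> g 1"]
       suc23 by auto
      then show ?thesis using 5 i flip self by auto
     qed
    qed
    then show "\<forall>s\<in>S. U \<sigma> (g k) s = 0" using key[OF g_closed] by blast
   qed
  qed
  then show ?thesis using that by blast
 qed
 obtain s where "s \<in> S" "s \<noteq> 0" using S(2) subspace_0[OF sS(1)] by auto
 then show ?thesis using triv[of 1] triv[of 2] sS(2) by auto
qed

text \<open>The \<open>k\<close>-th power of the augmentation ideal applied to \<open>V\<close>. A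
  sum of two linear images is already a subspace, so no span has to be taken.\<close>

fun R :: "'b set \<Rightarrow> ('g \<Rightarrow> 'b \<Rightarrow> 'b) \<Rightarrow> nat \<Rightarrow> 'b set" where
 "R V \<rho> 0 = V"
| "R V \<rho> (Suc k) = {U \<rho> (g 1) a + U \<rho> (g 2) b | a b. a \<in> R V \<rho> k \<and> b \<in> R V \<rho> k}"

lemma R_subspace: "isrep V \<rho> ==> subspace (R V \<rho> k) \<and> R V \<rho> k \<subseteq> V"
proof (induction k)
 case 0
 then show ?case by (simp add: isrep_sub)
next
 case (Suc k)
 let ?S = "R V \<rho> k"
 have S: "subspace ?S" "?S \<subseteq> V" and r: "isrep V \<rho>" using Suc by auto
 have l: "lin (U \<rho> (g 1))" "lin (U \<rho> (g 2))" using isrep_linU[OF r] by auto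
 have "subspace (R V \<rho> (Suc k))"
 proof (rule subspaceI)
  show "0 \<in> R V \<rho> (Suc k)"
   using subspace_0[OF S(1)] lin_0[OF l(1)] lin_0[OF l(2)] by (force intro!: exI[of _ 0])
 next
  fix x y assume "x \<in> R V \<rho> (Suc k)" "y \<in> R V \<rho> (Suc k)"
  then obtain a b a' b' where "a \<in> ?S" "b \<in> ?S" "a' \<in> ?S" "b' \<in> ?S"
   "x = U \<rho> (g 1) a + U \<rho> (g 2) b" "y = U \<rho> (g 1) a' + U \<rho> (g 2) b'" by auto
  then have "a + a' \<in> ?S" "b + b' \<in> ?S" "x + y = U \<rho> (g 1) (a + a') + U \<rho> (g 2) (b + b')"
   using subspace_add[OF S(1)] by (auto simp: lin_add[OF l(1)] lin_add[OF l(2)])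
  then show "x + y \<in> R V \<rho> (Suc k)" by auto
 next
  fix c x assume "x \<in> R V \<rho> (Suc k)"
  then obtain a b where "a \<in> ?S" "b \<in> ?S" "x = U \<rho> (g 1) a + U \<rho> (g 2) b" by auto
  then have "c *s a \<in> ?S" "c *s b \<in> ?S" "c *s x = U \<rho> (g 1) (c *s a) + U \<rho> (g 2) (c *s b)"
   using subspace_scale[OF S(1)] by (auto simp: lin_scale[OF l(1)] lin_scale[OF l(2)] scale_right_distrib)
  then show "c *s x \<in> R V \<rho> (Suc k)" by auto
 qed
 moreover have "R V \<rho> (Suc k) \<subseteq> V"
 proof
  fix y assume "y \<in> R V \<rho> (Suc k)"
  then obtain a b where "a \<in> ?S" "b \<in> ?S" "y = U \<rho> (g 1) a + U \<rho> (g 2) b" by auto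
  then have "a \<in> V" "b \<in> V" "y = U \<rho> (g 1) a + U \<rho> (g 2) b" using S(2) by blast+
  then show "y \<in> V"
   using subspace_add[OF isrep_sub[OF r] isrep_UV[OF r g_closed, of a 1] isrep_UV[OF r g_closed, of b 2]] by (simp only:)
 qed
 ultimately show ?case by blast
qed

lemma R_Suc_subset: "isrep V \<rho> ==> R V \<rho> (Suc k) \<subseteq> R V \<rho> k"
proof (induction k)
 case 0
 then show ?case using R_subspace[of V \<rho> "Suc 0"] by simp
next
 case (Suc k)
 then have "R V \<rho> (Suc k) \<subseteq> R V \<rho> k" by simp
 then show ?case unfolding R.simps(2)[of V \<rho> "Suc k"] R.simps(2)[of V \<rho> k] by blast
qed

lemma U_R:
 assumes r: "isrep V \<rho>" and x: "x \<in> R V \<rho> k"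
 shows "U \<rho> (g 1) x \<in> R V \<rho> (Suc k)" "U \<rho> (g 2) x \<in> R V \<rho> (Suc k)"
proof -
 have 0: "0 \<in> R V \<rho> k" using subspace_0[OF conjunct1[OF R_subspace[OF r, of k]]] .
 have "U \<rho> (g 1) x = U \<rho> (g 1) x + U \<rho> (g 2) 0" "U \<rho> (g 2) x = U \<rho> (g 1) 0 + U \<rho> (g 2) x"
  by (simp_all add: lin_0[OF isrep_linU[OF r g_closed]])
 then show "U \<rho> (g 1) x \<in> R V \<rho> (Suc k)" "U \<rho> (g 2) x \<in> R V \<rho> (Suc k)"
  unfolding R.simps(2) using 0 x by blast+
qed

text \<open>Induction on the dimension: modulo the line of a fixed vector the series reaches 0, so
  in \<open>V\<close> it reaches that line, and one more step kills it.\<close>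

lemma R_nilpotent: "isrep V \<rho> ==> \<exists>n. R V \<rho> n = {0}"
proof (induction "dim V" arbitrary: V \<rho> rule: less_induct)
 case less
 note r = less.prems
 show ?case
 proof (cases "V = {0}")
  case True
  then show ?thesis by (metis R.simps(1))
 next
  case False
  obtain w where w: "w \<in> V" "w \<noteq> 0" "U \<rho> (g 1) w = 0" "U \<rho> (g 2) w = 0"
   using fixed_vector[OF r False] by blast
  let ?N = "span {w}"
  have N0: "U \<rho> (g i) x = 0" if "x \<in> ?N" "i \<in> {1, 2}" for x i
   using that w lin_scale[OF isrep_linU[OF r g_closed]] by (auto simp: span_singleton)
  have N: "inv_sub V \<rho> ?N"
   using N0 w isrep_sub[OF r] span_zero by (auto simp: inv_sub_def span_minimal)
  have "?N \<noteq> {0}" using w span_base[of w "{w}"] by auto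
  obtain \<pi> where p: "lin \<pi>" "\<And>v. v \<in> V ==> \<pi> v \<in> V \<and> \<pi> v - v \<in> ?N" "\<And>n. n \<in> ?N ==> \<pi> n = 0"
   "isrep (\<pi> ` V) (\<lambda>x v. \<pi> (\<rho> x v))"
   "\<And>x v. x \<in> carrier G ==> v \<in> V ==> U (\<lambda>x v. \<pi> (\<rho> x v)) x (\<pi> v) = \<pi> (U \<rho> x v)"
   "?N \<noteq> {0} ==> dim (\<pi> ` V) < dim V"
   by (rule quot_rep[OF r N]) blast
  let ?\<rho> = "\<lambda>x v. \<pi> (\<rho> x v)"
  obtain n where n: "R (\<pi> ` V) ?\<rho> n = {0}"
   using less.hyps[OF p(6) p(4)] \<open>?N \<noteq> {0}\<close> by blast
  have "\<pi> ` R V \<rho> k \<subseteq> R (\<pi> ` V) ?\<rho> k" for k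
  proof (induction k)
   case (Suc k)
   show ?case
   proof
    fix y assume "y \<in> \<pi> ` R V \<rho> (Suc k)"
    then obtain a b where ab: "a \<in> R V \<rho> k" "b \<in> R V \<rho> k"
     "y = \<pi> (U \<rho> (g 1) a + U \<rho> (g 2) b)" by auto
    then have "a \<in> V" "b \<in> V" using R_subspace[OF r] by auto
    then have "y = U ?\<rho> (g 1) (\<pi> a) + U ?\<rho> (g 2) (\<pi> b)"
     using ab p(5)[OF g_closed] by (simp add: lin_add[OF p(1)])
    then show "y \<in> R (\<pi> ` V) ?\<rho> (Suc k)" using ab Suc by auto
   qed
  qed auto
  then have "R V \<rho> n \<subseteq> ?N"
  proof -
   have "x \<in> ?N" if "x \<in> R V \<rho> n" for x
   proof -
    have "\<pi> x = 0" using that \<open>\<And>k. \<pi> ` R V \<rho> k \<subseteq> R (\<pi> ` V) ?\<rho> k\<close>[of n] n by auto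
    moreover have "x \<in> V" using that R_subspace[OF r] by auto
    ultimately show ?thesis using p(2)[of x] span_neg[of "- x" "{w}"] by simp
   qed
   then show ?thesis by blast
  qed
  then have U0: "U \<rho> (g 1) a = 0" "U \<rho> (g 2) a = 0" if "a \<in> R V \<rho> n" for a
   using N0[of a 1] N0[of a 2] that by auto
  have "x = 0" if "x \<in> R V \<rho> (Suc n)" for x
  proof -
   from that obtain a b where "a \<in> R V \<rho> n" "b \<in> R V \<rho> n" "x = U \<rho> (g 1) a + U \<rho> (g 2) b" by auto
   then show ?thesis using U0 by simp
  qed
  then have "R V \<rho> (Suc n) \<subseteq> {0}" by blast
  then have "R V \<rho> (Suc n) = {0}" using subspace_0[OF conjunct1[OF R_subspace[OF r, of "Suc n"]]] by blast
  then show ?thesis by blast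
 qed
qed

end

declare One_nat_def [simp del]

section \<open>Scalar recursions for \<open>g 2\<close> along one-dimensional layers\<close>

primrec ysc :: "(nat \<Rightarrow> 'a::comm_ring_1) \<Rightarrow> nat \<Rightarrow> nat \<Rightarrow> 'a" where
 "ysc b 0 k = b k"
| "ysc b (Suc n) k = ysc b n k - ysc b n (Suc k)"

text \<open>\<open>ysc b n k\<close> is the signed binomial sum of \<open>b k\<close>, ...,
  \<open>b (k + n)\<close>, an iterated difference. The supports found below are so sparse that sums
  with a single non-zero term are what occurs.\<close>

lemma ysc_single:
 assumes "\<And>m. m \<le> n ==> m \<noteq> m0 ==> b (k + m) = 0"
 shows "ysc b n k = (- 1) ^ m0 * of_nat (n choose m0) * b (k + m0)"
 using assms
proof (induction n arbitrary: k m0)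
 case 0
 then show ?case using 0[of 0] by (cases m0) auto
next
 case (Suc n)
 have 1: "ysc b n k = (- 1) ^ m0 * of_nat (n choose m0) * b (k + m0)"
  by (rule Suc.IH) (use Suc.prems in auto)
 have z: "b (Suc k + m) = 0" if "m \<le> n" "Suc m \<noteq> m0" for m
  using Suc.prems[of "Suc m"] that by simp
 show ?case
 proof (cases m0)
  case 0
  have "ysc b n (Suc k) = (- 1) ^ Suc n * of_nat (n choose Suc n) * b (Suc k + Suc n)"
   by (rule Suc.IH) (use z 0 in auto)
  then show ?thesis using 1 0 by (simp add: binomial_eq_0)
 next
  case (Suc m)
  have "ysc b n (Suc k) = (- 1) ^ m * of_nat (n choose m) * b (Suc k + m)"
   by (rule Suc.IH) (use z Suc in auto)
  then show ?thesis using 1 Suc by (simp add: algebra_simps)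
 qed
qed

lemma ysc_zero: "(\<And>m. m \<le> n ==> b (k + m) = 0) ==> ysc b n k = 0"
 using ysc_single[of n "Suc n" b k] by (simp add: binomial_eq_0)

text \<open>Here \<open>b k\<close> is the scalar of \<open>g 2\<close> from layer \<open>k\<close>
  to layer \<open>k + 1\<close>, in bases for which \<open>T\<close> acts by 1 on each step. Then
  \<open>C\<close> expresses that \<open>g 2\<close> commutes at leading order with its
  \<open>n\<close>-fold bracket by \<open>T\<close>.\<close>

locale chain_scalars =
 fixes b :: "nat \<Rightarrow> 'a::field" and M N :: nat
 assumes ch: "\<And>n. 0 < n ==> n \<le> 12 ==> of_nat n \<noteq> (0::'a)"
  and C: "\<And>n k. 1 \<le> n ==> n + 2 \<le> M ==> k + n + 2 \<le> N \<Longrightarrow>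
   b (Suc (k + n)) * ysc b n k = ysc b n (Suc k) * b k"
  and MN: "Suc M = N" "3 \<le> M" "N \<le> 10"
begin

lemma C1: "k + 3 \<le> N ==> b (Suc (Suc k)) * (b k - b (Suc k)) = (b (Suc k) - b (Suc (Suc k))) * b k"
 using C[of 1 k] MN by (simp add: One_nat_def)

text \<open>If exactly one outer term of \<open>C1\<close> is 0, the relation forces a product of
  two neighbours to vanish; so two non-zero neighbours spread non-vanishing in both
  directions.\<close>

lemma consecutive:
 assumes "b j \<noteq> 0" "b (Suc j) \<noteq> 0" "Suc j < N" "k < N"
 shows "b k \<noteq> 0"
proof -
 have up: "Suc (j + m) < N ==> b (j + m) \<noteq> 0 \<and> b (Suc (j + m)) \<noteq> 0" for m
 proof (induction m)
  case (Suc m)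
  then have "b (j + m) \<noteq> 0" "b (Suc (j + m)) \<noteq> 0" by auto
  then show ?case using C1[of "j + m"] Suc.prems by auto
 qed (use assms in auto)
 have down: "m \<le> j ==> b (j - m) \<noteq> 0 \<and> b (Suc (j - m)) \<noteq> 0" for m
 proof (induction m)
  case (Suc m)
  then have 1: "b (j - m) \<noteq> 0" "b (Suc (j - m)) \<noteq> 0" by auto
  have e: "Suc (j - Suc m) = j - m" using Suc.prems by auto
  have "j - Suc m + 3 \<le> N" using Suc.prems assms(3) by linarith
  from C1[OF this] show ?case using 1 unfolding e by auto
 qed (use assms in auto)
 consider "k \<le> j" | "k = Suc (j + (k - j - 1))" by linarith
 then show ?thesis
 proof cases
  case 1
  then show ?thesis using down[of "j - k"] by simp
 next
  case 2
  then show ?thesis using up[of "k - j - 1"] assms(4) by simp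
 qed
qed

text \<open>Once some term is 0, no two neighbours are both non-zero. Between two successive
  non-zero terms at distance \<open>d\<close> the relation \<open>C\<close> has one surviving
  product, with coefficient 2 for even \<open>d\<close> and \<open>d\<close> for odd
  \<open>d\<close>, unless the gap is too long for \<open>C\<close> to apply.\<close>

lemma gap:
 assumes nz: "\<exists>k<N. b k = 0"
 shows "b j \<noteq> 0 ==> b (j + d) \<noteq> 0 ==> 0 < d ==> j + d < N \<Longrightarrow>
  (even d \<and> M \<le> d) \<or> (odd d \<and> M \<le> d + 1)"
proof (induction d arbitrary: j rule: less_induct)
 case (less d)
 note bj = less.prems(1) and bd = less.prems(2)
 have one: "b i = 0 \<or> b (Suc i) = 0" if "Suc i < N" for i
  using consecutive[of i] that nz by blast
 have d1: "d \<noteq> 1" using one[of j] less.prems by (auto simp: One_nat_def)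
 have mid: "b (j + m) = 0" if m: "0 < m" "m < d" for m
 proof (rule ccontr)
  assume n: "b (j + m) \<noteq> 0"
  have "M \<le> m + 1" using less.IH[OF m(2) bj n m(1)] m less.prems by auto
  moreover have "M \<le> d - m + 1"
   using less.IH[of "d - m" "j + m"] n bd m less.prems by auto
  ultimately show False using less.prems MN m by linarith
 qed
 show ?case
 proof (cases "even d")
  case True
  show ?thesis
  proof (rule ccontr)
   assume "\<not> ?thesis"
   then have dM: "d + 1 \<le> M" using True by auto
   obtain n where n: "d = Suc n" "1 \<le> n" using d1 less.prems by (cases d) auto
   have "b (Suc (j + n)) * ysc b n j = ysc b n (Suc j) * b j"
    using n dM less.prems by (intro C) auto
   moreover have "ysc b n j = b j"
    using ysc_single[of n 0 b j] mid n by simp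
   moreover have "ysc b n (Suc j) = (- 1) ^ n * of_nat (n choose n) * b (Suc j + n)"
    using mid n by (intro ysc_single) (metis add_Suc_right add_Suc le_neq_implies_less not_less_eq zero_less_Suc)
   moreover have "(- 1) ^ n = (- 1 :: 'a)" using True n by simp
   ultimately have "2 * (b (j + d) * b j) = 0" using n by (simp add: algebra_simps)
   with ch[of 2] bj bd show False by simp
  qed
 next
  case False
  show ?thesis
  proof (rule ccontr)
   assume "\<not> ?thesis"
   then have dM: "d + 2 \<le> M" using False by auto
   obtain n where n: "d = Suc n" using less.prems by (cases d) auto
   have odn: "(- 1) ^ n = (1 :: 'a)" using False n by simp
   show False
   \<comment> \<open>For odd \<open>d\<close> the window of \<open>C\<close> is one step longer than
     the gap: it is extended to the right if there is room, otherwise to the left.\<close>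
   proof (cases "j + d + 2 \<le> N")
    case True
    have z: "b (Suc (j + d)) = 0" using one[of "j + d"] True bd by auto
    have "b (Suc (j + d)) * ysc b d j = ysc b d (Suc j) * b j"
     using True dM less.prems by (intro C) auto
    moreover have "ysc b d (Suc j) = (- 1) ^ n * of_nat (d choose n) * b (Suc j + n)"
    proof (rule ysc_single)
     fix m assume "m \<le> d" "m \<noteq> n"
     then consider "m = d" | "Suc m < d" using n by linarith
     then show "b (Suc j + m) = 0" using z mid[of "Suc m"] by cases auto
    qed
    moreover have "d choose n = d" using n by simp
    ultimately have "of_nat d * (b (j + d) * b j) = 0" using z odn n by (simp add: algebra_simps)
    then show False using ch[of d] bj bd less.prems MN by auto
   next
    case False
    then have j: "1 \<le> j" using dM less.prems MN by linarith
    then obtain i where i: "j = Suc i" by (cases j) auto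
    have z: "b i = 0" using one[of i] i bj less.prems by (auto simp: One_nat_def)
    have "b (Suc (i + d)) * ysc b d i = ysc b d (Suc i) * b i"
     using dM less.prems i by (intro C) auto
    moreover have "ysc b d i = (- 1) ^ 1 * of_nat (d choose 1) * b (i + 1)"
    proof (rule ysc_single)
     fix m assume "m \<le> d" "m \<noteq> 1"
     then consider "m = 0" | m' where "m = Suc m'" "0 < m'" "m' < d"
      by (cases m) (auto simp: One_nat_def)
     then show "b (i + m) = 0" using z mid i by cases auto
    qed
    ultimately have "of_nat d * (b (j + d) * b j) = 0" using z i by (simp add: algebra_simps One_nat_def)
    then show False using ch[of d] bj bd less.prems MN by auto
   qed
  qed
 qed
qed

text \<open>For non-zero terms \<open>C1\<close> says that the inverses form an arithmetic
  progression, with difference \<open>v\<close>; iterated differences of such a sequence telescope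
  to a product.\<close>

lemma progression:
 assumes nz0: "\<forall>k<N. b k \<noteq> 0"
 shows "\<exists>v. (\<forall>k. k + 1 < N \<longrightarrow> b k - b (k + 1) = v * (b k * b (k + 1))) \<and>
  (\<forall>n k. k + n < N \<longrightarrow> ysc b n k = of_nat (fact n) * v ^ n * (\<Prod>m\<le>n. b (k + m)))"
proof -
 note nz = nz0[rule_format]
 define a where "a k = inverse (b k)" for k
 have st: "a (Suc (Suc k)) - a (Suc k) = a (Suc k) - a k" if "k + 2 < N" for k
 proof -
  have "inverse (b (Suc (Suc k))) + inverse (b k) = 2 * inverse (b (Suc k))"
   using C1[of k] nz[of k] nz[of "Suc k"] nz[of "Suc (Suc k)"] that by (simp add: field_simps)
  then show ?thesis unfolding a_def by (simp add: algebra_simps)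
 qed
 define v where "v = a (Suc 0) - a 0"
 have s1: "Suc k < N ==> a (Suc k) - a k = v" for k
 proof (induction k)
  case (Suc k)
  then show ?case using st[of k] by simp
 qed (simp add: v_def)
 have sm: "k + m < N ==> a (k + m) - a k = of_nat m * v" for k m
 proof (induction m)
  case (Suc m)
  then show ?case using s1[of "k + m"] by (simp add: algebra_simps)
 qed simp
 have dif: "b k - b (k + m) = of_nat m * v * (b k * b (k + m))" if "k + m < N" for k m
  using sm[OF that] nz[of k] nz[of "k + m"] that unfolding a_def by (simp add: field_simps)
 have y: "k + n < N ==> ysc b n k = of_nat (fact n) * v ^ n * (\<Prod>m\<le>n. b (k + m))" for n k
 proof (induction n arbitrary: k)
   case (Suc n)
   define Q where "Q = (\<Prod>m<n. b (Suc k + m))"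
   have e1: "(\<Prod>m\<le>n. b (k + m)) = b k * Q"
    unfolding Q_def lessThan_Suc_atMost[symmetric] prod.lessThan_Suc_shift by simp
   have e2: "(\<Prod>m\<le>n. b (Suc k + m)) = Q * b (k + Suc n)"
    unfolding Q_def lessThan_Suc_atMost[symmetric] prod.lessThan_Suc by simp
   have e3: "(\<Prod>m\<le>Suc n. b (k + m)) = b k * Q * b (k + Suc n)"
    using e1 by simp
   have "ysc b (Suc n) k = of_nat (fact n) * v ^ n * Q * (b k - b (k + Suc n))"
    using Suc e1 e2 by (simp add: algebra_simps)
   also have "\<dots> = of_nat (fact (Suc n)) * v ^ Suc n * (\<Prod>m\<le>Suc n. b (k + m))"
    unfolding dif[OF Suc.prems] e3 by (simp add: algebra_simps)
   finally show ?case .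
 qed simp
 show ?thesis
  using dif[of _ 1] y by (intro exI[of _ v]) simp
qed

text \<open>Without zeros the product formula would make both sides of \<open>Z\<close> equal. So
  \<open>gap\<close> applies with \<open>M = 8\<close> and allows only the distances 7 and 8, and
  \<open>Z\<close> requires two non-zero terms.\<close>

lemma supportB:
 assumes N: "N = 9" and Z: "b 8 * ysc b 7 0 \<noteq> ysc b 7 1 * b 0"
 shows "\<exists>j j'. (j, j') \<in> {(0, 8), (0, 7), (1, 8)} \<and> b j \<noteq> 0 \<and> b j' \<noteq> 0 \<and>
  (\<forall>k<9. k \<noteq> j \<longrightarrow> k \<noteq> j' \<longrightarrow> b k = 0)"
proof -
 have nz: "\<exists>k<N. b k = 0"
 proof (rule ccontr)
  assume "\<not> ?thesis"
  then have "\<forall>k<N. b k \<noteq> 0" by blast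
  from progression[OF this] obtain v where
   v: "\<forall>n k. k + n < N \<longrightarrow> ysc b n k = of_nat (fact n) * v ^ n * (\<Prod>m\<le>n. b (k + m))"
   by (elim exE conjE)
  let ?P = "\<Prod>m\<le>7. b (0 + m)" and ?Q = "\<Prod>m\<le>7. b (1 + m)" and ?X = "of_nat (fact 7) * v ^ 7"
  have y1: "ysc b 7 0 = ?X * ?P" by (rule v[rule_format]) (use N in simp)
  have y2: "ysc b 7 1 = ?X * ?Q" by (rule v[rule_format]) (use N in simp)
  have e8: "Suc 7 = 8" by simp
  have "(\<Prod>m\<le>Suc 7. b m) = ?P * b (Suc 7)" by (simp only: prod.atMost_Suc add_0_left)
  moreover have "(\<Prod>m\<le>Suc 7. b m) = b 0 * ?Q"
   by (simp only: prod.atMost_Suc_shift One_nat_def add_Suc add_0_left)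
  ultimately have q: "b 8 * ?P = b 0 * ?Q" unfolding e8 by (simp only: mult.commute)
  have "b 8 * ysc b 7 0 = ?X * (b 8 * ?P)" unfolding y1 by (simp only: mult_ac)
  also have "\<dots> = ysc b 7 1 * b 0" unfolding y2 q by (simp only: mult_ac)
  finally show False using Z by blast
 qed
 note gap' = gap[OF nz]
 have M: "M = 8" using MN N by simp
 have G: "j' - j \<ge> 7" "j' - j = 7 \<or> j' - j = 8"
  if "b j \<noteq> 0" "b j' \<noteq> 0" "j < j'" "j' < 9" for j j'
 proof -
  have "j' - j < 9" "0 < j' - j" "j + (j' - j) = j'" using that by auto
  then have "(even (j' - j) \<and> 8 \<le> j' - j) \<or> (odd (j' - j) \<and> 8 \<le> (j' - j) + 1)"
   using gap'[of j "j' - j"] that N M by simp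
  then show "j' - j \<ge> 7" "j' - j = 7 \<or> j' - j = 8" using \<open>j' - j < 9\<close> by (elim disjE conjE; linarith)+
 qed
 show ?thesis
 proof (cases "b 0 = 0")
  case True
  then have "b 8 \<noteq> 0" "ysc b 7 0 \<noteq> 0" using Z by auto
  then obtain m where m: "m \<le> 7" "b m \<noteq> 0" using ysc_zero[of 7 b 0] by auto
  have "m \<noteq> 0" using m(2) True by metis
  with G(2)[OF m(2) \<open>b 8 \<noteq> 0\<close>] m have "m = 1" by auto
  moreover have "b k = 0" if "k < 9" "k \<noteq> 1" "k \<noteq> 8" for k
  proof (rule ccontr)
   assume "b k \<noteq> 0"
   from G(2)[OF this \<open>b 8 \<noteq> 0\<close>] that True \<open>b k \<noteq> 0\<close> have "k = 0" by auto
   then show False using True \<open>b k \<noteq> 0\<close> by simp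
  qed
  ultimately show ?thesis using \<open>b 8 \<noteq> 0\<close> m by (intro exI[of _ 1] exI[of _ 8]) auto
 next
  case False
  have "\<exists>m\<in>{7, 8}. b m \<noteq> 0"
  proof (rule ccontr)
   assume n: "\<not> ?thesis"
   have "b m = 0" if "0 < m" "m \<le> 8" for m
    using G(2)[OF False, of m] that n by (cases "b m = 0") auto
   then have "ysc b 7 1 = 0" "b 8 = 0" using ysc_zero[of 7 b 1] by (auto simp: One_nat_def)
   then show False using Z by simp
  qed
  then obtain m where m: "m = 7 \<or> m = 8" "b m \<noteq> 0" by blast
  have "b k = 0" if "k < 9" "k \<noteq> 0" "k \<noteq> m" for k
  proof (rule ccontr)
   assume k: "b k \<noteq> 0"
   have "k = 7 \<or> k = 8" using G(2)[OF False k] that by auto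
   then show False using G(1)[OF k m(2)] G(1)[OF m(2) k] m(1) that by auto
  qed
  then show ?thesis using False m by (intro exI[of _ 0] exI[of _ m]) auto
 qed
qed

text \<open>Without zeros the product formula forces \<open>v = 0\<close>. With zeros, non-zero
  terms are 9 apart, so \<open>ysc b 8 0\<close> or \<open>ysc b 8 1\<close> contains exactly one of
  them, with a binomial coefficient of 8 as factor, and these are units modulo 13.\<close>

lemma supportA:
 assumes N: "N = 10" and Z: "ysc b 8 0 = 0" "ysc b 8 1 = 0"
 shows "\<exists>c. \<forall>k<10. b k = c"
proof (cases "\<exists>k<N. b k = 0")
 case False
 then have nz: "\<forall>k<N. b k \<noteq> 0" by blast
 from progression[OF nz] obtain v where
  v: "\<forall>k. k + 1 < N \<longrightarrow> b k - b (k + 1) = v * (b k * b (k + 1))"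
   "\<forall>n k. k + n < N \<longrightarrow> ysc b n k = of_nat (fact n) * v ^ n * (\<Prod>m\<le>n. b (k + m))" by (elim exE conjE)
 have "of_nat (fact 8) * v ^ 8 * (\<Prod>m\<le>8. b (0 + m)) = 0" using v(2)[rule_format, of 0 8] Z N by simp
 moreover have "(\<Prod>m\<le>8. b (0 + m)) \<noteq> 0" using nz N by auto
 moreover have "fact 8 = (2 * 3 * 4 * 5 * 6 * 7 * 8 :: nat)"
  by (simp add: fact_numeral)
 then have "of_nat (fact 8) \<noteq> (0 :: 'a)"
  using ch[of 2] ch[of 3] ch[of 4] ch[of 5] ch[of 6] ch[of 7] ch[of 8]
  by (simp only: of_nat_mult mult_eq_0_iff simp_thms)
 ultimately have "v = 0" by simp
 then have s: "k + 1 < 10 ==> b (k + 1) = b k" for k using v(1)[rule_format, of k] N by simp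
 have "k < 10 ==> b k = b 0" for k
 proof (induction k)
  case (Suc k)
  then show ?case using s[of k] by (simp add: One_nat_def)
 qed simp
 then show ?thesis by blast
next
 case True
 note gap' = gap[OF True]
 have M: "M = 9" using MN N by simp
 have G: "j' - j = 9" if "b j \<noteq> 0" "b j' \<noteq> 0" "j < j'" "j' < 10" for j j'
 proof -
  have "j' - j < 10" "0 < j' - j" "j + (j' - j) = j'" using that by auto
  then have g: "(even (j' - j) \<and> 9 \<le> j' - j) \<or> (odd (j' - j) \<and> 9 \<le> (j' - j) + 1)"
   using gap'[of j "j' - j"] that N M by simp
  then have "j' - j \<ge> 8" by (elim disjE conjE; linarith)
  moreover have "j' - j \<noteq> 8" using g by (cases "j' - j = 8") simp_all
  ultimately show ?thesis using \<open>j' - j < 10\<close> by linarith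
 qed
 have "b j = 0" if j: "j < 10" for j
 proof (rule ccontr)
  assume bj: "b j \<noteq> 0"
  have o: "b k = 0" if "k \<noteq> j" "k < 10" "k - j \<noteq> 9" "j - k \<noteq> 9" for k
   using G[OF _ bj, of k] G[OF bj, of k] that j by (cases "k < j") auto
  show False
  proof (cases "j = 9")
   case True
   have "ysc b 8 1 = (- 1) ^ 8 * of_nat (8 choose 8) * b (1 + 8)"
    by (rule ysc_single) (use o True in auto)
   then show False using Z bj True by simp
  next
   case False
   then have j8: "j \<le> 8" using j by simp
   have "ysc b 8 0 = (- 1) ^ j * of_nat (8 choose j) * b (0 + j)"
    by (rule ysc_single) (use o j8 in auto)
   then have z: "of_nat (8 choose j) = (0 :: 'a)" using Z bj by simp
   have "j \<in> {0, 1, 2, 3, 4, 5, 6, 7, 8}" using j8 by auto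
   moreover have "of_nat (4 * 7) \<noteq> (0 :: 'a)" "of_nat (7 * 8) \<noteq> (0 :: 'a)" "of_nat (7 * 10) \<noteq> (0 :: 'a)"
    using ch[of 4] ch[of 7] ch[of 8] ch[of 10] by (simp_all only: of_nat_mult mult_eq_0_iff simp_thms)
   moreover have "8 choose 2 = (4 * 7 :: nat)" "8 choose 6 = (4 * 7 :: nat)" "8 choose 3 = (7 * 8 :: nat)"
     "8 choose 5 = (7 * 8 :: nat)" "8 choose 4 = (7 * 10 :: nat)" "8 choose 7 = (8::nat)" "8 choose 8 = (1::nat)" "8 choose 1 = (8::nat)" "8 choose 0 = (1::nat)"
    by code_simp+
   ultimately show False using z ch[of 8] by (elim insertE emptyE) (simp_all only: of_nat_1 zero_neq_one one_neq_zero)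
  qed
 qed
 then show ?thesis by blast
qed

end

declare One_nat_def [simp del]

section \<open>Symbols on layers with one or two basis vectors\<close>

lemma sadp_numeral:
 "sadp a b t y (numeral v) k s =
  t (k + (pred_numeral v * a + b)) (sadp a b t y (pred_numeral v) k s) - sadp a b t y (pred_numeral v) (k + a) (t k s)"
 by (simp add: numeral_eq_Suc)

lemma sadp_one: "sadp a b t y 1 k s = t (k + b) (y k s) - y (k + a) (t k s)"
 by (simp add: One_nat_def)

lemma sadp_shift:
 fixes b :: "nat \<Rightarrow> 'a::comm_ring_1"
 shows "sadp 1 1 (\<lambda>k s. s) (\<lambda>k s. b k * s) n k s = ysc b n k * s"
 by (induction n arbitrary: k s) (simp_all add: algebra_simps One_nat_def)

context fvs
begin

text \<open>Two families serve two purposes: a layer with an additional basis vector, and later two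
  consecutive orders of one expansion.\<close>

definition pf :: "(nat \<Rightarrow> 'b) \<Rightarrow> (nat \<Rightarrow> 'b) \<Rightarrow> nat \<Rightarrow> 'a \<times> 'a \<Rightarrow> 'b" where
 "pf e w k st = fst st *s e k + snd st *s w k"

lemma phi_add_pf: "phi_add (pf e w)"
 by (simp add: phi_add_def pf_def algebra_simps)

lemma phi_add_scale: "phi_add (\<lambda>k (s::'a). s *s e k)"
 by (simp add: phi_add_def algebra_simps)

lemma sym2I:
 assumes Y: "lin Y" and F: "filt F" and r: "raises F n Y"
  and e: "\<And>k. Y (e k) - (a k *s e (k + n) + c k *s w (k + n)) \<in> F (k + n + r)"
  and w: "\<And>k. Y (w k) - (a' k *s e (k + n) + c' k *s w (k + n)) \<in> F (k + n + r)"
 shows "sym (\<lambda>k. F (k + r)) (pf e w) n Y (\<lambda>k st. (a k * fst st + a' k * snd st, c k * fst st + c' k * snd st))"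
 unfolding sym_def
proof (intro conjI allI Y)
 fix k
 show "subspace (F (k + r))" using filt_sub[OF F] .
next
 show "raises (\<lambda>k. F (k + r)) n Y" unfolding raises_def
 proof (intro allI ballI)
  fix k x assume "x \<in> F (k + r)"
  from raisesD[OF r this] show "Y x \<in> F (k + n + r)" by (simp add: ac_simps)
 qed
next
 fix k and st :: "'a \<times> 'a"
 obtain s t where st: "st = (s, t)" by force
 have "s *s (Y (e k) - (a k *s e (k + n) + c k *s w (k + n)))
   + t *s (Y (w k) - (a' k *s e (k + n) + c' k *s w (k + n))) \<in> F (k + n + r)"
  by (intro filt_add[OF F] filt_scale[OF F] e w)
 then show "Y (pf e w k st) - pf e w (k + n) (a k * fst st + a' k * snd st, c k * fst st + c' k * snd st) \<in> F (k + n + r)"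
  by (simp add: st pf_def lin_add[OF Y] lin_scale[OF Y] algebra_simps)
qed

lemma sym1I:
 assumes Y: "lin Y" and F: "filt F" and r: "raises F n Y"
  and e: "\<And>k. Y (e k) - a k *s e (k + n) \<in> F (k + n + r)"
 shows "sym (\<lambda>k. F (k + r)) (\<lambda>k s. s *s e k) n Y (\<lambda>k s. a k * s)"
 unfolding sym_def
proof (intro conjI allI Y)
 fix k
 show "subspace (F (k + r))" using filt_sub[OF F] .
next
 show "raises (\<lambda>k. F (k + r)) n Y" unfolding raises_def
 proof (intro allI ballI)
  fix k x assume "x \<in> F (k + r)"
  from raisesD[OF r this] show "Y x \<in> F (k + n + r)" by (simp add: ac_simps)
 qed
next
 fix k s
 have "s *s (Y (e k) - a k *s e (k + n)) \<in> F (k + n + r)"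
  by (intro filt_scale[OF F] e)
 then show "Y (s *s e k) - (a k * s) *s e (k + n) \<in> F (k + n + r)"
  by (simp add: lin_scale[OF Y] algebra_simps)
qed

text \<open>The source of all scalar equations: an operator that raises \<open>r\<close> degrees
  more than its nominal degree must have a symbol that vanishes modulo the error spaces.\<close>

lemma sym_vanish:
 assumes "sym (\<lambda>k. F (k + r)) \<phi> n Y y" "filt F" "raises F (n + r) Y" "\<phi> k s \<in> F k"
 shows "\<phi> (k + n) (y k s) \<in> F (k + n + r)"
proof -
 have "Y (\<phi> k s) \<in> F (k + n + r)" using raisesD[OF assms(3,4)] by (simp add: ac_simps)
 from filt_diff[OF assms(2) this symD[OF assms(1), of k s]] show ?thesis by simp
qed

lemma sym_vanish2:
 assumes "sym (\<lambda>k. F (k + r)) \<phi> n Y y" "sym (\<lambda>k. F (k + r)) \<phi> n Y' y'" "filt F"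
  "raises F (n + r) (\<lambda>v. Y v - d *s Y' v)" "\<phi> k s \<in> F k"
 shows "\<phi> (k + n) (y k s) - d *s \<phi> (k + n) (y' k s) \<in> F (k + n + r)"
proof -
 have 1: "Y (\<phi> k s) - d *s Y' (\<phi> k s) \<in> F (k + n + r)"
  using raisesD[OF assms(4,5)] by (simp add: ac_simps)
 have 2: "(Y (\<phi> k s) - \<phi> (k + n) (y k s)) - d *s (Y' (\<phi> k s) - \<phi> (k + n) (y' k s)) \<in> F (k + n + r)"
  by (intro filt_diff[OF assms(3)] filt_scale[OF assms(3)] symD[OF assms(1)] symD[OF assms(2)])
 from filt_diff[OF assms(3) 1 2] show ?thesis by (simp add: algebra_simps)
qed

lemma line_layer:
 assumes "subspace S" "subspace R" "S \<subseteq> R" "dim R \<le> dim S + 1" "e \<in> R" "e \<notin> S" "x \<in> R"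
 shows "\<exists>a. x - a *s e \<in> S"
proof -
 have sp: "span S = S" using assms(1) by (rule span_eq_iff[THEN iffD2])
 have eS: "e \<notin> span S" unfolding sp by (rule assms(6))
 have "span (insert e S) \<subseteq> R" using assms by (intro span_minimal) auto
 moreover have "dim (span (insert e S)) = dim S + 1" using eS by (simp add: dim_insert)
 ultimately have "span (insert e S) = R"
  using assms(2,4) by (intro subspace_dim_equal) auto
 then have "x \<in> span (insert e S)" using assms(7) by simp
 then show ?thesis unfolding span_breakdown_eq sp .
qed

lemma dim_strict: "subspace S ==> subspace R ==> S \<subseteq> R ==> S \<noteq> R ==> dim S < dim R"
 using subspace_dim_equal[of S R] by linarith

end

context prep
begin

declare R.simps(2) [simp del]

lemma of_nat_inj12: "i \<le> 12 ==> j \<le> 12 ==> of_nat i = (of_nat j :: 'a) ==> i = j"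
proof (rule ccontr)
 assume a: "i \<le> 12" "j \<le> 12" "of_nat i = (of_nat j :: 'a)" "i \<noteq> j"
 have "of_nat (max i j - min i j) = (0 :: 'a)" using a by (simp add: of_nat_diff max_def min_def)
 moreover have "0 < max i j - min i j" "max i j - min i j \<le> 12" using a by auto
 ultimately show False using char_ne by blast
qed

text \<open>The eleven candidates 0, ..., 10 for \<open>c\<close> are distinct in the field, and
  each of the ten conditions excludes at most one of them.\<close>

lemma ex_generic:
 fixes \<alpha> \<beta> :: "nat \<Rightarrow> 'a"
 assumes "\<forall>k<10. \<alpha> k \<noteq> 0 \<or> \<beta> k \<noteq> 0"
 shows "\<exists>c. \<forall>k<10. \<alpha> k + c * \<beta> k \<noteq> 0"
proof (rule ccontr)
 assume "\<not> ?thesis"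
 then have "\<forall>i. \<exists>k. k < 10 \<and> \<alpha> k + of_nat i * \<beta> k = 0" by blast
 then obtain \<kappa> where k: "\<And>i. \<kappa> i < 10" "\<And>i. \<alpha> (\<kappa> i) + of_nat i * \<beta> (\<kappa> i) = 0" by metis
 have "inj_on \<kappa> {..10}"
 proof (rule inj_onI)
  fix i j :: nat assume ij: "i \<in> {..10}" "j \<in> {..10}" "\<kappa> i = \<kappa> j"
  have "(of_nat i - of_nat j) * \<beta> (\<kappa> i) = (\<alpha> (\<kappa> i) + of_nat i * \<beta> (\<kappa> i)) - (\<alpha> (\<kappa> j) + of_nat j * \<beta> (\<kappa> j))"
   using ij(3) by (simp add: algebra_simps)
  then have "(of_nat i - of_nat j) * \<beta> (\<kappa> i) = 0" using k(2) by simp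
  moreover have "\<beta> (\<kappa> i) \<noteq> 0" using assms[rule_format, OF k(1)[of i]] k(2)[of i] by auto
  ultimately have "of_nat i = (of_nat j :: 'a)" by simp
  then show "i = j" using of_nat_inj12[of i j] ij by auto
 qed
 then have "card {..10::nat} \<le> card {..<10::nat}"
  using card_inj_on_le[of \<kappa> "{..10}" "{..<10}"] k(1) by auto
 then show False by simp
qed

end

section \<open>Minimal modules on which \<open>g 10\<close> acts non-trivially\<close>

locale minrep = prep scale Basis G g
 for scale :: "'a::field \<Rightarrow> 'b::ab_group_add \<Rightarrow> 'b" (infixr "*s" 75) and Basis :: "'b set"
  and G :: "('g, 'm) monoid_scheme" (structure) and g :: "nat \<Rightarrow> 'g" +
 fixes V \<rho>
 assumes rep: "isrep V \<rho>" and dimV: "dim V \<le> 11"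
  and Znz: "\<exists>v\<in>V. U \<rho> (g 10) v \<noteq> 0"
  and min1: "inv_sub V \<rho> S ==> S \<noteq> V ==> s \<in> S ==> U \<rho> (g 10) s = 0"
  and min2: "inv_sub V \<rho> S ==> S \<noteq> {0} ==> v \<in> V ==> U \<rho> (g 10) v \<in> S"
begin

abbreviation "L k \<equiv> R V \<rho> k"
abbreviation "u1 \<equiv> U \<rho> (g 1)"
abbreviation "u2 \<equiv> U \<rho> (g 2)"
abbreviation "Z \<equiv> U \<rho> (g 10)"
definition Tg :: "'a \<Rightarrow> 'b \<Rightarrow> 'b" where "Tg c = (\<lambda>v. u1 v + c *s u2 v)"

lemma subL: "subspace (L k)" and L_V: "L k \<subseteq> V"
 using R_subspace[OF rep] by auto

lemma filtL: "filt (\<lambda>k. L k)"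
 unfolding filt_def using subL R_Suc_subset[OF rep] by blast

lemma lin_u: "lin (U \<rho> (g k))"
 using isrep_linU[OF rep] by simp

lemma lin_Tg: "lin (Tg c)"
 unfolding Tg_def by (intro lin_plus lin_scl lin_u)

lemma u_L: "x \<in> L k ==> u1 x \<in> L (Suc k)" "x \<in> L k ==> u2 x \<in> L (Suc k)"
 using U_R[OF rep] by auto

lemma Tg_L: "x \<in> L k ==> Tg c x \<in> L (Suc k)"
 unfolding Tg_def by (intro subspace_add[OF subL] subspace_scale[OF subL] u_L)

lemma adm: "filt F ==> F 0 \<subseteq> V ==> raises F a u1 ==> raises F b u2 ==> 1 \<le> a ==> a \<le> b \<Longrightarrow>
  prep_adm scale Basis G g V \<rho> F a b"
 by unfold_locales (use rep in auto)

lemma raisesL: "raises (\<lambda>k. L k) 1 u1" "raises (\<lambda>k. L k) 1 u2"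
 unfolding raises_def using u_L by (auto simp: One_nat_def)

lemma invL: "inv_sub V \<rho> (L k)"
 unfolding inv_sub_def using subL L_V u_L filt_monoD[OF filtL, of _ "Suc k" k] by auto

text \<open>Equality of two consecutive terms would propagate to all later ones, against
  nilpotency.\<close>

lemma L_strict: "L k \<noteq> {0} ==> L (Suc k) \<noteq> L k"
proof
 assume a: "L k \<noteq> {0}" "L (Suc k) = L k"
 have "L (k + n) = L k" for n
 proof (induction n)
  case (Suc n)
  have "L (Suc (k + n)) = L (Suc k)" by (simp add: R.simps(2) Suc)
  then show ?case using a(2) by simp
 qed simp
 moreover obtain n where "L n = {0}" using R_nilpotent[OF rep] by blast
 moreover have "L (k + n) \<subseteq> L n" using filt_mono[OF filtL] by simp
 ultimately show False using a(1) subspace_0[OF subL, of k] by blast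
qed

lemma L_dim: "L k \<noteq> {0} ==> dim (L (Suc k)) < dim (L k)"
 using L_strict[of k] dim_strict[OF subL subL R_Suc_subset[OF rep]] by blast

lemma V_ne: "V \<noteq> {0}"
 using Znz lin_0[OF lin_u] by auto

lemma Z_L1: "x \<in> L (Suc 0) ==> Z x = 0"
 using min1[OF invL, of "Suc 0"] L_strict[of 0] V_ne by simp

text \<open>A vector \<open>v\<close> with \<open>Z v \<noteq> 0\<close> spans together with
  \<open>L 1\<close> an invariant subspace, which by \<open>min1\<close> is everything; so the top
  layer is one-dimensional.\<close>

lemma ex_v0: "\<exists>v\<in>V. v \<notin> L (Suc 0) \<and> Z v \<noteq> 0 \<and> (\<forall>x\<in>V. \<exists>a. x - a *s v \<in> L (Suc 0))"
proof -
 obtain v where v: "v \<in> V" "Z v \<noteq> 0" using Znz by blast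
 let ?S = "span (insert v (L (Suc 0)))"
 have sp: "span (L (Suc 0)) = L (Suc 0)" using subL by (rule span_eq_iff[THEN iffD2])
 have LS: "L (Suc 0) \<subseteq> ?S" using span_superset by blast
 have "insert v (L (Suc 0)) \<subseteq> V" using v L_V by blast
 then have SV: "?S \<subseteq> V" using isrep_sub[OF rep] by (intro span_minimal)
 have "inv_sub V \<rho> ?S" unfolding inv_sub_def
  using SV LS u_L[of _ 0] by auto
 then have "?S = V" using min1[of ?S v] v span_base[of v "insert v (L (Suc 0))"] by blast
 moreover have "v \<notin> L (Suc 0)" using Z_L1 v by auto
 ultimately show ?thesis using v span_breakdown_eq[of _ v "L (Suc 0)"] sp by auto
qed

lemma Z_raises: "raises (\<lambda>k. L k) 9 Z"
proof -
 interpret a: prep_adm scale Basis G g V \<rho> "\<lambda>k. L k" 1 1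
  using raisesL by (intro adm filtL) auto
 show ?thesis using a.D_raises[OF a.D_g[of 10]] by (simp add: hgt_def)
qed

lemma Z_v: "v \<in> V ==> Z v \<in> L 9"
 using raisesD[OF Z_raises, of v 0] by simp

lemma L9: "L 9 \<noteq> {0}"
 using Znz Z_v by auto

lemma L_le9: "k \<le> 9 ==> L k \<noteq> {0}"
 using L9 filt_mono[OF filtL, of k 9] subspace_0[OF subL] by blast

text \<open>The counterpart of \<open>ex_v0\<close> at the bottom: a fixed line is invariant, so by
  \<open>min2\<close> it contains the image of \<open>Z\<close>.\<close>

lemma fixed: "v \<in> V ==> u1 v = 0 ==> u2 v = 0 ==> v \<noteq> 0 ==> x \<in> V ==> \<exists>a. Z x = a *s v"
proof -
 assume a: "v \<in> V" "u1 v = 0" "u2 v = 0" "v \<noteq> 0" "x \<in> V"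
 have "inv_sub V \<rho> (span {v})" unfolding inv_sub_def
 proof (intro conjI ballI)
  show "span {v} \<subseteq> V" using a isrep_sub[OF rep] by (intro span_minimal) auto
  fix s assume "s \<in> span {v}"
  then have "u1 s = 0" "u2 s = 0" using a lin_scale[OF lin_u] by (auto simp: span_singleton)
  then show "u1 s \<in> span {v}" "u2 s \<in> span {v}" using span_zero by auto
 qed auto
 moreover have "span {v} \<noteq> {0}" using a span_base[of v "{v}"] by auto
 ultimately have "Z x \<in> span {v}" using min2 a by blast
 then show ?thesis by (auto simp: span_singleton)
qed

text \<open>Dimensions drop strictly as long as \<open>L k\<close> is non-zero, which holds up to
  \<open>L 9\<close>; against the total of 11 this leaves one dimension to spare.\<close>

lemma dimL: "k \<le> 9 ==> 10 - k \<le> dim (L k)" "k \<le> 9 ==> dim (L k) \<le> 11 - k"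
proof -
 have "n \<le> 9 ==> Suc n \<le> dim (L (9 - n))" for n
 proof (induction n)
  case 0
  have "dim (L 9) \<noteq> 0" using L9 subspace_0[OF subL, of 9] by (auto simp: dim_eq_0)
  then show ?case by (simp del: dim_eq_0)
 next
  case (Suc n)
  have "Suc (9 - Suc n) = 9 - n" using Suc.prems by simp
  moreover have "9 - Suc n \<le> 9" by simp
  ultimately show ?case using L_dim[OF L_le9, of "9 - Suc n"] Suc by simp
 qed
 from this[of "9 - k"] show "k \<le> 9 ==> 10 - k \<le> dim (L k)" by simp
 show "k \<le> 9 ==> dim (L k) \<le> 11 - k"
 proof (induction k)
  case 0
  then show ?case using dimV by simp
 next
  case (Suc k)
  then show ?case using L_dim[OF L_le9, of k] by simp
 qed
qed

end

section \<open>Chains adapted to the layers, and the exclusion of eleven layers\<close>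

context minrep
begin

text \<open>Control of \<open>u1\<close> and \<open>u2\<close> on representatives modulo
  \<open>L (Suc k)\<close> is enough, since the difference is sent into \<open>L (k + 2)\<close>
  anyway.\<close>

lemma layer_next:
 assumes S: "subspace S" "L (k + 2) \<subseteq> S"
  and y: "\<And>y. y \<in> L k ==> \<exists>y'. u1 y' \<in> S \<and> u2 y' \<in> S \<and> y - y' \<in> L (Suc k)"
 shows "L (Suc k) \<subseteq> S"
proof
 fix x assume "x \<in> L (Suc k)"
 then obtain a b where ab: "a \<in> L k" "b \<in> L k" "x = u1 a + u2 b"
  unfolding R.simps(2) by blast
 have SS: "Suc (Suc k) = k + 2" by simp
 obtain a' where a': "u1 a' \<in> S" "a - a' \<in> L (Suc k)" using y[OF ab(1)] by blast
 obtain b' where b': "u2 b' \<in> S" "b - b' \<in> L (Suc k)" using y[OF ab(2)] by blast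
 have "u1 (a - a') \<in> S" "u2 (b - b') \<in> S"
  using u_L(1)[OF a'(2)] u_L(2)[OF b'(2)] S(2) unfolding SS by blast+
 then have "(u1 (a - a') + u1 a') + (u2 (b - b') + u2 b') \<in> S"
  using a' b' by (intro subspace_add[OF S(1)])
 then show "x \<in> S" by (simp add: ab lin_diff[OF lin_u])
qed

text \<open>With \<open>c\<close> from \<open>ex_generic\<close> the operator \<open>Tg c\<close> is
  non-zero on every step, so the orbit of \<open>h 0\<close> can replace the arbitrary
  representatives \<open>h k\<close>.\<close>

lemma chain_exists:
 assumes F: "filt F" and r: "raises F 1 u1" "raises F 1 u2" and N: "N \<le> 10"
  and h: "\<And>k. k \<le> N ==> h k \<in> F k"
  and st: "\<And>k. k < N ==> \<exists>\<alpha> \<beta>. u1 (h k) - \<alpha> *s h (Suc k) \<in> F (k + 2) \<and>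
    u2 (h k) - \<beta> *s h (Suc k) \<in> F (k + 2) \<and> (\<alpha> \<noteq> 0 \<or> \<beta> \<noteq> 0)"
 shows "\<exists>c b. (\<forall>k\<le>N. \<exists>l. l \<noteq> 0 \<and> (Tg c ^^ k) (h 0) - l *s h k \<in> F (Suc k)) \<and>
   (\<forall>k<N. u2 ((Tg c ^^ k) (h 0)) - b k *s (Tg c ^^ Suc k) (h 0) \<in> F (k + 2))"
proof -
 have "\<forall>k. \<exists>\<alpha> \<beta>. k < N \<longrightarrow> u1 (h k) - \<alpha> *s h (Suc k) \<in> F (k + 2) \<and>
    u2 (h k) - \<beta> *s h (Suc k) \<in> F (k + 2) \<and> (\<alpha> \<noteq> 0 \<or> \<beta> \<noteq> 0)" using st by blast
 then obtain \<alpha> \<beta> where ab: "\<And>k. k < N ==> u1 (h k) - \<alpha> k *s h (Suc k) \<in> F (k + 2)"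
  "\<And>k. k < N ==> u2 (h k) - \<beta> k *s h (Suc k) \<in> F (k + 2)"
  "\<And>k. k < N ==> \<alpha> k \<noteq> 0 \<or> \<beta> k \<noteq> 0" by metis
 \<comment> \<open>Steps from \<open>N\<close> on receive the dummy pair (1, 1), so that all ten
   conditions are defined.\<close>
 obtain c where c: "\<forall>k<10. (if k < N then \<alpha> k else 1) + c * (if k < N then \<beta> k else 1) \<noteq> 0"
 proof -
  have "\<forall>k<10. (if k < N then \<alpha> k else 1) \<noteq> 0 \<or> (if k < N then \<beta> k else 1) \<noteq> 0" using ab(3) by auto
  from ex_generic[OF this] that show thesis by blast
 qed
 have c': "\<alpha> k + c * \<beta> k \<noteq> 0" if "k < N" for k
  using c[rule_format, of k] that N by auto
 define e where "e k = (Tg c ^^ k) (h 0)" for k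
 have SS: "Suc k + 1 = k + 2" for k by simp
 have Th: "Tg c (h k) - (\<alpha> k + c * \<beta> k) *s h (Suc k) \<in> F (k + 2)" if "k < N" for k
 proof -
  have "(u1 (h k) - \<alpha> k *s h (Suc k)) + c *s (u2 (h k) - \<beta> k *s h (Suc k)) \<in> F (k + 2)"
   using ab that by (intro filt_add[OF F] filt_scale[OF F])
  then show ?thesis by (simp add: Tg_def algebra_simps)
 qed
 have rT: "raises F 1 (Tg c)"
  unfolding Tg_def by (intro raises_add[OF F] raises_scale[OF F] r)
 have lex: "k \<le> N ==> \<exists>l. l \<noteq> 0 \<and> e k - l *s h k \<in> F (Suc k)" for k
 proof (induction k)
  case 0
  then show ?case using filt_0[OF F] by (intro exI[of _ 1]) (simp add: e_def)
 next
  case (Suc k)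
  then obtain l where l: "l \<noteq> 0" "e k - l *s h k \<in> F (Suc k)" by auto
  have "Tg c (e k - l *s h k) \<in> F (k + 2)" using raisesD[OF rT l(2)] unfolding SS .
  moreover have "l *s (Tg c (h k) - (\<alpha> k + c * \<beta> k) *s h (Suc k)) \<in> F (k + 2)"
   using Th Suc.prems by (intro filt_scale[OF F]) auto
  ultimately have "Tg c (e k - l *s h k) + l *s (Tg c (h k) - (\<alpha> k + c * \<beta> k) *s h (Suc k)) \<in> F (k + 2)"
   by (rule filt_add[OF F])
  then have "e (Suc k) - (l * (\<alpha> k + c * \<beta> k)) *s h (Suc k) \<in> F (Suc (Suc k))"
   by (simp add: e_def lin_diff[OF lin_Tg] lin_scale[OF lin_Tg] scale_right_diff_distrib)
  moreover have "l * (\<alpha> k + c * \<beta> k) \<noteq> 0" using l c'[of k] Suc.prems by simp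
  ultimately show ?case by blast
 qed
 have "\<exists>b. k < N \<longrightarrow> u2 (e k) - b *s e (Suc k) \<in> F (k + 2)" for k
 proof (cases "k < N")
  case True
  obtain l where l: "l \<noteq> 0" "e k - l *s h k \<in> F (Suc k)" using lex[of k] True by auto
  obtain m where m: "m \<noteq> 0" "e (Suc k) - m *s h (Suc k) \<in> F (Suc (Suc k))" using lex[of "Suc k"] True by auto
  have 1: "u2 (e k - l *s h k) \<in> F (k + 2)" using raisesD[OF r(2) l(2)] unfolding SS .
  have 2: "l *s (u2 (h k) - \<beta> k *s h (Suc k)) \<in> F (k + 2)" using ab(2)[OF True] by (rule filt_scale[OF F])
  have 3: "(l * \<beta> k / m) *s (e (Suc k) - m *s h (Suc k)) \<in> F (k + 2)" using m(2) by (intro filt_scale[OF F]) simp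
  from filt_diff[OF F filt_add[OF F 1 2] 3]
  have "u2 (e k) - (l * \<beta> k / m) *s e (Suc k) \<in> F (k + 2)"
   using m(1) by (simp add: lin_diff[OF lin_u] lin_scale[OF lin_u] scale_right_diff_distrib algebra_simps)
  then show ?thesis by blast
 qed auto
 then obtain b where "\<And>k. k < N ==> u2 (e k) - b k *s e (Suc k) \<in> F (k + 2)" by metis
 then show ?thesis using lex unfolding e_def by blast
qed

lemma pick: "k \<le> 9 ==> \<exists>x. x \<in> L k \<and> x \<notin> L (Suc k)"
 using L_strict[OF L_le9] R_Suc_subset[OF rep, of k] by blast

lemma prep11L: "prep11 scale Basis G g V \<rho> (\<lambda>k. L k)"
 unfolding prep11_def using raisesL by (intro adm filtL) auto

text \<open>A filtration that has reached 0 at the weight \<open>7a + 2b\<close> of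
  \<open>g 10\<close> would make \<open>Z\<close> vanish.\<close>

lemma no_weights:
 assumes "filt F" "F 0 = V" "raises F a u1" "raises F b u2" "1 \<le> a" "a \<le> b" "F (7 * a + 2 * b) = {0}"
 shows False
proof -
 interpret a: prep_adm scale Basis G g V \<rho> F a b
  using assms by (intro adm) auto
 have "raises F (7 * a + 2 * b) Z" using a.D_raises[OF a.D_g[of 10]] by (simp add: hgt_def)
 then have "Z v = 0" if "v \<in> V" for v
  using raisesD[of F "7 * a + 2 * b" Z v 0] that assms(2,7) by simp
 then show False using Znz by blast
qed

text \<open>With \<open>L 10 \<noteq> 0\<close> all eleven layers are lines. Then
  \<open>supportA\<close> makes \<open>g 2\<close> act by the same scalar on all steps, so a
  combination \<open>Y\<close> of \<open>u1\<close> and \<open>u2\<close> raises by 2, and the group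
  relations push \<open>g 10\<close> into degree 11, where nothing is left.\<close>

lemma caseA:
 assumes L10: "L 10 \<noteq> {0}"
 shows False
proof -
 have le10: "L k \<noteq> {0}" if "k \<le> 10" for k
  using L10 filt_mono[OF filtL that] subspace_0[OF subL] by blast
 have up: "k \<le> 10 ==> dim (L k) \<le> 11 - k" for k
 proof (induction k)
  case (Suc k)
  then show ?case using L_dim[OF le10, of k] by simp
 qed (use dimV in simp)
 have lo0: "n \<le> 10 ==> Suc n \<le> dim (L (10 - n))" for n
 proof (induction n)
  case 0
  have "dim (L 10) \<noteq> 0" using L10 subspace_0[OF subL, of 10] by (auto simp: dim_eq_0)
  then show ?case by (simp del: dim_eq_0)
 next
  case (Suc n)
  have "Suc (10 - Suc n) = 10 - n" "10 - Suc n \<le> 10" using Suc.prems by auto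
  then show ?case using L_dim[OF le10, of "10 - Suc n"] Suc by simp
 qed
 have lo: "k \<le> 10 ==> 11 - k \<le> dim (L k)" for k using lo0[of "10 - k"] by simp
 have "dim (L 11) = 0" using L_dim[OF L10] up[of 10] by (simp del: dim_eq_0)
 then have L11: "L 11 = {0}" using subspace_0[OF subL, of 11] by (auto simp: dim_eq_0)
 have z11: "x = 0" if "x \<in> L k" "11 \<le> k" for x k
  using filt_mono[OF filtL that(2)] that(1) L11 by auto
 have "\<forall>k. \<exists>x. k \<le> 10 \<longrightarrow> x \<in> L k \<and> x \<notin> L (Suc k)"
  using L_strict[OF le10] R_Suc_subset[OF rep] by blast
 then obtain h where h: "\<And>k. k \<le> 10 ==> h k \<in> L k" "\<And>k. k \<le> 10 ==> h k \<notin> L (Suc k)" by metis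
 have dk: "dim (L k) \<le> dim (L (Suc k)) + 1" if "k \<le> 10" for k
  using up[OF that] lo[of "Suc k"] that by (cases "k = 10") auto
 have lin1: "\<exists>a. x - a *s h k \<in> L (Suc k)" if "k \<le> 10" "x \<in> L k" for k x
  using dk[OF that(1)] that h R_Suc_subset[OF rep]
  by (intro line_layer[OF subL subL]) auto
 have st: "\<exists>\<alpha> \<beta>. u1 (h k) - \<alpha> *s h (Suc k) \<in> L (k + 2) \<and>
    u2 (h k) - \<beta> *s h (Suc k) \<in> L (k + 2) \<and> (\<alpha> \<noteq> 0 \<or> \<beta> \<noteq> 0)" if k: "k < 10" for k
 proof -
  obtain \<alpha> where a: "u1 (h k) - \<alpha> *s h (Suc k) \<in> L (k + 2)"
   using lin1[of "Suc k" "u1 (h k)"] u_L(1)[OF h(1)[of k]] k by auto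
  obtain \<beta> where b: "u2 (h k) - \<beta> *s h (Suc k) \<in> L (k + 2)"
   using lin1[of "Suc k" "u2 (h k)"] u_L(2)[OF h(1)[of k]] k by auto
  have "\<alpha> \<noteq> 0 \<or> \<beta> \<noteq> 0"
  proof (rule ccontr)
   assume "\<not> ?thesis"
   then have z: "u1 (h k) \<in> L (k + 2)" "u2 (h k) \<in> L (k + 2)" using a b by auto
   have "L (Suc k) \<subseteq> L (k + 2)"
   proof (rule layer_next[OF subL subset_refl])
    fix y assume "y \<in> L k"
    then obtain a where "y - a *s h k \<in> L (Suc k)" using lin1[of k y] k by auto
    then show "\<exists>y'. u1 y' \<in> L (k + 2) \<and> u2 y' \<in> L (k + 2) \<and> y - y' \<in> L (Suc k)"
     using z by (intro exI[of _ "a *s h k"]) (simp add: lin_scale[OF lin_u] subspace_scale[OF subL])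
   qed
   then show False using h[of "Suc k"] k by auto
  qed
  then show ?thesis using a b by blast
 qed
 obtain c b0 where cb: "\<forall>k\<le>10. \<exists>l. l \<noteq> 0 \<and> (Tg c ^^ k) (h 0) - l *s h k \<in> L (Suc k)"
   "\<forall>k<10. u2 ((Tg c ^^ k) (h 0)) - b0 k *s (Tg c ^^ Suc k) (h 0) \<in> L (k + 2)"
  using chain_exists[OF filtL raisesL, of 10 h] h(1) st by blast
 define e where "e k = (Tg c ^^ k) (h 0)" for k
 define b where "b k = (if k < 10 then b0 k else 0)" for k
 have Te: "Tg c (e k) = e (Suc k)" for k by (simp add: e_def)
 have eL: "e k \<in> L k" for k
 proof (induction k)
  case (Suc k)
  then show ?case using Tg_L Te by metis
 qed (use h(1)[of 0] in \<open>simp add: e_def\<close>)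
 have en: "e k \<notin> L (Suc k)" if kN: "k \<le> 10" for k
 proof
  assume a: "e k \<in> L (Suc k)"
  obtain l where l: "l \<noteq> 0" "e k - l *s h k \<in> L (Suc k)" using cb(1)[rule_format, OF kN] unfolding e_def[symmetric] by blast
  from subspace_scale[OF subL subspace_diff[OF subL a l(2)], of "inverse l"]
  show False using l h(2)[OF kN] by simp
 qed
 have ub: "u2 (e k) - b k *s e (Suc k) \<in> L (k + 2)" for k
 proof (cases "k < 10")
  case True
  then show ?thesis using cb(2) by (simp add: b_def e_def)
 next
  case False
  then have "u2 (e k) = 0" using u_L(2)[OF eL[of k]] z11 by auto
  then show ?thesis using False subspace_0[OF subL] by (simp add: b_def)
 qed
 have zero: "a = 0" if "a *s e k \<in> L (Suc k)" "k \<le> 10" for a k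
 proof (rule ccontr)
  assume "a \<noteq> 0"
  with subspace_scale[OF subL that(1), of "inverse a"] en[OF that(2)] show False by simp
 qed
 interpret a: prep11 scale Basis G g V \<rho> "\<lambda>k. L k" by (rule prep11L)
 have Tc: "a.Tc c = Tg c" by (simp add: a.Tc_def Tg_def)
 have rT: "raises (\<lambda>k. L k) 1 (Tg c)" using a.raises_Tc[of c] unfolding Tc .
 let ?\<phi> = "\<lambda>k (s::'a). s *s e k"
 have sT: "sym (\<lambda>k. L (k + 1)) ?\<phi> 1 (Tg c) (\<lambda>k s. 1 * s)"
  by (rule sym1I[OF lin_Tg filtL rT]) (simp add: Te One_nat_def subspace_0[OF subL])
 have su: "sym (\<lambda>k. L (k + 1)) ?\<phi> 1 u2 (\<lambda>k s. b k * s)"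
  by (rule sym1I[OF lin_u filtL raisesL(2)]) (use ub in \<open>simp add: One_nat_def\<close>)
 have sX: "sym (\<lambda>k. L (k + 1)) ?\<phi> (n + 1) (adp (Tg c) u2 n) (\<lambda>k s. ysc b n k * s)" for n
 proof -
  have sh: "sadp 1 1 (\<lambda>k s. 1 * s) (\<lambda>k s. b k * s) n = (\<lambda>k s. ysc b n k * s)"
   by (intro ext) (simp add: sadp_shift)
  show ?thesis using sym_adp[OF phi_add_scale sT su, of n] unfolding sh by simp
 qed
 have sC: "sym (\<lambda>k. L (k + 1)) ?\<phi> (n + 2) (cm u2 (adp (Tg c) u2 n))
   (\<lambda>k s. (b (k + n + 1) * ysc b n k - ysc b n (Suc k) * b k) * s)" for n
  using sym_cm[OF phi_add_scale su sX[of n]] by (simp add: algebra_simps One_nat_def)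
 \<comment> \<open>\<open>min2\<close> for the non-zero subspace \<open>L 10\<close> gives one
   degree more than the weight 9 of \<open>g 10\<close>; this makes the relation for
   \<open>n = 7\<close> homogeneous too.\<close>
 have Z10: "raises (\<lambda>k. L k) 10 Z" unfolding raises_def
 proof (intro allI ballI)
  fix k x assume x: "x \<in> L k"
  show "Z x \<in> L (k + 10)"
  proof (cases k)
   case 0
   then show ?thesis using min2[OF invL L10, of x] x by simp
  next
   case (Suc m)
   then have "x \<in> L (Suc 0)" using x filt_monoD[OF filtL, of x k "Suc 0"] by simp
   then show ?thesis using Z_L1 subspace_0[OF subL] by simp
  qed
 qed
 have rC: "raises (\<lambda>k. L k) (n + 2 + 1) (cm u2 (adp (Tg c) u2 n))" if "1 \<le> n" "n \<le> 7" for n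
 proof (cases "n = 7")
  case True
  show ?thesis using raises_add[OF filtL a.rel11_z[of c] Z10] True unfolding Tc by simp
 next
  case False
  have e: "n + 2 + 1 = n + 3" by simp
  show ?thesis unfolding e using False a.rel11_2n[of n c] that unfolding Tc by simp
 qed
 have C: "b (k + n + 1) * ysc b n k = ysc b n (Suc k) * b k"
  if "1 \<le> n" "n \<le> 7" "k + n + 2 \<le> 10" for n k
 proof -
  have m: "((b (k + n + 1) * ysc b n k - ysc b n (Suc k) * b k) * 1) *s e (k + (n + 2)) \<in> L (k + (n + 2) + 1)"
   by (rule sym_vanish[OF sC filtL rC[OF that(1,2)], where k = k and s = 1]) (use eL[of k] in simp)
  have i: "k + (n + 2) + 1 = Suc (k + (n + 2))" by simp
  have "k + (n + 2) \<le> 10" using that(3) by simp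
  from zero[OF m[unfolded i] this]
  have "(b (k + n + 1) * ysc b n k - ysc b n (Suc k) * b k) * 1 = 0" .
  then show ?thesis by simp
 qed
 have r8: "raises (\<lambda>k. L k) (8 + 1 + 1) (adp (Tg c) u2 8)"
 proof -
  have e8: "adp (Tg c) u2 8 = cm (Tg c) (adp (Tg c) u2 7)" using adp.simps(2)[of "Tg c" u2 7] by simp
  show ?thesis
   using raises_add[OF filtL a.rel11_19[of c] raises_scale[OF filtL Z10, of c]] unfolding Tc e8 by simp
 qed
 have Y8: "ysc b 8 k = 0" if "k \<le> 1" for k
 proof -
  have m: "(ysc b 8 k * 1) *s e (k + (8 + 1)) \<in> L (k + (8 + 1) + 1)"
   by (rule sym_vanish[OF sX filtL r8, where k = k and s = 1]) (use eL[of k] in simp)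
  have i: "k + (8 + 1) + 1 = Suc (k + (8 + 1))" by simp
  have "k + (8 + 1) \<le> 10" using that by simp
  from zero[OF m[unfolded i] this] have "ysc b 8 k * 1 = 0" .
  then show ?thesis by simp
 qed
 interpret cs: chain_scalars b 9 10
  by unfold_locales (use char_ne C in \<open>auto simp: One_nat_def\<close>)
 obtain c' where c': "\<And>k. k < 10 ==> b k = c'"
  using cs.supportA Y8[of 0] Y8[of 1] by auto
 have lin1e: "\<exists>a. x - a *s e k \<in> L (Suc k)" if "x \<in> L k" for k x
 proof (cases "k \<le> 10")
  case True
  then show ?thesis
   using dk[OF True] that eL en R_Suc_subset[OF rep]
   by (intro line_layer[OF subL subL]) auto
 next
  case False
  then show ?thesis using z11[OF that] subspace_0[OF subL] by (intro exI[of _ 0]) simp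
 qed
 \<comment> \<open>These are the coefficients of \<open>u2 - c' * Tg c\<close> in terms of
   \<open>u1\<close> and \<open>u2\<close>; this combination vanishes on every step.\<close>
 define \<mu> \<nu> where "\<mu> = - c'" and "\<nu> = 1 - c' * c"
 have mn: "\<mu> \<noteq> 0 \<or> \<nu> \<noteq> 0" by (auto simp: \<mu>_def \<nu>_def)
 define Y where "Y = (\<lambda>v. \<mu> *s u1 v + \<nu> *s u2 v)"
 have linY: "lin Y" unfolding Y_def by (intro lin_plus lin_scl lin_u)
 have Y1: "raises (\<lambda>k. L k) 1 Y" unfolding Y_def by (intro raises_add[OF filtL] raises_scale[OF filtL] raisesL)
 have Ye: "Y (e k) \<in> L (k + 2)" for k
 proof (cases "k < 10")
  case True
  have "Y (e k) = u2 (e k) - b k *s e (Suc k)"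
   unfolding Te[symmetric] c'[OF True] by (simp add: Y_def Tg_def \<mu>_def \<nu>_def algebra_simps)
  then show ?thesis using ub by simp
 next
  case False
  have "Y (e k) \<in> L (Suc k)" using raisesD[OF Y1 eL[of k]] by (simp add: One_nat_def)
  then have "Y (e k) = 0" using z11[of "Y (e k)" "Suc k"] False by simp
  then show ?thesis using subspace_0[OF subL] by simp
 qed
 have Y2: "raises (\<lambda>k. L k) 2 Y" unfolding raises_def
 proof (intro allI ballI)
  fix k x assume "x \<in> L k"
  then obtain a where a: "x - a *s e k \<in> L (Suc k)" using lin1e by blast
  have "Y (x - a *s e k) \<in> L (k + 2)" using raisesD[OF Y1 a] by (simp add: One_nat_def)
  from subspace_add[OF subL this subspace_scale[OF subL Ye[of k], of a]]
  show "Y x \<in> L (k + 2)" by (simp add: lin_diff[OF linY] lin_scale[OF linY])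
 qed
 have Dz: "False" if "g 10 \<in> D \<rho> (\<lambda>k. L k) 11"
 proof -
  have "Z v \<in> L 11" if "v \<in> V" for v
   using raisesD[OF a.D_raises[OF \<open>g 10 \<in> _\<close>], of v 0] that by simp
  then show False using L11 Znz by auto
 qed
 have D9: "g 9 \<in> D \<rho> (\<lambda>k. L k) 10 ==> False"
  using a.D_comm[OF a.g2_D _ g_closed r29, of 10] Dz by simp
 \<comment> \<open>One surplus degree of \<open>g 4\<close> is passed on by \<open>r1\<close> to
   \<open>g 9\<close>, and by \<open>r29\<close> from there to \<open>g 10\<close>.\<close>
 have up4: "g (n + 4) \<in> D \<rho> (\<lambda>k. L k) (n + 5)" if "g 4 \<in> D \<rho> (\<lambda>k. L k) 5" "n \<le> 5" for n
  using that(2)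
 proof (induction n)
  case (Suc n)
  have "g 1 \<otimes> g (n + 4) = g (Suc (n + 4)) \<otimes> (g (n + 4) \<otimes> g 1)" using Suc.prems by (intro r1) auto
  then show ?case using a.D_comm[OF a.g1_D _ g_closed, of "g (n + 4)" "n + 5"] Suc by simp
 qed (use that in simp)
 have D4: "g 4 \<in> D \<rho> (\<lambda>k. L k) 5 ==> False" using up4[of 5] D9 by simp
 have s23: "Suc 2 = 3" "Suc 3 = 4" by simp_all
 note r12 = r1[of 2, unfolded s23] and r13 = r1[of 3, unfolded s23]
 consider "\<mu> = 0" | "\<nu> = 0" | "\<mu> \<noteq> 0" "\<nu> \<noteq> 0" by blast
 then show False
 proof cases
  case 1
  then have "raises (\<lambda>k. L k) 2 (\<lambda>v. inverse \<nu> *s Y v)" using Y2 by (intro raises_scale[OF filtL])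
  then have "raises (\<lambda>k. L k) 2 u2" using 1 mn by (simp add: Y_def)
  then show False using no_weights[OF filtL _ raisesL(1), of 2] L11 by simp
 next
  case 2
  then have "raises (\<lambda>k. L k) 2 (\<lambda>v. inverse \<mu> *s Y v)" using Y2 by (intro raises_scale[OF filtL])
  then have "raises (\<lambda>k. L k) 2 u1" using 2 mn by (simp add: Y_def)
  then have g1: "g 1 \<in> D \<rho> (\<lambda>k. L k) 2" by (intro a.D_I g_closed)
  have "g 3 \<in> D \<rho> (\<lambda>k. L k) (2 + 1)" using a.D_comm[OF g1 a.g2_D g_closed r12] by simp
  from a.D_comm[OF g1 this g_closed r13] show False using D4 by simp
 next
  case 3
  \<comment> \<open>Now \<open>u2 = m * u1 + X\<close> with \<open>X\<close> of degree 2. First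
    \<open>[u1, u2] = [u1, X]\<close> puts \<open>g 3\<close> in degree 3. Then
    \<open>[u2, g 3]\<close> has degree 5 by \<open>r2\<close> and so has \<open>[X, g 3]\<close>,
    hence also \<open>m * [u1, g 3]\<close>, which puts \<open>g 4\<close> in degree 5.\<close>
  define X where "X = (\<lambda>v. inverse \<nu> *s Y v)"
  have X2: "raises (\<lambda>k. L k) 2 X" unfolding X_def using Y2 by (intro raises_scale[OF filtL])
  have linX: "lin X" unfolding X_def using linY by (rule lin_scl)
  define m where "m = - (\<mu> / \<nu>)"
  have m0: "m \<noteq> 0" using 3 by (simp add: m_def)
  have u2X: "u2 v = m *s u1 v + X v" for v
   using 3 by (simp add: X_def Y_def m_def scale_right_distrib field_simps)
  have cX: "cm u2 Q v = m *s cm u1 Q v + cm X Q v" if "lin Q" for Q v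
   unfolding cm_def u2X by (simp add: lin_add[OF that] lin_scale[OF that] algebra_simps)
  have "cm u1 u2 v = cm u1 X v" for v
   unfolding cm_def u2X by (simp add: lin_add[OF lin_u] lin_scale[OF lin_u])
  then have c12: "raises (\<lambda>k. L k) 3 (cm u1 u2)"
   using raises_cm[OF filtL raisesL(1) X2] by (simp add: raises_def)
  \<comment> \<open>A variant of \<open>D_comm\<close> that starts from a bound on the operator
    bracket instead of the degrees of its factors.\<close>
  have Dcm: "d \<in> D \<rho> (\<lambda>k. L k) l"
   if xy: "x \<in> D \<rho> (\<lambda>k. L k) 0" "y \<in> D \<rho> (\<lambda>k. L k) 0" "d \<in> carrier G" "x \<otimes> y = d \<otimes> (y \<otimes> x)"
    and cl: "raises (\<lambda>k. L k) l (cm (U \<rho> x) (U \<rho> y))" for x y d l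
  proof (rule a.D_I[OF xy(3)], unfold raises_def, intro allI ballI)
   fix k v assume v: "v \<in> L k"
   have car: "x \<in> carrier G" "y \<in> carrier G" using xy a.D_carrier by auto
   have "inv (y \<otimes> x) \<in> D \<rho> (\<lambda>k. L k) 0" by (intro a.D_inv a.D_mult xy)
   then have w: "\<rho> (inv (y \<otimes> x)) v \<in> L k" using a.rho_pres v by blast
   have "cm (U \<rho> x) (U \<rho> y) (\<rho> (inv (y \<otimes> x)) v) = U \<rho> d (\<rho> (y \<otimes> x) (\<rho> (inv (y \<otimes> x)) v))"
    by (rule a.cm_u) (use xy car w a.FkV in auto)
   also have "\<rho> (y \<otimes> x) (\<rho> (inv (y \<otimes> x)) v) = v"
    using car a.FkV[OF v] by (simp add: a.rho_mult[symmetric] a.rho_one del: inv_mult_group)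
   finally show "U \<rho> d v \<in> L (k + l)" using raisesD[OF cl w] by simp
  qed
  have D0: "g k \<in> D \<rho> (\<lambda>k. L k) 0" if "1 \<le> k" "k \<le> 10" for k
  proof (cases "k = 1")
   case True
   then show ?thesis using a.D_mono[OF a.g1_D] by simp
  next
   case False
   then show ?thesis using a.D_mono[OF a.D_g[of k]] that by simp
  qed
  have g3: "g 3 \<in> D \<rho> (\<lambda>k. L k) 3" using Dcm[OF D0[of 1] D0[of 2] g_closed r12 c12] by simp
  have up3: "n \<le> 6 ==> g (n + 3) \<in> D \<rho> (\<lambda>k. L k) (n + 3)" for n
  proof (induction n)
   case (Suc n)
   have "g 1 \<otimes> g (n + 3) = g (Suc (n + 3)) \<otimes> (g (n + 3) \<otimes> g 1)" using Suc.prems by (intro r1) auto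
   then show ?case using a.D_comm[OF a.g1_D _ g_closed, of "g (n + 3)" "n + 3"] Suc by simp
  qed (use g3 in simp)
  have "g ` {3 + 2..10} \<subseteq> D \<rho> (\<lambda>k. L k) 5"
  proof
   fix x assume "x \<in> g ` {3 + 2..10}"
   then obtain k where k: "x = g k" "5 \<le> k" "k \<le> 10" by auto
   show "x \<in> D \<rho> (\<lambda>k. L k) 5"
   proof (cases "k = 10")
    case True
    then show ?thesis using a.D_mono[OF a.D_g[of 10], of 5] k by (simp add: hgt_def)
   next
    case False
    then show ?thesis using a.D_mono[OF up3[of "k - 3"], of 5] k by auto
   qed
  qed
  from a.D_generate[OF this] r2[of 3] obtain s where
   s: "s \<in> D \<rho> (\<lambda>k. L k) 5" "g 2 \<otimes> g 3 = s \<otimes> (g 3 \<otimes> g 2)" by auto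
  have c23: "raises (\<lambda>k. L k) 5 (cm u2 (U \<rho> (g 3)))"
   using a.cm_u_raises(1)[OF a.g2_D g3 s] .
  have cX3: "raises (\<lambda>k. L k) 5 (cm X (U \<rho> (g 3)))"
   using raises_cm[OF filtL X2 a.D_raises[OF g3]] by simp
  have "raises (\<lambda>k. L k) 5 (\<lambda>v. inverse m *s (cm u2 (U \<rho> (g 3)) v - cm X (U \<rho> (g 3)) v))"
   by (intro raises_scale[OF filtL] raises_diff[OF filtL] c23 cX3)
  then have "raises (\<lambda>k. L k) 5 (cm u1 (U \<rho> (g 3)))"
   using m0 by (simp add: cX[OF lin_u])
  from Dcm[OF D0[of 1] D0[of 3] g_closed r13 this] show False using D4 by simp
 qed
qed

end

section \<open>Ten layers with a split vector \<open>w\<close> in the double layer\<close>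

context fvs
begin

lemma lin_subspace_image: "lin f ==> subspace S ==> subspace (f ` S)"
proof (rule subspaceI)
 assume f: "lin f" and S: "subspace S"
 show "0 \<in> f ` S" using imageI[OF subspace_0[OF S], of f] lin_0[OF f] by simp
 show "a + b \<in> f ` S" if "a \<in> f ` S" "b \<in> f ` S" for a b
  using that subspace_add[OF S] by (auto simp: lin_add[OF f, symmetric])
 show "c *s a \<in> f ` S" if "a \<in> f ` S" for c a
  using that subspace_scale[OF S] by (auto simp: lin_scale[OF f, symmetric])
qed

lemma lin_span_into:
 assumes Y: "lin Y" and S: "subspace S" and a: "\<And>x. x \<in> A ==> Y x \<in> S" and x: "x \<in> span A"
 shows "Y x \<in> S"
proof -
 have "subspace {x. Y x \<in> S}"
  by (rule subspaceI) (use S in \<open>auto simp: lin_0[OF Y] lin_add[OF Y] lin_scale[OF Y] subspace_0 subspace_add subspace_scale\<close>)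
 from span_minimal[OF _ this, of A] a x show ?thesis by blast
qed

end

context minrep
begin

text \<open>If \<open>L 10 = 0\<close>, then \<open>L 9\<close> consists of fixed vectors, and by
  \<open>fixed\<close> each non-zero one of them is a multiple of \<open>Z v\<close>.\<close>

lemma caseB:
 assumes L10: "L 10 = {0}"
 shows "x \<in> L k ==> 10 \<le> k ==> x = 0" and "x \<in> L 9 ==> u1 x = 0 \<and> u2 x = 0" and "dim (L 9) = 1"
proof -
 show z: "x \<in> L k ==> 10 \<le> k ==> x = 0" for x k using filt_mono[OF filtL, of 10 k] L10 by auto
 have f: "x \<in> L 9 ==> u1 x = 0 \<and> u2 x = 0" for x using u_L[of x 9] z[of _ "Suc 9"] by simp
 then show "x \<in> L 9 ==> u1 x = 0 \<and> u2 x = 0" .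
 obtain v where v: "v \<in> V" "Z v \<noteq> 0" using Znz by blast
 have "x \<in> span {Z v}" if x: "x \<in> L 9" for x
 proof (cases "x = 0")
  case False
  then obtain a where a: "Z v = a *s x" using fixed[of x v] f[OF x] x L_V v by blast
  then have "a \<noteq> 0" using v by auto
  then have "x = inverse a *s Z v" using a by simp
  then show ?thesis using span_scale[OF span_base[of "Z v" "{Z v}"]] by simp
 qed (simp add: span_zero)
 then have "L 9 = span {Z v}"
  using span_minimal[of "{Z v}" "L 9"] subL Z_v[OF v(1)] by auto
 then show "dim (L 9) = 1" using v dim_insert[of "Z v" "{}"] by simp
qed

text \<open>Adding \<open>w\<close> to degree \<open>j + 1\<close> makes every quotient
  \<open>L k / F (k + 1)\<close> a line, while \<open>u1\<close> and \<open>u2\<close> still raise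
  by 1 because they send \<open>w\<close> into \<open>L (j + 2)\<close>. So
  \<open>chain_exists\<close> applies to the modified filtration.\<close>

lemma chain_build:
 assumes L10: "L 10 = {0}" and j: "1 \<le> j" "j \<le> 8"
  and w: "w \<in> L j" "u1 w \<in> L (j + 2)" "u2 w \<in> L (j + 2)"
  and lay: "\<And>k. k \<le> 9 ==> k \<noteq> j ==> dim (L k) \<le> dim (L (Suc k)) + 1"
  and S: "S = span (insert w (L (Suc j)))" and layj: "dim (L j) = dim S + 1"
 shows "\<exists>c e. (\<forall>k. e k \<in> L k) \<and> (\<forall>k. Tg c (e k) = e (Suc k)) \<and>
  (\<forall>k\<le>9. e k \<notin> (if k = j then S else L (Suc k))) \<and>
  (\<forall>k x. x \<in> L k \<longrightarrow> (\<exists>a. x - a *s e k \<in> (if k = j then S else L (Suc k))))"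
proof -
 define F where "F k = (if k = Suc j then S else L k)" for k
 have SL: "S \<subseteq> L j" unfolding S
  using w(1) subL R_Suc_subset[OF rep, of j] by (intro span_minimal) auto
 have LS: "L (Suc j) \<subseteq> S" unfolding S using span_superset by blast
 have subS: "subspace S" unfolding S by simp
 have F: "filt F" unfolding filt_def F_def
  using subS subL SL LS R_Suc_subset[OF rep] by (auto dest: subsetD[OF R_Suc_subset[OF rep]])
 have uS: "u1 x \<in> L (j + 2)" "u2 x \<in> L (j + 2)" if "x \<in> S" for x
  using that w(2,3) u_L[of _ "Suc j"] unfolding S
  by (auto intro!: lin_span_into[OF lin_u subL _ that[unfolded S]])
 have r: "raises F 1 u1" "raises F 1 u2"
  unfolding raises_def F_def using uS u_L LS by (auto simp: One_nat_def)
 have LF: "L k \<subseteq> F k" for k using LS by (auto simp: F_def)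
 have Fs: "F (Suc k) = (if k = j then S else L (Suc k))" for k by (simp add: F_def)
 have subF: "subspace (F k)" for k using filt_sub[OF F] .
 have FL: "F (Suc k) \<subseteq> L k" for k using SL R_Suc_subset[OF rep] by (simp add: Fs)
 have dF: "k \<le> 9 ==> dim (L k) \<le> dim (F (Suc k)) + 1" for k using lay[of k] layj by (simp add: Fs)
 have ne: "k \<le> 9 ==> F (Suc k) \<noteq> L k" for k
  using L_strict[OF L_le9] layj by (auto simp: Fs)
 have "\<forall>k. \<exists>x. k \<le> 9 \<longrightarrow> x \<in> L k \<and> x \<notin> F (Suc k)" using ne FL by blast
 then obtain h where h: "\<And>k. k \<le> 9 ==> h k \<in> L k" "\<And>k. k \<le> 9 ==> h k \<notin> F (Suc k)" by metis
 have lin1: "\<exists>a. x - a *s h k \<in> F (Suc k)" if "k \<le> 9" "x \<in> L k" for k x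
  using dF h that FL by (intro line_layer[OF subF subL]) auto
 have S2: "Suc (Suc k) = k + 2" for k by simp
 have st: "\<exists>\<alpha> \<beta>. u1 (h k) - \<alpha> *s h (Suc k) \<in> F (k + 2) \<and>
    u2 (h k) - \<beta> *s h (Suc k) \<in> F (k + 2) \<and> (\<alpha> \<noteq> 0 \<or> \<beta> \<noteq> 0)" if k: "k < 9" for k
 proof -
  obtain \<alpha> where a: "u1 (h k) - \<alpha> *s h (Suc k) \<in> F (k + 2)"
   using lin1[of "Suc k" "u1 (h k)"] u_L(1)[OF h(1)[of k]] k by auto
  obtain \<beta> where b: "u2 (h k) - \<beta> *s h (Suc k) \<in> F (k + 2)"
   using lin1[of "Suc k" "u2 (h k)"] u_L(2)[OF h(1)[of k]] k by auto
  have "\<alpha> \<noteq> 0 \<or> \<beta> \<noteq> 0"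
  proof (rule ccontr)
   assume "\<not> ?thesis"
   then have z: "u1 (h k) \<in> F (k + 2)" "u2 (h k) \<in> F (k + 2)" using a b by auto
   have "L (Suc k) \<subseteq> F (k + 2)"
   proof (rule layer_next[OF subF LF])
    fix y assume "y \<in> L k"
    then obtain a where a: "y - a *s h k \<in> F (Suc k)" using lin1[of k y] k by auto
    show "\<exists>y'. u1 y' \<in> F (k + 2) \<and> u2 y' \<in> F (k + 2) \<and> y - y' \<in> L (Suc k)"
    proof (cases "k = j")
     case True
     then obtain b where b: "y - a *s h k - b *s w \<in> L (Suc k)"
      using a span_breakdown_eq[of "y - a *s h k" w "L (Suc j)"] subL[of "Suc j"]
      by (auto simp: Fs S span_eq_iff[THEN iffD2])
     have "u1 w \<in> F (k + 2)" "u2 w \<in> F (k + 2)" using w True LF by blast+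
     then show ?thesis using z b
      by (intro exI[of _ "a *s h k + b *s w"])
       (simp add: lin_add[OF lin_u] lin_scale[OF lin_u] subspace_scale[OF subF] subspace_add[OF subF] diff_diff_eq)
    next
     case False
     then have "y - a *s h k \<in> L (Suc k)" using a by (simp add: Fs)
     then show ?thesis
      using z by (intro exI[of _ "a *s h k"]) (simp only: lin_scale[OF lin_u] subspace_scale[OF subF] simp_thms)
    qed
   qed
   then show False using h[of "Suc k"] k by auto
  qed
  then show ?thesis using a b by blast
 qed
 have "\<And>k. k \<le> 9 ==> h k \<in> F k" using h(1) LF by blast
 from chain_exists[OF F r, of 9 h] this st obtain c b0 where
  cb: "\<forall>k\<le>9. \<exists>l. l \<noteq> 0 \<and> (Tg c ^^ k) (h 0) - l *s h k \<in> F (Suc k)" by auto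
 define e where "e k = (Tg c ^^ k) (h 0)" for k
 have Te: "Tg c (e k) = e (Suc k)" for k by (simp add: e_def)
 have eL: "e k \<in> L k" for k
 proof (induction k)
  case (Suc k)
  then show ?case using Tg_L Te by metis
 qed (use h(1)[of 0] in \<open>simp add: e_def\<close>)
 have en: "e k \<notin> F (Suc k)" if kN: "k \<le> 9" for k
 proof
  assume a: "e k \<in> F (Suc k)"
  obtain l where l: "l \<noteq> 0" "e k - l *s h k \<in> F (Suc k)" using cb[rule_format, OF kN] unfolding e_def[symmetric] by blast
  from subspace_scale[OF subF subspace_diff[OF subF a l(2)], of "inverse l"]
  show False using l h(2)[OF kN] by simp
 qed
 have "\<exists>a. x - a *s e k \<in> F (Suc k)" if "x \<in> L k" for k x
 proof (cases "k \<le> 9")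
  case True
  then show ?thesis using dF eL en that FL by (intro line_layer[OF subF subL]) auto
 next
  case False
  then show ?thesis using caseB(1)[OF L10 that] subspace_0[OF subF] by (intro exI[of _ 0]) simp
 qed
 then show ?thesis using Te eL en unfolding Fs by blast
qed

end

text \<open>The value \<open>w = 0\<close> is allowed and describes ten one-dimensional layers, so
  modules of dimension 10 and 11 are treated together.\<close>

locale chain = minrep scale Basis G g V \<rho>
 for scale :: "'a::field \<Rightarrow> 'b::ab_group_add \<Rightarrow> 'b" (infixr "*s" 75) and Basis :: "'b set"
  and G :: "('g, 'm) monoid_scheme" (structure) and g :: "nat \<Rightarrow> 'g" and V \<rho> +
 fixes c e w j
 assumes L10: "L 10 = {0}" and j: "1 \<le> j" "j \<le> 8"
  and e_L: "e k \<in> L k" and Te: "Tg c (e k) = e (Suc k)"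
  and Tw: "Tg c w = 0" and wL: "w \<in> L j" and uw: "u2 w \<in> L (j + 2)"
  and spL: "j < m ==> x \<in> L m ==> x \<in> span (e ` {m..9})"
  and spj: "m \<le> j ==> x \<in> L m ==> x \<in> span (insert w (e ` {m..9}))"
  and ind: "k \<le> 9 ==> e k \<notin> span (insert w (e ` {Suc k..9}))"
  and wn: "w \<noteq> 0 ==> w \<notin> L (Suc j)"

context minrep
begin

text \<open>\<open>Tg c\<close> maps the span of \<open>e (j + 1)\<close>, ..., \<open>e 8\<close>
  onto that of \<open>e (j + 2)\<close>, ..., \<open>e 9\<close>, which contains
  \<open>Tg c w\<close>. Subtracting a preimage \<open>y\<close> yields a split vector killed by
  \<open>Tg c\<close>.\<close>

lemma chain_data:
 assumes L10: "L 10 = {0}" and j: "1 \<le> j" "j \<le> 8"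
  and w: "w \<in> L j" "u1 w \<in> L (j + 2)" "u2 w \<in> L (j + 2)"
  and lay: "\<And>k. k \<le> 9 ==> k \<noteq> j ==> dim (L k) \<le> dim (L (Suc k)) + 1"
  and layj: "dim (L j) = dim (span (insert w (L (Suc j)))) + 1"
  and wn: "w = 0 \<or> w \<notin> L (Suc j)"
 shows "\<exists>c e w. chain scale Basis G g V \<rho> c e w j"
proof -
 define S where "S = span (insert w (L (Suc j)))"
 obtain c e where ce: "\<And>k. e k \<in> L k" "\<And>k. Tg c (e k) = e (Suc k)"
  "\<And>k. k \<le> 9 ==> e k \<notin> (if k = j then S else L (Suc k))"
  "\<And>k x. x \<in> L k ==> \<exists>a. x - a *s e k \<in> (if k = j then S else L (Suc k))"
  using chain_build[OF L10 j w lay S_def, folded S_def, OF _ _ layj[folded S_def]] by (auto 4 3)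
 have eq: "{m..9} = insert m {Suc m..9}" if "m \<le> 9" for m :: nat using that by auto
 have ext: "x \<in> span (insert y (e ` {m..9}))" if "x - a *s e m \<in> span (insert y (e ` {Suc m..9}))" "m \<le> 9" for x y a m
  using that(1) span_breakdown_eq[of x "e m" "insert y (e ` {Suc m..9})"] unfolding eq[OF that(2)] by (auto simp: insert_commute)
 have sp: "n \<le> 10 - j ==> j < 10 - n ==> x \<in> L (10 - n) ==> x \<in> span (e ` {10 - n..9})" for n x
 proof (induction n arbitrary: x)
  case 0
  then show ?case using caseB(1)[OF L10, of x 10] span_zero by simp
 next
  case (Suc n)
  define m where "m = 10 - Suc n"
  have m: "10 - n = Suc m" "m \<le> 9" "j < m" using Suc.prems by (auto simp: m_def)
  obtain a where "x - a *s e m \<in> L (Suc m)" using ce(4)[of x m] Suc.prems m unfolding m_def by auto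
  then have "x - a *s e m \<in> span (e ` {Suc m..9})" using Suc.IH[of "x - a *s e m"] Suc.prems m by auto
  then show ?case
   using span_breakdown_eq[of x "e m" "e ` {Suc m..9}"] unfolding m_def[symmetric] eq[OF m(2)] by auto
 qed
 have spL: "x \<in> span (e ` {m..9})" if "j < m" "x \<in> L m" for m x
 proof (cases "m \<le> 10")
  case True
  then show ?thesis using sp[of "10 - m" x] that j by simp
 next
  case False
  then show ?thesis using caseB(1)[OF L10 that(2)] span_zero by simp
 qed
 obtain y where y: "y \<in> span (e ` {Suc j..8})" "Tg c y = Tg c w" "w = 0 ==> y = 0"
 proof (cases "w = 0")
  case True
  then show ?thesis using that[of 0] span_zero by simp
 next
  case False
  have "Tg c w \<in> L (j + 2)" unfolding Tg_def by (intro subspace_add[OF subL] subspace_scale[OF subL] w)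
  then have "Tg c w \<in> span (e ` {j + 2..9})" using spL[of "j + 2"] by simp
  moreover have "span (e ` {j + 2..9}) \<subseteq> Tg c ` span (e ` {Suc j..8})"
  proof (rule span_minimal)
   show "subspace (Tg c ` span (e ` {Suc j..8}))" by (intro lin_subspace_image lin_Tg subspace_span)
   show "e ` {j + 2..9} \<subseteq> Tg c ` span (e ` {Suc j..8})"
   proof (rule image_subsetI)
    fix m assume m: "m \<in> {j + 2..9}"
    then have "e m = Tg c (e (m - 1))" "m - 1 \<in> {Suc j..8}" using ce(2)[of "m - 1"] by auto
    then show "e m \<in> Tg c ` span (e ` {Suc j..8})" using span_base[of "e (m - 1)" "e ` {Suc j..8}"] by blast
   qed
  qed
  ultimately obtain y where "y \<in> span (e ` {Suc j..8})" "Tg c w = Tg c y" by blast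
  then show ?thesis using that[of y] False by simp
 qed
 have yL: "y \<in> L (Suc j)"
 proof -
  have "e ` {Suc j..8} \<subseteq> L (Suc j)" using ce(1) filt_monoD[OF filtL] by fastforce
  then show ?thesis using span_minimal[OF _ subL, of "e ` {Suc j..8}"] y(1) by blast
 qed
 define w' where "w' = w - y"
 have w'L: "w' \<in> L j" unfolding w'_def
  using w(1) yL filt_monoD[OF filtL, of y "Suc j" j] by (intro subspace_diff[OF subL]) auto
 have S': "x \<in> S \<longleftrightarrow> (\<exists>a. x - a *s w' \<in> L (Suc j))" for x
 proof -
  have "x \<in> S \<longleftrightarrow> (\<exists>a. x - a *s w \<in> L (Suc j))"
   unfolding S_def span_breakdown_eq span_eq_iff[THEN iffD2, OF subL[of "Suc j"]] by (rule refl)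
  moreover have "x - a *s w \<in> L (Suc j) \<longleftrightarrow> x - a *s w' \<in> L (Suc j)" for a
  proof -
   have e: "x - a *s w' = (x - a *s w) + a *s y" "x - a *s w = (x - a *s w') - a *s y"
    by (simp_all add: w'_def algebra_simps)
   show ?thesis using subspace_add[OF subL] subspace_diff[OF subL] subspace_scale[OF subL yL, of a] e by metis
  qed
  ultimately show ?thesis by simp
 qed
 have wn': "w' \<notin> L (Suc j)" if "w' \<noteq> 0"
 proof
  assume a: "w' \<in> L (Suc j)"
  then have "w \<in> L (Suc j)" using subspace_add[OF subL a yL] by (simp add: w'_def)
  then show False using wn y(3) that by (auto simp: w'_def)
 qed
 have spj: "n \<le> j ==> x \<in> L (j - n) ==> x \<in> span (insert w' (e ` {j - n..9}))" for n x
 proof (induction n arbitrary: x)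
  case 0
  obtain a where "x - a *s e j \<in> S" using ce(4)[of x j] 0 by auto
  then obtain b where "x - a *s e j - b *s w' \<in> L (Suc j)" using S' by blast
  then have "x - a *s e j - b *s w' \<in> span (e ` {Suc j..9})" using spL[of "Suc j"] by blast
  then have "x - a *s e j \<in> span (insert w' (e ` {Suc j..9}))" using span_breakdown_eq by blast
  then show ?case using ext[of x a j w'] j by simp
 next
  case (Suc n)
  define m where "m = j - Suc n"
  have m: "j - n = Suc m" "m \<le> 9" "m \<noteq> j" using Suc.prems j by (auto simp: m_def)
  obtain a where "x - a *s e m \<in> L (Suc m)" using ce(4)[of x m] Suc.prems m unfolding m_def by auto
  then have "x - a *s e m \<in> span (insert w' (e ` {Suc m..9}))" using Suc.IH[of "x - a *s e m"] Suc.prems m by auto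
  then show ?case using ext[of x a m w'] m unfolding m_def[symmetric] by blast
 qed
 have ind: "e k \<notin> span (insert w' (e ` {Suc k..9}))" if k: "k \<le> 9" for k
 proof
  assume a: "e k \<in> span (insert w' (e ` {Suc k..9}))"
  have eE: "span (e ` {Suc k..9}) \<subseteq> L (Suc k)"
   using ce(1) filt_monoD[OF filtL] by (intro span_minimal subL) fastforce
  obtain b where b: "e k - b *s w' \<in> L (Suc k)" using a eE unfolding span_breakdown_eq by blast
  consider "k = j" | "Suc k \<le> j" | "j < k" by linarith
  then show False
  proof cases
   case 1
   then show False using b S' ce(3)[OF k] by auto
  next
   case 2
   then have "b *s w' \<in> L (Suc k)" using filt_monoD[OF filtL w'L 2] subspace_scale[OF subL] by blast
   from subspace_add[OF subL b this] show False using ce(3)[OF k] 2 by auto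
  next
   case 3
   have "b *s w' \<in> L k"
    using subspace_diff[OF subL ce(1)[of k] filt_monoD[OF filtL b, of k]] by simp
   then have bw: "b *s w' \<in> L (Suc j)" using filt_monoD[OF filtL, of _ k "Suc j"] 3 by simp
   have "b *s w' = 0"
   proof (rule ccontr)
    assume "b *s w' \<noteq> 0"
    then have "b \<noteq> 0" "w' \<noteq> 0" by auto
    with subspace_scale[OF subL bw, of "inverse b"] wn' show False by simp
   qed
   then show False using b ce(3)[OF k] 3 by auto
  qed
 qed
 have "chain scale Basis G g V \<rho> c e w' j"
 proof unfold_locales
  show "L 10 = {0}" "1 \<le> j" "j \<le> 8" by fact+
  show "e k \<in> L k" "Tg c (e k) = e (Suc k)" for k by (fact ce)+
  show "Tg c w' = 0" by (simp add: w'_def lin_diff[OF lin_Tg] y)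
  show "w' \<in> L j" by fact
  have "u2 y \<in> L (j + 2)" using u_L(2)[OF yL] by simp
  then show "u2 w' \<in> L (j + 2)" unfolding w'_def using w(3) by (simp add: lin_diff[OF lin_u] subspace_diff[OF subL])
  show "j < m ==> x \<in> L m ==> x \<in> span (e ` {m..9})" for m x using spL .
  show "m \<le> j ==> x \<in> L m ==> x \<in> span (insert w' (e ` {m..9}))" for m x
   using spj[of "j - m" x] by simp
  show "k \<le> 9 ==> e k \<notin> span (insert w' (e ` {Suc k..9}))" for k by (rule ind)
  show "w' \<noteq> 0 ==> w' \<notin> L (Suc j)" by (rule wn')
 qed
 then show ?thesis by blast
qed

end

context fvs
begin

lemma span_tail_coord:
 "x \<in> span (insert y (e ` {m..9})) ==> \<exists>a f. x = a *s y + (\<Sum>l\<in>{m..9}. f l *s e l)" for e :: "nat \<Rightarrow> 'b"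
proof (induction "10 - m" arbitrary: m x)
 case 0
 then have "{m..9} = {}" by auto
 then show ?case using 0 by (auto simp: span_singleton)
next
 case (Suc n)
 then have m: "m \<le> 9" "n = 10 - Suc m" by auto
 then have eq: "{m..9} = insert m {Suc m..9}" by auto
 have "x \<in> span (insert (e m) (insert y (e ` {Suc m..9})))"
  using Suc.prems unfolding eq by (simp add: insert_commute)
 then obtain b where "x - b *s e m \<in> span (insert y (e ` {Suc m..9}))" unfolding span_breakdown_eq by blast
 then obtain a f where af: "x - b *s e m = a *s y + (\<Sum>l\<in>{Suc m..9}. f l *s e l)"
  using Suc.hyps(1)[OF m(2)] by blast
 have "(\<Sum>l\<in>{Suc m..9}. (f(m := b)) l *s e l) = (\<Sum>l\<in>{Suc m..9}. f l *s e l)"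
  by (rule sum.cong) auto
 then have "x = a *s y + (\<Sum>l\<in>{m..9}. (f(m := b)) l *s e l)"
  using af unfolding eq by (simp add: algebra_simps)
 then show ?case by blast
qed

end

text \<open>All coordinates of \<open>u2\<close> are recorded, not only the steps
  \<open>B k (k + 1)\<close>, because finer weights make later diagonals visible.
  \<open>\<omega>\<close> is the way from the chain into \<open>w\<close>, and
  \<open>\<sigma>\<close> with its index \<open>m0\<close> is the leading term on the way
  back.\<close>

locale chainc = chain scale Basis G g V \<rho> c e w j
 for scale :: "'a::field \<Rightarrow> 'b::ab_group_add \<Rightarrow> 'b" (infixr "*s" 75) and Basis :: "'b set"
  and G :: "('g, 'm) monoid_scheme" (structure) and g :: "nat \<Rightarrow> 'g" and V \<rho> c e w j +
 fixes B :: "nat \<Rightarrow> nat \<Rightarrow> 'a" and \<omega> :: "nat \<Rightarrow> 'a" and m0 :: nat and \<sigma> :: 'a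
 assumes uB: "u2 (e k) = \<omega> k *s w + (\<Sum>l\<in>{Suc k..9}. B k l *s e l)"
  and om0: "j \<le> k ==> \<omega> k = 0"
  and m0: "j + 2 \<le> m0" "m0 \<le> 10" "w \<noteq> 0 ==> m0 \<le> 9"
  and sg: "u2 w - \<sigma> *s e m0 \<in> span (e ` {Suc m0..9})" "m0 \<le> 9 ==> \<sigma> \<noteq> 0"

context chain
begin

lemma e10: "10 \<le> k ==> e k = 0"
 using caseB(1)[OF L10 e_L] .

lemma tail_step: "m \<le> 9 ==> x \<in> span (e ` {m..9}) \<longleftrightarrow> (\<exists>a. x - a *s e m \<in> span (e ` {Suc m..9}))"
proof -
 assume "m \<le> 9"
 then have "{m..9} = insert m {Suc m..9}" by auto
 then show ?thesis using span_breakdown_eq[of x "e m" "e ` {Suc m..9}"] by simp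
qed

lemma tail_L: "span (e ` {m..9}) \<subseteq> L m"
 using e_L filt_monoD[OF filtL] by (intro span_minimal subL) fastforce

lemma w_indep: "w \<noteq> 0 ==> w \<notin> span (e ` {k..9})"
proof (induction "10 - k" arbitrary: k)
 case 0
 then have "{k..9} = {}" by auto
 then show ?case using 0 by simp
next
 case (Suc n)
 then have k: "k \<le> 9" "n = 10 - Suc k" by auto
 show ?case
 proof
  assume "w \<in> span (e ` {k..9})"
  then obtain a where a: "w - a *s e k \<in> span (e ` {Suc k..9})" using tail_step[OF k(1)] by blast
  have "a = 0"
  proof (rule ccontr)
   assume a0: "a \<noteq> 0"
   have "w - a *s e k \<in> span (insert w (e ` {Suc k..9}))" using a span_mono[of "e ` {Suc k..9}" "insert w (e ` {Suc k..9})"] by blast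
   from span_scale[OF span_diff[OF span_base[of w] this], of "inverse a"]
   show False using ind[OF k(1)] a0 by simp
  qed
  then show False using Suc.hyps(1)[OF k(2) Suc.prems] a by simp
 qed
qed

lemma Z_e0: "Z (e 0) \<noteq> 0"
proof
 assume z: "Z (e 0) = 0"
 have eq: "insert w (e ` {0..9}) = insert (e 0) (insert w (e ` {1..9}))"
 proof -
  have "{0..9::nat} = insert 0 {1..9}" by auto
  then show ?thesis by auto
 qed
 have "insert w (e ` {1..9}) \<subseteq> L 1" using wL e_L filt_monoD[OF filtL] j by fastforce
 then have s: "span (insert w (e ` {1..9})) \<subseteq> L 1" by (intro span_minimal subL)
 obtain v where v: "v \<in> V" "Z v \<noteq> 0" using Znz by blast
 have "v \<in> span (insert w (e ` {0..9}))" using spj[of 0 v] v j by simp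
 then obtain a where "v - a *s e 0 \<in> L 1" 
  using s unfolding eq span_breakdown_eq[of v "e 0" "insert w (e ` {1..9})"] by blast
 then have "Z (v - a *s e 0) = 0" using Z_L1 by (simp add: One_nat_def)
 then show False using v z by (simp add: lin_diff[OF lin_u] lin_scale[OF lin_u])
qed

lemma coords: "\<exists>B \<omega> m0 \<sigma>. chainc scale Basis G g V \<rho> c e w j B \<omega> m0 \<sigma>"
proof -
 have "\<exists>a f. u2 (e k) = a *s w + (\<Sum>l\<in>{Suc k..9}. f l *s e l) \<and> (j \<le> k \<longrightarrow> a = 0)" for k
 proof (cases "j \<le> k")
  case True
  then have "u2 (e k) \<in> span (e ` {Suc k..9})" using spL[of "Suc k"] u_L(2)[OF e_L] by simp
  then have "u2 (e k) \<in> span (insert 0 (e ` {Suc k..9}))" by simp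
  then obtain a f where "u2 (e k) = a *s 0 + (\<Sum>l\<in>{Suc k..9}. f l *s e l)" using span_tail_coord by blast
  then show ?thesis by (intro exI[of _ 0] exI[of _ f]) simp
 next
  case False
  then have "u2 (e k) \<in> span (insert w (e ` {Suc k..9}))" using spj[of "Suc k"] u_L(2)[OF e_L] by simp
  then show ?thesis using span_tail_coord False by blast
 qed
 then obtain \<omega> B where B: "\<And>k. u2 (e k) = \<omega> k *s w + (\<Sum>l\<in>{Suc k..9}. B k l *s e l)" "\<And>k. j \<le> k ==> \<omega> k = 0"
  by metis
 define M where "M = {m. m \<le> 10 \<and> u2 w \<in> span (e ` {m..9})}"
 have fM: "finite M" unfolding M_def by simp
 have jM: "j + 2 \<in> M" unfolding M_def using spL[of "j + 2"] uw j by simp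
 define m0 where "m0 = Max M"
 have m0M: "m0 \<in> M" unfolding m0_def using fM jM by (intro Max_in) auto
 have m0ge: "m \<le> m0" if "m \<in> M" for m unfolding m0_def using fM that by (rule Max_ge)
 have le: "m0 \<le> 10" "u2 w \<in> span (e ` {m0..9})" using m0M by (auto simp: M_def)
 obtain s where s: "u2 w - s *s e m0 \<in> span (e ` {Suc m0..9})"
 proof (cases "m0 \<le> 9")
  case True
  then show ?thesis using tail_step le that by blast
 next
  case False
  then have "{m0..9} = {}" "{Suc m0..9} = {}" by auto
  then show ?thesis using le(2) that[of 0] by simp
 qed
 have s0: "s \<noteq> 0" if "m0 \<le> 9"
 proof
  assume "s = 0"
  then have "Suc m0 \<in> M" using s that by (simp add: M_def)
  then show False using m0ge by fastforce
 qed
 \<comment> \<open>If \<open>u2 w = 0\<close>, then \<open>w\<close> is fixed, so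
   \<open>Z (e 0)\<close> is a non-zero multiple of \<open>w\<close> lying in \<open>L 9\<close>,
   which contradicts \<open>wn\<close>.\<close>
 have wm: "m0 \<le> 9" if w0: "w \<noteq> 0"
 proof (rule ccontr)
  assume "\<not> m0 \<le> 9"
  then have "{m0..9} = {}" by auto
  then have "u2 w = 0" using le(2) by simp
  moreover have "u1 w = 0" using Tw calculation by (simp add: Tg_def)
  ultimately obtain a where a: "Z (e 0) = a *s w" using fixed[of w "e 0"] w0 wL e_L[of 0] L_V by auto
  then have "a \<noteq> 0" using Z_e0 by auto
  have "a *s w \<in> L (Suc j)" using Z_v[of "e 0"] e_L[of 0] a filt_monoD[OF filtL, of "a *s w" 9 "Suc j"] j by simp
  from subspace_scale[OF subL this, of "inverse a"] wn[OF w0] \<open>a \<noteq> 0\<close> show False by simp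
 qed
 have "chainc scale Basis G g V \<rho> c e w j B \<omega> m0 s"
  by unfold_locales (use B m0ge[OF jM] le s s0 wm in auto)
 then show ?thesis by blast
qed

end

section \<open>Weighted filtrations of a chain\<close>

context chainc
begin

text \<open>Otherwise layer \<open>j - 1\<close> would generate only chain vectors, and
  \<open>L j\<close> would not contain \<open>w\<close>.\<close>

lemma omj: "w \<noteq> 0 ==> \<omega> (j - 1) \<noteq> 0"
proof
 assume w0: "w \<noteq> 0" and z: "\<omega> (j - 1) = 0"
 define k where "k = j - 1"
 have k: "Suc k = j" "k \<le> 9" using j by (auto simp: k_def)
 let ?S = "span (e ` {j..9})"
 have eS: "e l \<in> ?S" if "j \<le> l" for l
 proof (cases "l \<le> 9")
  case True
  then show ?thesis using that by (intro span_base) auto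
 next
  case False
  then show ?thesis using e10[of l] span_zero by simp
 qed
 have 2: "u2 (e k) \<in> ?S"
  unfolding uB using z eS k by (auto simp: k_def intro!: span_sum span_scale)
 have "u1 (e k) = e (Suc k) - c *s u2 (e k)" unfolding Te[symmetric] by (simp add: Tg_def)
 then have 1: "u1 (e k) \<in> ?S" using 2 eS k by (auto intro!: span_diff span_scale)
 have "L (Suc k) \<subseteq> ?S"
 proof (rule layer_next[OF subspace_span])
  show "L (k + 2) \<subseteq> ?S"
   using spL[of "k + 2"] k span_mono[of "e ` {k + 2..9}" "e ` {j..9}"] by fastforce
  fix y assume "y \<in> L k"
  then have "y \<in> span (insert w (e ` {k..9}))" using spj[of k y] k by simp
  moreover have "insert w (e ` {k..9}) = insert (e k) (insert w (e ` {j..9}))"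
  proof -
   have "{k..9} = insert k {j..9}" using k by auto
   then show ?thesis by auto
  qed
  ultimately have "y \<in> span (insert (e k) (insert w (e ` {j..9})))" by (simp only:)
  then obtain a where a: "y - a *s e k \<in> span (insert w (e ` {j..9}))"
   unfolding span_breakdown_eq[of y "e k" "insert w (e ` {j..9})"] by blast
  moreover have "span (insert w (e ` {j..9})) \<subseteq> L j"
   using wL tail_L[of j] span_superset[of "e ` {j..9}"] by (intro span_minimal subL) auto
  ultimately show "\<exists>y'. u1 y' \<in> ?S \<and> u2 y' \<in> ?S \<and> y - y' \<in> L (Suc k)"
   using 1 2 k by (intro exI[of _ "a *s e k"]) (auto simp: lin_scale[OF lin_u] intro!: span_scale)
 qed
 then show False using wL k w_indep[OF w0] by auto
qed

text \<open>\<open>\<kappa> n\<close> is the first chain index of degree at least \<open>n\<close>,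
  so \<open>\<kappa>\<close> encodes how the chain vectors are spread over the degrees;
  \<open>d\<close> is the degree assigned to \<open>w\<close>.\<close>

definition FF :: "(nat \<Rightarrow> nat) \<Rightarrow> nat \<Rightarrow> nat \<Rightarrow> 'b set" where
 "FF \<kappa> d n = span (e ` {\<kappa> n..9} \<union> (if n \<le> d then {w} else {}))"

text \<open>Exactly what makes \<open>Tg c\<close> raise by \<open>a\<close> and \<open>u2\<close>
  by \<open>b\<close>; the two clauses on \<open>w\<close> bound the ways into \<open>w\<close> and
  out of it.\<close>

definition adms :: "(nat \<Rightarrow> nat) \<Rightarrow> nat \<Rightarrow> nat \<Rightarrow> nat \<Rightarrow> bool" where
 "adms \<kappa> d a b \<longleftrightarrow> (\<forall>n. \<kappa> n \<le> \<kappa> (Suc n)) \<and> (\<forall>n. \<kappa> n \<le> 10) \<and> (\<forall>n. \<kappa> (n + a) \<le> Suc (\<kappa> n)) \<and>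
  1 \<le> a \<and> a \<le> b \<and>
  (\<forall>n k l. \<kappa> n \<le> k \<longrightarrow> k < l \<longrightarrow> l < \<kappa> (n + b) \<longrightarrow> B k l = 0) \<and>
  (w \<noteq> 0 \<longrightarrow> (\<forall>n k. \<kappa> n \<le> k \<longrightarrow> \<omega> k \<noteq> 0 \<longrightarrow> n + b \<le> d) \<and> (\<forall>n\<le>d. \<kappa> (n + b) \<le> m0))"

lemma FF_e: "\<kappa> n \<le> l ==> e l \<in> FF \<kappa> d n"
proof (cases "l \<le> 9")
 case True
 assume "\<kappa> n \<le> l"
 with True show ?thesis unfolding FF_def by (intro span_base) auto
qed (use e10 in \<open>simp add: FF_def span_zero\<close>)

lemma FF_w: "n \<le> d ==> w \<in> FF \<kappa> d n"
 unfolding FF_def by (intro span_base) auto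

lemma FF_sub: "subspace (FF \<kappa> d n)"
 unfolding FF_def by simp

lemma FF_tail: "\<kappa> n \<le> m ==> x \<in> span (e ` {m..9}) ==> x \<in> FF \<kappa> d n"
 unfolding FF_def using span_mono[of "e ` {m..9}" "e ` {\<kappa> n..9} \<union> (if n \<le> d then {w} else {})"] by fastforce

lemma FF_filt:
 assumes "adms \<kappa> d a b" shows "filt (FF \<kappa> d)"
proof -
 have k: "\<kappa> n \<le> \<kappa> (Suc n)" for n using assms by (simp add: adms_def)
 have "FF \<kappa> d (Suc n) \<subseteq> FF \<kappa> d n" for n
  unfolding FF_def[of \<kappa> d "Suc n"]
 proof (rule span_minimal[OF _ FF_sub])
  show "e ` {\<kappa> (Suc n)..9} \<union> (if Suc n \<le> d then {w} else {}) \<subseteq> FF \<kappa> d n"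
   using FF_e FF_w k[of n] by auto
 qed
 then show ?thesis using FF_sub by (simp add: filt_def)
qed

lemma FF_raises:
 assumes "adms \<kappa> d a b"
 shows "raises (FF \<kappa> d) a (Tg c)" "raises (FF \<kappa> d) b u2" "raises (FF \<kappa> d) a u1"
proof -
 have kk: "\<kappa> (n + a) \<le> Suc (\<kappa> n)" "a \<le> b" "1 \<le> a" for n using assms by (auto simp: adms_def)
 have kB: "B k l = 0" if "\<kappa> n \<le> k" "k < l" "l < \<kappa> (n + b)" for n k l using assms that by (auto simp: adms_def)
 have ko: "w \<noteq> 0 ==> \<kappa> n \<le> k ==> \<omega> k \<noteq> 0 ==> n + b \<le> d" "w \<noteq> 0 ==> n \<le> d ==> \<kappa> (n + b) \<le> m0" for n k
  using assms by (auto simp: adms_def)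
 show T: "raises (FF \<kappa> d) a (Tg c)" unfolding raises_def
 proof (intro allI ballI)
  fix n x assume "x \<in> FF \<kappa> d n"
  then show "Tg c x \<in> FF \<kappa> d (n + a)" unfolding FF_def[of \<kappa> d n]
  proof (rule lin_span_into[OF lin_Tg FF_sub, rotated])
   fix y assume "y \<in> e ` {\<kappa> n..9} \<union> (if n \<le> d then {w} else {})"
   then consider l where "y = e l" "\<kappa> n \<le> l" | "y = w" by (auto split: if_splits)
   then show "Tg c y \<in> FF \<kappa> d (n + a)"
   proof cases
    case 1
    then show ?thesis using kk(1)[of n] by (auto simp: Te intro!: FF_e)
   qed (use Tw subspace_0[OF FF_sub] in simp)
  qed
 qed
 show u: "raises (FF \<kappa> d) b u2" unfolding raises_def
 proof (intro allI ballI)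
  fix n x assume "x \<in> FF \<kappa> d n"
  then show "u2 x \<in> FF \<kappa> d (n + b)" unfolding FF_def[of \<kappa> d n]
  proof (rule lin_span_into[OF lin_u FF_sub, rotated])
   fix y assume "y \<in> e ` {\<kappa> n..9} \<union> (if n \<le> d then {w} else {})"
   then consider l where "y = e l" "\<kappa> n \<le> l" | "y = w" "n \<le> d" by (auto split: if_splits)
   then show "u2 y \<in> FF \<kappa> d (n + b)"
   proof cases
    case (1 k)
    have "\<omega> k *s w \<in> FF \<kappa> d (n + b)"
     using ko(1)[of n k] 1 FF_w subspace_0[OF FF_sub] subspace_scale[OF FF_sub]
     by (cases "\<omega> k = 0 \<or> w = 0") auto
    moreover have "(\<Sum>l\<in>{Suc k..9}. B k l *s e l) \<in> FF \<kappa> d (n + b)"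
    proof (rule subspace_sum[OF FF_sub])
     fix l assume "l \<in> {Suc k..9}"
     then show "B k l *s e l \<in> FF \<kappa> d (n + b)"
      using kB[of n k l] 1 FF_e[of \<kappa> "n + b" l d] subspace_scale[OF FF_sub] subspace_0[OF FF_sub]
      by (cases "\<kappa> (n + b) \<le> l") auto
    qed
    ultimately show ?thesis unfolding 1 uB by (rule subspace_add[OF FF_sub])
   next
    case 2
    show ?thesis
    proof (cases "w = 0")
     case True
     then show ?thesis using 2 lin_0[OF lin_u] subspace_0[OF FF_sub] by simp
    next
     case False
     have 1: "u2 w - \<sigma> *s e m0 \<in> FF \<kappa> d (n + b)" using FF_tail[OF _ sg(1), of \<kappa> "n + b"] ko(2)[OF False 2(2)] by simp
     from subspace_add[OF FF_sub 1 subspace_scale[OF FF_sub FF_e, of \<kappa> "n + b" m0 \<sigma>]] ko(2)[OF False 2(2)] 2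
     show ?thesis by simp
    qed
   qed
  qed
 qed
 have "u1 = (\<lambda>v. Tg c v - c *s u2 v)" by (simp add: Tg_def fun_eq_iff)
 then show "raises (FF \<kappa> d) a u1"
  using raises_diff[OF FF_filt[OF assms] T raises_scale[OF FF_filt[OF assms] raises_mono[OF FF_filt[OF assms] u kk(2)]]] by simp
qed

lemma FF_adm: "adms \<kappa> d a b ==> prep_adm scale Basis G g V \<rho> (FF \<kappa> d) a b"
proof (rule adm)
 assume a: "adms \<kappa> d a b"
 show "filt (FF \<kappa> d)" "raises (FF \<kappa> d) a u1" "raises (FF \<kappa> d) b u2" "1 \<le> a" "a \<le> b"
  using FF_filt[OF a] FF_raises[OF a] a by (auto simp: adms_def)
 have "e ` {\<kappa> 0..9} \<union> (if 0 \<le> d then {w} else {}) \<subseteq> V" using e_L wL L_V by auto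
 then show "FF \<kappa> d 0 \<subseteq> V" unfolding FF_def by (rule span_minimal[OF _ isrep_sub[OF rep]])
qed

text \<open>Degree \<open>n\<close> is occupied when \<open>\<kappa>\<close> jumps after
  \<open>n\<close>. Empty degrees get the vector 0, so that symbols can be indexed by all
  degrees.\<close>

definition Ef :: "(nat \<Rightarrow> nat) \<Rightarrow> nat \<Rightarrow> 'b" where
 "Ef \<kappa> n = (if \<kappa> n < \<kappa> (Suc n) then e (\<kappa> n) else 0)"

definition Wf :: "nat \<Rightarrow> nat \<Rightarrow> 'b" where
 "Wf d n = (if n = d then w else 0)"

definition tf :: "(nat \<Rightarrow> nat) \<Rightarrow> nat \<Rightarrow> nat \<Rightarrow> 'a" where
 "tf \<kappa> a n = (if \<kappa> n < \<kappa> (Suc n) \<and> \<kappa> (n + a) = Suc (\<kappa> n) \<and> \<kappa> (n + a) < \<kappa> (Suc (n + a)) then 1 else 0)"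

definition yf :: "(nat \<Rightarrow> nat) \<Rightarrow> nat \<Rightarrow> nat \<Rightarrow> 'a" where
 "yf \<kappa> b n = (if \<kappa> n < \<kappa> (Suc n) \<and> \<kappa> n < \<kappa> (n + b) \<and> \<kappa> (n + b) < \<kappa> (Suc (n + b)) then B (\<kappa> n) (\<kappa> (n + b)) else 0)"

definition omf :: "(nat \<Rightarrow> nat) \<Rightarrow> nat \<Rightarrow> nat \<Rightarrow> nat \<Rightarrow> 'a" where
 "omf \<kappa> d b n = (if \<kappa> n < \<kappa> (Suc n) \<and> n + b = d then \<omega> (\<kappa> n) else 0)"

definition sgf :: "(nat \<Rightarrow> nat) \<Rightarrow> nat \<Rightarrow> nat \<Rightarrow> nat \<Rightarrow> 'a" where
 "sgf \<kappa> d b n = (if n = d \<and> w \<noteq> 0 \<and> \<kappa> (n + b) = m0 \<and> m0 < \<kappa> (Suc (n + b)) then \<sigma> else 0)"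

abbreviation "TT \<kappa> a \<equiv> \<lambda>n (st :: 'a \<times> 'a). (tf \<kappa> a n * fst st + 0 * snd st, 0 * fst st + 0 * snd st)"
abbreviation "UU \<kappa> d b \<equiv> \<lambda>n (st :: 'a \<times> 'a). (yf \<kappa> b n * fst st + sgf \<kappa> d b n * snd st, omf \<kappa> d b n * fst st + 0 * snd st)"

lemma sum_tail: "(\<And>l. l \<in> A ==> f l \<noteq> 0 ==> \<kappa> n \<le> l) ==> (\<Sum>l\<in>A. f l *s e l) \<in> FF \<kappa> d n"
proof (rule subspace_sum[OF FF_sub])
 fix l assume "\<And>l. l \<in> A ==> f l \<noteq> 0 ==> \<kappa> n \<le> l" "l \<in> A"
 then show "f l *s e l \<in> FF \<kappa> d n"
  using FF_e[of \<kappa> n l d] subspace_scale[OF FF_sub] subspace_0[OF FF_sub] by (cases "f l = 0") auto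
qed

lemma sym_TT:
 assumes "adms \<kappa> d a b"
 shows "sym (\<lambda>n. FF \<kappa> d (n + 1)) (pf (Ef \<kappa>) (Wf d)) a (Tg c) (TT \<kappa> a)"
proof (rule sym2I[OF lin_Tg FF_filt[OF assms] FF_raises(1)[OF assms]])
 have kk: "\<kappa> (n + a) \<le> Suc (\<kappa> n)" "\<kappa> n \<le> \<kappa> (Suc n)" for n using assms by (auto simp: adms_def)
 show "Tg c (Ef \<kappa> n) - (tf \<kappa> a n *s Ef \<kappa> (n + a) + 0 *s Wf d (n + a)) \<in> FF \<kappa> d (n + a + 1)" for n
 proof (cases "\<kappa> n < \<kappa> (Suc n)")
  case False
  then show ?thesis using lin_0[OF lin_Tg] subspace_0[OF FF_sub] by (simp add: Ef_def tf_def)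
 next
  case True
  show ?thesis
  proof (cases "\<kappa> (Suc (n + a)) \<le> Suc (\<kappa> n)")
   case True
   then have "tf \<kappa> a n = 0" using kk by (auto simp: tf_def)
   then show ?thesis using \<open>\<kappa> n < _\<close> True by (simp add: Ef_def Te FF_e One_nat_def)
  next
   case False
   show ?thesis
   proof (cases "\<kappa> (n + a) = Suc (\<kappa> n)")
    case True
    then have "tf \<kappa> a n = 1" "Ef \<kappa> (n + a) = e (Suc (\<kappa> n))" using \<open>\<kappa> n < _\<close> False by (auto simp: tf_def Ef_def)
    then show ?thesis using \<open>\<kappa> n < _\<close> subspace_0[OF FF_sub] by (simp add: Ef_def[of \<kappa> n] Te)
   next
    case F2: False
    have "1 \<le> a" using assms by (simp add: adms_def)
    then have "\<kappa> (Suc (n + a)) \<le> Suc (\<kappa> (Suc n))" using kk(1)[of "Suc n"] by simp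
    have "\<kappa> (Suc n) \<le> \<kappa> (n + a)" using lift_Suc_mono_le[of \<kappa> "Suc n" "n + a"] kk(2) \<open>1 \<le> a\<close> by simp
    then have "\<kappa> (n + a) = Suc (\<kappa> n)" using kk(1)[of n] \<open>\<kappa> n < _\<close> by linarith
    then show ?thesis using F2 by simp
   qed
  qed
 qed
 show "Tg c (Wf d n) - (0 *s Ef \<kappa> (n + a) + 0 *s Wf d (n + a)) \<in> FF \<kappa> d (n + a + 1)" for n
  using Tw lin_0[OF lin_Tg] subspace_0[OF FF_sub] by (simp add: Wf_def)
qed

lemma sym_UU:
 assumes "adms \<kappa> d a b"
 shows "sym (\<lambda>n. FF \<kappa> d (n + 1)) (pf (Ef \<kappa>) (Wf d)) b u2 (UU \<kappa> d b)"
proof (rule sym2I[OF lin_u FF_filt[OF assms] FF_raises(2)[OF assms]])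
 have kk: "\<kappa> n \<le> \<kappa> (Suc n)" "\<kappa> n \<le> 10" "1 \<le> b" for n using assms by (auto simp: adms_def)
 have kB: "B k l = 0" if "\<kappa> n \<le> k" "k < l" "l < \<kappa> (n + b)" for n k l using assms that by (auto simp: adms_def)
 have ko: "w \<noteq> 0 ==> \<kappa> n \<le> k ==> \<omega> k \<noteq> 0 ==> n + b \<le> d" "w \<noteq> 0 ==> n \<le> d ==> \<kappa> (n + b) \<le> m0" for n k
  using assms by (auto simp: adms_def)
 have step: "\<kappa> (Suc n) \<le> Suc (\<kappa> n)" for n
 proof -
  have "\<kappa> (Suc n) \<le> \<kappa> (n + a)" using lift_Suc_mono_le[of \<kappa> "Suc n" "n + a"] kk(1) assms by (simp add: adms_def)
  also have "\<dots> \<le> Suc (\<kappa> n)" using assms by (simp add: adms_def)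
  finally show ?thesis .
 qed
 show "u2 (Ef \<kappa> n) - (yf \<kappa> b n *s Ef \<kappa> (n + b) + omf \<kappa> d b n *s Wf d (n + b)) \<in> FF \<kappa> d (n + b + 1)" for n
 proof (cases "\<kappa> n < \<kappa> (Suc n)")
  case False
  then show ?thesis using lin_0[OF lin_u] subspace_0[OF FF_sub] by (simp add: Ef_def yf_def omf_def)
 next
  case True
  define k l0 where "k = \<kappa> n" and "l0 = \<kappa> (n + b)"
  have kl: "k < l0" using True lift_Suc_mono_le[of \<kappa> "Suc n" "n + b"] kk by (simp add: k_def l0_def)
  have 1: "\<omega> k *s w - omf \<kappa> d b n *s Wf d (n + b) \<in> FF \<kappa> d (n + b + 1)"
   using ko(1)[of n k] True FF_w[of "n + b + 1" d \<kappa>] subspace_0[OF FF_sub] subspace_scale[OF FF_sub]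
   by (cases "w = 0 \<or> \<omega> k = 0"; cases "n + b = d") (auto simp: omf_def Wf_def k_def)
  have 2: "(\<Sum>l\<in>{Suc k..9}. B k l *s e l) - yf \<kappa> b n *s Ef \<kappa> (n + b) \<in> FF \<kappa> d (n + b + 1)"
  proof (cases "l0 < \<kappa> (Suc (n + b))")
   case D: True
   have l09: "l0 \<le> 9" using D kk(2)[of "Suc (n + b)"] by simp
   then have "(\<Sum>l\<in>{Suc k..9}. B k l *s e l) = B k l0 *s e l0 + (\<Sum>l\<in>{Suc k..9} - {l0}. B k l *s e l)"
    using kl by (intro sum.remove) auto
   moreover have "yf \<kappa> b n *s Ef \<kappa> (n + b) = B k l0 *s e l0"
    using True D kl by (auto simp: yf_def Ef_def k_def l0_def)
   moreover have "(\<Sum>l\<in>{Suc k..9} - {l0}. B k l *s e l) \<in> FF \<kappa> d (n + b + 1)"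
   proof (rule sum_tail)
    fix l assume l: "l \<in> {Suc k..9} - {l0}" "B k l \<noteq> 0"
    have "\<not> l < l0" using kB[of n k l] l by (auto simp: k_def l0_def)
    then have "Suc l0 \<le> l" using l by auto
    then show "\<kappa> (n + b + 1) \<le> l" using step[of "n + b"] by (simp add: l0_def One_nat_def)
   qed
   ultimately show ?thesis by simp
  next
   case D: False
   then have e: "\<kappa> (Suc (n + b)) = l0" using kk(1)[of "n + b"] by (simp add: l0_def)
   have "(\<Sum>l\<in>{Suc k..9}. B k l *s e l) \<in> FF \<kappa> d (n + b + 1)"
   proof (rule sum_tail)
    fix l assume l: "l \<in> {Suc k..9}" "B k l \<noteq> 0"
    have "\<not> l < l0" using kB[of n k l] l by (auto simp: k_def l0_def)
    then show "\<kappa> (n + b + 1) \<le> l" using e by (simp add: One_nat_def)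
   qed
   then show ?thesis using D by (simp add: Ef_def l0_def)
  qed
  have "u2 (Ef \<kappa> n) = \<omega> k *s w + (\<Sum>l\<in>{Suc k..9}. B k l *s e l)" using True uB[of k] by (simp add: Ef_def k_def)
  then have "u2 (Ef \<kappa> n) - (yf \<kappa> b n *s Ef \<kappa> (n + b) + omf \<kappa> d b n *s Wf d (n + b))
   = (\<omega> k *s w - omf \<kappa> d b n *s Wf d (n + b)) + ((\<Sum>l\<in>{Suc k..9}. B k l *s e l) - yf \<kappa> b n *s Ef \<kappa> (n + b))"
   by (simp add: algebra_simps)
  then show ?thesis using subspace_add[OF FF_sub 1 2] by (simp only:)
 qed
 show "u2 (Wf d n) - (sgf \<kappa> d b n *s Ef \<kappa> (n + b) + 0 *s Wf d (n + b)) \<in> FF \<kappa> d (n + b + 1)" for n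
 proof (cases "n = d \<and> w \<noteq> 0")
  case False
  then show ?thesis using lin_0[OF lin_u] subspace_0[OF FF_sub] by (auto simp: Wf_def sgf_def)
 next
  case True
  then have le: "\<kappa> (n + b) \<le> m0" and m9: "m0 \<le> 9" using ko(2) m0(3) by auto
  show ?thesis
  proof (cases "\<kappa> (Suc (n + b)) \<le> m0")
   case K: True
   have 1: "u2 w - \<sigma> *s e m0 \<in> FF \<kappa> d (n + b + 1)"
    using FF_tail[OF _ sg(1), of \<kappa> "n + b + 1"] K by (simp add: One_nat_def)
   from subspace_add[OF FF_sub 1 subspace_scale[OF FF_sub FF_e, of \<kappa> "n + b + 1" m0 \<sigma>]] K True
   show ?thesis by (simp add: Wf_def sgf_def One_nat_def)
  next
   case K: False
   then have e: "\<kappa> (n + b) = m0" "\<kappa> (Suc (n + b)) = Suc m0" using le step[of "n + b"] by auto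
   have "u2 w - \<sigma> *s e m0 \<in> FF \<kappa> d (n + b + 1)"
    using FF_tail[OF _ sg(1), of \<kappa> "n + b + 1"] e by (simp add: One_nat_def)
   then show ?thesis using True K e by (simp add: Wf_def sgf_def Ef_def)
  qed
 qed
qed

lemma pf_FF: "pf (Ef \<kappa>) (Wf d) n st \<in> FF \<kappa> d n"
proof -
 have "Ef \<kappa> n \<in> FF \<kappa> d n" "Wf d n \<in> FF \<kappa> d n"
  using FF_e FF_w subspace_0[OF FF_sub] by (auto simp: Ef_def Wf_def)
 then show ?thesis unfolding pf_def by (intro subspace_add[OF FF_sub] subspace_scale[OF FF_sub])
qed

text \<open>By the independence built into the chain, a congruence between vectors becomes an
  equation between scalars.\<close>

lemma pf_zero:
 assumes a: "adms \<kappa> d a b" and p: "pf (Ef \<kappa>) (Wf d) n st \<in> FF \<kappa> d (n + 1)"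
 shows "\<kappa> n < \<kappa> (Suc n) ==> fst st = 0" and "n = d ==> w \<noteq> 0 ==> snd st = 0"
proof -
 have step: "\<kappa> n \<le> 10" for n using a by (auto simp: adms_def)
 have sub: "FF \<kappa> d (n + 1) \<subseteq> span (insert w (e ` {\<kappa> (Suc n)..9}))"
  unfolding FF_def by (rule span_mono) (auto simp: One_nat_def)
 show f: "fst st = 0" if k: "\<kappa> n < \<kappa> (Suc n)"
 proof (rule ccontr)
  assume s: "fst st \<noteq> 0"
  have k9: "\<kappa> n \<le> 9" using k step[of "Suc n"] by simp
  let ?S = "span (insert w (e ` {Suc (\<kappa> n)..9}))"
  have "span (insert w (e ` {\<kappa> (Suc n)..9})) \<subseteq> ?S" using k by (intro span_mono) auto
  then have 1: "pf (Ef \<kappa>) (Wf d) n st \<in> ?S" using p sub by blast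
  have "snd st *s Wf d n \<in> ?S" using span_base[of w "insert w (e ` {Suc (\<kappa> n)..9})"] span_zero
   by (auto simp: Wf_def intro!: span_scale)
  from span_scale[OF span_diff[OF 1 this], of "inverse (fst st)"]
  have "e (\<kappa> n) \<in> ?S" using s k by (simp add: pf_def Ef_def)
  then show False using ind[OF k9] by simp
 qed
 assume n: "n = d" "w \<noteq> 0"
 show "snd st = 0"
 proof (rule ccontr)
  assume s: "snd st \<noteq> 0"
  have z0: "fst st *s Ef \<kappa> n = 0" using f by (cases "\<kappa> n < \<kappa> (Suc n)") (auto simp: Ef_def)
  have "fst st *s Ef \<kappa> n + snd st *s w \<in> FF \<kappa> d (n + 1)" using p n by (simp add: pf_def Wf_def)
  then have "snd st *s w \<in> FF \<kappa> d (n + 1)" by (simp only: z0 add_0_left)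
  from subspace_scale[OF FF_sub this, of "inverse (snd st)"]
  have "w \<in> span (e ` {\<kappa> (Suc n)..9})" using s n by (simp add: FF_def One_nat_def)
  then show False using w_indep[OF n(2)] by blast
 qed
qed

abbreviation "SX \<kappa> d a b n \<equiv> sadp a b (TT \<kappa> a) (UU \<kappa> d b) n"
abbreviation "Xo n \<equiv> adp (Tg c) u2 n"

lemma sym_SX: "adms \<kappa> d a b ==> sym (\<lambda>n. FF \<kappa> d (n + 1)) (pf (Ef \<kappa>) (Wf d)) (n * a + b) (Xo n) (SX \<kappa> d a b n)"
 by (rule sym_adp[OF phi_add_pf sym_TT sym_UU])

lemma rel0:
 assumes a: "adms \<kappa> d a b" and r: "raises (FF \<kappa> d) N' (cm (Xo n) (Xo m))"
  and N: "N = (n * a + b) + (m * a + b)" "N' = N + 1"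
 shows "pf (Ef \<kappa>) (Wf d) (k + N) (SX \<kappa> d a b n (k + (m * a + b)) (SX \<kappa> d a b m k st)
   - SX \<kappa> d a b m (k + (n * a + b)) (SX \<kappa> d a b n k st)) \<in> FF \<kappa> d (k + N + 1)"
 using sym_vanish[OF sym_cm[OF phi_add_pf sym_SX[OF a] sym_SX[OF a]] FF_filt[OF a], of n m k st] r pf_FF
 unfolding N by simp

lemma pf_minus: "pf E W n st - dd *s pf E W n st' = pf E W n (fst st - dd * fst st', snd st - dd * snd st')"
 by (simp add: pf_def algebra_simps)

lemma relD:
 assumes a: "adms \<kappa> d a b" and r: "raises (FF \<kappa> d) N' (\<lambda>v. cm (Xo n) (Xo m) v - dd *s Xo q v)"
  and N: "N = (n * a + b) + (m * a + b)" "N = q * a + b" "N' = N + 1"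
  and st': "st' = SX \<kappa> d a b n (k + (m * a + b)) (SX \<kappa> d a b m k st)
   - SX \<kappa> d a b m (k + (n * a + b)) (SX \<kappa> d a b n k st)"
 shows "pf (Ef \<kappa>) (Wf d) (k + N) (fst st' - dd * fst (SX \<kappa> d a b q k st), snd st' - dd * snd (SX \<kappa> d a b q k st))
  \<in> FF \<kappa> d (k + N + 1)"
 using sym_vanish2[OF sym_cm[OF phi_add_pf sym_SX[OF a] sym_SX[OF a], of n m, folded N(1)]
   sym_SX[OF a, of q, folded N(2)] FF_filt[OF a], of dd k st] r pf_FF
 unfolding pf_minus N(3) st' by simp

end

section \<open>Tables of weights and the possible supports of \<open>g 2\<close>\<close>

definition k11 :: "nat \<Rightarrow> nat" where "k11 n = min n 10"
text \<open>Weights (1,2), support (0,8): the vectors \<open>e 0\<close>, ..., \<open>e 9\<close>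
  get the degrees 0, 2, 3, ..., 9, 11. The two steps on which \<open>u2\<close> is non-zero have
  length 2, the others length 1.\<close>

definition ka :: "nat \<Rightarrow> nat" where
 "ka n = (if n = 0 then 0 else if n \<le> 2 then 1 else if n \<le> 9 then n - 1 else if n \<le> 11 then 9 else 10)"
text \<open>Weights (1,2), support (0,7): degrees 0, 2, 3, ..., 8, 10, 11.\<close>

definition kb :: "nat \<Rightarrow> nat" where
 "kb n = (if n = 0 then 0 else if n \<le> 2 then 1 else if n \<le> 8 then n - 1 else if n \<le> 10 then 8 else if n \<le> 11 then 9 else 10)"
text \<open>Weights (1,2), support (1,8): degrees 0, 1, 3, 4, ..., 9, 11.\<close>

definition kc :: "nat \<Rightarrow> nat" where
 "kc n = (if n \<le> 1 then n else if n \<le> 3 then 2 else if n \<le> 9 then n - 1 else if n \<le> 11 then 9 else 10)"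
text \<open>Weights (2,3): degrees 0, 3, 5, 7, ..., 17, 20. The first and the last step have the
  length 3 of \<open>u2\<close>, and the total 20 is the weight of \<open>g 10\<close>.\<close>

definition kd :: "nat \<Rightarrow> nat" where
 "kd n = (if n = 0 then 0 else if n \<le> 3 then 1 else if n \<le> 17 then n div 2 else if n \<le> 20 then 9 else 10)"

context chainc
begin

definition bb :: "nat \<Rightarrow> 'a" where "bb k = (if k \<le> 8 then B k (Suc k) else 0)"

lemma adms11: "(w \<noteq> 0 ==> j \<le> d \<and> d + 1 \<le> m0) ==> adms k11 d 1 1"
proof -
 assume d: "w \<noteq> 0 ==> j \<le> d \<and> d + 1 \<le> m0"
 have "n + 1 \<le> d" if "w \<noteq> 0" "min n 10 \<le> k" "\<omega> k \<noteq> 0" for n k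
 proof -
  have "k < j" using om0[of k] that by (meson not_le)
  then show ?thesis using d that j by auto
 qed
 then show ?thesis using d unfolding adms_def k11_def by auto
qed

text \<open>Because \<open>Tg c w = 0\<close>, the part ending in \<open>w\<close> comes only from
  \<open>u2\<close> applied after all \<open>n\<close> factors \<open>Tg c\<close>, hence the sign;
  the part starting in \<open>w\<close> comes only from \<open>u2\<close> applied first.\<close>

lemma SX11:
 "k + n \<le> 8 ==> SX k11 d 1 1 n k (s, t) =
  (ysc bb n k * s + sgf k11 d 1 k * t, (- 1) ^ n * omf k11 d 1 (k + n) * s)"
proof (induction n arbitrary: k s t)
 case 0
 then have "yf k11 1 k = bb k" by (auto simp: yf_def bb_def k11_def One_nat_def)
 then show ?case by simp
next
 case (Suc n)
 have t: "tf k11 1 k = 1" "tf k11 1 (k + (n * 1 + 1)) = 1" using Suc.prems by (auto simp: tf_def k11_def One_nat_def)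
 have 1: "SX k11 d 1 1 n k (s, t) = (ysc bb n k * s + sgf k11 d 1 k * t, (- 1) ^ n * omf k11 d 1 (k + n) * s)" for s t
  using Suc by simp
 have 2: "SX k11 d 1 1 n (k + 1) (s, t) = (ysc bb n (Suc k) * s + sgf k11 d 1 (Suc k) * t, (- 1) ^ n * omf k11 d 1 (Suc (k + n)) * s)" for s t
  using Suc.IH[of "k + 1"] Suc.prems by (simp add: One_nat_def)
 show ?case unfolding sadp.simps(2) t 1 2 by (simp add: algebra_simps 2)
qed

lemma br11:
 assumes a: "adms k11 d 1 1" and n: "1 \<le> n" "n \<le> 6" "k + n + 2 \<le> 9"
 shows "bb (k + n + 1) * (ysc bb n k * s + sgf k11 d 1 k * t) + sgf k11 d 1 (k + n + 1) * ((- 1) ^ n * omf k11 d 1 (k + n) * s)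
   = ysc bb n (Suc k) * (bb k * s + sgf k11 d 1 k * t) + sgf k11 d 1 (Suc k) * (omf k11 d 1 k * s)"
  and "d = k + n + 2 ==> w \<noteq> 0 ==> omf k11 d 1 (k + n + 1) * (ysc bb n k * s + sgf k11 d 1 k * t)
   = (- 1) ^ n * omf k11 d 1 (k + n + 1) * (bb k * s + sgf k11 d 1 k * t)"
proof -
 interpret a: prep11 scale Basis G g V \<rho> "FF k11 d" unfolding prep11_def by (rule FF_adm[OF a])
 have Tc: "a.Tc c = Tg c" by (simp add: a.Tc_def Tg_def)
 have r: "raises (FF k11 d) (n + 3) (cm (Xo 0) (Xo n))" using a.rel11_2n[OF n(1,2), of c] unfolding Tc .
 let ?p = "SX k11 d 1 1 0 (k + (n * 1 + 1)) (SX k11 d 1 1 n k (s, t)) - SX k11 d 1 1 n (k + (0 * 1 + 1)) (SX k11 d 1 1 0 k (s, t))"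
 have m: "pf (Ef k11) (Wf d) (k + (n + 2)) ?p \<in> FF k11 d (k + (n + 2) + 1)"
  by (rule rel0[OF a r]) simp_all
 have e: "?p = (bb (k + n + 1) * (ysc bb n k * s + sgf k11 d 1 k * t) + sgf k11 d 1 (k + n + 1) * ((- 1) ^ n * omf k11 d 1 (k + n) * s)
   - (ysc bb n (Suc k) * (bb k * s + sgf k11 d 1 k * t) + sgf k11 d 1 (Suc k) * (omf k11 d 1 k * s)),
   omf k11 d 1 (k + n + 1) * (ysc bb n k * s + sgf k11 d 1 k * t)
   - (- 1) ^ n * omf k11 d 1 (k + n + 1) * (bb k * s + sgf k11 d 1 k * t))"
 proof -
  have i: "k + (n * 1 + 1) = k + n + 1" "k + (0 * 1 + 1) = Suc k" "Suc k + n = k + n + 1" by (simp_all add: One_nat_def)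
  have h: "k + n \<le> 8" "k + n + 1 + 0 \<le> 8" "Suc k + n \<le> 8" "k + 0 \<le> 8" using n by simp_all
  show ?thesis
   unfolding i SX11[OF h(1)] SX11[OF h(4)] SX11[OF h(2)] SX11[OF h(3)] by simp
 qed
 have "fst ?p = 0" using pf_zero(1)[OF a m] n by (simp add: k11_def)
 then show "bb (k + n + 1) * (ysc bb n k * s + sgf k11 d 1 k * t) + sgf k11 d 1 (k + n + 1) * ((- 1) ^ n * omf k11 d 1 (k + n) * s)
   = ysc bb n (Suc k) * (bb k * s + sgf k11 d 1 k * t) + sgf k11 d 1 (Suc k) * (omf k11 d 1 k * s)" unfolding e by simp
 assume "d = k + n + 2" "w \<noteq> 0"
 then have "snd ?p = 0" using pf_zero(2)[OF a m] by simp
 then show "omf k11 d 1 (k + n + 1) * (ysc bb n k * s + sgf k11 d 1 k * t)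
   = (- 1) ^ n * omf k11 d 1 (k + n + 1) * (bb k * s + sgf k11 d 1 k * t)" unfolding e by simp
qed

definition dj :: nat where "dj = (if w = 0 then 0 else j)"

lemma adj: "adms k11 dj 1 1"
 by (rule adms11) (use m0 in \<open>auto simp: dj_def\<close>)

lemma sgj: "sgf k11 dj 1 k = 0"
 using m0 j by (auto simp: sgf_def dj_def k11_def)

lemma C11: "1 \<le> n ==> n \<le> 6 ==> k + n + 2 \<le> 9 ==> bb (k + n + 1) * ysc bb n k = ysc bb n (Suc k) * bb k"
 using br11(1)[OF adj, of n k 1 0] by (simp add: sgj)

text \<open>The \<open>w\<close>-coordinate of the vanishing bracket of \<open>u2\<close> with its
  \<open>n\<close>-fold bracket, read from layer \<open>j - n - 2\<close>; the common factor
  \<open>\<omega> (j - 1)\<close> is non-zero by \<open>omj\<close>.\<close>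

lemma L11: "w \<noteq> 0 ==> 1 \<le> n ==> n \<le> 6 ==> j = k + n + 2 ==> ysc bb n k = (- 1) ^ n * bb k"
proof -
 assume a: "w \<noteq> 0" "1 \<le> n" "n \<le> 6" "j = k + n + 2"
 have dd: "dj = j" using a(1) by (simp add: dj_def)
 have e: "k + n + 1 = j - 1" using a(4) by simp
 have "omf k11 dj 1 (k + n + 1) = \<omega> (j - 1)" unfolding e dd omf_def k11_def using j by simp
 then have "\<omega> (j - 1) * ysc bb n k = (- 1) ^ n * \<omega> (j - 1) * bb k"
  using br11(2)[OF adj a(2,3), of k 1 0] a(1) a(4)[symmetric] j dd by (simp add: sgj)
 then show ?thesis using omj[OF a(1)] by (simp add: algebra_simps)
qed

text \<open>The same relation applied to \<open>w\<close>. Moving \<open>w\<close> to degree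
  \<open>m0 - 1\<close> makes \<open>\<sigma> *s e m0\<close> the leading part of
  \<open>u2 w\<close> and hides the ways into \<open>w\<close>.\<close>

lemma U11: "w \<noteq> 0 ==> 1 \<le> n ==> n \<le> 6 ==> m0 + n + 1 \<le> 9 ==> bb (m0 + n) = ysc bb n m0"
proof -
 assume a: "w \<noteq> 0" "1 \<le> n" "n \<le> 6" "m0 + n + 1 \<le> 9"
 define d where "d = m0 - 1"
 have d: "Suc d = m0" "j \<le> d" using m0 by (auto simp: d_def)
 have ad: "adms k11 d 1 1" by (rule adms11) (use d in auto)
 have om: "omf k11 d 1 k = 0" for k
  using om0[of k] d m0(1) a(4) by (auto simp: omf_def k11_def One_nat_def)
 have sgd: "sgf k11 d 1 d = \<sigma>" using a d by (auto simp: sgf_def k11_def One_nat_def)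
 have "bb (d + n + 1) * \<sigma> = ysc bb n (Suc d) * \<sigma>"
  using br11(1)[OF ad a(2,3), of d 0 1] a(4) d by (simp add: om sgd)
 moreover have "d + n + 1 = m0 + n" using d by simp
 ultimately show ?thesis using sg(2) m0(3)[OF a(1)] d by (simp only:) simp
qed

text \<open>Equality would make the bracket of \<open>u2\<close> and its 7-fold bracket vanish on
  \<open>e 0\<close> in degree 9. But there it agrees with \<open>Z (e 0)\<close>, which is
  non-zero, and nothing lives in degree 10.\<close>

lemma Z11: "bb 8 * ysc bb 7 0 \<noteq> ysc bb 7 1 * bb 0"
proof
 assume eq: "bb 8 * ysc bb 7 0 = ysc bb 7 1 * bb 0"
 let ?d = dj
 note a = adj
 interpret a: prep11 scale Basis G g V \<rho> "FF k11 dj" unfolding prep11_def by (rule FF_adm[OF a])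
 have Tc: "a.Tc c = Tg c" by (simp add: a.Tc_def Tg_def)
 let ?p = "SX k11 ?d 1 1 0 (0 + (7 * 1 + 1)) (SX k11 ?d 1 1 7 0 (1, 0)) - SX k11 ?d 1 1 7 (0 + (0 * 1 + 1)) (SX k11 ?d 1 1 0 0 (1, 0))"
 have s: "cm (Xo 0) (Xo 7) (pf (Ef k11) (Wf ?d) 0 (1, 0)) - pf (Ef k11) (Wf ?d) 9 ?p \<in> FF k11 ?d 10"
  using symD[OF sym_cm[OF phi_add_pf sym_SX[OF a, of 0] sym_SX[OF a, of 7]], of 0 "(1, 0)"] by simp
 have i: "0 + (7 * 1 + 1) = (8::nat)" "0 + (0 * 1 + 1) = (1::nat)" by simp_all
 have 1: "SX k11 ?d 1 1 7 0 (1, 0) = (ysc bb 7 0 * 1 + sgf k11 ?d 1 0 * 0, (- 1) ^ 7 * omf k11 ?d 1 (0 + 7) * 1)"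
  by (rule SX11) simp
 have 2: "SX k11 ?d 1 1 7 1 (s, t) = (ysc bb 7 1 * s + sgf k11 ?d 1 1 * t, (- 1) ^ 7 * omf k11 ?d 1 (1 + 7) * s)" for s t
  by (rule SX11) simp
 have 3: "SX k11 ?d 1 1 0 8 (s, t) = (bb 8 * s + sgf k11 ?d 1 8 * t, omf k11 ?d 1 8 * s)"
  "SX k11 ?d 1 1 0 0 (s, t) = (bb 0 * s + sgf k11 ?d 1 0 * t, omf k11 ?d 1 0 * s)" for s t
  using SX11[of 8 0 ?d s t] SX11[of 0 0 ?d s t] by (simp_all del: sadp.simps)
 have "fst ?p = bb 8 * ysc bb 7 0 - ysc bb 7 1 * bb 0"
  unfolding i 1 3 2 by (simp add: sgj)
 then have "fst ?p = 0" using eq by simp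
 moreover have "Wf ?d 9 = 0" using j by (auto simp: Wf_def dj_def)
 ultimately have "pf (Ef k11) (Wf ?d) 9 ?p = 0" unfolding pf_def by simp
 moreover have "pf (Ef k11) (Wf ?d) 0 (1, 0) = e 0" by (simp add: pf_def Ef_def k11_def)
 ultimately have c1: "cm (Xo 0) (Xo 7) (e 0) \<in> FF k11 ?d 10" using s by simp
 have "e 0 \<in> FF k11 ?d 0" by (rule FF_e) (simp add: k11_def)
 from raisesD[OF a.rel11_z[of c, unfolded Tc] this]
 have c2: "cm (Xo 0) (Xo 7) (e 0) - Z (e 0) \<in> FF k11 ?d 10" by simp
 have "Z (e 0) \<in> FF k11 ?d 10" using subspace_diff[OF FF_sub c1 c2] by simp
 moreover have "FF k11 ?d 10 = {0}" using j by (auto simp: FF_def k11_def dj_def)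
 ultimately show False using Z_e0 by simp
qed

text \<open>Chain coordinates of the relations \<open>[X 0, X 1] = X 3\<close>,
  \<open>[X 1, X 2] = - X 5\<close> and \<open>[X 2, X 3] = 3 * X 7\<close>. The names count group
  elements, \<open>X n\<close> having the leading part of \<open>g (n + 2)\<close>.\<close>

definition r23 where "r23 \<kappa> d k = fst (SX \<kappa> d 1 2 0 (k + 3) (SX \<kappa> d 1 2 1 k (1, 0)) - SX \<kappa> d 1 2 1 (k + 2) (SX \<kappa> d 1 2 0 k (1, 0)))
  - fst (SX \<kappa> d 1 2 3 k (1, 0))"
definition r34 where "r34 \<kappa> d k = fst (SX \<kappa> d 1 2 1 (k + 4) (SX \<kappa> d 1 2 2 k (1, 0)) - SX \<kappa> d 1 2 2 (k + 3) (SX \<kappa> d 1 2 1 k (1, 0)))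
  + fst (SX \<kappa> d 1 2 5 k (1, 0))"
definition r45 where "r45 \<kappa> d k = fst (SX \<kappa> d 1 2 2 (k + 5) (SX \<kappa> d 1 2 3 k (1, 0)) - SX \<kappa> d 1 2 3 (k + 4) (SX \<kappa> d 1 2 2 k (1, 0)))
  - 3 * fst (SX \<kappa> d 1 2 7 k (1, 0))"

lemma eq12:
 assumes a: "adms \<kappa> d 1 2"
 shows "\<kappa> (k + 5) < \<kappa> (Suc (k + 5)) ==> r23 \<kappa> d k = 0"
  and "\<kappa> (k + 7) < \<kappa> (Suc (k + 7)) ==> r34 \<kappa> d k = 0"
  and "\<kappa> (k + 9) < \<kappa> (Suc (k + 9)) ==> r45 \<kappa> d k = 0"
proof -
 interpret a: prep12 scale Basis G g V \<rho> "FF \<kappa> d" unfolding prep12_def by (rule FF_adm[OF a])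
 have Tc: "a.Tc c = Tg c" by (simp add: a.Tc_def Tg_def)
 have 1: "raises (FF \<kappa> d) 6 (\<lambda>v. cm (Xo 0) (Xo 1) v - 1 *s Xo 3 v)" using a.rel12_23[of c] unfolding Tc by simp
 have 2: "raises (FF \<kappa> d) 8 (\<lambda>v. cm (Xo 1) (Xo 2) v - (- 1) *s Xo 5 v)" using a.rel12_34[of c] unfolding Tc by simp
 have 3: "raises (FF \<kappa> d) 10 (\<lambda>v. cm (Xo 2) (Xo 3) v - 3 *s Xo 7 v)" using a.rel12_45[of c] unfolding Tc by simp
 show "r23 \<kappa> d k = 0" if h: "\<kappa> (k + 5) < \<kappa> (Suc (k + 5))"
 proof -
  define p where "p = SX \<kappa> d 1 2 0 (k + (1 * 1 + 2)) (SX \<kappa> d 1 2 1 k (1, 0)) - SX \<kappa> d 1 2 1 (k + (0 * 1 + 2)) (SX \<kappa> d 1 2 0 k (1, 0))"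
  have "pf (Ef \<kappa>) (Wf d) (k + 5) (fst p - (1) * fst (SX \<kappa> d 1 2 3 k (1, 0)), snd p - (1) * snd (SX \<kappa> d 1 2 3 k (1, 0))) \<in> FF \<kappa> d (k + 5 + 1)"
   by (rule relD[OF a 1 _ _ _ p_def]) simp_all
  from pf_zero(1)[OF a this h] have "fst p - (1) * fst (SX \<kappa> d 1 2 3 k (1, 0)) = 0" by (simp only: fst_conv)
  moreover have "1 * 1 + 2 = (3::nat)" "0 * 1 + 2 = (2::nat)" by simp_all
  ultimately show ?thesis unfolding r23_def p_def by (simp only: mult_1_left mult_minus1 diff_minus_eq_add)
 qed
 show "r34 \<kappa> d k = 0" if h: "\<kappa> (k + 7) < \<kappa> (Suc (k + 7))"
 proof -
  define p where "p = SX \<kappa> d 1 2 1 (k + (2 * 1 + 2)) (SX \<kappa> d 1 2 2 k (1, 0)) - SX \<kappa> d 1 2 2 (k + (1 * 1 + 2)) (SX \<kappa> d 1 2 1 k (1, 0))"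
  have "pf (Ef \<kappa>) (Wf d) (k + 7) (fst p - (- 1) * fst (SX \<kappa> d 1 2 5 k (1, 0)), snd p - (- 1) * snd (SX \<kappa> d 1 2 5 k (1, 0))) \<in> FF \<kappa> d (k + 7 + 1)"
   by (rule relD[OF a 2 _ _ _ p_def]) simp_all
  from pf_zero(1)[OF a this h] have "fst p - (- 1) * fst (SX \<kappa> d 1 2 5 k (1, 0)) = 0" by (simp only: fst_conv)
  moreover have "2 * 1 + 2 = (4::nat)" "1 * 1 + 2 = (3::nat)" by simp_all
  ultimately show ?thesis unfolding r34_def p_def by (simp only: mult_1_left mult_minus1 diff_minus_eq_add)
 qed
 show "r45 \<kappa> d k = 0" if h: "\<kappa> (k + 9) < \<kappa> (Suc (k + 9))"
 proof -
  define p where "p = SX \<kappa> d 1 2 2 (k + (3 * 1 + 2)) (SX \<kappa> d 1 2 3 k (1, 0)) - SX \<kappa> d 1 2 3 (k + (2 * 1 + 2)) (SX \<kappa> d 1 2 2 k (1, 0))"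
  have "pf (Ef \<kappa>) (Wf d) (k + 9) (fst p - (3) * fst (SX \<kappa> d 1 2 7 k (1, 0)), snd p - (3) * snd (SX \<kappa> d 1 2 7 k (1, 0))) \<in> FF \<kappa> d (k + 9 + 1)"
   by (rule relD[OF a 3 _ _ _ p_def]) simp_all
  from pf_zero(1)[OF a this h] have "fst p - (3) * fst (SX \<kappa> d 1 2 7 k (1, 0)) = 0" by (simp only: fst_conv)
  moreover have "3 * 1 + 2 = (5::nat)" "2 * 1 + 2 = (4::nat)" by simp_all
  ultimately show ?thesis unfolding r45_def p_def by (simp only: mult_1_left mult_minus1 diff_minus_eq_add)
 qed
qed

lemma B_bb: "k \<le> 8 ==> bb k = 0 ==> B k (Suc k) = 0"
 by (simp add: bb_def)

lemma om_lt: "\<omega> k \<noteq> 0 ==> k < j"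
 using om0[of k] by (meson not_le)

text \<open>When \<open>b 0\<close> is the only non-zero scalar in range, \<open>L11\<close>
  compares \<open>b 0\<close> with its multiple by the sign of \<open>j - 2\<close>, so odd
  \<open>j \<ge> 3\<close> fail; \<open>j = 8\<close> would need \<open>m0 \<ge> 10\<close>.\<close>

lemma even_w:
 assumes "bb 0 \<noteq> 0" "\<And>k. 1 \<le> k ==> k \<le> 6 ==> bb k = 0" "w \<noteq> 0"
 shows "j = 1 \<or> j = 2 \<or> j = 4 \<or> j = 6"
proof (rule ccontr)
 assume n: "\<not> ?thesis"
 have "j \<noteq> 8" using m0(1) m0(3)[OF assms(3)] by auto
 then have o: "odd j" "3 \<le> j" "j \<le> 7" using n j by presburger+
 have e: "j = 0 + (j - 2) + 2" using o by simp
 have A: "ysc bb (j - 2) 0 = (- 1) ^ (j - 2) * bb 0"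
  by (rule L11[OF assms(3) _ _ e]) (use o in auto)
 have "ysc bb (j - 2) 0 = (- 1) ^ 0 * of_nat ((j - 2) choose 0) * bb (0 + 0)"
  by (rule ysc_single) (use assms(2) o in auto)
 then have A': "ysc bb (j - 2) 0 = bb 0" by simp
 have "odd (j - 2)" using o by presburger
 then have pw: "(- 1) ^ (j - 2) = (- 1 :: 'a)" by simp
 have "bb 0 = - 1 * bb 0" using A unfolding A' pw .
 then have "2 * bb 0 = 0" by Groebner_Basis.algebra
 then show False using assms(1) char_ne[of 2] by simp
qed

text \<open>For \<open>m0 = j + 2\<close> and \<open>w\<close> in degree \<open>2j + 2\<close>, the
  path from \<open>e (j - 1)\<close> through \<open>w\<close> to \<open>e m0\<close> is homogeneous
  in weights (2,3), and the relation for \<open>g 2\<close> and \<open>g 3\<close> reduces to the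
  vanishing of \<open>\<sigma> * \<omega> (j - 1)\<close>.\<close>

lemma shift3:
 assumes b: "\<And>k. 1 \<le> k ==> k \<le> 7 ==> bb k = 0" and w: "w \<noteq> 0" and jj: "j = 2 \<or> j = 4 \<or> j = 6"
 shows "m0 \<noteq> j + 2"
proof
 assume mj: "m0 = j + 2"
 define d where "d = 2 * j + 2"
 have kd_mono: "kd n \<le> kd (Suc n)" "kd n \<le> 10" "kd (n + 2) \<le> Suc (kd n)" for n
  by (auto simp: kd_def)
 have B0: "B k l = 0" if "kd n \<le> k" "k < l" "l < kd (n + 3)" for n k l
 proof -
  have "l = Suc k \<and> 1 \<le> k \<and> k \<le> 7" using that unfolding kd_def by (auto split: if_splits)
  then show ?thesis using B_bb[of k] b by auto
 qed
 have o: "n + 3 \<le> d" if "kd n \<le> k" "\<omega> k \<noteq> 0" for n k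
  using om_lt[OF that(2)] that(1) jj unfolding kd_def d_def by (auto split: if_splits)
 have s: "kd (n + 3) \<le> m0" if "n \<le> d" for n
  using that jj unfolding kd_def d_def mj by (auto split: if_splits)
 have adm: "adms kd d 2 3" unfolding adms_def using kd_mono B0 o s by auto
 interpret a: prep23 scale Basis G g V \<rho> "FF kd d" unfolding prep23_def by (rule FF_adm[OF adm])
 have Tc: "a.Tc c = Tg c" by (simp add: a.Tc_def Tg_def)
 note r = a.rel23_23[of c, unfolded Tc]
 have z: "fst (SX kd d 2 3 0 (k + (1 * 2 + 3)) (SX kd d 2 3 1 k (1, 0)) - SX kd d 2 3 1 (k + (0 * 2 + 3)) (SX kd d 2 3 0 k (1, 0))) = 0"
  if "kd (k + 8) < kd (Suc (k + 8))" for k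
  using pf_zero(1)[OF adm rel0[OF adm r, where N = 8 and k = k and st = "(1, 0)"]] that by simp
 have sn: "\<sigma> \<noteq> 0" using sg(2) m0(3)[OF w] by simp
 note on = omj[OF w]
 have sgv: "sgf kd d 3 d = \<sigma>" unfolding sgf_def using w mj jj by (auto simp: d_def kd_def)
 have sg0: "sgf kd d 3 n = 0" if "n \<noteq> d" for n using that by (simp add: sgf_def)
 note defs = kd_def sadp_one tf_def yf_def omf_def
 show False using jj
 \<comment> \<open>For \<open>j = 4\<close> and \<open>j = 6\<close> the relation is read on
   \<open>e (j - 2)\<close>. For \<open>j = 2\<close> this would be \<open>e 0\<close>, whose step
   to \<open>e 1\<close> has length 3 and is invisible to \<open>Tg c\<close>, so \<open>e 1\<close>
   is used.\<close>
 proof (elim disjE)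
  assume j2: "j = 2"
  have d: "d = 6" using j2 by (simp add: d_def)
  have "\<omega> 1 \<noteq> 0" using on j2 by (simp add: One_nat_def)
  then show False using z[of 3] sn sgv sg0 unfolding d by (simp add: defs)
 next
  assume j4: "j = 4"
  have d: "d = 10" using j4 by (simp add: d_def)
  have "\<omega> 3 \<noteq> 0" using on j4 by simp
  then show False using z[of 5] sn sgv sg0 unfolding d by (simp add: defs)
 next
  assume j6: "j = 6"
  have d: "d = 14" using j6 by (simp add: d_def)
  have "\<omega> 5 \<noteq> 0" using on j6 by simp
  then show False using z[of 9] sn sgv sg0 unfolding d by (simp add: defs)
 qed
qed

text \<open>Parity and \<open>shift3\<close> leave room to place \<open>w\<close> so deep that it
  drops out. The second diagonal \<open>B k (k + 2)\<close> then satisfies linear relations that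
  express all entries by \<open>s = B 3 5\<close>, and two quadratic ones without a common root
  modulo 13.\<close>

lemma no_08:
 assumes b: "bb 0 \<noteq> 0" "bb 8 \<noteq> 0" "\<And>k. 1 \<le> k ==> k \<le> 7 ==> bb k = 0"
 shows False
proof -
 have jj: "j = 1 \<or> j = 2 \<or> j = 4 \<or> j = 6" if "w \<noteq> 0" using even_w b that by auto
 have m: "even m0 \<or> 8 \<le> m0" if w: "w \<noteq> 0"
 proof (rule ccontr)
  assume n: "\<not> ?thesis"
  then have o: "odd m0" "3 \<le> m0" "m0 \<le> 7" using m0 j by auto
  have m8: "m0 + (8 - m0) = 8" using o by simp
  have A: "bb (m0 + (8 - m0)) = ysc bb (8 - m0) m0" by (rule U11[OF w]) (use o in auto)
  have A': "ysc bb (8 - m0) m0 = (- 1) ^ (8 - m0) * of_nat ((8 - m0) choose (8 - m0)) * bb (m0 + (8 - m0))"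
   by (rule ysc_single) (use b o in auto)
  have "odd (8 - m0)" using o by auto
  then have pw: "(- 1) ^ (8 - m0) = (- 1 :: 'a)" by simp
  have "bb 8 = - 1 * of_nat 1 * bb 8" using A unfolding A' pw m8 binomial_n_n .
  then have "2 * bb 8 = 0" unfolding of_nat_1 by Groebner_Basis.algebra
  then show False using b char_ne[of 2] by simp
 qed
 have sh: "m0 \<noteq> j + 2" if "w \<noteq> 0" "j \<noteq> 1" using shift3[OF b(3) that(1)] jj[OF that(1)] that(2) by auto
 \<comment> \<open>\<open>e (j - 1)\<close> has degree \<open>j\<close> for \<open>j \<ge> 2\<close>
   and degree 0 for \<open>j = 1\<close>; \<open>d\<close> exceeds the degree of
   \<open>u2 (e (j - 1))\<close> by one, so that \<open>omf\<close> vanishes.\<close>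
 define d where "d = (if w = 0 then 0 else if j = 1 then 3 else j + 3)"
 have mge: "m0 \<ge> 4" "j \<noteq> 1 ==> j + 4 \<le> m0 \<or> m0 = 9" "m0 \<le> 9" if w: "w \<noteq> 0"
  using m[OF w] sh[OF w] jj[OF w] m0 w by auto
 have km: "ka n \<le> ka (Suc n)" "ka n \<le> 10" "ka (n + 1) \<le> Suc (ka n)" for n by (auto simp: ka_def)
 have B0: "B k l = 0" if "ka n \<le> k" "k < l" "l < ka (n + 2)" for n k l
 proof -
  have "l = Suc k \<and> 1 \<le> k \<and> k \<le> 7" using that unfolding ka_def by (auto split: if_splits)
  then show ?thesis using B_bb[of k] b by auto
 qed
 have o: "n + 2 \<le> d" if "w \<noteq> 0" "ka n \<le> k" "\<omega> k \<noteq> 0" for n k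
  using om_lt[OF that(3)] that(1,2) jj[OF that(1)] unfolding ka_def d_def by (auto split: if_splits)
 have s: "ka (n + 2) \<le> m0" if "w \<noteq> 0" "n \<le> d" for n
  using that(2) jj[OF that(1)] mge[OF that(1)] that(1) unfolding ka_def d_def by (auto split: if_splits)
 have adm: "adms ka d 1 2" unfolding adms_def using km B0 o s by auto
 have om: "omf ka d 2 n = 0" for n
 proof (rule ccontr)
  assume "omf ka d 2 n \<noteq> 0"
  then have "ka n < ka (Suc n)" "n + 2 = d" "\<omega> (ka n) \<noteq> 0" by (auto simp: omf_def split: if_splits)
  moreover have "w \<noteq> 0" using calculation(2) by (auto simp: d_def)
  ultimately show False using om_lt[of "ka n"] jj by (auto simp: d_def ka_def split: if_splits)
 qed
 have s12: "Suc 0 = 1" "Suc (Suc 0) = 2" by (simp_all add: One_nat_def)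
 have tab: "tf ka 1 0 = 0" "yf ka 2 0 = B 0 1" "tf ka 1 1 = 0" "yf ka 2 1 = 0" "tf ka 1 2 = 1" "yf ka 2 2 = B 1 3" "tf ka 1 3 = 1" "yf ka 2 3 = B 2 4" "tf ka 1 4 = 1" "yf ka 2 4 = B 3 5" "tf ka 1 5 = 1" "yf ka 2 5 = B 4 6" "tf ka 1 6 = 1" "yf ka 2 6 = B 5 7" "tf ka 1 7 = 1" "yf ka 2 7 = B 6 8" "tf ka 1 8 = 1" "yf ka 2 8 = 0" "tf ka 1 9 = 0" "yf ka 2 9 = B 8 9" "tf ka 1 10 = 0" "yf ka 2 10 = 0" "tf ka 1 11 = 0" "yf ka 2 11 = 0"
  by (simp_all add: tf_def yf_def ka_def)
 have E23_0: "- B 0 1 - B 0 1 * B 1 3 + 2 * B 0 1 * B 2 4 = 0"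
 proof -
  have "r23 ka d 0 = - B 0 1 - B 0 1 * B 1 3 + 2 * B 0 1 * B 2 4"
   unfolding r23_def by (simp add: sadp_numeral sadp_one tab om s12 algebra_simps)
  then show ?thesis using eq12(1)[OF adm, of 0] by (simp add: ka_def)
 qed
 have E34_0: "B 0 1 - B 0 1 * B 2 4 + 3 * B 0 1 * B 3 5 - 2 * B 0 1 * B 4 6 = 0"
 proof -
  have "r34 ka d 0 = B 0 1 - B 0 1 * B 2 4 + 3 * B 0 1 * B 3 5 - 2 * B 0 1 * B 4 6"
   unfolding r34_def by (simp add: sadp_numeral sadp_one tab om s12 algebra_simps)
  then show ?thesis using eq12(2)[OF adm, of 0] by (simp add: ka_def)
 qed
 have E45_2: "2 * B 1 3 * B 8 9 - 5 * B 2 4 * B 8 9 + 4 * B 3 5 * B 8 9 - B 4 6 * B 8 9 + 3 * B 8 9 = 0"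
 proof -
  have "r45 ka d 2 = 2 * B 1 3 * B 8 9 - 5 * B 2 4 * B 8 9 + 4 * B 3 5 * B 8 9 - B 4 6 * B 8 9 + 3 * B 8 9"
   unfolding r45_def by (simp add: sadp_numeral sadp_one tab om s12 algebra_simps)
  then show ?thesis using eq12(3)[OF adm, of 2] by (simp add: ka_def)
 qed
 have E34_4: "- 2 * B 3 5 * B 8 9 + 3 * B 4 6 * B 8 9 - B 5 7 * B 8 9 - B 8 9 = 0"
 proof -
  have "r34 ka d 4 = - 2 * B 3 5 * B 8 9 + 3 * B 4 6 * B 8 9 - B 5 7 * B 8 9 - B 8 9"
   unfolding r34_def by (simp add: sadp_numeral sadp_one tab om s12 algebra_simps)
  then show ?thesis using eq12(2)[OF adm, of 4] by (simp add: ka_def)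
 qed
 have E23_6: "2 * B 5 7 * B 8 9 - B 6 8 * B 8 9 + B 8 9 = 0"
 proof -
  have "r23 ka d 6 = 2 * B 5 7 * B 8 9 - B 6 8 * B 8 9 + B 8 9"
   unfolding r23_def by (simp add: sadp_numeral sadp_one tab om s12 algebra_simps)
  then show ?thesis using eq12(1)[OF adm, of 6] by (simp add: ka_def)
 qed
 have E23_2: "- B 1 3 - B 1 3 * B 3 5 + 2 * B 1 3 * B 4 6 + 3 * B 2 4 - B 2 4 * B 4 6 - 3 * B 3 5 + B 4 6 = 0"
 proof -
  have "r23 ka d 2 = - B 1 3 - B 1 3 * B 3 5 + 2 * B 1 3 * B 4 6 + 3 * B 2 4 - B 2 4 * B 4 6 - 3 * B 3 5 + B 4 6"
   unfolding r23_def by (simp add: sadp_numeral sadp_one tab om s12 algebra_simps)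
  then show ?thesis using eq12(1)[OF adm, of 2] by (simp add: ka_def)
 qed
 have E23_3: "- B 2 4 - B 2 4 * B 4 6 + 2 * B 2 4 * B 5 7 + 3 * B 3 5 - B 3 5 * B 5 7 - 3 * B 4 6 + B 5 7 = 0"
 proof -
  have "r23 ka d 3 = - B 2 4 - B 2 4 * B 4 6 + 2 * B 2 4 * B 5 7 + 3 * B 3 5 - B 3 5 * B 5 7 - 3 * B 4 6 + B 5 7"
   unfolding r23_def by (simp add: sadp_numeral sadp_one tab om s12 algebra_simps)
  then show ?thesis using eq12(1)[OF adm, of 3] by (simp add: ka_def)
 qed
 have nz: "B 0 1 \<noteq> 0" "B 8 9 \<noteq> 0" using b by (auto simp: bb_def One_nat_def)
 define s where "s = B 3 5"
 have 1: "B 1 3 = 2 * B 2 4 - 1"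
 proof -
  have "B 0 1 * (2 * B 2 4 - 1 - B 1 3) = 0" using E23_0 by (simp add: algebra_simps)
  then show ?thesis using nz by simp
 qed
 have 2: "B 2 4 = 1 + 3 * s - 2 * B 4 6"
 proof -
  have "B 0 1 * (1 + 3 * s - 2 * B 4 6 - B 2 4) = 0" using E34_0 by (simp add: algebra_simps s_def)
  then show ?thesis using nz by simp
 qed
 have 3: "2 * B 1 3 - 5 * B 2 4 + 4 * s - B 4 6 + 3 = 0"
 proof -
  have "B 8 9 * (2 * B 1 3 - 5 * B 2 4 + 4 * s - B 4 6 + 3) = 0" using E45_2 by (simp add: algebra_simps s_def)
  then show ?thesis using nz by simp
 qed
 have 4: "B 5 7 = 3 * B 4 6 - 2 * s - 1"
 proof -
  have "B 8 9 * (3 * B 4 6 - 2 * s - 1 - B 5 7) = 0" using E34_4 by (simp add: algebra_simps s_def)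
  then show ?thesis using nz by simp
 qed
 have 5: "B 6 8 = 2 * B 5 7 + 1"
 proof -
  have "B 8 9 * (2 * B 5 7 + 1 - B 6 8) = 0" using E23_6 by (simp add: algebra_simps)
  then show ?thesis using nz by simp
 qed
 have b5: "B 4 6 = - s" using 1 2 3 by Groebner_Basis.algebra
 have v: "B 2 4 = 5 * s + 1" "B 1 3 = 10 * s + 1" "B 5 7 = - 5 * s - 1" "B 6 8 = - 10 * s - 1" "B 3 5 = s"
  using 1 2 4 5 b5 s_def by Groebner_Basis.algebra+
 have q1: "2 - s - 25 * s * s = 0" using E23_2 unfolding v b5 by Groebner_Basis.algebra
 have q2: "- 4 - 22 * s - 40 * s * s = 0" using E23_3 unfolding v b5 by Groebner_Basis.algebra
 \<comment> \<open>The multipliers 8 and 5 eliminate the square, as 8 * 25 = 5 * 40. Modulo 13 the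
   remaining linear equation says \<open>s = 5\<close>, which fails the first quadratic by
   4.\<close>
 have "102 * s + 36 = 8 * (2 - s - 25 * s * s) - 5 * (- 4 - 22 * s - 40 * s * s)" by (simp add: algebra_simps)
 then have "102 * s + 36 = 0" unfolding q1 q2 by simp
 then have "2 * (s - 5) = 13 * (2 * (4 * s + 1))" by Groebner_Basis.algebra
 then have "2 * (s - 5) = 0" unfolding char13 by simp
 moreover have "(2::'a) \<noteq> 0" using char_ne[of 2] by simp
 ultimately have "s - 5 = 0" by (simp only: mult_eq_0_iff simp_thms)
 then have s5: "s = 5" by simp
 have "13 * 48 + (4::'a) = 0" using q1 unfolding s5 by simp
 then show False unfolding char13 using char_ne[of 4] by simp
qed

text \<open>Here \<open>m0\<close> is 8 or 9. The unknown contribution of the path through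
  \<open>w\<close> occurs in three relations and is eliminated; the linear relations left give
  \<open>B 4 6\<close> both as -2 and as -1.\<close>

lemma no_07:
 assumes b: "bb 0 \<noteq> 0" "bb 7 \<noteq> 0" "\<And>k. 1 \<le> k ==> k \<le> 8 ==> k \<noteq> 7 ==> bb k = 0"
 shows False
proof -
 have jj: "j = 1 \<or> j = 2 \<or> j = 4 \<or> j = 6" if "w \<noteq> 0" using even_w b that by auto
 have m: "8 \<le> m0" if w: "w \<noteq> 0"
 proof (rule ccontr)
  assume n: "\<not> ?thesis"
  then have o: "3 \<le> m0" "m0 \<le> 7" using m0 j by auto
  obtain q where q: "m0 + q = 7" using o by (metis le_Suc_ex)
  have "bb (m0 + Suc q) = ysc bb (Suc q) m0" by (rule U11[OF w]) (use o q in auto)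
  moreover have "ysc bb (Suc q) m0 = (- 1) ^ q * of_nat (Suc q choose q) * bb (m0 + q)"
   by (rule ysc_single) (use b o q in auto)
  moreover have "bb (m0 + Suc q) = 0" using b(3)[of 8] q by simp
  ultimately have "of_nat (Suc q) = (0::'a)" using b q by (simp del: of_nat_Suc)
  then show False using char_ne[of "Suc q"] q by (simp del: of_nat_Suc)
 qed
 \<comment> \<open>For \<open>j = 6\<close> and \<open>m0 = 8\<close> degree \<open>j + 3\<close> is
   not possible, since \<open>u2 w\<close> would have to reach index 9; so \<open>w\<close> stays in
   degree 8 and the path through it is homogeneous.\<close>
 define d where "d = (if w = 0 then 0 else if j = 1 then 3 else if j = 6 \<and> m0 = 8 then 8 else j + 3)"
 have m9: "m0 = 8 \<or> m0 = 9" if "w \<noteq> 0" using m[OF that] m0(3)[OF that] by auto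
 have km: "kb n \<le> kb (Suc n)" "kb n \<le> 10" "kb (n + 1) \<le> Suc (kb n)" for n by (auto simp: kb_def)
 have B0: "B k l = 0" if "kb n \<le> k" "k < l" "l < kb (n + 2)" for n k l
 proof -
  have "l = Suc k \<and> 1 \<le> k \<and> k \<le> 8 \<and> k \<noteq> 7" using that unfolding kb_def by (auto split: if_splits)
  then show ?thesis using B_bb[of k] b by auto
 qed
 have o: "n + 2 \<le> d" if "w \<noteq> 0" "kb n \<le> k" "\<omega> k \<noteq> 0" for n k
  using om_lt[OF that(3)] that(1,2) jj[OF that(1)] unfolding kb_def d_def by (auto split: if_splits)
 have s: "kb (n + 2) \<le> m0" if "w \<noteq> 0" "n \<le> d" for n
  using that(2) jj[OF that(1)] m9[OF that(1)] that(1) unfolding kb_def d_def by (auto split: if_splits)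
 have adm: "adms kb d 1 2" unfolding adms_def using km B0 o s by auto
 have om': "omf kb d 2 n = 0" if "n \<noteq> 6" for n
 proof (rule ccontr)
  assume "omf kb d 2 n \<noteq> 0"
  then have "kb n < kb (Suc n)" "n + 2 = d" "\<omega> (kb n) \<noteq> 0" by (auto simp: omf_def split: if_splits)
  moreover have "w \<noteq> 0" using calculation(2) by (auto simp: d_def)
  ultimately show False using om_lt[of "kb n"] jj that by (auto simp: d_def kb_def split: if_splits)
 qed
 have om: "omf kb d 2 0 = 0" "omf kb d 2 1 = 0" "omf kb d 2 2 = 0" "omf kb d 2 3 = 0" "omf kb d 2 4 = 0" "omf kb d 2 5 = 0"
  "omf kb d 2 7 = 0" "omf kb d 2 8 = 0" "omf kb d 2 9 = 0" "omf kb d 2 10 = 0" "omf kb d 2 11 = 0"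
  by (simp_all add: om')
 have s12: "Suc 0 = 1" "Suc (Suc 0) = 2" by (simp_all add: One_nat_def)
 have tab: "tf kb 1 0 = 0" "yf kb 2 0 = B 0 1" "tf kb 1 1 = 0" "yf kb 2 1 = 0" "tf kb 1 2 = 1" "yf kb 2 2 = B 1 3" "tf kb 1 3 = 1" "yf kb 2 3 = B 2 4" "tf kb 1 4 = 1" "yf kb 2 4 = B 3 5" "tf kb 1 5 = 1" "yf kb 2 5 = B 4 6" "tf kb 1 6 = 1" "yf kb 2 6 = B 5 7" "tf kb 1 7 = 1" "yf kb 2 7 = 0" "tf kb 1 8 = 0" "yf kb 2 8 = B 7 8" "tf kb 1 9 = 0" "yf kb 2 9 = 0" "tf kb 1 10 = 1" "yf kb 2 10 = 0" "tf kb 1 11 = 0" "yf kb 2 11 = 0"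
  by (simp_all add: tf_def yf_def kb_def)
 have E23_5: "2 * B 4 6 * B 7 8 - B 5 7 * B 7 8 + B 7 8 - sgf kb d 2 8 * omf kb d 2 6 = 0"
 proof -
  have "r23 kb d 5 = 2 * B 4 6 * B 7 8 - B 5 7 * B 7 8 + B 7 8 - sgf kb d 2 8 * omf kb d 2 6"
   unfolding r23_def by (simp add: sadp_numeral sadp_one tab om s12 algebra_simps)
  then show ?thesis using eq12(1)[OF adm, of 5] by (simp add: kb_def)
 qed
 have E23_6: "- B 5 7 * B 7 8 - 3 * B 7 8 - sgf kb d 2 8 * omf kb d 2 6 = 0"
 proof -
  have "r23 kb d 6 = - B 5 7 * B 7 8 - 3 * B 7 8 - sgf kb d 2 8 * omf kb d 2 6"
   unfolding r23_def by (simp add: sadp_numeral sadp_one tab om s12 algebra_simps)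
  then show ?thesis using eq12(1)[OF adm, of 6] by (simp add: kb_def)
 qed
 have E34_4: "3 * B 3 5 * B 7 8 - 4 * B 4 6 * B 7 8 + B 5 7 * B 7 8 + 5 * B 7 8 + sgf kb d 2 8 * omf kb d 2 6 = 0"
 proof -
  have "r34 kb d 4 = 3 * B 3 5 * B 7 8 - 4 * B 4 6 * B 7 8 + B 5 7 * B 7 8 + 5 * B 7 8 + sgf kb d 2 8 * omf kb d 2 6"
   unfolding r34_def by (simp add: sadp_numeral sadp_one tab om s12 algebra_simps)
  then show ?thesis using eq12(2)[OF adm, of 4] by (simp add: kb_def)
 qed
 have E34_3: "- 2 * B 2 4 * B 7 8 + 3 * B 3 5 * B 7 8 - B 4 6 * B 7 8 - B 7 8 = 0"
 proof -
  have "r34 kb d 3 = - 2 * B 2 4 * B 7 8 + 3 * B 3 5 * B 7 8 - B 4 6 * B 7 8 - B 7 8"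
   unfolding r34_def by (simp add: sadp_numeral sadp_one tab om s12 algebra_simps)
  then show ?thesis using eq12(2)[OF adm, of 3] by (simp add: kb_def)
 qed
 have E34_0: "B 0 1 - B 0 1 * B 2 4 + 3 * B 0 1 * B 3 5 - 2 * B 0 1 * B 4 6 = 0"
 proof -
  have "r34 kb d 0 = B 0 1 - B 0 1 * B 2 4 + 3 * B 0 1 * B 3 5 - 2 * B 0 1 * B 4 6"
   unfolding r34_def by (simp add: sadp_numeral sadp_one tab om s12 algebra_simps)
  then show ?thesis using eq12(2)[OF adm, of 0] by (simp add: kb_def)
 qed
 have nz: "B 0 1 \<noteq> 0" "B 7 8 \<noteq> 0" using b by (auto simp: bb_def One_nat_def)
 have 1: "2 * B 4 6 = - 4"
 proof -
  have "B 7 8 * (2 * B 4 6 + 4) = 0" using E23_5 E23_6 by Groebner_Basis.algebra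
  then show ?thesis using nz by (simp add: eq_neg_iff_add_eq_0)
 qed
 have 2: "3 * B 3 5 = 4 * B 4 6 - 2"
 proof -
  have "B 7 8 * (3 * B 3 5 - (4 * B 4 6 - 2)) = 0" using E34_4 E23_6 by Groebner_Basis.algebra
  then show ?thesis using nz by simp
 qed
 have 3: "2 * B 2 4 = 3 * B 3 5 - B 4 6 - 1"
 proof -
  have "B 7 8 * (2 * B 2 4 - (3 * B 3 5 - B 4 6 - 1)) = 0" using E34_3 by Groebner_Basis.algebra
  then show ?thesis using nz by simp
 qed
 have 4: "B 2 4 = 1 + 3 * B 3 5 - 2 * B 4 6"
 proof -
  have "B 0 1 * (B 2 4 - (1 + 3 * B 3 5 - 2 * B 4 6)) = 0" using E34_0 by Groebner_Basis.algebra
  then show ?thesis using nz by simp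
 qed
 have x: "B 4 6 = - 1" using 2 3 4 by Groebner_Basis.algebra
 have "of_nat 2 = (of_nat 4 :: 'a)" using 1 unfolding x by simp
 then show False using of_nat_inj12[of 2 4] by simp
qed

text \<open>\<open>L11\<close> forces \<open>j \<le> 2\<close> and \<open>U11\<close> forces
  \<open>m0 \<ge> 4\<close>, so \<open>w\<close> fits into degree 3. Its contribution is eliminated
  from three relations, after which \<open>B 3 5\<close> would be both 2 and 1.\<close>

lemma no_18:
 assumes b: "bb 1 \<noteq> 0" "bb 8 \<noteq> 0" "\<And>k. k \<le> 7 ==> k \<noteq> 1 ==> bb k = 0"
 shows False
proof -
 have jj: "j \<le> 2" if w: "w \<noteq> 0"
 proof (rule ccontr)
  assume n: "\<not> ?thesis"
  obtain q where q: "j = 0 + q + 2" "1 \<le> q" "q \<le> 6" 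
  proof
   show "j = 0 + (j - 2) + 2" "1 \<le> j - 2" "j - 2 \<le> 6" using n j by auto
  qed
  have "ysc bb q 0 = (- 1) ^ q * bb 0" by (rule L11[OF w q(2,3,1)])
  moreover have "ysc bb q 0 = (- 1) ^ 1 * of_nat (q choose 1) * bb (0 + 1)"
   by (rule ysc_single) (use b q in auto)
  ultimately have "of_nat q * bb 1 = 0" using b(3)[of 0] by (simp add: One_nat_def)
  then show False using char_ne[of q] q b by auto
 qed
 have m: "4 \<le> m0" if w: "w \<noteq> 0"
 proof (rule ccontr)
  assume n: "\<not> ?thesis"
  then have o: "m0 = 3" using m0 j by auto
  have "bb (m0 + 5) = ysc bb 5 m0" by (rule U11[OF w]) (use o in auto)
  moreover have "ysc bb 5 m0 = (- 1) ^ 5 * of_nat (5 choose 5) * bb (m0 + 5)"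
   by (rule ysc_single) (use b o in auto)
  ultimately have "2 * bb 8 = 0" using o by simp
  then show False using b char_ne[of 2] by simp
 qed
 define d where "d = (if w = 0 then 0 else 3::nat)"
 have km: "kc n \<le> kc (Suc n)" "kc n \<le> 10" "kc (n + 1) \<le> Suc (kc n)" for n by (auto simp: kc_def)
 have B0: "B k l = 0" if "kc n \<le> k" "k < l" "l < kc (n + 2)" for n k l
 proof -
  have "l = Suc k \<and> k \<le> 7 \<and> k \<noteq> 1" using that unfolding kc_def by (auto split: if_splits)
  then show ?thesis using B_bb[of k] b by auto
 qed
 have o: "n + 2 \<le> d" if "w \<noteq> 0" "kc n \<le> k" "\<omega> k \<noteq> 0" for n k
  using om_lt[OF that(3)] that(1,2) jj[OF that(1)] unfolding kc_def d_def by (auto split: if_splits)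
 have s: "kc (n + 2) \<le> m0" if "w \<noteq> 0" "n \<le> d" for n
  using that(2) m[OF that(1)] that(1) unfolding kc_def d_def by (auto split: if_splits)
 have adm: "adms kc d 1 2" unfolding adms_def using km B0 o s by auto
 have om': "omf kc d 2 n = 0" if "n \<noteq> 1" for n
  using that by (auto simp: omf_def d_def)
 have om: "omf kc d 2 0 = 0" "omf kc d 2 2 = 0" "omf kc d 2 3 = 0" "omf kc d 2 4 = 0" "omf kc d 2 5 = 0" "omf kc d 2 6 = 0"
  "omf kc d 2 7 = 0" "omf kc d 2 8 = 0" "omf kc d 2 9 = 0" "omf kc d 2 10 = 0" "omf kc d 2 11 = 0"
  by (simp_all add: om')
 have s12: "Suc 0 = 1" "Suc (Suc 0) = 2" by (simp_all add: One_nat_def)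
 have tab: "tf kc 1 0 = 1" "yf kc 2 0 = 0" "tf kc 1 1 = 0" "yf kc 2 1 = B 1 2" "tf kc 1 2 = 0" "yf kc 2 2 = 0" "tf kc 1 3 = 1" "yf kc 2 3 = B 2 4" "tf kc 1 4 = 1" "yf kc 2 4 = B 3 5" "tf kc 1 5 = 1" "yf kc 2 5 = B 4 6" "tf kc 1 6 = 1" "yf kc 2 6 = B 5 7" "tf kc 1 7 = 1" "yf kc 2 7 = B 6 8" "tf kc 1 8 = 1" "yf kc 2 8 = 0" "tf kc 1 9 = 0" "yf kc 2 9 = B 8 9" "tf kc 1 10 = 0" "yf kc 2 10 = 0" "tf kc 1 11 = 0" "yf kc 2 11 = 0"
  by (simp_all add: tf_def yf_def kc_def)
 have E23_0: "3 * B 1 2 - B 1 2 * B 2 4 - sgf kc d 2 3 * omf kc d 2 1 = 0"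
 proof -
  have "r23 kc d 0 = 3 * B 1 2 - B 1 2 * B 2 4 - sgf kc d 2 3 * omf kc d 2 1"
   unfolding r23_def by (simp add: sadp_numeral sadp_one tab om s12 algebra_simps)
  then show ?thesis using eq12(1)[OF adm, of 0] by (simp add: kc_def)
 qed
 have E23_1: "- B 1 2 - B 1 2 * B 2 4 + 2 * B 1 2 * B 3 5 - sgf kc d 2 3 * omf kc d 2 1 = 0"
 proof -
  have "r23 kc d 1 = - B 1 2 - B 1 2 * B 2 4 + 2 * B 1 2 * B 3 5 - sgf kc d 2 3 * omf kc d 2 1"
   unfolding r23_def by (simp add: sadp_numeral sadp_one tab om s12 algebra_simps)
  then show ?thesis using eq12(1)[OF adm, of 1] by (simp add: kc_def)
 qed
 have E34_0: "- 5 * B 1 2 + B 1 2 * B 2 4 - 4 * B 1 2 * B 3 5 + 3 * B 1 2 * B 4 6 + sgf kc d 2 3 * omf kc d 2 1 = 0"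
 proof -
  have "r34 kc d 0 = - 5 * B 1 2 + B 1 2 * B 2 4 - 4 * B 1 2 * B 3 5 + 3 * B 1 2 * B 4 6 + sgf kc d 2 3 * omf kc d 2 1"
   unfolding r34_def by (simp add: sadp_numeral sadp_one tab om s12 algebra_simps)
  then show ?thesis using eq12(2)[OF adm, of 0] by (simp add: kc_def)
 qed
 have E34_1: "B 1 2 - B 1 2 * B 3 5 + 3 * B 1 2 * B 4 6 - 2 * B 1 2 * B 5 7 = 0"
 proof -
  have "r34 kc d 1 = B 1 2 - B 1 2 * B 3 5 + 3 * B 1 2 * B 4 6 - 2 * B 1 2 * B 5 7"
   unfolding r34_def by (simp add: sadp_numeral sadp_one tab om s12 algebra_simps)
  then show ?thesis using eq12(2)[OF adm, of 1] by (simp add: kc_def)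
 qed
 have E34_4: "- 2 * B 3 5 * B 8 9 + 3 * B 4 6 * B 8 9 - B 5 7 * B 8 9 - B 8 9 = 0"
 proof -
  have "r34 kc d 4 = - 2 * B 3 5 * B 8 9 + 3 * B 4 6 * B 8 9 - B 5 7 * B 8 9 - B 8 9"
   unfolding r34_def by (simp add: sadp_numeral sadp_one tab om s12 algebra_simps)
  then show ?thesis using eq12(2)[OF adm, of 4] by (simp add: kc_def)
 qed
 have nz: "B 1 2 \<noteq> 0" "B 8 9 \<noteq> 0" using b by (auto simp: bb_def One_nat_def numeral_2_eq_2)
 have 1: "2 * B 3 5 = 4"
 proof -
  have "B 1 2 * (2 * B 3 5 - 4) = 0" using E23_0 E23_1 by Groebner_Basis.algebra
  then show ?thesis using nz by simp
 qed
 have 2: "3 * B 4 6 = 4 * B 3 5 + 2"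
 proof -
  have "B 1 2 * (3 * B 4 6 - (4 * B 3 5 + 2)) = 0" using E34_0 E23_0 by Groebner_Basis.algebra
  then show ?thesis using nz by simp
 qed
 have 3: "2 * B 5 7 = 1 - B 3 5 + 3 * B 4 6"
 proof -
  have "B 1 2 * (2 * B 5 7 - (1 - B 3 5 + 3 * B 4 6)) = 0" using E34_1 by Groebner_Basis.algebra
  then show ?thesis using nz by simp
 qed
 have 4: "B 5 7 = 3 * B 4 6 - 2 * B 3 5 - 1"
 proof -
  have "B 8 9 * (B 5 7 - (3 * B 4 6 - 2 * B 3 5 - 1)) = 0" using E34_4 by Groebner_Basis.algebra
  then show ?thesis using nz by simp
 qed
 have x: "B 3 5 = 1" using 2 3 4 by Groebner_Basis.algebra
 have "of_nat 2 = (of_nat 4 :: 'a)" using 1 unfolding x by simp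
 then show False using of_nat_inj12[of 2 4] by simp
qed

lemma chain_false: False
proof -
 interpret cs: chain_scalars bb 8 9
  by unfold_locales (use char_ne C11 in \<open>auto simp: One_nat_def\<close>)
 obtain p q where pq: "(p, q) \<in> {(0, 8), (0, 7), (1, 8)}" "bb p \<noteq> 0" "bb q \<noteq> 0"
  "\<And>k. k < 9 ==> k \<noteq> p ==> k \<noteq> q ==> bb k = 0"
  using cs.supportB[OF refl Z11] by blast
 from pq(1) show False
 proof (elim insertE emptyE)
  assume "(p, q) = (0, 8)"
  then show False using no_08 pq(2-4) by auto
 next
  assume "(p, q) = (0, 7)"
  then show False using no_07 pq(2-4) by auto
 next
  assume "(p, q) = (1, 8)"
  then show False using no_18 pq(2-4) by auto
 qed
qed

end

lemma (in minrep) no_chain: "chain scale Basis G g V \<rho> c e w j ==> False"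
 using chain.coords[of scale Basis G g V \<rho> c e w j] chainc.chain_false by blast

section \<open>Double layers without a split vector\<close>

locale proper = minrep scale Basis G g V \<rho>
 for scale :: "'a::field \<Rightarrow> 'b::ab_group_add \<Rightarrow> 'b" (infixr "*s" 75) and Basis :: "'b set"
  and G :: "('g, 'm) monoid_scheme" (structure) and g :: "nat \<Rightarrow> 'g" and V \<rho> +
 fixes c and E :: "nat \<Rightarrow> 'b" and p2 :: 'b and j :: nat and b :: "nat \<Rightarrow> 'a" and th P Q Rr :: 'a
 assumes L10: "L 10 = {0}" and j: "1 \<le> j" "j \<le> 4"
  and E_L: "E k \<in> L k" and p2L: "p2 \<in> L j"
  and TE: "k \<noteq> j ==> Tg c (E k) = E (Suc k)"
  and up: "Suc k = j ==> u2 (E k) = p2"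
  and uE: "Suc k \<noteq> j ==> k \<noteq> j ==> u2 (E k) - b k *s E (Suc k) \<in> L (k + 2)"
  and Tj: "Tg c (E j) - th *s E (Suc j) \<in> L (j + 2)" "Tg c p2 - P *s E (Suc j) \<in> L (j + 2)"
   "u2 (E j) - Q *s E (Suc j) \<in> L (j + 2)" "u2 p2 - Rr *s E (Suc j) \<in> L (j + 2)"
  and det: "th * Rr - P * Q \<noteq> 0"
  and sp: "x \<in> L k ==> k \<noteq> j ==> \<exists>a. x - a *s E k \<in> L (Suc k)"
  and spj: "x \<in> L j ==> \<exists>a a'. x - a *s E j - a' *s p2 \<in> L (Suc j)"
  and nE: "k \<le> 9 ==> k \<noteq> j ==> E k \<notin> L (Suc k)"
  and nj: "a *s E j + a' *s p2 \<in> L (Suc j) ==> a = 0 \<and> a' = 0"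

context minrep
begin

lemma seg:
 assumes h: "\<And>k. s \<le> k ==> k < t ==> \<gamma> k \<noteq> 0 \<and> Tg c (h k) - \<gamma> k *s h (Suc k) \<in> L (k + 2)"
 shows "s + m \<le> t ==> \<exists>l. l \<noteq> 0 \<and> (Tg c ^^ m) (h s) - l *s h (s + m) \<in> L (Suc (s + m))"
proof (induction m)
 case 0
 then show ?case using subspace_0[OF subL] by (intro exI[of _ 1]) simp
next
 case (Suc m)
 then obtain l where l: "l \<noteq> 0" "(Tg c ^^ m) (h s) - l *s h (s + m) \<in> L (Suc (s + m))" by auto
 have g: "\<gamma> (s + m) \<noteq> 0" "Tg c (h (s + m)) - \<gamma> (s + m) *s h (Suc (s + m)) \<in> L (s + m + 2)"
  using h[of "s + m"] Suc.prems by auto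
 have "Tg c ((Tg c ^^ m) (h s) - l *s h (s + m)) \<in> L (s + m + 2)" using Tg_L[OF l(2)] by simp
 from subspace_add[OF subL this subspace_scale[OF subL g(2), of l]]
 have "(Tg c ^^ Suc m) (h s) - (l * \<gamma> (s + m)) *s h (s + Suc m) \<in> L (Suc (s + Suc m))"
  by (simp add: lin_diff[OF lin_Tg] lin_scale[OF lin_Tg] scale_right_diff_distrib)
 then show ?case using l g by (intro exI[of _ "l * \<gamma> (s + m)"]) simp
qed

text \<open>Layer \<open>j\<close> has the basis \<open>E j = Tg c (E (j - 1))\<close>,
  \<open>p2 = u2 (E (j - 1))\<close>. The chain is restarted at \<open>j + 1\<close>, because
  \<open>Tg c\<close> need not be 1 out of the double layer; \<open>th\<close>, \<open>P\<close> and
  \<open>Q\<close>, \<open>Rr\<close> are the scalars of \<open>Tg c\<close> and \<open>u2\<close>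
  from this basis to \<open>E (j + 1)\<close>.\<close>

lemma proper_data:
 assumes L10: "L 10 = {0}" and j: "1 \<le> j" "j \<le> 4"
  and lay: "\<And>k. k \<le> 9 ==> k \<noteq> j ==> dim (L k) \<le> dim (L (Suc k)) + 1"
  and layj: "dim (L j) = dim (L (Suc j)) + 2"
  and propr: "\<And>w. w \<in> L j ==> u1 w \<in> L (j + 2) ==> u2 w \<in> L (j + 2) ==> w \<in> L (Suc j)"
 shows "\<exists>c E p2 b th P Q Rr. proper scale Basis G g V \<rho> c E p2 j b th P Q Rr"
proof -
 have "\<forall>k. \<exists>x. k \<le> 9 \<longrightarrow> x \<in> L k \<and> x \<notin> L (Suc k)" using pick by blast
 then obtain h where h: "\<And>k. k \<le> 9 ==> h k \<in> L k" "\<And>k. k \<le> 9 ==> h k \<notin> L (Suc k)" by metis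
 have z: "x = 0" if "x \<in> L k" "10 \<le> k" for x k using caseB(1)[OF L10 that] .
 have line: "\<exists>a. x - a *s y \<in> L (Suc k)" if "x \<in> L k" "k \<noteq> j" "k \<le> 9" "y \<in> L k" "y \<notin> L (Suc k)" for x y k
  using lay that R_Suc_subset[OF rep] by (intro line_layer[OF subL subL]) auto
 have S2: "L (Suc (Suc k)) = L (k + 2)" for k by simp
 have ab: "\<exists>\<alpha> \<beta>. k \<le> 8 \<and> k \<noteq> j \<and> Suc k \<noteq> j \<longrightarrow> u1 (h k) - \<alpha> *s h (Suc k) \<in> L (k + 2) \<and>
    u2 (h k) - \<beta> *s h (Suc k) \<in> L (k + 2) \<and> (\<alpha> \<noteq> 0 \<or> \<beta> \<noteq> 0)" for k
 proof (cases "k \<le> 8 \<and> k \<noteq> j \<and> Suc k \<noteq> j")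
  case True
  then have k: "k \<le> 9" "Suc k \<le> 9" "Suc k \<noteq> j" "k \<noteq> j" by auto
  obtain \<alpha> where a: "u1 (h k) - \<alpha> *s h (Suc k) \<in> L (k + 2)"
   using line[OF u_L(1)[OF h(1)[OF k(1)]] k(3,2) h[OF k(2)]] unfolding S2 by blast
  obtain \<beta> where b: "u2 (h k) - \<beta> *s h (Suc k) \<in> L (k + 2)"
   using line[OF u_L(2)[OF h(1)[OF k(1)]] k(3,2) h[OF k(2)]] unfolding S2 by blast
  have "\<alpha> \<noteq> 0 \<or> \<beta> \<noteq> 0"
  proof (rule ccontr)
   assume "\<not> ?thesis"
   then have zz: "u1 (h k) \<in> L (k + 2)" "u2 (h k) \<in> L (k + 2)" using a b by auto
   have "L (Suc k) \<subseteq> L (k + 2)"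
   proof (rule layer_next[OF subL subset_refl])
    fix y assume "y \<in> L k"
    then obtain a where "y - a *s h k \<in> L (Suc k)" using line[of y k "h k"] k h by blast
    then show "\<exists>y'. u1 y' \<in> L (k + 2) \<and> u2 y' \<in> L (k + 2) \<and> y - y' \<in> L (Suc k)"
     using zz by (intro exI[of _ "a *s h k"]) (simp only: lin_scale[OF lin_u] subspace_scale[OF subL] simp_thms)
   qed
   then show False using h[OF k(2)] unfolding S2 by blast
  qed
  then show ?thesis using a b by blast
 qed blast
 then obtain \<alpha> \<beta> where ab: "\<And>k. k \<le> 8 ==> k \<noteq> j ==> Suc k \<noteq> j ==> u1 (h k) - \<alpha> k *s h (Suc k) \<in> L (k + 2) \<and>
    u2 (h k) - \<beta> k *s h (Suc k) \<in> L (k + 2) \<and> (\<alpha> k \<noteq> 0 \<or> \<beta> k \<noteq> 0)" by metis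
 let ?good = "\<lambda>k. k \<le> 8 \<and> k \<noteq> j \<and> Suc k \<noteq> j"
 have "\<forall>k<10. (if ?good k then \<alpha> k else 1) \<noteq> 0 \<or> (if ?good k then \<beta> k else 1) \<noteq> 0" using ab by auto
 from ex_generic[OF this] obtain c where
  c: "\<And>k. k < 10 ==> (if ?good k then \<alpha> k else 1) + c * (if ?good k then \<beta> k else 1) \<noteq> 0" by blast
 have T: "\<alpha> k + c * \<beta> k \<noteq> 0 \<and> Tg c (h k) - (\<alpha> k + c * \<beta> k) *s h (Suc k) \<in> L (k + 2)"
  if "k \<le> 8" "k \<noteq> j" "Suc k \<noteq> j" for k
 proof -
  have "(u1 (h k) - \<alpha> k *s h (Suc k)) + c *s (u2 (h k) - \<beta> k *s h (Suc k)) \<in> L (k + 2)"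
   using ab[OF that] by (intro subspace_add[OF subL] subspace_scale[OF subL]) auto
  then show ?thesis using c[of k] that by (auto simp: Tg_def algebra_simps)
 qed
 define E where "E k = (if k \<le> j then (Tg c ^^ k) (h 0) else (Tg c ^^ (k - Suc j)) (h (Suc j)))" for k
 define p2 where "p2 = u2 (E (j - 1))"
 have pw: "x \<in> L s ==> (Tg c ^^ m) x \<in> L (s + m)" for x s m
 proof (induction m)
  case (Suc m)
  then show ?case using Tg_L[of "(Tg c ^^ m) x" "s + m"] by simp
 qed simp
 have E_L: "E k \<in> L k" for k
  using pw[OF h(1)[of 0], of k] pw[OF h(1)[of "Suc j"], of "k - Suc j"] j by (auto simp: E_def)
 have TE: "Tg c (E k) = E (Suc k)" if "k \<noteq> j" for k
 proof (cases "k < j")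
  case True
  then show ?thesis by (simp add: E_def)
 next
  case False
  then have "Suc k - Suc j = Suc (k - Suc j)" using that by simp
  then show ?thesis using False that by (simp add: E_def del: diff_Suc_Suc)
 qed
 have lead: "\<exists>l. l \<noteq> 0 \<and> E k - l *s h k \<in> L (Suc k)" if "k \<le> 9" "k \<noteq> j" for k
 proof (cases "k < j")
  case True
  have "\<exists>l. l \<noteq> 0 \<and> (Tg c ^^ k) (h 0) - l *s h (0 + k) \<in> L (Suc (0 + k))"
   by (rule seg[where t = "j - 1" and \<gamma> = "\<lambda>k. \<alpha> k + c * \<beta> k"]) (use T j True in auto)
  then show ?thesis using True by (simp add: E_def)
 next
  case False
  have "\<exists>l. l \<noteq> 0 \<and> (Tg c ^^ (k - Suc j)) (h (Suc j)) - l *s h (Suc j + (k - Suc j)) \<in> L (Suc (Suc j + (k - Suc j)))"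
   by (rule seg[where t = 9 and \<gamma> = "\<lambda>k. \<alpha> k + c * \<beta> k"]) (use T j False that in auto)
  then show ?thesis using False that by (simp add: E_def)
 qed
 have nE: "E k \<notin> L (Suc k)" if k: "k \<le> 9" "k \<noteq> j" for k
 proof
  assume a: "E k \<in> L (Suc k)"
  obtain l where l: "l \<noteq> 0" "E k - l *s h k \<in> L (Suc k)" using lead[OF k] by blast
  from subspace_scale[OF subL subspace_diff[OF subL a l(2)], of "inverse l"]
  show False using l h(2)[OF k(1)] by simp
 qed
 have sp: "\<exists>a. x - a *s E k \<in> L (Suc k)" if "x \<in> L k" "k \<noteq> j" for x k
 proof (cases "k \<le> 9")
  case True
  then show ?thesis using line[OF that True E_L nE[OF True that(2)]] by blast
 next
  case False
  then show ?thesis using z[OF that(1)] subspace_0[OF subL] by (intro exI[of _ 0]) simp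
 qed
 define k0 where "k0 = j - 1"
 have k0: "Suc k0 = j" "k0 \<noteq> j" using j by (auto simp: k0_def)
 have p2: "p2 = u2 (E k0)" "E j = Tg c (E k0)" using TE[OF k0(2)] k0 by (auto simp: p2_def k0_def)
 have p2L: "p2 \<in> L j" using u_L(2)[OF E_L[of k0]] k0 p2 by simp
 let ?S = "span (insert (E j) (insert p2 (L (Suc j))))"
 have u1E: "u1 (E k0) = E j - c *s p2" unfolding p2 by (simp add: Tg_def)
 have LS: "L j \<subseteq> ?S"
 proof -
  have "L (Suc k0) \<subseteq> ?S"
  proof (rule layer_next[OF subspace_span])
   show "L (k0 + 2) \<subseteq> ?S" using k0 span_superset[of "insert (E j) (insert p2 (L (Suc j)))"] by auto
   fix y assume "y \<in> L k0"
   then obtain a where a: "y - a *s E k0 \<in> L (Suc k0)" using sp k0 by blast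
   have "p2 \<in> ?S" "E j \<in> ?S" by (auto intro: span_base)
   then have "u1 (E k0) \<in> ?S" "u2 (E k0) \<in> ?S" unfolding u1E p2(1)[symmetric]
    by (auto intro: span_diff span_scale)
   then show "\<exists>y'. u1 y' \<in> ?S \<and> u2 y' \<in> ?S \<and> y - y' \<in> L (Suc k0)"
    using a by (intro exI[of _ "a *s E k0"]) (auto simp only: lin_scale[OF lin_u] intro: span_scale)
  qed
  then show ?thesis using k0 by simp
 qed
 have spL: "span (L (Suc j)) = L (Suc j)" by (rule span_eq_iff[THEN iffD2, OF subL])
 have spj: "\<exists>a a'. x - a *s E j - a' *s p2 \<in> L (Suc j)" if "x \<in> L j" for x
 proof -
  have "x \<in> ?S" using LS that by blast
  then show ?thesis unfolding span_breakdown_eq spL .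
 qed
 have d2: "dim (insert (E j) (insert p2 (L (Suc j)))) \<ge> dim (L (Suc j)) + 2"
  using dim_subset[OF LS] layj by simp
 have p2n: "p2 \<notin> span (L (Suc j))"
 proof
  assume "p2 \<in> span (L (Suc j))"
  then have "dim (insert p2 (L (Suc j))) = dim (L (Suc j))" by (simp add: dim_insert)
  then show False using d2 by (simp add: dim_insert split: if_splits)
 qed
 have En: "E j \<notin> span (insert p2 (L (Suc j)))"
 proof
  assume a: "E j \<in> span (insert p2 (L (Suc j)))"
  have "dim (insert p2 (L (Suc j))) \<le> dim (L (Suc j)) + 1" by (simp add: dim_insert)
  then show False using d2 a dim_insert[of "E j" "insert p2 (L (Suc j))"] by simp
 qed
 have nj: "a = 0 \<and> a' = 0" if aa: "a *s E j + a' *s p2 \<in> L (Suc j)" for a a'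
 proof -
  have a0: "a = 0"
  proof (rule ccontr)
   assume "a \<noteq> 0"
   have "(a *s E j + a' *s p2) - a' *s p2 \<in> span (insert p2 (L (Suc j)))"
    by (intro span_diff span_scale) (use aa in \<open>auto intro: span_base\<close>)
   then have "a *s E j \<in> span (insert p2 (L (Suc j)))" by simp
   from span_scale[OF this, of "inverse a"]
   have "inverse a *s (a *s E j) \<in> span (insert p2 (L (Suc j)))" .
   moreover have "inverse a *s (a *s E j) = E j" using \<open>a \<noteq> 0\<close> by simp
   ultimately show False using En by (simp only:)
  qed
  moreover have "a' = 0"
  proof (rule ccontr)
   assume "a' \<noteq> 0"
   have "a' *s p2 \<in> L (Suc j)" using aa a0 by simp
   from subspace_scale[OF subL this, of "inverse a'"] show False
    using p2n \<open>a' \<noteq> 0\<close> unfolding spL by simp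
  qed
  ultimately show ?thesis by simp
 qed
 have j9: "Suc j \<noteq> j" "Suc j \<le> 9" using j by auto
 have ex: "\<exists>a. x - a *s E (Suc j) \<in> L (j + 2)" if "x \<in> L (Suc j)" for x
  using sp[OF that j9(1)] by simp
 obtain th where th: "Tg c (E j) - th *s E (Suc j) \<in> L (j + 2)" using ex[OF Tg_L[OF E_L]] by blast
 obtain P where P: "Tg c p2 - P *s E (Suc j) \<in> L (j + 2)" using ex[OF Tg_L[OF p2L]] by blast
 obtain Q where Q: "u2 (E j) - Q *s E (Suc j) \<in> L (j + 2)" using ex[OF u_L(2)[OF E_L]] by blast
 obtain Rr where Rr: "u2 p2 - Rr *s E (Suc j) \<in> L (j + 2)" using ex[OF u_L(2)[OF p2L]] by blast
 \<comment> \<open>A vanishing determinant would give a combination of \<open>E j\<close> and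
   \<open>p2\<close> that both generators send into \<open>L (j + 2)\<close>, that is a split
   vector.\<close>
 have det: "th * Rr - P * Q \<noteq> 0"
 proof
  assume d0: "th * Rr - P * Q = 0"
  have comb: "s = 0 \<and> t = 0" if st: "s * th + t * P = 0" "s * Q + t * Rr = 0" for s t
  proof -
   let ?w = "s *s E j + t *s p2"
   have T: "Tg c ?w \<in> L (j + 2)"
   proof -
    have "s *s (Tg c (E j) - th *s E (Suc j)) + t *s (Tg c p2 - P *s E (Suc j)) \<in> L (j + 2)"
     by (intro subspace_add[OF subL] subspace_scale[OF subL] th P)
    also have "s *s (Tg c (E j) - th *s E (Suc j)) + t *s (Tg c p2 - P *s E (Suc j)) = Tg c ?w - (s * th + t * P) *s E (Suc j)"
     by (simp add: lin_add[OF lin_Tg] lin_scale[OF lin_Tg] algebra_simps)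
    finally show ?thesis using st by simp
   qed
   have U: "u2 ?w \<in> L (j + 2)"
   proof -
    have "s *s (u2 (E j) - Q *s E (Suc j)) + t *s (u2 p2 - Rr *s E (Suc j)) \<in> L (j + 2)"
     by (intro subspace_add[OF subL] subspace_scale[OF subL] Q Rr)
    also have "s *s (u2 (E j) - Q *s E (Suc j)) + t *s (u2 p2 - Rr *s E (Suc j)) = u2 ?w - (s * Q + t * Rr) *s E (Suc j)"
     by (simp add: lin_add[OF lin_u] lin_scale[OF lin_u] algebra_simps)
    finally show ?thesis using st by simp
   qed
   have "u1 ?w \<in> L (j + 2)"
    using subspace_diff[OF subL T subspace_scale[OF subL U, of c]] by (simp add: Tg_def)
   moreover have "?w \<in> L j" by (intro subspace_add[OF subL] subspace_scale[OF subL] E_L p2L)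
   ultimately have "?w \<in> L (Suc j)" using propr U by blast
   then show ?thesis by (rule nj)
  qed
  have "P = 0 \<and> - th = 0" by (rule comb) (use d0 in \<open>simp_all add: algebra_simps\<close>)
  moreover have "Rr = 0 \<and> - Q = 0" by (rule comb) (use d0 in \<open>simp_all add: algebra_simps\<close>)
  ultimately show False using comb[of 1 0] by simp
 qed
 have "\<exists>a. Suc k \<noteq> j \<and> k \<noteq> j \<longrightarrow> u2 (E k) - a *s E (Suc k) \<in> L (k + 2)" for k
  using sp[OF u_L(2)[OF E_L[of k]]] by (cases "Suc k = j") auto
 then obtain b where b: "\<And>k. Suc k \<noteq> j ==> k \<noteq> j ==> u2 (E k) - b k *s E (Suc k) \<in> L (k + 2)" by metis
 have "proper scale Basis G g V \<rho> c E p2 j b th P Q Rr"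
 proof unfold_locales
  show "L 10 = {0}" "1 \<le> j" "j \<le> 4" by fact+
  show "E k \<in> L k" for k by (rule E_L)
  show "p2 \<in> L j" by (rule p2L)
  show "k \<noteq> j ==> Tg c (E k) = E (Suc k)" for k by (rule TE)
  show "Suc k = j ==> u2 (E k) = p2" for k using p2(1) k0(1) by (metis nat.inject)
  show "Suc k \<noteq> j ==> k \<noteq> j ==> u2 (E k) - b k *s E (Suc k) \<in> L (k + 2)" for k by (rule b)
  show "Tg c (E j) - th *s E (Suc j) \<in> L (j + 2)" by (rule th)
  show "Tg c p2 - P *s E (Suc j) \<in> L (j + 2)" by (rule P)
  show "u2 (E j) - Q *s E (Suc j) \<in> L (j + 2)" by (rule Q)
  show "u2 p2 - Rr *s E (Suc j) \<in> L (j + 2)" by (rule Rr)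
  show "th * Rr - P * Q \<noteq> 0" by (rule det)
  show "x \<in> L k ==> k \<noteq> j ==> \<exists>a. x - a *s E k \<in> L (Suc k)" for x k by (rule sp)
  show "x \<in> L j ==> \<exists>a a'. x - a *s E j - a' *s p2 \<in> L (Suc j)" for x by (rule spj)
  show "k \<le> 9 ==> k \<noteq> j ==> E k \<notin> L (Suc k)" for k by (rule nE)
  show "a *s E j + a' *s p2 \<in> L (Suc j) ==> a = 0 \<and> a' = 0" for a a' by (rule nj)
 qed
 then show ?thesis by blast
qed

end

context proper
begin

lemma z10: "x \<in> L k ==> 10 \<le> k ==> x = 0"
 using caseB(1)[OF L10] .

lemma Z_E0: "Z (E 0) \<noteq> 0"
proof
 assume z: "Z (E 0) = 0"
 obtain v where v: "v \<in> V" "Z v \<noteq> 0" using Znz by blast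
 obtain a where "v - a *s E 0 \<in> L (Suc 0)" using sp[of v 0] v j by auto
 then have "Z (v - a *s E 0) = 0" by (rule Z_L1)
 then show False using v z by (simp add: lin_diff[OF lin_u] lin_scale[OF lin_u])
qed

text \<open>The second coordinate is alive only in degree \<open>j\<close>. The scalars
  \<open>ta\<close>, \<open>tb\<close> belong to \<open>Tg c\<close>, the scalars \<open>ua\<close>,
  \<open>ub\<close>, \<open>uc\<close> to \<open>u2\<close>, and \<open>uc\<close> records
  \<open>u2 (E (j - 1)) = p2\<close>.\<close>

definition Wp :: "nat \<Rightarrow> 'b" where "Wp k = (if k = j then p2 else 0)"
definition ta :: "nat \<Rightarrow> 'a" where "ta k = (if k = j then th else 1)"
definition tb :: "nat \<Rightarrow> 'a" where "tb k = (if k = j then P else 0)"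
definition ua :: "nat \<Rightarrow> 'a" where "ua k = (if k = j then Q else if Suc k = j then 0 else b k)"
definition ub :: "nat \<Rightarrow> 'a" where "ub k = (if k = j then Rr else 0)"
definition uc :: "nat \<Rightarrow> 'a" where "uc k = (if Suc k = j then 1 else 0)"

abbreviation "PT \<equiv> \<lambda>n (st :: 'a \<times> 'a). (ta n * fst st + tb n * snd st, 0 * fst st + 0 * snd st)"
abbreviation "PU \<equiv> \<lambda>n (st :: 'a \<times> 'a). (ua n * fst st + ub n * snd st, uc n * fst st + 0 * snd st)"
abbreviation "PX n \<equiv> sadp 1 1 PT PU n"
abbreviation "Xo n \<equiv> adp (Tg c) u2 n"

lemma sym_PT: "sym (\<lambda>k. L (k + 1)) (pf E Wp) 1 (Tg c) PT"
proof (rule sym2I[OF lin_Tg filtL])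
 show "raises (\<lambda>k. L k) 1 (Tg c)" unfolding raises_def using Tg_L by (auto simp: One_nat_def)
 show "Tg c (E k) - (ta k *s E (k + 1) + 0 *s Wp (k + 1)) \<in> L (k + 1 + 1)" for k
  using Tj(1) TE[of k] subspace_0[OF subL] by (auto simp: ta_def One_nat_def)
 show "Tg c (Wp k) - (tb k *s E (k + 1) + 0 *s Wp (k + 1)) \<in> L (k + 1 + 1)" for k
  using Tj(2) lin_0[OF lin_Tg] subspace_0[OF subL] by (auto simp: tb_def Wp_def One_nat_def)
qed

lemma sym_PU: "sym (\<lambda>k. L (k + 1)) (pf E Wp) 1 u2 PU"
proof (rule sym2I[OF lin_u filtL raisesL(2)])
 show "u2 (E k) - (ua k *s E (k + 1) + uc k *s Wp (k + 1)) \<in> L (k + 1 + 1)" for k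
  using Tj(3) uE[of k] up[of k] subspace_0[OF subL] by (auto simp: ua_def uc_def Wp_def One_nat_def)
 show "u2 (Wp k) - (ub k *s E (k + 1) + 0 *s Wp (k + 1)) \<in> L (k + 1 + 1)" for k
  using Tj(4) lin_0[OF lin_u] subspace_0[OF subL] by (auto simp: ub_def Wp_def One_nat_def)
qed

lemma sym_PX: "sym (\<lambda>k. L (k + 1)) (pf E Wp) (n * 1 + 1) (Xo n) (PX n)"
 by (rule sym_adp[OF phi_add_pf sym_PT sym_PU])

lemma pfL: "pf E Wp k st \<in> L k"
 unfolding pf_def Wp_def using E_L p2L subspace_0[OF subL]
 by (intro subspace_add[OF subL] subspace_scale[OF subL]) auto

lemma pf0: "pf E Wp k st \<in> L (k + 1) ==> k \<le> 9 ==> fst st = 0 \<and> (k = j \<longrightarrow> snd st = 0)"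
proof (cases "k = j")
 case True
 assume "pf E Wp k st \<in> L (k + 1)"
 then show ?thesis using nj[of "fst st" "snd st"] True by (simp add: pf_def Wp_def One_nat_def)
next
 case False
 assume a: "pf E Wp k st \<in> L (k + 1)" "k \<le> 9"
 then have s: "fst st *s E k \<in> L (Suc k)" using False by (simp add: pf_def Wp_def One_nat_def)
 have "fst st = 0"
 proof (rule ccontr)
  assume "fst st \<noteq> 0"
  with subspace_scale[OF subL s, of "inverse (fst st)"] nE[OF a(2) False] show False by simp
 qed
 then show ?thesis using False by simp
qed

definition br where "br n m k st = PX n (k + (m + 1)) (PX m k st) - PX m (k + (n + 1)) (PX n k st)"

lemma sym_br: "sym (\<lambda>k. L (k + 1)) (pf E Wp) (n + m + 2) (cm (Xo n) (Xo m)) (br n m)"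
proof -
 have e: "br n m = (\<lambda>k s. PX n (k + (m * 1 + 1)) (PX m k s) - PX m (k + (n * 1 + 1)) (PX n k s))"
  by (intro ext) (simp add: br_def)
 have i: "n * 1 + 1 + (m * 1 + 1) = n + m + 2" by simp
 show ?thesis using sym_cm[OF phi_add_pf sym_PX[of n] sym_PX[of m]] unfolding e i .
qed

lemma br0:
 assumes r: "raises (\<lambda>k. L k) (n + m + 3) (cm (Xo n) (Xo m))" and k: "k + (n + m + 2) \<le> 9"
 shows "fst (br n m k st) = 0 \<and> (k + (n + m + 2) = j \<longrightarrow> snd (br n m k st) = 0)"
proof -
 have "raises (\<lambda>k. L k) (n + m + 2 + 1) (cm (Xo n) (Xo m))" using r by (simp add: numeral_3_eq_3 One_nat_def)
 from sym_vanish[OF sym_br filtL this pfL] show ?thesis using pf0 k by blast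
qed

lemma rel2n: "1 \<le> n ==> n \<le> 6 ==> k + (n + 2) \<le> 9 ==> fst (br 0 n k st) = 0 \<and> (k + (n + 2) = j \<longrightarrow> snd (br 0 n k st) = 0)"
proof -
 assume n: "1 \<le> n" "n \<le> 6" "k + (n + 2) \<le> 9"
 interpret a: prep11 scale Basis G g V \<rho> "\<lambda>k. L k" by (rule prep11L)
 have Tc: "a.Tc c = Tg c" by (simp add: a.Tc_def Tg_def)
 have "raises (\<lambda>k. L k) (0 + n + 3) (cm (Xo 0) (Xo n))" using a.rel11_2n[OF n(1,2), of c] unfolding Tc by simp
 from br0[OF this, of k st] n(3) show ?thesis by simp
qed

lemma rel34: "k + 5 \<le> 9 ==> fst (br 1 2 k st) = 0"
proof -
 assume n: "k + 5 \<le> 9"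
 interpret a: prep11 scale Basis G g V \<rho> "\<lambda>k. L k" by (rule prep11L)
 have Tc: "a.Tc c = Tg c" by (simp add: a.Tc_def Tg_def)
 have "raises (\<lambda>k. L k) (1 + 2 + 3) (cm (Xo 1) (Xo 2))" using a.rel11_34[of c] unfolding Tc by simp
 from br0[OF this, of k st] n show ?thesis by simp
qed

lemma relZ: "fst (br 0 7 0 (1, 0)) \<noteq> 0"
proof
 assume f: "fst (br 0 7 0 (1, 0)) = 0"
 interpret a: prep11 scale Basis G g V \<rho> "\<lambda>k. L k" by (rule prep11L)
 have Tc: "a.Tc c = Tg c" by (simp add: a.Tc_def Tg_def)
 have s: "cm (Xo 0) (Xo 7) (pf E Wp 0 (1, 0)) - pf E Wp 9 (br 0 7 0 (1, 0)) \<in> L 10"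
  using symD[OF sym_br[of 0 7], of 0 "(1, 0)"] by simp
 have "pf E Wp 9 (br 0 7 0 (1, 0)) = 0" using f j by (simp add: pf_def Wp_def)
 moreover have e0: "pf E Wp 0 (1, 0) = E 0" by (simp add: pf_def)
 ultimately have 1: "cm (Xo 0) (Xo 7) (E 0) \<in> L 10" using s by simp
 have 2: "cm (Xo 0) (Xo 7) (E 0) - Z (E 0) \<in> L 10"
  using raisesD[OF a.rel11_z[of c, unfolded Tc] E_L[of 0]] by simp
 from subspace_diff[OF subL 1 2] have "Z (E 0) = 0" using L10 by simp
 then show False using Z_E0 by simp
qed

lemma br01: "br 0 1 k st = PU (k + 2) (PT (k + 1) (PU k st) - PU (k + 1) (PT k st))
  - (PT (k + 2) (PU (k + 1) (PU k st)) - PU (k + 2) (PT (k + 1) (PU k st)))"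
proof -
 have i: "k + (1 + 1) = k + 2" "k + (0 + 1) = k + 1" "k + 1 + 1 = k + 2" by simp_all
 show ?thesis unfolding br_def i sadp_one sadp.simps(1) by (rule refl)
qed

text \<open>On the two basis vectors of layer \<open>j\<close> the bracket relation is a linear
  system for \<open>2 * b (j + 2) - b (j + 1)\<close> and \<open>b (j + 1) * b (j + 2)\<close> whose
  determinant is that of \<open>det\<close>, so both vanish. Read on layer \<open>j - 1\<close> it
  gives \<open>Rr = 0\<close>.\<close>

lemma gap_after: "b (j + 1) = 0 \<and> b (j + 2) = 0 \<and> Rr = 0 \<and> P \<noteq> 0 \<and> Q \<noteq> 0"
proof -
 define x y where "x = b (j + 1)" and "y = b (j + 2)"
 have t: "ta j = th" "tb j = P" "ua j = Q" "ub j = Rr" "uc j = 0" "ta (j + 1) = 1" "tb (j + 1) = 0" "ua (j + 1) = x"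
  "ub (j + 1) = 0" "uc (j + 1) = 0" "ta (j + 2) = 1" "tb (j + 2) = 0" "ub (j + 2) = 0" "uc (j + 2) = 0" "ua (j + 2) = y"
  unfolding ta_def tb_def ua_def ub_def uc_def x_def y_def by auto
 have e1: "- Q * x + 2 * Q * y - x * y * th = 0"
 proof -
  have "fst (br 0 1 j (1, 0)) = - Q * x + 2 * Q * y - x * y * th"
   unfolding br01 t by (simp add: algebra_simps)
  then show ?thesis using rel2n[of 1 j "(1, 0)"] j by simp
 qed
 have e2: "- P * x * y - Rr * x + 2 * Rr * y = 0"
 proof -
  have "fst (br 0 1 j (0, 1)) = - P * x * y - Rr * x + 2 * Rr * y"
   unfolding br01 t by (simp add: algebra_simps)
  then show ?thesis using rel2n[of 1 j "(0, 1)"] j by simp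
 qed
 have "x * y * (th * Rr - P * Q) = 0" using e1 e2 by Groebner_Basis.algebra
 then have xy: "x * y = 0" using det by simp
 have "Q * (2 * y - x) = 0" "Rr * (2 * y - x) = 0" using e1 e2 xy by Groebner_Basis.algebra+
 moreover have "Q \<noteq> 0 \<or> Rr \<noteq> 0" using det by auto
 ultimately have "x = 2 * y" by auto
 then have "2 * (y * y) = 0" using xy by simp
 then have y0: "y = 0" using char_ne[of 2] by simp
 then have x0: "x = 0" using \<open>x = 2 * y\<close> by simp
 define k where "k = j - 1"
 have k: "Suc k = j" "k + 1 = j" "k + 2 = j + 1" using j by (auto simp: k_def)
 have tk: "ta k = 1" "tb k = 0" "ua k = 0" "ub k = 0" "uc k = 1" "ta (k + 1) = th" "tb (k + 1) = P" "ua (k + 1) = Q"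
  "ub (k + 1) = Rr" "uc (k + 1) = 0" "ta (k + 2) = 1" "tb (k + 2) = 0" "ub (k + 2) = 0" "uc (k + 2) = 0" "ua (k + 2) = x"
  unfolding ta_def tb_def ua_def ub_def uc_def x_def using k by (auto simp: One_nat_def)
 have "fst (br 0 1 k (1, 0)) = 2 * P * x - Q * x - Rr"
  unfolding br01 tk by (simp add: algebra_simps)
 then have "Rr = 0" using rel2n[of 1 k "(1, 0)"] k j x0 by simp
 then show ?thesis using x0 y0 det by (auto simp: x_def y_def)
qed

text \<open>Weights (1,1) suffice: \<open>b 0 = 0\<close>, so \<open>relZ\<close> needs
  \<open>b 8 \<noteq> 0\<close>; the other relations then make one scalar after another vanish until
  only \<open>2 * Q * b 8 = 0\<close> remains.\<close>

lemma j2: assumes jj: "j = 2" shows False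
proof -
 have z: "b 3 = 0" "b 4 = 0" "Rr = 0" "P \<noteq> 0" "Q \<noteq> 0" using gap_after jj by auto
 have s12: "Suc 0 = 1" "Suc (Suc 0) = 2" by (simp_all add: One_nat_def)
 have tab: "ta 0 = 1" "tb 0 = 0" "ua 0 = b 0" "ub 0 = 0" "uc 0 = 0" "ta 1 = 1" "tb 1 = 0" "ua 1 = 0" "ub 1 = 0" "uc 1 = 1" "ta 2 = th" "tb 2 = P" "ua 2 = Q" "ub 2 = Rr" "uc 2 = 0" "ta 3 = 1" "tb 3 = 0" "ua 3 = b 3" "ub 3 = 0" "uc 3 = 0" "ta 4 = 1" "tb 4 = 0" "ua 4 = b 4" "ub 4 = 0" "uc 4 = 0" "ta 5 = 1" "tb 5 = 0" "ua 5 = b 5" "ub 5 = 0" "uc 5 = 0" "ta 6 = 1" "tb 6 = 0" "ua 6 = b 6" "ub 6 = 0" "uc 6 = 0" "ta 7 = 1" "tb 7 = 0" "ua 7 = b 7" "ub 7 = 0" "uc 7 = 0" "ta 8 = 1" "tb 8 = 0" "ua 8 = b 8" "ub 8 = 0" "uc 8 = 0" "ta 9 = 1" "tb 9 = 0" "ua 9 = b 9" "ub 9 = 0" "uc 9 = 0"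
  unfolding ta_def tb_def ua_def ub_def uc_def using jj by (simp_all add: One_nat_def)
 have E12_0: "- 4 * P * b 3 + 3 * P * b 4 - Q * b 0 + Q * b 3 - Q * b 4 + Rr + 3 * b 0 * b 3 * th - 2 * b 0 * b 4 * th = 0"
 proof -
  have "fst (br 1 2 0 (1, 0)) = - 4 * P * b 3 + 3 * P * b 4 - Q * b 0 + Q * b 3 - Q * b 4 + Rr + 3 * b 0 * b 3 * th - 2 * b 0 * b 4 * th"
   unfolding br_def by (simp add: sadp_numeral sadp_one tab s12 algebra_simps)
  then show ?thesis using rel34[of 0 "(1, 0)"] jj by simp
 qed
 have E03_4: "- b 4 * b 5 + 3 * b 4 * b 6 - 3 * b 4 * b 7 + 2 * b 4 * b 8 - 3 * b 5 * b 8 + 3 * b 6 * b 8 - b 7 * b 8 = 0"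
 proof -
  have "fst (br 0 3 4 (1, 0)) = - b 4 * b 5 + 3 * b 4 * b 6 - 3 * b 4 * b 7 + 2 * b 4 * b 8 - 3 * b 5 * b 8 + 3 * b 6 * b 8 - b 7 * b 8"
   unfolding br_def by (simp add: sadp_numeral sadp_one tab s12 algebra_simps)
  then show ?thesis using rel2n[of 3 4 "(1, 0)"] jj by simp
 qed
 have E04_3: "- b 3 * b 4 + 4 * b 3 * b 5 - 6 * b 3 * b 6 + 4 * b 3 * b 7 - 4 * b 4 * b 8 + 6 * b 5 * b 8 - 4 * b 6 * b 8 + b 7 * b 8 = 0"
 proof -
  have "fst (br 0 4 3 (1, 0)) = - b 3 * b 4 + 4 * b 3 * b 5 - 6 * b 3 * b 6 + 4 * b 3 * b 7 - 4 * b 4 * b 8 + 6 * b 5 * b 8 - 4 * b 6 * b 8 + b 7 * b 8"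
   unfolding br_def by (simp add: sadp_numeral sadp_one tab s12 algebra_simps)
  then show ?thesis using rel2n[of 4 3 "(1, 0)"] jj by simp
 qed
 have E02_3: "- b 3 * b 4 + 2 * b 3 * b 5 - 2 * b 4 * b 6 + b 5 * b 6 = 0"
 proof -
  have "fst (br 0 2 3 (1, 0)) = - b 3 * b 4 + 2 * b 3 * b 5 - 2 * b 4 * b 6 + b 5 * b 6"
   unfolding br_def by (simp add: sadp_numeral sadp_one tab s12 algebra_simps)
  then show ?thesis using rel2n[of 2 3 "(1, 0)"] jj by simp
 qed
 have E05_2: "- Q * b 3 + 5 * Q * b 4 - 10 * Q * b 5 + 10 * Q * b 6 - 5 * Q * b 7 + 2 * Q * b 8 - 5 * b 3 * b 8 * th + 10 * b 4 * b 8 * th - 10 * b 5 * b 8 * th + 5 * b 6 * b 8 * th - b 7 * b 8 * th = 0"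
 proof -
  have "fst (br 0 5 2 (1, 0)) = - Q * b 3 + 5 * Q * b 4 - 10 * Q * b 5 + 10 * Q * b 6 - 5 * Q * b 7 + 2 * Q * b 8 - 5 * b 3 * b 8 * th + 10 * b 4 * b 8 * th - 10 * b 5 * b 8 * th + 5 * b 6 * b 8 * th - b 7 * b 8 * th"
   unfolding br_def by (simp add: sadp_numeral sadp_one tab s12 algebra_simps)
  then show ?thesis using rel2n[of 5 2 "(1, 0)"] jj by simp
 qed
 have E07_0: "- P * b 0 - 7 * P * b 8 + 7 * Q * b 0 + 21 * Q * b 8 - 21 * b 0 * b 3 * th + 35 * b 0 * b 4 * th - 35 * b 0 * b 5 * th + 21 * b 0 * b 6 * th - 7 * b 0 * b 7 * th + 2 * b 0 * b 8 * th - 35 * b 3 * b 8 * th + 35 * b 4 * b 8 * th - 21 * b 5 * b 8 * th + 7 * b 6 * b 8 * th - b 7 * b 8 * th \<noteq> 0"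
 proof -
  have "fst (br 0 7 0 (1, 0)) = - P * b 0 - 7 * P * b 8 + 7 * Q * b 0 + 21 * Q * b 8 - 21 * b 0 * b 3 * th + 35 * b 0 * b 4 * th - 35 * b 0 * b 5 * th + 21 * b 0 * b 6 * th - 7 * b 0 * b 7 * th + 2 * b 0 * b 8 * th - 35 * b 3 * b 8 * th + 35 * b 4 * b 8 * th - 21 * b 5 * b 8 * th + 7 * b 6 * b 8 * th - b 7 * b 8 * th"
   unfolding br_def by (simp add: sadp_numeral sadp_one tab s12 algebra_simps)
  then show ?thesis using relZ by simp
 qed

 have b0: "b 0 = 0" using E12_0 z by simp
 have b8: "b 8 \<noteq> 0" using E07_0 z b0 by auto
 have "b 8 * (3 * b 5 - b 6) = 0" "b 8 * (b 7 - 3 * b 6 + 3 * b 5) = 0" using E03_4 E04_3 z by Groebner_Basis.algebra+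
 then have 6: "b 6 = 3 * b 5" and 7: "b 7 = 3 * b 6 - 3 * b 5" using b8 by (auto simp: algebra_simps)
 have "3 * (b 5 * b 5) = 0" using E02_3 z 6 by Groebner_Basis.algebra
 then have "b 5 = 0" using char_ne[of 3] by simp
 then show False using E05_2 6 7 z b8 char_ne[of 2] by simp
qed

text \<open>Weights (1,1) suffice: all scalars other than \<open>b 0\<close> vanish,
  \<open>relZ\<close> needs \<open>b 0 \<noteq> 0\<close>, and then \<open>2 * Q = 3 * P\<close> and
  \<open>Q = P\<close>.\<close>

lemma j4: assumes jj: "j = 4" shows False
proof -
 have z: "b 5 = 0" "b 6 = 0" "Rr = 0" "P \<noteq> 0" "Q \<noteq> 0" using gap_after jj by auto
 have s12: "Suc 0 = 1" "Suc (Suc 0) = 2" by (simp_all add: One_nat_def)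
 have tab: "ta 0 = 1" "tb 0 = 0" "ua 0 = b 0" "ub 0 = 0" "uc 0 = 0" "ta 1 = 1" "tb 1 = 0" "ua 1 = b 1" "ub 1 = 0" "uc 1 = 0" "ta 2 = 1" "tb 2 = 0" "ua 2 = b 2" "ub 2 = 0" "uc 2 = 0" "ta 3 = 1" "tb 3 = 0" "ua 3 = 0" "ub 3 = 0" "uc 3 = 1" "ta 4 = th" "tb 4 = P" "ua 4 = Q" "ub 4 = Rr" "uc 4 = 0" "ta 5 = 1" "tb 5 = 0" "ua 5 = b 5" "ub 5 = 0" "uc 5 = 0" "ta 6 = 1" "tb 6 = 0" "ua 6 = b 6" "ub 6 = 0" "uc 6 = 0" "ta 7 = 1" "tb 7 = 0" "ua 7 = b 7" "ub 7 = 0" "uc 7 = 0" "ta 8 = 1" "tb 8 = 0" "ua 8 = b 8" "ub 8 = 0" "uc 8 = 0" "ta 9 = 1" "tb 9 = 0" "ua 9 = b 9" "ub 9 = 0" "uc 9 = 0"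
  unfolding ta_def tb_def ua_def ub_def uc_def using jj by (simp_all add: One_nat_def)
 have E01_1: "- b 1 * b 2 = 0"
 proof -
  have "fst (br 0 1 1 (1, 0)) = - b 1 * b 2"
   unfolding br_def by (simp add: sadp_numeral sadp_one tab s12 algebra_simps)
  then show ?thesis using rel2n[of 1 1 "(1, 0)"] jj by simp
 qed
 have E01_1s: "2 * b 1 - b 2 = 0"
 proof -
  have "snd (br 0 1 1 (1, 0)) = 2 * b 1 - b 2"
   unfolding br_def by (simp add: sadp_numeral sadp_one tab s12 algebra_simps)
  then show ?thesis using rel2n[of 1 1 "(1, 0)"] jj by simp
 qed
 have E03_4: "- Q * b 5 + 3 * Q * b 6 - 3 * Q * b 7 + 2 * Q * b 8 - 3 * b 5 * b 8 * th + 3 * b 6 * b 8 * th - b 7 * b 8 * th = 0"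
 proof -
  have "fst (br 0 3 4 (1, 0)) = - Q * b 5 + 3 * Q * b 6 - 3 * Q * b 7 + 2 * Q * b 8 - 3 * b 5 * b 8 * th + 3 * b 6 * b 8 * th - b 7 * b 8 * th"
   unfolding br_def by (simp add: sadp_numeral sadp_one tab s12 algebra_simps)
  then show ?thesis using rel2n[of 3 4 "(1, 0)"] jj by simp
 qed
 have E03_4w: "- 3 * P * b 5 * b 8 + 3 * P * b 6 * b 8 - P * b 7 * b 8 - Rr * b 5 + 3 * Rr * b 6 - 3 * Rr * b 7 + 2 * Rr * b 8 = 0"
 proof -
  have "fst (br 0 3 4 (0, 1)) = - 3 * P * b 5 * b 8 + 3 * P * b 6 * b 8 - P * b 7 * b 8 - Rr * b 5 + 3 * Rr * b 6 - 3 * Rr * b 7 + 2 * Rr * b 8"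
   unfolding br_def by (simp add: sadp_numeral sadp_one tab s12 algebra_simps)
  then show ?thesis using rel2n[of 3 4 "(0, 1)"] jj by simp
 qed
 have E03_0: "- 3 * P * b 0 + 2 * Q * b 0 - 3 * Q * b 1 + 3 * Q * b 2 - Rr - b 0 * b 1 * th + 3 * b 0 * b 2 * th = 0"
 proof -
  have "fst (br 0 3 0 (1, 0)) = - 3 * P * b 0 + 2 * Q * b 0 - 3 * Q * b 1 + 3 * Q * b 2 - Rr - b 0 * b 1 * th + 3 * b 0 * b 2 * th"
   unfolding br_def by (simp add: sadp_numeral sadp_one tab s12 algebra_simps)
  then show ?thesis using rel2n[of 3 0 "(1, 0)"] jj by simp
 qed
 have E05_0: "- 10 * P * b 0 - 10 * P * b 6 + 10 * Q * b 0 + 5 * Q * b 6 - b 0 * b 1 * th + 5 * b 0 * b 2 * th - 5 * b 0 * b 5 * th + 2 * b 0 * b 6 * th - 5 * b 1 * b 6 * th + 10 * b 2 * b 6 * th - b 5 * b 6 * th = 0"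
 proof -
  have "fst (br 0 5 0 (1, 0)) = - 10 * P * b 0 - 10 * P * b 6 + 10 * Q * b 0 + 5 * Q * b 6 - b 0 * b 1 * th + 5 * b 0 * b 2 * th - 5 * b 0 * b 5 * th + 2 * b 0 * b 6 * th - 5 * b 1 * b 6 * th + 10 * b 2 * b 6 * th - b 5 * b 6 * th"
   unfolding br_def by (simp add: sadp_numeral sadp_one tab s12 algebra_simps)
  then show ?thesis using rel2n[of 5 0 "(1, 0)"] jj by simp
 qed
 have E07_0: "- 21 * P * b 0 - 35 * P * b 8 + 35 * Q * b 0 + 35 * Q * b 8 - b 0 * b 1 * th + 7 * b 0 * b 2 * th - 35 * b 0 * b 5 * th + 21 * b 0 * b 6 * th - 7 * b 0 * b 7 * th + 2 * b 0 * b 8 * th - 7 * b 1 * b 8 * th + 21 * b 2 * b 8 * th - 21 * b 5 * b 8 * th + 7 * b 6 * b 8 * th - b 7 * b 8 * th \<noteq> 0"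
 proof -
  have "fst (br 0 7 0 (1, 0)) = - 21 * P * b 0 - 35 * P * b 8 + 35 * Q * b 0 + 35 * Q * b 8 - b 0 * b 1 * th + 7 * b 0 * b 2 * th - 35 * b 0 * b 5 * th + 21 * b 0 * b 6 * th - 7 * b 0 * b 7 * th + 2 * b 0 * b 8 * th - 7 * b 1 * b 8 * th + 21 * b 2 * b 8 * th - 21 * b 5 * b 8 * th + 7 * b 6 * b 8 * th - b 7 * b 8 * th"
   unfolding br_def by (simp add: sadp_numeral sadp_one tab s12 algebra_simps)
  then show ?thesis using relZ by simp
 qed

 have b2: "b 2 = 2 * b 1" using E01_1s by (simp add: algebra_simps)
 then have "2 * (b 1 * b 1) = 0" using E01_1 by Groebner_Basis.algebra
 then have b1: "b 1 = 0" using char_ne[of 2] by simp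
 then have b2: "b 2 = 0" using b2 by simp
 have b78: "b 7 * b 8 = 0" using E03_4w z by simp
 then have "Q * (2 * b 8 - 3 * b 7) = 0" using E03_4 z by Groebner_Basis.algebra
 then have e: "2 * b 8 = 3 * b 7" using z by simp
 then have "3 * (b 7 * b 7) = 0" using b78 by Groebner_Basis.algebra
 then have b7: "b 7 = 0" using char_ne[of 3] by simp
 then have b8: "b 8 = 0" using e char_ne[of 2] by simp
 have b0: "b 0 \<noteq> 0" using E07_0 z b1 b2 b7 b8 by auto
 have "b 0 * (2 * Q - 3 * P) = 0" using E03_0 z b1 b2 by Groebner_Basis.algebra
 then have 1: "2 * Q = 3 * P" using b0 by simp
 have "b 0 * (10 * (Q - P)) = 0" using E05_0 z b1 b2 b7 b8 by Groebner_Basis.algebra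
 then have "Q = P" using b0 char_ne[of 10] by simp
 then have "2 * P = 3 * P" using 1 by (simp only:)
 then show False using z of_nat_inj12[of 2 3] by simp
qed

text \<open>In weights (1,1) this configuration is not excluded, only reduced to \<open>b 8\<close>
  and the ratio of \<open>P\<close> and \<open>Q\<close>. The zeros found are what permits weights
  (1,2).\<close>

lemma j3_zero: assumes jj: "j = 3"
 shows "b 0 = 0" "b 1 = 0" "b 4 = 0" "b 5 = 0" "b 6 = 0" "b 7 = 0" "b 8 \<noteq> 0" "Rr = 0" "Q \<noteq> 0" "2 * P = 5 * Q"
proof -
 have z: "b 4 = 0" "b 5 = 0" "Rr = 0" "P \<noteq> 0" "Q \<noteq> 0" using gap_after jj by auto
 have s12: "Suc 0 = 1" "Suc (Suc 0) = 2" by (simp_all add: One_nat_def)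
 have tab: "ta 0 = 1" "tb 0 = 0" "ua 0 = b 0" "ub 0 = 0" "uc 0 = 0" "ta 1 = 1" "tb 1 = 0" "ua 1 = b 1" "ub 1 = 0" "uc 1 = 0" "ta 2 = 1" "tb 2 = 0" "ua 2 = 0" "ub 2 = 0" "uc 2 = 1" "ta 3 = th" "tb 3 = P" "ua 3 = Q" "ub 3 = Rr" "uc 3 = 0" "ta 4 = 1" "tb 4 = 0" "ua 4 = b 4" "ub 4 = 0" "uc 4 = 0" "ta 5 = 1" "tb 5 = 0" "ua 5 = b 5" "ub 5 = 0" "uc 5 = 0" "ta 6 = 1" "tb 6 = 0" "ua 6 = b 6" "ub 6 = 0" "uc 6 = 0" "ta 7 = 1" "tb 7 = 0" "ua 7 = b 7" "ub 7 = 0" "uc 7 = 0" "ta 8 = 1" "tb 8 = 0" "ua 8 = b 8" "ub 8 = 0" "uc 8 = 0" "ta 9 = 1" "tb 9 = 0" "ua 9 = b 9" "ub 9 = 0" "uc 9 = 0"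
  unfolding ta_def tb_def ua_def ub_def uc_def using jj by (simp_all add: One_nat_def)
 have E01_0: "- b 0 * b 1 = 0"
 proof -
  have "fst (br 0 1 0 (1, 0)) = - b 0 * b 1"
   unfolding br_def by (simp add: sadp_numeral sadp_one tab s12 algebra_simps)
  then show ?thesis using rel2n[of 1 0 "(1, 0)"] jj by simp
 qed
 have E01_0s: "2 * b 0 - b 1 = 0"
 proof -
  have "snd (br 0 1 0 (1, 0)) = 2 * b 0 - b 1"
   unfolding br_def by (simp add: sadp_numeral sadp_one tab s12 algebra_simps)
  then show ?thesis using rel2n[of 1 0 "(1, 0)"] jj by simp
 qed
 have E03_4: "- b 4 * b 5 + 3 * b 4 * b 6 - 3 * b 4 * b 7 + 2 * b 4 * b 8 - 3 * b 5 * b 8 + 3 * b 6 * b 8 - b 7 * b 8 = 0"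
 proof -
  have "fst (br 0 3 4 (1, 0)) = - b 4 * b 5 + 3 * b 4 * b 6 - 3 * b 4 * b 7 + 2 * b 4 * b 8 - 3 * b 5 * b 8 + 3 * b 6 * b 8 - b 7 * b 8"
   unfolding br_def by (simp add: sadp_numeral sadp_one tab s12 algebra_simps)
  then show ?thesis using rel2n[of 3 4 "(1, 0)"] jj by simp
 qed
 have E04_3w: "- 4 * P * b 4 * b 8 + 6 * P * b 5 * b 8 - 4 * P * b 6 * b 8 + P * b 7 * b 8 - Rr * b 4 + 4 * Rr * b 5 - 6 * Rr * b 6 + 4 * Rr * b 7 = 0"
 proof -
  have "fst (br 0 4 3 (0, 1)) = - 4 * P * b 4 * b 8 + 6 * P * b 5 * b 8 - 4 * P * b 6 * b 8 + P * b 7 * b 8 - Rr * b 4 + 4 * Rr * b 5 - 6 * Rr * b 6 + 4 * Rr * b 7"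
   unfolding br_def by (simp add: sadp_numeral sadp_one tab s12 algebra_simps)
  then show ?thesis using rel2n[of 4 3 "(0, 1)"] jj by simp
 qed
 have E05_2: "5 * P * b 4 - 10 * P * b 5 + 10 * P * b 6 - 5 * P * b 7 + 2 * P * b 8 - 5 * Q * b 8 - Rr + 10 * b 4 * b 8 * th - 10 * b 5 * b 8 * th + 5 * b 6 * b 8 * th - b 7 * b 8 * th = 0"
 proof -
  have "fst (br 0 5 2 (1, 0)) = 5 * P * b 4 - 10 * P * b 5 + 10 * P * b 6 - 5 * P * b 7 + 2 * P * b 8 - 5 * Q * b 8 - Rr + 10 * b 4 * b 8 * th - 10 * b 5 * b 8 * th + 5 * b 6 * b 8 * th - b 7 * b 8 * th"
   unfolding br_def by (simp add: sadp_numeral sadp_one tab s12 algebra_simps)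
  then show ?thesis using rel2n[of 5 2 "(1, 0)"] jj by simp
 qed
 have E07_0: "7 * P * b 0 + 21 * P * b 8 - 21 * Q * b 0 - 35 * Q * b 8 - b 0 * b 1 * th + 35 * b 0 * b 4 * th - 35 * b 0 * b 5 * th + 21 * b 0 * b 6 * th - 7 * b 0 * b 7 * th + 2 * b 0 * b 8 * th - 7 * b 1 * b 8 * th + 35 * b 4 * b 8 * th - 21 * b 5 * b 8 * th + 7 * b 6 * b 8 * th - b 7 * b 8 * th \<noteq> 0"
 proof -
  have "fst (br 0 7 0 (1, 0)) = 7 * P * b 0 + 21 * P * b 8 - 21 * Q * b 0 - 35 * Q * b 8 - b 0 * b 1 * th + 35 * b 0 * b 4 * th - 35 * b 0 * b 5 * th + 21 * b 0 * b 6 * th - 7 * b 0 * b 7 * th + 2 * b 0 * b 8 * th - 7 * b 1 * b 8 * th + 35 * b 4 * b 8 * th - 21 * b 5 * b 8 * th + 7 * b 6 * b 8 * th - b 7 * b 8 * th"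
   unfolding br_def by (simp add: sadp_numeral sadp_one tab s12 algebra_simps)
  then show ?thesis using relZ by simp
 qed

 have b1: "b 1 = 2 * b 0" using E01_0s by (simp add: algebra_simps)
 then have "2 * (b 0 * b 0) = 0" using E01_0 by Groebner_Basis.algebra
 then have b0: "b 0 = 0" using char_ne[of 2] by simp
 then have b1: "b 1 = 0" using b1 by simp
 have b8: "b 8 \<noteq> 0" using E07_0 z b0 b1 by auto
 have "b 8 * (3 * b 6 - b 7) = 0" "P * b 8 * (b 7 - 4 * b 6) = 0" using E03_4 E04_3w z by Groebner_Basis.algebra+
 then have 7: "b 7 = 3 * b 6" "b 7 = 4 * b 6" using z b8 by (auto simp: algebra_simps)
 then have b6: "b 6 = 0" by Groebner_Basis.algebra
 then have b7: "b 7 = 0" using 7 by simp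
 have "b 8 * (2 * P - 5 * Q) = 0" using E05_2 z b6 b7 by Groebner_Basis.algebra
 then have "2 * P = 5 * Q" using b8 by simp
 then show "b 0 = 0" "b 1 = 0" "b 4 = 0" "b 5 = 0" "b 6 = 0" "b 7 = 0" "b 8 \<noteq> 0" "Rr = 0" "Q \<noteq> 0" "2 * P = 5 * Q"
  using z b0 b1 b6 b7 b8 by auto
qed

text \<open>As for \<open>j = 3\<close>, weights (1,1) are used to reach the zeros that permit
  weights (1,2). The same pair of equations, a product and a linear one, is solved for
  \<open>b 4, b 5\<close> and again for \<open>b 6, b 7\<close>.\<close>

lemma j1_zero: assumes jj: "j = 1"
 shows "b 2 = 0" "b 3 = 0" "b 4 = 0" "b 5 = 0" "b 6 = 0" "b 7 = 0" "b 8 \<noteq> 0" "Rr = 0" "Q \<noteq> 0" "P \<noteq> 0"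
proof -
 have z: "b 2 = 0" "b 3 = 0" "Rr = 0" "P \<noteq> 0" "Q \<noteq> 0" using gap_after jj by (auto simp: numeral_2_eq_2 numeral_3_eq_3)
 have s12: "Suc 0 = 1" "Suc (Suc 0) = 2" by (simp_all add: One_nat_def)
 have tab: "ta 0 = 1" "tb 0 = 0" "ua 0 = 0" "ub 0 = 0" "uc 0 = 1" "ta 1 = th" "tb 1 = P" "ua 1 = Q" "ub 1 = Rr" "uc 1 = 0" "ta 2 = 1" "tb 2 = 0" "ua 2 = b 2" "ub 2 = 0" "uc 2 = 0" "ta 3 = 1" "tb 3 = 0" "ua 3 = b 3" "ub 3 = 0" "uc 3 = 0" "ta 4 = 1" "tb 4 = 0" "ua 4 = b 4" "ub 4 = 0" "uc 4 = 0" "ta 5 = 1" "tb 5 = 0" "ua 5 = b 5" "ub 5 = 0" "uc 5 = 0" "ta 6 = 1" "tb 6 = 0" "ua 6 = b 6" "ub 6 = 0" "uc 6 = 0" "ta 7 = 1" "tb 7 = 0" "ua 7 = b 7" "ub 7 = 0" "uc 7 = 0" "ta 8 = 1" "tb 8 = 0" "ua 8 = b 8" "ub 8 = 0" "uc 8 = 0" "ta 9 = 1" "tb 9 = 0" "ua 9 = b 9" "ub 9 = 0" "uc 9 = 0"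
  unfolding ta_def tb_def ua_def ub_def uc_def using jj by (simp_all add: One_nat_def)
 have E03_1: "- Q * b 2 + 3 * Q * b 3 - 3 * Q * b 4 + 2 * Q * b 5 - 3 * b 2 * b 5 * th + 3 * b 3 * b 5 * th - b 4 * b 5 * th = 0"
 proof -
  have "fst (br 0 3 1 (1, 0)) = - Q * b 2 + 3 * Q * b 3 - 3 * Q * b 4 + 2 * Q * b 5 - 3 * b 2 * b 5 * th + 3 * b 3 * b 5 * th - b 4 * b 5 * th"
   unfolding br_def by (simp add: sadp_numeral sadp_one tab s12 algebra_simps)
  then show ?thesis using rel2n[of 3 1 "(1, 0)"] jj by simp
 qed
 have E03_1w: "- 3 * P * b 2 * b 5 + 3 * P * b 3 * b 5 - P * b 4 * b 5 - Rr * b 2 + 3 * Rr * b 3 - 3 * Rr * b 4 + 2 * Rr * b 5 = 0"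
 proof -
  have "fst (br 0 3 1 (0, 1)) = - 3 * P * b 2 * b 5 + 3 * P * b 3 * b 5 - P * b 4 * b 5 - Rr * b 2 + 3 * Rr * b 3 - 3 * Rr * b 4 + 2 * Rr * b 5"
   unfolding br_def by (simp add: sadp_numeral sadp_one tab s12 algebra_simps)
  then show ?thesis using rel2n[of 3 1 "(0, 1)"] jj by simp
 qed
 have E05_1: "- Q * b 2 + 5 * Q * b 3 - 10 * Q * b 4 + 10 * Q * b 5 - 5 * Q * b 6 + 2 * Q * b 7 - 5 * b 2 * b 7 * th + 10 * b 3 * b 7 * th - 10 * b 4 * b 7 * th + 5 * b 5 * b 7 * th - b 6 * b 7 * th = 0"
 proof -
  have "fst (br 0 5 1 (1, 0)) = - Q * b 2 + 5 * Q * b 3 - 10 * Q * b 4 + 10 * Q * b 5 - 5 * Q * b 6 + 2 * Q * b 7 - 5 * b 2 * b 7 * th + 10 * b 3 * b 7 * th - 10 * b 4 * b 7 * th + 5 * b 5 * b 7 * th - b 6 * b 7 * th"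
   unfolding br_def by (simp add: sadp_numeral sadp_one tab s12 algebra_simps)
  then show ?thesis using rel2n[of 5 1 "(1, 0)"] jj by simp
 qed
 have E05_1w: "- 5 * P * b 2 * b 7 + 10 * P * b 3 * b 7 - 10 * P * b 4 * b 7 + 5 * P * b 5 * b 7 - P * b 6 * b 7 - Rr * b 2 + 5 * Rr * b 3 - 10 * Rr * b 4 + 10 * Rr * b 5 - 5 * Rr * b 6 + 2 * Rr * b 7 = 0"
 proof -
  have "fst (br 0 5 1 (0, 1)) = - 5 * P * b 2 * b 7 + 10 * P * b 3 * b 7 - 10 * P * b 4 * b 7 + 5 * P * b 5 * b 7 - P * b 6 * b 7 - Rr * b 2 + 5 * Rr * b 3 - 10 * Rr * b 4 + 10 * Rr * b 5 - 5 * Rr * b 6 + 2 * Rr * b 7"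
   unfolding br_def by (simp add: sadp_numeral sadp_one tab s12 algebra_simps)
  then show ?thesis using rel2n[of 5 1 "(0, 1)"] jj by simp
 qed
 have E07_0: "7 * P * b 2 - 21 * P * b 3 + 35 * P * b 4 - 35 * P * b 5 + 21 * P * b 6 - 7 * P * b 7 + 2 * P * b 8 - 7 * Q * b 8 - Rr + 21 * b 2 * b 8 * th - 35 * b 3 * b 8 * th + 35 * b 4 * b 8 * th - 21 * b 5 * b 8 * th + 7 * b 6 * b 8 * th - b 7 * b 8 * th \<noteq> 0"
 proof -
  have "fst (br 0 7 0 (1, 0)) = 7 * P * b 2 - 21 * P * b 3 + 35 * P * b 4 - 35 * P * b 5 + 21 * P * b 6 - 7 * P * b 7 + 2 * P * b 8 - 7 * Q * b 8 - Rr + 21 * b 2 * b 8 * th - 35 * b 3 * b 8 * th + 35 * b 4 * b 8 * th - 21 * b 5 * b 8 * th + 7 * b 6 * b 8 * th - b 7 * b 8 * th"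
   unfolding br_def by (simp add: sadp_numeral sadp_one tab s12 algebra_simps)
  then show ?thesis using relZ by simp
 qed

 have b45: "b 4 * b 5 = 0" using E03_1w z by simp
 then have "Q * (2 * b 5 - 3 * b 4) = 0" using E03_1 z by Groebner_Basis.algebra
 then have e: "2 * b 5 = 3 * b 4" using z by simp
 then have "3 * (b 4 * b 4) = 0" using b45 by Groebner_Basis.algebra
 then have b4: "b 4 = 0" using char_ne[of 3] by simp
 then have b5: "b 5 = 0" using e char_ne[of 2] by simp
 have b67: "b 6 * b 7 = 0" using E05_1w z b4 b5 by simp
 then have "Q * (2 * b 7 - 5 * b 6) = 0" using E05_1 z b4 b5 by Groebner_Basis.algebra
 then have e: "2 * b 7 = 5 * b 6" using z by simp
 then have "5 * (b 6 * b 6) = 0" using b67 by Groebner_Basis.algebra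
 then have b6: "b 6 = 0" using char_ne[of 5] by simp
 then have b7: "b 7 = 0" using e char_ne[of 2] by simp
 have b8: "b 8 \<noteq> 0" using E07_0 z b4 b5 b6 b7 by auto
 then show "b 2 = 0" "b 3 = 0" "b 4 = 0" "b 5 = 0" "b 6 = 0" "b 7 = 0" "b 8 \<noteq> 0" "Rr = 0" "Q \<noteq> 0" "P \<noteq> 0"
  using z b4 b5 b6 b7 by auto
qed

end

section \<open>Second-order terms in weights (1,2)\<close>

context prep12
begin

definition hf :: 'a where "hf = inverse 2"

lemma hf: "2 * hf = 1" "hf + hf = 1"
proof -
 have "(2::'a) \<noteq> 0" using char_ne[of 2] by simp
 then show "2 * hf = 1" by (simp add: hf_def)
 then show "hf + hf = 1" by (simp only: mult_2)
qed

text \<open>The truncated logarithm \<open>u - u^2/2\<close> of \<open>g 1\<close> plays the role of \<open>x\<^sub>1\<close> up to second order.\<close>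

definition Al :: "'b \<Rightarrow> 'b" where
 "Al = (\<lambda>v. u (g 1) v - hf *s u (g 1) (u (g 1) v))"

lemma lin_u1: "lin (u (g 1))" by (rule lin_u[OF g_closed])

lemma lin_Al: "lin Al"
 unfolding Al_def by (intro lin_minus lin_scl lin_comp[of "u (g 1)" "u (g 1)"] lin_u1)

lemma raises_u11: "raises F 2 (\<lambda>v. u (g 1) (u (g 1) v))"
 using raises_comp[OF g1D g1D] by simp

lemma raises_Al: "raises F 1 Al"
 unfolding Al_def
 by (intro raises_diff[OF filtF] raises_scale[OF filtF] g1D raises_mono[OF filtF raises_u11]) simp

lemma Al_u1: "raises F 2 (\<lambda>v. Al v - u (g 1) v)"
 using raises_scale[OF filtF raises_u11, of "- hf"] by (simp add: Al_def)

text \<open>The second estimate keeps one more term of the factor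
  \<open>\<rho> (g k \<otimes> g 1)\<close> in \<open>cm_u\<close>; of
  \<open>u (g k \<otimes> g 1)\<close> only \<open>u (g 1)\<close> has degree below 2.\<close>

lemma cm_u1:
 assumes "2 \<le> k" "k \<le> 8"
 shows "raises F (k + 2) (\<lambda>v. cm (u (g 1)) (u (g k)) v - u (g (Suc k)) v)"
  and "raises F (k + 3) (\<lambda>v. cm (u (g 1)) (u (g k)) v - u (g (Suc k)) v - u (g (Suc k)) (u (g 1) v))"
proof -
 have gS: "g (Suc k) \<in> D \<rho> F (Suc k)" using gD12[of "Suc k"] assms by simp
 have gk: "g k \<in> D \<rho> F k" using gD12[of k] assms by simp
 show "raises F (k + 2) (\<lambda>v. cm (u (g 1)) (u (g k)) v - u (g (Suc k)) v)"
  using cm_u_raises(2)[OF g1_D gk gS r1[OF assms], of 1] assms by (simp add: One_nat_def)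
 have m: "raises F 2 (\<lambda>v. u (g k \<otimes> g 1) v - u (g 1) v)"
 proof -
  have "raises F 2 (\<lambda>v. (u (g k \<otimes> g 1) v - (u (g k) v + u (g 1) v)) + u (g k) v)"
   using assms by (intro raises_add[OF filtF] raises_mono[OF filtF u_mult_diff[OF gk g1_D]] raises_mono[OF filtF D_raises[OF gk]]) auto
  then show ?thesis by (simp add: algebra_simps)
 qed
 have i: "Suc k + 2 = k + 3" by simp
 have "raises F (k + 3) (\<lambda>v. u (g (Suc k)) (u (g k \<otimes> g 1) v - u (g 1) v))"
  using raises_comp[OF D_raises[OF gS] m] unfolding i .
 moreover have "cm (u (g 1)) (u (g k)) v - u (g (Suc k)) v - u (g (Suc k)) (u (g 1) v)
   = u (g (Suc k)) (u (g k \<otimes> g 1) v - u (g 1) v)" if "v \<in> V" for v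
 proof -
  have e: "\<rho> (g k \<otimes> g 1) v = u (g k \<otimes> g 1) v + v" by (simp add: U_def)
  have "cm (u (g 1)) (u (g k)) v = u (g (Suc k)) (\<rho> (g k \<otimes> g 1) v)"
   by (rule cm_u[OF g_closed g_closed g_closed r1[OF assms] that])
  then show ?thesis unfolding e by (simp add: lin_add[OF lin_u] lin_diff[OF lin_u])
 qed
 ultimately show "raises F (k + 3) (\<lambda>v. cm (u (g 1)) (u (g k)) v - u (g (Suc k)) v - u (g (Suc k)) (u (g 1) v))"
  by (subst raises_cong[where Y' = "\<lambda>v. u (g (Suc k)) (u (g k \<otimes> g 1) v - u (g 1) v)"]) auto
qed

lemma cm_Al_expand: "lin Y ==> cm Al Y v = cm (u (g 1)) Y v - hf *s (u (g 1) (cm (u (g 1)) Y v) + cm (u (g 1)) Y (u (g 1) v))"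
 by (simp add: cm_def Al_def lin_diff[of Y] lin_scale[of Y] lin_diff[OF lin_u1] algebra_simps)

lemma cm_Al_lead:
 assumes "2 \<le> k" "k \<le> 8"
 shows "raises F (k + 2) (\<lambda>v. cm Al (u (g k)) v - u (g (Suc k)) v)"
proof -
 have gk: "raises F k (u (g k))" using D_raises[OF gD12[of k]] assms by simp
 have C: "raises F (Suc k) (cm (u (g 1)) (u (g k)))" using raises_cm[OF filtF g1D gk] by (simp add: One_nat_def)
 have ab: "raises F (k + 2) (\<lambda>v. u (g 1) (cm (u (g 1)) (u (g k)) v))" "raises F (k + 2) (\<lambda>v. cm (u (g 1)) (u (g k)) (u (g 1) v))"
  using raises_comp[OF g1D C] raises_comp[OF C g1D] by (simp_all add: One_nat_def)
 have eq: "(cm (u (g 1)) (u (g k)) v - u (g (Suc k)) v)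
   - hf *s (u (g 1) (cm (u (g 1)) (u (g k)) v) + cm (u (g 1)) (u (g k)) (u (g 1) v)) = cm Al (u (g k)) v - u (g (Suc k)) v" for v
  by (simp add: cm_Al_expand[OF lin_u[OF g_closed]])
 show ?thesis
  using raises_diff[OF filtF cm_u1(1)[OF assms] raises_scale[OF filtF raises_add[OF filtF ab], of hf]] unfolding eq .
qed

text \<open>The quadratic part of the logarithm cancels the mixed term of \<open>cm_u1\<close>, and
  only group elements remain, as in the Baker-Campbell-Hausdorff formula: the bracket of
  \<open>x1\<close> with \<open>x_k\<close> is \<open>x_(k+1) - x_(k+2) / 2\<close>.\<close>

lemma cm_Al:
 assumes "2 \<le> k" "k \<le> 7"
 shows "raises F (k + 3) (\<lambda>v. cm Al (u (g k)) v - (u (g (Suc k)) v - hf *s u (g (Suc (Suc k))) v))"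
proof -
 let ?C = "cm (u (g 1)) (u (g k))" and ?D = "u (g (Suc k))"
 have k8: "k \<le> 8" using assms by simp
 note c1 = cm_u1(1)[OF assms(1) k8] and c2 = cm_u1(2)[OF assms(1) k8]
 have 1: "raises F (k + 3) (\<lambda>v. u (g 1) (?C v - ?D v))" "raises F (k + 3) (\<lambda>v. ?C (u (g 1) v) - ?D (u (g 1) v))"
  using raises_comp[OF g1D c1] raises_comp[OF c1 g1D] by (simp_all add: One_nat_def numeral_3_eq_3)
 have 2: "raises F (k + 3) (\<lambda>v. cm (u (g 1)) ?D v - u (g (Suc (Suc k))) v)"
  using cm_u1(1)[of "Suc k"] assms by (simp add: numeral_3_eq_3)
 note R = raises_diff[OF filtF raises_diff[OF filtF c2 raises_scale[OF filtF raises_add[OF filtF 1], of hf]] raises_scale[OF filtF 2, of hf]]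
 have eq: "((?C v - ?D v - ?D (u (g 1) v)) - hf *s (u (g 1) (?C v - ?D v) + (?C (u (g 1) v) - ?D (u (g 1) v))))
   - hf *s (cm (u (g 1)) ?D v - u (g (Suc (Suc k))) v)
  = cm Al (u (g k)) v - (?D v - hf *s u (g (Suc (Suc k))) v)" for v
 proof -
  have "?D (u (g 1) v) = (hf + hf) *s ?D (u (g 1) v)" using hf(2) by simp
  then have d: "?D (u (g 1) v) = hf *s ?D (u (g 1) v) + hf *s ?D (u (g 1) v)" by (simp only: scale_left_distrib)
  have e: "cm (u (g 1)) ?D v = u (g 1) (?D v) - ?D (u (g 1) v)" by (simp add: cm_def)
  show ?thesis unfolding cm_Al_expand[OF lin_u[OF g_closed]] lin_diff[OF lin_u1] e
   by (simp only: scale_right_diff_distrib scale_right_distrib) (use d in \<open>simp add: algebra_simps\<close>)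
 qed
 show ?thesis using R unfolding eq .
qed

text \<open>The second-order value of the \<open>n\<close>-fold bracket: each use of
  \<open>cm_Al\<close> contributes another -1/2.\<close>

definition wn :: "nat \<Rightarrow> 'b \<Rightarrow> 'b" where
 "wn n = (\<lambda>v. u (g (n + 2)) v - (of_nat n * hf) *s u (g (n + 3)) v)"

lemma lin_wn: "lin (wn n)"
 unfolding wn_def by (intro lin_minus lin_scl lin_u g_closed)

lemma raises_wn: "n \<le> 6 ==> raises F (n + 2) (wn n)"
 unfolding wn_def
 by (intro raises_diff[OF filtF] raises_scale[OF filtF] raises_mono[OF filtF D_raises[OF gD12]]) auto

abbreviation "XA n \<equiv> adp Al (u (g 2)) n"

lemma XA_wn: "n \<le> 6 ==> raises F (n + 4) (\<lambda>v. XA n v - wn n v)"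
proof (induction n)
 case 0
 have e: "(0::nat) + 2 = 2" by (rule add_0_left)
 have w: "wn 0 v = u (g 2) v" for v unfolding wn_def e by simp
 show ?case using filt_0[OF filtF] by (simp add: w raises_def)
next
 case (Suc n)
 then have IH: "raises F (n + 4) (\<lambda>v. XA n v - wn n v)" and n: "n \<le> 5" by auto
 have 1: "raises F (n + 5) (cm Al (\<lambda>v. XA n v - wn n v))"
 proof -
  have i: "1 + (n + 4) = n + 5" by simp
  show ?thesis using raises_cm[OF filtF raises_Al IH] unfolding i .
 qed
 have i: "Suc (n + 2) = n + 3" "Suc (n + 3) = n + 4" "n + 2 + 3 = n + 5" "n + 3 + 2 = n + 5" by simp_all
 have 2: "raises F (n + 5) (\<lambda>v. cm Al (u (g (n + 2))) v - (u (g (n + 3)) v - hf *s u (g (n + 4)) v))"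
  using cm_Al[of "n + 2", unfolded i] n by simp
 have 3: "raises F (n + 5) (\<lambda>v. cm Al (u (g (n + 3))) v - u (g (n + 4)) v)"
  using cm_Al_lead[of "n + 3", unfolded i] n by simp
 note R = raises_diff[OF filtF raises_add[OF filtF 1 2] raises_scale[OF filtF 3, of "of_nat n * hf"]]
 have eq: "cm Al (\<lambda>v. XA n v - wn n v) v +
   (cm Al (u (g (n + 2))) v - (u (g (n + 3)) v - hf *s u (g (n + 4)) v))
   - (of_nat n * hf) *s (cm Al (u (g (n + 3))) v - u (g (n + 4)) v) = XA (Suc n) v - wn (Suc n) v" for v
 proof -
  have i: "Suc n + 2 = n + 3" "Suc n + 3 = n + 4" by simp_all
  show ?thesis unfolding wn_def i
   by (simp add: cm_def lin_diff[OF lin_Al] lin_add[OF lin_Al] lin_scale[OF lin_Al] algebra_simps)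
 qed
 have i5: "Suc n + 4 = n + 5" by simp
 show ?case unfolding i5 using R unfolding eq .
qed

lemma m12: "of_nat 12 = (- 1 :: 'a)"
proof -
 have "(12::'a) + 1 = 0" using char13 by simp
 then show ?thesis by (simp add: eq_neg_iff_add_eq_0)
qed

lemma cm_u24: "raises F 7 (\<lambda>v. cm (u (g 2)) (u (g 4)) v - u (g 6) v)"
proof -
 obtain s where s: "s \<in> generate G (g ` {7..10})" "g 2 \<otimes> g 4 = (g 6 \<otimes> s) \<otimes> (g 4 \<otimes> g 2)" using r24 by blast
 have D: "s \<in> D \<rho> F 7" "g 6 \<in> D \<rho> F 6" using SD12[OF _ s(1)] gD12 by auto
 have c: "g 6 \<otimes> s \<in> D \<rho> F 6" using D_mult[OF D(2) D_mono[OF D(1)]] by simp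
 have 1: "raises F 7 (\<lambda>v. cm (u (g 2)) (u (g 4)) v - u (g 6 \<otimes> s) v)"
  using raises_mono[OF filtF cm_u_raises(2)[OF gD12[of 2] gD12[of 4] c s(2), of 2], of 7] by simp
 show ?thesis using raises_trans[OF filtF 1 u_prod_diff[OF D(2,1)]] .
qed

lemma cm_u35: "raises F 9 (\<lambda>v. cm (u (g 3)) (u (g 5)) v + u (g 8) v)"
proof -
 obtain s where s: "s \<in> generate G (g ` {9..10})" "g 3 \<otimes> g 5 = (g 8 [^] (12::nat) \<otimes> s) \<otimes> (g 5 \<otimes> g 3)" using r35 by blast
 have D: "s \<in> D \<rho> F 9" "g 8 \<in> D \<rho> F 8" using SD12[OF _ s(1)] gD12 by auto
 have c: "g 8 [^] (12::nat) \<otimes> s \<in> D \<rho> F 8" using D_mult[OF D_pow[OF D(2)] D_mono[OF D(1)]] by simp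
 have 1: "raises F 9 (\<lambda>v. cm (u (g 3)) (u (g 5)) v - u (g 8 [^] (12::nat) \<otimes> s) v)"
  using raises_mono[OF filtF cm_u_raises(2)[OF gD12[of 3] gD12[of 5] c s(2), of 3], of 9] by simp
 have 2: "raises F 9 (\<lambda>v. u (g 8 [^] (12::nat)) v + u (g 8) v)"
  using raises_mono[OF filtF u_pow_diff[OF D(2), of 12], of 9] by (simp only: m12) simp
 show ?thesis
  using raises_add[OF filtF raises_trans[OF filtF 1 u_prod_diff[OF D_pow[OF D(2)] D(1)]] 2] by simp
qed

text \<open>The exponent -1 of \<open>g 6\<close> in \<open>r23\<close> and half of the bracket of
  \<open>g 2\<close> and \<open>g 4\<close> add up to the correction -3/2 contained in
  \<open>wn 3\<close>, so no extra term appears at second order.\<close>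

lemma relA_23: "raises F 7 (\<lambda>v. cm (XA 0) (XA 1) v - XA 3 v)"
proof -
 obtain d where d: "raises F 7 (\<lambda>v. u d v - (u (g 5) v - u (g 6) v))" "d \<in> D \<rho> F 5"
  "g 2 \<otimes> g 3 = d \<otimes> (g 3 \<otimes> g 2)" using comm12_23 by blast
 have 1: "raises F 7 (cm (u (g 2)) (\<lambda>v. XA 1 v - wn 1 v))"
  using raises_cm[OF filtF g2D XA_wn[of 1]] by simp
 have 2: "raises F 7 (\<lambda>v. cm (u (g 2)) (u (g 3)) v - u d v)"
  using raises_mono[OF filtF cm_u_raises(2)[OF gD12[of 2] gD12[of 3] d(2,3), of 2], of 7] by simp
 have 3: "raises F 7 (\<lambda>v. XA 3 v - wn 3 v)" using XA_wn[of 3] by simp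
 note R = raises_diff[OF filtF raises_diff[OF filtF raises_add[OF filtF raises_add[OF filtF 1 2] d(1)] raises_scale[OF filtF cm_u24, of hf]] 3]
 have eq: "cm (u (g 2)) (\<lambda>v. XA 1 v - wn 1 v) v + (cm (u (g 2)) (u (g 3)) v - u d v)
   + (u d v - (u (g 5) v - u (g 6) v)) - hf *s (cm (u (g 2)) (u (g 4)) v - u (g 6) v) - (XA 3 v - wn 3 v)
   = cm (XA 0) (XA 1) v - XA 3 v" for v
 proof -
  have w1: "wn 1 = (\<lambda>v. u (g 3) v - hf *s u (g 4) v)" and w3: "wn 3 v = u (g 5) v - (3 * hf) *s u (g 6) v"
   by (simp_all add: wn_def)
  have "(2 + 1) * hf = 2 * hf + 1 * hf" by (rule distrib_right)
  then have h3: "3 * hf = 1 + hf" using hf(1) by simp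
  show ?thesis unfolding w1 w3 h3
   by (simp add: cm_def lin_diff[OF lin_u[OF g_closed]] lin_scale[OF lin_u[OF g_closed]] scale_right_diff_distrib scale_left_distrib)
 qed
 show ?thesis using R unfolding eq .
qed

text \<open>The exponent 9 of \<open>g 8\<close> equals 5/2 modulo 13, the correction contained in
  \<open>wn 5\<close>; the bracket of \<open>g 3\<close> and \<open>g 5\<close> is then left over
  and yields \<open>XA 6\<close>.\<close>

lemma relA_34: "raises F 9 (\<lambda>v. cm (XA 1) (XA 2) v + XA 5 v - XA 6 v)"
proof -
 obtain d where d: "raises F 9 (\<lambda>v. u d v - (9 *s u (g 8) v - u (g 7) v))" "d \<in> D \<rho> F 7"
  "g 3 \<otimes> g 4 = d \<otimes> (g 4 \<otimes> g 3)" using comm12_34 by blast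
 have lX: "lin (XA n)" for n by (intro lin_adp lin_Al lin_u g_closed)
 have rX: "raises F (n + 2) (XA n)" for n using raises_adp[OF filtF raises_Al g2D, of n] by simp
 have 1: "raises F 9 (\<lambda>v. cm (XA 1) (XA 2) v - cm (wn 1) (wn 2) v)"
  by (rule cm_cong[OF filtF lX lX lin_wn lin_wn rX raises_wn XA_wn XA_wn]) simp_all
 have 2: "raises F 9 (\<lambda>v. cm (u (g 3)) (u (g 4)) v - u d v)"
  using raises_mono[OF filtF cm_u_raises(2)[OF gD12[of 3] gD12[of 4] d(2,3), of 3], of 9] by simp
 have 4: "raises F 9 (cm (u (g 4)) (u (g 5)))" using raises_cm[OF filtF D_raises[OF gD12[of 4]] D_raises[OF gD12[of 5]]] by simp
 have 5: "raises F 9 (\<lambda>v. XA 5 v - wn 5 v)" "raises F 9 (\<lambda>v. XA 6 v - wn 6 v)"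
  using XA_wn[of 5] raises_mono[OF filtF XA_wn[of 6], of 9] by simp_all
 have 9: "raises F 9 (u (g 9))" using D_raises[OF gD12[of 9]] by simp
 note R = raises_add[OF filtF raises_diff[OF filtF raises_add[OF filtF raises_add[OF filtF raises_diff[OF filtF raises_add[OF filtF
  raises_add[OF filtF 1 2] d(1)] cm_u35] raises_scale[OF filtF 4, of hf]] 5(1)] 5(2)] raises_scale[OF filtF 9, of "6 * hf"]]
 have eq: "(cm (XA 1) (XA 2) v - cm (wn 1) (wn 2) v) + (cm (u (g 3)) (u (g 4)) v - u d v)
   + (u d v - (9 *s u (g 8) v - u (g 7) v)) - (cm (u (g 3)) (u (g 5)) v + u (g 8) v) + hf *s cm (u (g 4)) (u (g 5)) v
   + (XA 5 v - wn 5 v) - (XA 6 v - wn 6 v) + (6 * hf) *s u (g 9) v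
   = cm (XA 1) (XA 2) v + XA 5 v - XA 6 v" for v
 proof -
  have h5: "5 * hf = 9"
  proof -
   have "2 * (5 * hf - 9) = 5 * (2 * hf) - 18" by (simp add: algebra_simps)
   also have "\<dots> = - 13" unfolding hf(1) by simp
   finally have "2 * (5 * hf - 9) = 0" using char13 by simp
   moreover have "(2::'a) \<noteq> 0" using char_ne[of 2] by simp
   ultimately have "5 * hf - 9 = 0" by (simp only: mult_eq_0_iff simp_thms)
   then show ?thesis by simp
  qed
  have w: "wn 1 = (\<lambda>v. u (g 3) v - hf *s u (g 4) v)" "wn 2 = (\<lambda>v. u (g 4) v - u (g 5) v)"
   "wn 5 v = u (g 7) v - 9 *s u (g 8) v" "wn 6 v = u (g 8) v - (6 * hf) *s u (g 9) v"
   using h5 hf(1) by (simp_all add: wn_def)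
  have "cm (wn 1) (wn 2) v = cm (u (g 3)) (u (g 4)) v - cm (u (g 3)) (u (g 5)) v + hf *s cm (u (g 4)) (u (g 5)) v"
   unfolding w by (simp add: cm_def lin_diff[OF lin_u[OF g_closed]] lin_scale[OF lin_u[OF g_closed]] scale_right_diff_distrib)
  then show ?thesis unfolding w(3,4) by (simp add: algebra_simps)
 qed
 show ?thesis using R unfolding eq .
qed

end

text \<open>Scalar forms of the three brackets in weights (1,2) for one basis vector per degree,
  with \<open>t\<close> and \<open>y\<close> the scalars of the two generators.\<close>

definition q23 :: "(nat \<Rightarrow> 'a::comm_ring_1) \<Rightarrow> (nat \<Rightarrow> 'a) \<Rightarrow> nat \<Rightarrow> 'a" where
 "q23 t y k = (let X = sadp 1 2 (\<lambda>k s. t k * s) (\<lambda>k s. y k * s) in X 0 (k + 3) (X 1 k 1) - X 1 (k + 2) (X 0 k 1) - X 3 k 1)"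
definition q34 :: "(nat \<Rightarrow> 'a::comm_ring_1) \<Rightarrow> (nat \<Rightarrow> 'a) \<Rightarrow> nat \<Rightarrow> 'a" where
 "q34 t y k = (let X = sadp 1 2 (\<lambda>k s. t k * s) (\<lambda>k s. y k * s) in X 1 (k + 4) (X 2 k 1) - X 2 (k + 3) (X 1 k 1) + X 5 k 1)"
definition q45 :: "(nat \<Rightarrow> 'a::comm_ring_1) \<Rightarrow> (nat \<Rightarrow> 'a) \<Rightarrow> nat \<Rightarrow> 'a" where
 "q45 t y k = (let X = sadp 1 2 (\<lambda>k s. t k * s) (\<lambda>k s. y k * s) in X 2 (k + 5) (X 3 k 1) - X 3 (k + 4) (X 2 k 1) - 3 * X 7 k 1)"

text \<open>The set \<open>{0..9} \<union> {11}\<close> lists the occupied degrees; only there does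
  a congruence determine a scalar.\<close>

lemma (in prep12) graded_rel:
 assumes fF: "\<And>k. f k \<in> F k"
  and t: "\<And>k. Tc c (f k) - t k *s f (k + 1) \<in> F (k + 1 + 1)"
  and y: "\<And>k. u (g 2) (f k) - y k *s f (k + 2) \<in> F (k + 2 + 1)"
  and nz: "\<And>a k. k \<in> {0..9} \<union> {11} ==> a *s f k \<in> F (Suc k) ==> a = 0"
 shows "k + 5 \<in> {0..9} \<union> {11} ==> q23 t y k = 0"
  "k + 7 \<in> {0..9} \<union> {11} ==> q34 t y k = 0"
  "k + 9 \<in> {0..9} \<union> {11} ==> q45 t y k = 0"
proof -
 let ?\<phi> = "\<lambda>k (s::'a). s *s f k" and ?X = "sadp 1 2 (\<lambda>k s. t k * s) (\<lambda>k s. y k * s)"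
 have sT: "sym (\<lambda>k. F (k + 1)) ?\<phi> 1 (Tc c) (\<lambda>k s. t k * s)" by (rule sym1I[OF lin_Tc filtF raises_Tc t])
 have sU: "sym (\<lambda>k. F (k + 1)) ?\<phi> 2 (u (g 2)) (\<lambda>k s. y k * s)" by (rule sym1I[OF lin_u[OF g_closed] filtF g2D y])
 have sX: "sym (\<lambda>k. F (k + 1)) ?\<phi> (n + 2) (X (Tc c) n) (?X n)" for n
  using sym_adp[OF phi_add_scale sT sU, of n] by simp
 have main: "?X n (k + (m + 2)) (?X m k 1) - ?X m (k + (n + 2)) (?X n k 1) - d * ?X q k 1 = 0"
  if r: "raises F (N + 1) (\<lambda>v. cm (X (Tc c) n) (X (Tc c) m) v - d *s X (Tc c) q v)"
   and N: "n + 2 + (m + 2) = N" "q + 2 = N" "k + N \<in> {0..9} \<union> {11}" for n m d q N k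
 proof -
  have "?\<phi> (k + N) (?X n (k + (m + 2)) (?X m k 1) - ?X m (k + (n + 2)) (?X n k 1)) - d *s ?\<phi> (k + N) (?X q k 1) \<in> F (k + N + 1)"
   by (rule sym_vanish2[OF sym_cm[OF phi_add_scale sX[of n] sX[of m], unfolded N] sX[of q, unfolded N] filtF r]) (use fF in simp)
  then have "(?X n (k + (m + 2)) (?X m k 1) - ?X m (k + (n + 2)) (?X n k 1) - d * ?X q k 1) *s f (k + N) \<in> F (Suc (k + N))"
   by (simp add: scale_left_diff_distrib One_nat_def)
  from nz[OF N(3) this] show ?thesis .
 qed
 show "k + 5 \<in> {0..9} \<union> {11} ==> q23 t y k = 0"
  using main[of 5 0 1 1 3 k] rel12_23[of c] by (simp add: q23_def Let_def)
 show "k + 7 \<in> {0..9} \<union> {11} ==> q34 t y k = 0"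
  using main[of 7 1 2 "- 1" 5 k] rel12_34[of c] by (simp add: q34_def Let_def)
 show "k + 9 \<in> {0..9} \<union> {11} ==> q45 t y k = 0"
  using main[of 9 2 3 3 7 k] rel12_45[of c] by (simp add: q45_def Let_def)
qed

section \<open>Double layers in degrees 1 and 3\<close>

context proper
begin

definition Sp :: "'b set" where "Sp = span (insert p2 (L (Suc j)))"

text \<open>Degrees for weights (1,2): \<open>E k\<close> has degree \<open>k\<close> for
  \<open>k \<le> j\<close>, \<open>p2\<close> as an image under \<open>u2\<close> has degree
  \<open>j + 1\<close>, \<open>E k\<close> has degree \<open>k + 1\<close> for
  \<open>j < k \<le> 8\<close>, and \<open>E 9\<close> has degree 11 because of the step
  \<open>b 8\<close>.\<close>

definition F12 :: "nat \<Rightarrow> 'b set" where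
 "F12 n = (if n \<le> j then L n else if n = Suc j then Sp else if n \<le> 9 then L (n - 1) else if n \<le> 11 then L 9 else {0})"

definition E12 :: "nat \<Rightarrow> 'b" where
 "E12 n = (if n \<le> j then E n else if n = Suc j then p2 else if n \<le> 9 then E (n - 1) else if n = 11 then E 9 else 0)"

lemma Sp: "x \<in> Sp \<longleftrightarrow> (\<exists>a. x - a *s p2 \<in> L (Suc j))"
 unfolding Sp_def span_breakdown_eq span_eq_iff[THEN iffD2, OF subL[of "Suc j"]] by (rule refl)

lemma Sp_sub: "subspace Sp" unfolding Sp_def by simp

lemma Sp_L: "Sp \<subseteq> L j" "L (Suc j) \<subseteq> Sp" "p2 \<in> Sp"
proof -
 have "L (Suc j) \<subseteq> L j" by (rule R_Suc_subset[OF rep])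
 then show "Sp \<subseteq> L j" unfolding Sp_def using p2L by (intro span_minimal subL) auto
 show "L (Suc j) \<subseteq> Sp" "p2 \<in> Sp" unfolding Sp_def using span_superset[of "insert p2 (L (Suc j))"] by auto
qed

lemma F12_eq: "n \<le> j ==> F12 n = L n" "F12 (Suc j) = Sp" "j + 2 \<le> n ==> n \<le> 9 ==> F12 n = L (n - 1)"
 "10 \<le> n ==> n \<le> 11 ==> F12 n = L 9" "12 \<le> n ==> F12 n = {0}"
 using j by (auto simp: F12_def)

lemma n_cases:
 obtains "Suc n < j" | "Suc n = j" | "n = j" | "n = Suc j" | "j + 2 \<le> n" "n \<le> 7" | "n = 8" | "n = 9" | "n = 10" | "n = 11" | "12 \<le> n"
 using j by linarith

lemma F12_sub: "subspace (F12 n)"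
 unfolding F12_def using subL Sp_sub by (auto simp: subspace_single_0)

lemma F12_Suc: "F12 (Suc n) \<subseteq> F12 n"
proof -
 have s: "L (Suc k) \<subseteq> L k" for k by (rule R_Suc_subset[OF rep])
 show ?thesis
 proof (cases rule: n_cases[of n])
  case 5
  then show ?thesis using s[of "n - 1"] by (simp add: F12_eq)
 qed (use s s[of 7] s[of 8] Sp_L subspace_0[OF subL] j in \<open>auto simp: F12_eq F12_def dest: subsetD[OF s] subsetD[OF Sp_L(1)] subsetD[OF Sp_L(2)]\<close>)
qed

lemma F12_filt: "filt F12"
 unfolding filt_def using F12_sub F12_Suc by blast

lemma L9u: "x \<in> L 9 ==> u1 x = 0" "x \<in> L 9 ==> u2 x = 0"
 using caseB(2)[OF L10] by auto

lemma F12_u1: "raises F12 1 u1"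
 unfolding raises_def
proof (intro allI ballI)
 fix n x assume x: "x \<in> F12 n"
 show "u1 x \<in> F12 (n + 1)"
 proof (cases rule: n_cases[of n])
  case 1
  then show ?thesis using x u_L(1)[of x n] by (simp add: F12_eq One_nat_def)
 next
  case 2
  then show ?thesis using x u_L(1)[of x n] by (simp add: F12_eq One_nat_def)
 next
  case 3
  then show ?thesis using x u_L(1)[of x n] Sp_L(2) by (auto simp: F12_eq One_nat_def)
 next
  case 4
  then have "x \<in> L j" using x Sp_L(1) by (auto simp: F12_eq)
  then show ?thesis using u_L(1)[of x j] 4 j by (simp add: F12_eq One_nat_def)
 next
  case 5
  then show ?thesis using x u_L(1)[of x "n - 1"] by (simp add: F12_eq One_nat_def)
 next
  case 6
  then show ?thesis using x u_L(1)[of x 7] j by (simp add: F12_eq)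
 next
  case 7
  then show ?thesis using x u_L(1)[of x 8] j by (simp add: F12_eq)
 next
  case 8
  then show ?thesis using x L9u subspace_0[OF subL] by (simp add: F12_eq)
 next
  case 9
  then show ?thesis using x L9u by (simp add: F12_eq)
 next
  case 10
  then show ?thesis using x lin_0[OF lin_u] by (simp add: F12_eq)
 qed
qed

text \<open>Outside the double layer \<open>u2\<close> has to skip a layer, which is
  \<open>zb\<close>. \<open>Rr = 0\<close> is required because \<open>p2\<close> and
  \<open>E (j + 1)\<close> are only one degree apart.\<close>

lemma F12_u2:
 assumes zb: "\<And>k. k \<le> 7 ==> k \<noteq> j ==> Suc k \<noteq> j ==> b k = 0" and R0: "Rr = 0"
 shows "raises F12 2 u2"
 unfolding raises_def
proof (intro allI ballI)
 fix n x assume x: "x \<in> F12 n"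
 have z: "u2 v \<in> L (k + 2)" if v: "v \<in> L k" and k: "k \<le> 7" "k \<noteq> j" "Suc k \<noteq> j" for v k
 proof -
  obtain a where a: "v - a *s E k \<in> L (Suc k)" using sp[OF v k(2)] by blast
  have 1: "u2 (v - a *s E k) \<in> L (k + 2)" using u_L(2)[OF a] by simp
  have 2: "u2 (E k) \<in> L (k + 2)" using uE[OF k(3,2)] zb[OF k] by simp
  from subspace_add[OF subL 1 subspace_scale[OF subL 2, of a]] show ?thesis
   by (simp add: lin_diff[OF lin_u] lin_scale[OF lin_u])
 qed
 show "u2 x \<in> F12 (n + 2)"
 proof (cases rule: n_cases[of n])
  case 1
  then show ?thesis using x z[of x n] j by (simp add: F12_eq)
 next
  case 2
  then have xl: "x \<in> L n" "n \<noteq> j" using x by (auto simp: F12_eq)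
  obtain a where a: "x - a *s E n \<in> L (Suc n)" using sp[OF xl] by blast
  have "u2 x - a *s p2 = u2 (x - a *s E n)" using up[OF 2] by (simp add: lin_diff[OF lin_u] lin_scale[OF lin_u])
  then have "u2 x - a *s p2 \<in> L (Suc j)" using u_L(2)[OF a] 2 by simp
  then have "u2 x \<in> Sp" using Sp by blast
  moreover have "n + 2 = Suc j" using 2 by simp
  ultimately show ?thesis using F12_eq(2) by simp
 next
  case 3
  then show ?thesis using x u_L(2)[of x j] j by (simp add: F12_eq)
 next
  case 4
  then obtain a where a: "x - a *s p2 \<in> L (Suc j)" using x Sp by (auto simp: F12_eq)
  have "u2 (x - a *s p2) \<in> L (j + 2)" "u2 p2 \<in> L (j + 2)" using u_L(2)[OF a] Tj(4) R0 by auto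
  then have "u2 (x - a *s p2) + a *s u2 p2 \<in> L (j + 2)" by (intro subspace_add[OF subL] subspace_scale[OF subL])
  then show ?thesis using 4 j by (simp add: F12_eq lin_diff[OF lin_u] lin_scale[OF lin_u])
 next
  case 5
  then have "n - 1 + 2 = Suc n" "n - 1 \<le> 7" "n - 1 \<noteq> j" "Suc (n - 1) \<noteq> j" by auto
  then show ?thesis using x z[of x "n - 1"] 5 by (simp add: F12_eq)
 next
  case 6
  then show ?thesis using x z[of x 7] j by (simp add: F12_eq)
 next
  case 7
  then show ?thesis using x u_L(2)[of x 8] j by (simp add: F12_eq)
 next
  case 8
  then show ?thesis using x L9u by (simp add: F12_eq)
 next
  case 9
  then show ?thesis using x L9u by (simp add: F12_eq)
 next
  case 10
  then show ?thesis using x lin_0[OF lin_u] by (simp add: F12_eq)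
 qed
qed

lemma E12_eq: "n \<le> j ==> E12 n = E n" "E12 (Suc j) = p2" "j + 2 \<le> n ==> n \<le> 9 ==> E12 n = E (n - 1)"
 "E12 10 = 0" "E12 11 = E 9" "12 \<le> n ==> E12 n = 0"
 using j by (auto simp: E12_def)

lemma E12_F: "E12 n \<in> F12 n"
 by (cases rule: n_cases[of n]) (use E_L Sp_L subspace_0[OF subL] j in \<open>auto simp: E12_eq F12_eq\<close>)

lemma lay12: "x \<in> F12 n ==> \<exists>a. x - a *s E12 n \<in> F12 (Suc n)"
proof -
 assume x: "x \<in> F12 n"
 show ?thesis
 proof (cases rule: n_cases[of n])
  case 1
  then show ?thesis using x sp[of x n] by (simp add: F12_eq E12_eq)
 next
  case 2
  then show ?thesis using x sp[of x n] by (simp add: F12_eq E12_eq)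
 next
  case 3
  then obtain a a' where "x - a *s E j - a' *s p2 \<in> L (Suc j)" using x spj[of x] by (auto simp: F12_eq)
  then have "x - a *s E j \<in> Sp" using Sp by blast
  then show ?thesis using 3 by (auto simp: F12_eq E12_eq)
 next
  case 4
  then show ?thesis using x Sp[of x] j by (simp add: F12_eq E12_eq)
 next
  case 5
  then show ?thesis using x sp[of x "n - 1"] by (simp add: F12_eq E12_eq)
 next
  case 6
  then show ?thesis using x sp[of x 7] j by (simp add: F12_eq E12_eq)
 next
  case 7
  then show ?thesis using x sp[of x 8] j by (simp add: F12_eq E12_eq)
 next
  case 8
  then show ?thesis using x by (simp add: F12_eq E12_eq)
 next
  case 9
  then show ?thesis using x sp[of x 9] j L10 by (simp add: F12_eq E12_eq)
 next
  case 10
  then show ?thesis using x by (intro exI[of _ 0]) (simp add: F12_eq E12_eq)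
 qed
qed

lemma nz12: "n \<in> {0..9} \<union> {11} ==> a *s E12 n \<in> F12 (Suc n) ==> a = 0"
proof -
 assume n: "n \<in> {0..9} \<union> {11}" and a: "a *s E12 n \<in> F12 (Suc n)"
 have z: "a = 0" if "a *s E k \<in> L (Suc k)" "k \<le> 9" "k \<noteq> j" for k
 proof (rule ccontr)
  assume "a \<noteq> 0"
  with subspace_scale[OF subL that(1), of "inverse a"] nE[OF that(2,3)] show False by simp
 qed
 show ?thesis
 proof (cases rule: n_cases[of n])
  case 1
  then show ?thesis using a z[of n] j by (simp add: F12_eq E12_eq)
 next
  case 2
  then show ?thesis using a z[of n] j by (simp add: F12_eq E12_eq)
 next
  case 3
  then obtain a' where "a *s E j - a' *s p2 \<in> L (Suc j)" using a Sp by (auto simp: F12_eq E12_eq)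
  then have "a *s E j + (- a') *s p2 \<in> L (Suc j)" by simp
  then show ?thesis using nj by blast
 next
  case 4
  then show ?thesis using a nj[of 0 a] j by (simp add: F12_eq E12_eq)
 next
  case 5
  then show ?thesis using a z[of "n - 1"] by (simp add: F12_eq E12_eq)
 next
  case 6
  then show ?thesis using a z[of 7] j by (simp add: F12_eq E12_eq)
 next
  case 7
  then show ?thesis using a z[of 8] j by (simp add: F12_eq E12_eq)
 next
  case 8
  then show ?thesis using n by simp
 next
  case 9
  then show ?thesis using a z[of 9] j L10 by (simp add: F12_eq E12_eq)
 next
  case 10
  then show ?thesis using n by simp
 qed
qed

lemma prep12F:
 assumes "\<And>k. k \<le> 7 ==> k \<noteq> j ==> Suc k \<noteq> j ==> b k = 0" "Rr = 0"
 shows "prep12 scale Basis G g V \<rho> F12"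
 unfolding prep12_def using F12_filt F12_u1 F12_u2[OF assms] L_V[of 0] j by (intro adm) (auto simp: F12_eq)

text \<open>The linear relations express the scalars by \<open>y 6\<close> and \<open>P\<close>. One
  more relation gives \<open>7 * y 6 = - 6\<close>, and with the quadratic one
  \<open>y 6 = - 2\<close>, so 8 would be 0.\<close>

lemma j3: assumes jj: "j = 3" shows False
proof -
 note z = j3_zero[OF jj]
 have zb: "b k = 0" if "k \<le> 7" "k \<noteq> j" "Suc k \<noteq> j" for k
 proof -
  have "k = 0 \<or> k = 1 \<or> k = 4 \<or> k = 5 \<or> k = 6 \<or> k = 7" using that jj by auto
  then show ?thesis using z by auto
 qed
 interpret a: prep12 scale Basis G g V \<rho> F12 by (rule prep12F[OF zb z(8)])
 have Tc: "a.Tc c = Tg c" by (simp add: a.Tc_def Tg_def)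
 \<comment> \<open>The scalar is 0 at degree 3, since \<open>Tg c (E 3)\<close> lies in degree 5
   rather than 4, and at degree 9, since degree 10 is empty; \<open>P\<close> belongs to the step
   from \<open>p2\<close> to \<open>E 4\<close>.\<close>
 define t where "t n = (if n < 3 then 1 else if n = 3 then 0 else if n = 4 then P else if n \<le> 8 then 1 else (0::'a))" for n :: nat
 have F3: "F12 (Suc (Suc n)) = (if n \<le> 1 then L (n + 2) else if n = 2 then Sp else if n \<le> 7 then L (n + 1) else if n \<le> 9 then L 9 else {0})" for n
  unfolding F12_def using jj by (auto simp: One_nat_def)
 have E3: "E12 n = (if n \<le> 3 then E n else if n = 4 then p2 else if n \<le> 9 then E (n - 1) else if n = 11 then E 9 else 0)" for n
  unfolding E12_def using jj by auto
 have j4: "Suc j = 4" "j + 2 = 5" using jj by auto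
 have T: "Tg c (E12 n) - t n *s E12 (n + 1) \<in> F12 (n + 1 + 1)" for n
 proof -
  consider "n < 3" | "n = 3" | "n = 4" | "5 \<le> n" "n \<le> 8" | "n = 9" | "n = 10" | "n = 11" | "12 \<le> n" by linarith
  then show ?thesis
  proof cases
   case 1
   then have "Tg c (E n) = E (Suc n)" using TE[of n] jj by simp
   then show ?thesis using 1 subspace_0[OF F12_sub] by (simp add: t_def E3 One_nat_def)
  next
   case 2
   have f: "F12 5 = L 4" unfolding F12_def using jj by simp
   have "Tg c (E 3) \<in> L 4" using Tg_L[OF E_L[of 3]] by simp
   then show ?thesis using 2 f by (simp add: t_def E3)
  next
   case 3
   have f: "F12 6 = L 5" unfolding F12_def using jj by simp
   show ?thesis using Tj(2)[unfolded j4] 3 f by (simp add: t_def E3)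
  next
   case 4
   then have "Tg c (E (n - 1)) = E n" using TE[of "n - 1"] jj by simp
   then show ?thesis using 4 subspace_0[OF F12_sub] by (simp add: t_def E3 One_nat_def)
  next
   case 5
   have "Tg c (E 8) \<in> L 9" using Tg_L[OF E_L[of 8]] by simp
   have f: "F12 11 = L 9" unfolding F12_def using jj by simp
   from \<open>Tg c (E 8) \<in> L 9\<close> show ?thesis using 5 f by (simp add: t_def E3)
  next
   case 6
   then show ?thesis using lin_0[OF lin_Tg] subspace_0[OF F12_sub] by (simp add: t_def E3)
  next
   case 7
   have "Tg c (E 9) = 0" using z10[OF Tg_L[OF E_L[of 9]]] by simp
   then show ?thesis using 7 subspace_0[OF F12_sub] by (simp add: t_def E3)
  next
   case 8
   then show ?thesis using lin_0[OF lin_Tg] subspace_0[OF F12_sub] by (simp add: t_def E3)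
  qed
 qed
 have "\<exists>a. u2 (E12 n) - a *s E12 (n + 2) \<in> F12 (n + 2 + 1)" for n
  using lay12[OF raisesD[OF a.g2D E12_F[of n]]] by (simp add: One_nat_def)
 then obtain y0 where y0: "\<And>n. u2 (E12 n) - y0 n *s E12 (n + 2) \<in> F12 (n + 2 + 1)" by metis
 define y where "y n = (if n = 2 then 1 else if n = 3 then Q else if n = 9 then b 8 else if n = 8 \<or> 10 \<le> n then 0 else y0 n)" for n
 have Y: "u2 (E12 n) - y n *s E12 (n + 2) \<in> F12 (n + 2 + 1)" for n
 proof -
  consider "n = 2" | "n = 3" | "n = 9" | "n = 8" | "n = 10" | "12 \<le> n" | "n = 11" | "n \<noteq> 2" "n \<noteq> 3" "n \<noteq> 8" "n < 9" by linarith
  then show ?thesis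
  proof cases
   case 1
   have "u2 (E 2) = p2" using up[of 2] jj by simp
   then show ?thesis using 1 subspace_0[OF F12_sub] by (simp add: y_def E3)
  next
   case 2
   have f: "F12 6 = L 5" unfolding F12_def using jj by simp
   have "u2 (E 3) - Q *s E 4 \<in> L 5" using Tj(3)[unfolded j4] unfolding jj .
   then show ?thesis using 2 f by (simp add: y_def E3)
  next
   case 3
   have f: "F12 12 = {0}" unfolding F12_def using jj by simp
   have "u2 (E 8) - b 8 *s E 9 \<in> L 10" using uE[of 8] jj by simp
   then show ?thesis using 3 f L10 by (simp add: y_def E3)
  next
   case 4
   then show ?thesis using y0[of 8] by (simp add: y_def E3)
  next
   case 5
   then show ?thesis using lin_0[OF lin_u] subspace_0[OF F12_sub] by (simp add: y_def E3)
  next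
   case 6
   then show ?thesis using lin_0[OF lin_u] subspace_0[OF F12_sub] by (simp add: y_def E3)
  next
   case 7
   then show ?thesis using L9u(2)[OF E_L[of 9]] subspace_0[OF F12_sub] by (simp add: y_def E3)
  next
   case 8
   then show ?thesis using y0[of n] by (simp add: y_def)
  qed
 qed
 have eqL: "k + 5 \<in> {0..9} \<union> {11} ==> q23 t y k = 0" "k + 7 \<in> {0..9} \<union> {11} ==> q34 t y k = 0" for k
  by ((rule a.graded_rel[of E12 c t y]; (rule E12_F | rule T[folded Tc] | rule Y | erule (1) nz12 | assumption))+)
 have s12: "Suc 0 = 1" "Suc (Suc 0) = 2" by (simp_all add: One_nat_def)
 have tab: "t 0 = 1" "t 1 = 1" "t 2 = 1" "y 2 = 1" "t 3 = 0" "y 3 = Q" "t 4 = P" "t 5 = 1" "t 6 = 1" "t 7 = 1" "t 8 = 1" "y 8 = 0" "t 9 = 0" "y 9 = b 8" "t 10 = 0" "y 10 = 0" "t 11 = 0" "y 11 = 0"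
  by (simp_all add: t_def y_def)
 have E23_3: "- Q - Q * y 5 + 2 * Q * y 6 = 0"
 proof -
  have "q23 t y 3 = - Q - Q * y 5 + 2 * Q * y 6"
   unfolding q23_def Let_def by (simp add: sadp_numeral sadp_one tab s12 algebra_simps)
  then show ?thesis using eqL(1)[of 3] by simp
 qed
 have E23_6: "b 8 + 2 * b 8 * y 6 - b 8 * y 7 = 0"
 proof -
  have "q23 t y 6 = b 8 + 2 * b 8 * y 6 - b 8 * y 7"
   unfolding q23_def Let_def by (simp add: sadp_numeral sadp_one tab s12 algebra_simps)
  then show ?thesis using eqL(1)[of 6] by simp
 qed
 have E34_4: "- P * b 8 + 3 * P * b 8 * y 5 - P * b 8 * y 6 - 2 * b 8 * y 4 = 0"
 proof -
  have "q34 t y 4 = - P * b 8 + 3 * P * b 8 * y 5 - P * b 8 * y 6 - 2 * b 8 * y 4"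
   unfolding q34_def Let_def by (simp add: sadp_numeral sadp_one tab s12 algebra_simps)
  then show ?thesis using eqL(2)[of 4] by simp
 qed
 have E34_2: "P - P * y 5 + 3 * P * y 6 - 2 * P * y 7 - 5 * Q + Q * y 5 - 4 * Q * y 6 + 3 * Q * y 7 = 0"
 proof -
  have "q34 t y 2 = P - P * y 5 + 3 * P * y 6 - 2 * P * y 7 - 5 * Q + Q * y 5 - 4 * Q * y 6 + 3 * Q * y 7"
   unfolding q34_def Let_def by (simp add: sadp_numeral sadp_one tab s12 algebra_simps)
  then show ?thesis using eqL(2)[of 2] by simp
 qed
 have E23_4: "3 * P * y 5 - P * y 5 * y 7 - 3 * P * y 6 + P * y 7 - y 4 - y 4 * y 6 + 2 * y 4 * y 7 = 0"
 proof -
  have "q23 t y 4 = 3 * P * y 5 - P * y 5 * y 7 - 3 * P * y 6 + P * y 7 - y 4 - y 4 * y 6 + 2 * y 4 * y 7"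
   unfolding q23_def Let_def by (simp add: sadp_numeral sadp_one tab s12 algebra_simps)
  then show ?thesis using eqL(1)[of 4] by simp
 qed
 have b8: "b 8 \<noteq> 0" and Q0: "Q \<noteq> 0" and PQ: "2 * P = 5 * Q" using z by auto
 have P0: "P \<noteq> 0"
 proof
  assume "P = 0"
  then have "5 * Q = 0" using PQ by simp
  then show False using Q0 char_ne[of 5] by simp
 qed
 have 5: "y 5 = 2 * y 6 - 1"
 proof -
  have "Q * (2 * y 6 - 1 - y 5) = 0" using E23_3 by Groebner_Basis.algebra
  then show ?thesis using Q0 by simp
 qed
 have 7: "y 7 = 2 * y 6 + 1"
 proof -
  have "b 8 * (2 * y 6 + 1 - y 7) = 0" using E23_6 by Groebner_Basis.algebra
  then show ?thesis using b8 by simp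
 qed
 have 4: "2 * y 4 = P * (5 * y 6 - 4)"
 proof -
  have "b 8 * (P * (5 * y 6 - 4) - 2 * y 4) = 0" using E34_4 5 by Groebner_Basis.algebra
  then show ?thesis using b8 by simp
 qed
 have 6: "7 * y 6 = - 6"
 proof -
  have "Q * (7 * y 6 + 6) = 0" using E34_2 5 7 PQ by Groebner_Basis.algebra
  then have "7 * y 6 + 6 = 0" using Q0 by simp
  then show ?thesis by (simp add: eq_neg_iff_add_eq_0)
 qed
 have "P * (7 * y 6 * y 6 + 3 * y 6 - 6) = 0" using E23_4 5 7 4 by Groebner_Basis.algebra
 then have "7 * y 6 * y 6 + 3 * y 6 - 6 = 0" using P0 by simp
 then have "3 * (y 6 + 2) = 0" using 6 by Groebner_Basis.algebra
 then have "3 = (0::'a) \<or> y 6 + 2 = 0" by (simp only: mult_eq_0_iff)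
 then have "y 6 + 2 = 0" using char_ne[of 3] by simp
 then have "y 6 = - 2" by (simp add: eq_neg_iff_add_eq_0)
 then have e: "7 * (- 2) = (- 6 :: 'a)" using 6 by simp
 have "(of_nat 8 :: 'a) = - (7 * (- 2) - (- 6))" by simp
 also have "\<dots> = 0" unfolding e by simp
 finally show False using char_ne[of 8] by simp
qed

end

context proper
begin

text \<open>The leading equations leave a candidate, with \<open>y 5 = 2\<close>. Therefore the
  relations are compared one degree deeper, using \<open>Al\<close> in place of \<open>u1\<close>;
  the eight second-order equations obtained for the candidate are contradictory.\<close>

lemma j1: assumes jj: "j = 1" shows False
proof -
 note z = j1_zero[OF jj]
 have zb: "b k = 0" if "k \<le> 7" "k \<noteq> j" "Suc k \<noteq> j" for k
 proof -
  have "k \<noteq> 0" "k \<noteq> 1" using that jj by (auto simp: One_nat_def)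
  then have "k = 2 \<or> k = 3 \<or> k = 4 \<or> k = 5 \<or> k = 6 \<or> k = 7" using that(1) by linarith
  then show ?thesis using z by auto
 qed
 interpret a: prep12 scale Basis G g V \<rho> F12 by (rule prep12F[OF zb z(8)])
 let ?A = "a.Al"
 have Sj: "Suc j = 2" "j + 2 = 3" using jj by auto
 have F1: "F12 n = (if n \<le> 1 then L n else if n = 2 then Sp else if n \<le> 9 then L (n - 1) else if n \<le> 11 then L 9 else {0})" for n
  unfolding F12_def Sj using jj by simp
 have E1: "E12 n = (if n \<le> 1 then E n else if n = 2 then p2 else if n \<le> 9 then E (n - 1) else if n = 11 then E 9 else 0)" for n
  unfolding E12_def Sj using jj by simp
 have s0: "0 \<in> F12 n" for n by (rule subspace_0[OF F12_sub])
 have lA: "lin ?A" by (rule a.lin_Al)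
 have AT: "raises F12 2 (\<lambda>v. ?A v - Tg c v)"
 proof -
  have "(?A v - u1 v) - c *s u2 v = ?A v - Tg c v" for v by (simp add: Tg_def)
  then show ?thesis using raises_diff[OF F12_filt a.Al_u1 raises_scale[OF F12_filt a.g2D, of c]] by (simp only:)
 qed
 \<comment> \<open>The basis is generated by \<open>Al\<close>, so that \<open>Al\<close> acts by 1
   exactly, not only at leading order, from \<open>f 0\<close> to \<open>f 1\<close> and along
   \<open>f 2\<close>, ..., \<open>f 9\<close>.\<close>
 define f where "f n = (if n = 0 then E 0 else if n = 1 then ?A (E 0) else if n \<le> 9 then (?A ^^ (n - 2)) p2 else if n = 11 then E 9 else 0)" for n
 have f: "f 0 = E 0" "f 1 = ?A (E 0)" "f 2 = p2" "f 10 = 0" "f 11 = E 9" "\<And>n. 12 \<le> n ==> f n = 0"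
  by (simp_all add: f_def)
 have Af: "?A (f n) = f (Suc n)" if "2 \<le> n" "n \<le> 8" for n
 proof -
  have "Suc n - 2 = Suc (n - 2)" using that by simp
  then show ?thesis using that by (simp add: f_def)
 qed
 have Af0: "?A (f 0) = f 1" by (simp add: f)
 have u20: "u2 (f 0) = f 2" using up[of 0] jj by (simp add: f One_nat_def)
 \<comment> \<open>The ratio to the earlier basis: from \<open>p2\<close> on the new chain follows
   \<open>Al\<close>, whose first step to \<open>E 2\<close> has the scalar
   \<open>P\<close>.\<close>
 define kp where "kp n = (if 3 \<le> n \<and> n \<le> 9 then P else (1::'a))" for n :: nat
 have kp0: "kp n \<noteq> 0" for n using z by (simp add: kp_def)
 have lead0: "m \<le> 6 ==> f (m + 3) - P *s E12 (m + 3) \<in> F12 (m + 4)" for m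
 proof (induction m)
  case 0
  have 1: "?A p2 - Tg c p2 \<in> F12 4" using raisesD[OF AT, of p2 2] Sp_L(3) by (simp add: F1)
  have 2: "Tg c p2 - P *s E 2 \<in> F12 4" using Tj(2) unfolding Sj by (simp add: F1)
  have "f 3 = ?A p2" using Af[of 2] f(3) by simp
  then show ?case using subspace_add[OF F12_sub 1 2] by (simp add: E1)
 next
  case (Suc m)
  let ?n = "m + 3"
  have n: "?n \<le> 8" using Suc.prems by simp
  have s1: "m + 3 + 2 = m + 5" "m + 4 + 1 = m + 5" "m + 4 + Suc 0 = m + 5" "Suc (m + 3) = m + 4" "Suc (m + 2) = m + 3" by simp_all
  have IH: "f ?n - P *s E12 ?n \<in> F12 (m + 4)" using Suc by simp
  have 1: "?A (f ?n - P *s E12 ?n) \<in> F12 (m + 5)" using raisesD[OF a.raises_Al IH] by (simp only: s1)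
  have 2: "?A (E12 ?n) - Tg c (E12 ?n) \<in> F12 (m + 5)" using raisesD[OF AT E12_F[of ?n]] by (simp only: s1)
  have "E12 ?n = E (m + 2)" "E12 (m + 4) = E (m + 3)" unfolding E1 using n by (simp_all add: add.commute)
  moreover have "Tg c (E (m + 2)) = E (m + 3)" using TE[of "m + 2", unfolded s1] jj by simp
  ultimately have t: "Tg c (E12 ?n) = E12 (m + 4)" by (simp only:)
  have e: "f (m + 4) = ?A (f ?n)" using Af[of ?n, unfolded s1] n by simp
  have "?A (f ?n - P *s E12 ?n) + P *s (?A (E12 ?n) - Tg c (E12 ?n)) \<in> F12 (m + 5)"
   by (intro subspace_add[OF F12_sub] subspace_scale[OF F12_sub] 1 2)
  then have "f (m + 4) - P *s E12 (m + 4) \<in> F12 (m + 5)"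
   unfolding e t by (simp add: lin_diff[OF lA] lin_scale[OF lA] scale_right_diff_distrib)
  moreover have "Suc m + 3 = m + 4" "Suc m + 4 = m + 5" by simp_all
  ultimately show ?case by (simp only:)
 qed
 have lead: "f n - kp n *s E12 n \<in> F12 (Suc n)" for n
 proof -
  consider "n = 0" | "n = 1" | "n = 2" | "3 \<le> n" "n \<le> 9" | "n = 10" | "n = 11" | "12 \<le> n" by linarith
  then show ?thesis
  proof cases
   case 1
   then show ?thesis using s0 by (simp add: f kp_def E1)
  next
   case 2
   have "?A (E 0) - Tg c (E 0) \<in> F12 2" using raisesD[OF AT, of "E 0" 0] E_L[of 0] by (simp add: F1)
   moreover have "Tg c (E 0) = E 1" using TE[of 0] jj by (simp add: One_nat_def)
   ultimately show ?thesis using 2 by (simp add: f kp_def E1)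
  next
   case 3
   then show ?thesis using s0 by (simp add: f kp_def E1)
  next
   case 4
   have "n - 3 + 3 = n" "n - 3 + 4 = Suc n" using 4 by auto
   then show ?thesis using lead0[of "n - 3"] 4 by (simp add: kp_def)
  next
   case 5
   then show ?thesis using s0 by (simp add: f kp_def E1)
  next
   case 6
   then show ?thesis using s0 by (simp add: f kp_def E1)
  next
   case 7
   then show ?thesis using s0 f(6) by (simp add: kp_def E1)
  qed
 qed
 have fF: "f n \<in> F12 n" for n
 proof -
  have "f n - kp n *s E12 n \<in> F12 n" using lead[of n] F12_Suc[of n] by blast
  from subspace_add[OF F12_sub this subspace_scale[OF F12_sub E12_F, of "kp n" n]] show ?thesis by simp
 qed
 have nzf: "x = 0" if n: "n \<in> {0..9} \<union> {11}" and x: "x *s f n \<in> F12 (Suc n)" for x n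
 proof -
  have "x *s f n - x *s (f n - kp n *s E12 n) \<in> F12 (Suc n)"
   by (intro subspace_diff[OF F12_sub] subspace_scale[OF F12_sub] x lead)
  then have "(x * kp n) *s E12 n \<in> F12 (Suc n)" by (simp add: scale_right_diff_distrib)
  from nz12[OF n this] show ?thesis using kp0[of n] by simp
 qed
 have layf: "\<exists>x. v - x *s f n \<in> F12 (Suc n)" if v: "v \<in> F12 n" for v n
 proof -
  obtain x where x: "v - x *s E12 n \<in> F12 (Suc n)" using lay12[OF v] by blast
  have "(v - x *s E12 n) - (x / kp n) *s (f n - kp n *s E12 n) \<in> F12 (Suc n)"
   by (intro subspace_diff[OF F12_sub] subspace_scale[OF F12_sub] x lead)
  then have "v - (x / kp n) *s f n \<in> F12 (Suc n)" using kp0[of n] by (simp add: scale_right_diff_distrib)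
  then show ?thesis by blast
 qed
 have u1f1: "u1 (f 1) \<in> F12 3" using u_L(1)[of "f 1" 1] fF[of 1] by (simp add: F1)
 have u1f9: "u1 (f 9) \<in> L 9" using u_L(1)[of "f 9" 8] fF[of 9] by (simp add: F1)
 define t where "t n = (if n = 0 \<or> 2 \<le> n \<and> n \<le> 8 then 1 else (0::'a))" for n :: nat
 have Au: "?A v - u1 v \<in> F12 (n + 2)" if "v \<in> F12 n" for v n using raisesD[OF a.Al_u1 that] .
 have Tlead: "?A (f n) - t n *s f (n + 1) \<in> F12 (n + 1 + 1)" for n
 proof -
  consider "n = 0" | "n = 1" | "2 \<le> n" "n \<le> 8" | "n = 9" | "n = 10" | "n = 11" | "12 \<le> n" by linarith
  then show ?thesis
  proof cases
   case 1
   then show ?thesis using Af0 s0 by (simp add: t_def)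
  next
   case 2
   have "?A (f 1) - u1 (f 1) \<in> F12 3" using Au[OF fF[of 1]] by simp
   from subspace_add[OF F12_sub this u1f1] have "?A (f 1) - u1 (f 1) + u1 (f 1) \<in> F12 3" .
   then show ?thesis using 2 by (simp add: t_def)
  next
   case 3
   then show ?thesis using Af[of n] s0 by (simp add: t_def One_nat_def)
  next
   case 4
   have "?A (f 9) - u1 (f 9) \<in> F12 11" "u1 (f 9) \<in> F12 11" using Au[OF fF[of 9]] u1f9 by (simp_all add: F1)
   from subspace_add[OF F12_sub this] show ?thesis using 4 by (simp add: t_def)
  next
   case 5
   then show ?thesis using lin_0[OF lA] s0 by (simp add: t_def f)
  next
   case 6
   then show ?thesis using Au[OF fF[of 11]] L9u(1)[OF E_L[of 9]] s0 by (simp add: t_def f)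
  next
   case 7
   then show ?thesis using lin_0[OF lA] s0 f(6)[of n] by (simp add: t_def)
  qed
 qed
 have Tlead0: "a.Tc 0 (f n) - t n *s f (n + 1) \<in> F12 (n + 1 + 1)" for n
 proof -
  have e: "a.Tc 0 (f n) = u1 (f n)" by (simp add: a.Tc_def)
  have i: "n + 1 + 1 = n + 2" by simp
  from subspace_diff[OF F12_sub Tlead[of n, unfolded i] Au[OF fF[of n]]]
  show ?thesis unfolding e i by (simp add: algebra_simps)
 qed
 have "\<exists>x. u2 (f n) - x *s f (n + 2) \<in> F12 (n + 2 + 1)" for n
  using layf[OF raisesD[OF a.g2D fF[of n]]] by (simp add: One_nat_def)
 then obtain y0 where y0: "\<And>n. u2 (f n) - y0 n *s f (n + 2) \<in> F12 (n + 2 + 1)" by metis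
 define y where "y n = (if n = 0 then 1 else if n = 8 \<or> 10 \<le> n then 0 else y0 n)" for n
 have Y: "u2 (f n) - y n *s f (n + 2) \<in> F12 (n + 2 + 1)" for n
 proof -
  consider "n = 0" | "n = 8" | "n = 10" | "n = 11" | "12 \<le> n" | "n \<noteq> 0" "n \<noteq> 8" "n \<le> 9" by linarith
  then show ?thesis
  proof cases
   case 1
   then show ?thesis using u20 s0 by (simp add: y_def numeral_2_eq_2)
  next
   case 2
   then show ?thesis using y0[of 8] by (simp add: y_def f)
  next
   case 3
   then show ?thesis using lin_0[OF lin_u] s0 by (simp add: y_def f)
  next
   case 4
   then show ?thesis using L9u(2)[OF E_L[of 9]] s0 by (simp add: y_def f)
  next
   case 5
   then show ?thesis using lin_0[OF lin_u] s0 f(6)[of n] by (simp add: y_def)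
  next
   case 6
   then show ?thesis using y0[of n] by (simp add: y_def)
  qed
 qed
 have eqL: "k + 5 \<in> {0..9} \<union> {11} ==> q23 t y k = 0" "k + 7 \<in> {0..9} \<union> {11} ==> q34 t y k = 0"
  "k + 9 \<in> {0..9} \<union> {11} ==> q45 t y k = 0" for k
  by ((rule a.graded_rel[of f 0 t y]; (rule fF | rule Tlead0 | rule Y | erule (1) nzf | assumption))+)
 have s12: "Suc 0 = 1" "Suc (Suc 0) = 2" by (simp_all add: One_nat_def)
 have tab: "t 0 = 1" "t 1 = 0" "t 2 = 1" "t 3 = 1" "t 4 = 1" "t 5 = 1" "t 6 = 1" "t 7 = 1" "t 8 = 1" "t 9 = 0" "t 10 = 0" "t 11 = 0" "y 0 = 1" "y 8 = 0" "y 10 = 0" "y 11 = 0"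
  by (simp_all add: t_def y_def)
 have E23_1: "- y 1 - y 1 * y 3 + 2 * y 1 * y 4 = 0"
 proof -
  have "q23 t y 1 = - y 1 - y 1 * y 3 + 2 * y 1 * y 4"
   unfolding q23_def Let_def by (simp add: sadp_numeral sadp_one tab s12 algebra_simps)
  then show ?thesis using eqL(1)[of 1] by simp
 qed
 have E34_1: "y 1 - y 1 * y 4 + 3 * y 1 * y 5 - 2 * y 1 * y 6 = 0"
 proof -
  have "q34 t y 1 = y 1 - y 1 * y 4 + 3 * y 1 * y 5 - 2 * y 1 * y 6"
   unfolding q34_def Let_def by (simp add: sadp_numeral sadp_one tab s12 algebra_simps)
  then show ?thesis using eqL(2)[of 1] by simp
 qed
 have E34_4: "- 2 * y 4 * y 9 + 3 * y 5 * y 9 - y 6 * y 9 - y 9 = 0"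
 proof -
  have "q34 t y 4 = - 2 * y 4 * y 9 + 3 * y 5 * y 9 - y 6 * y 9 - y 9"
   unfolding q34_def Let_def by (simp add: sadp_numeral sadp_one tab s12 algebra_simps)
  then show ?thesis using eqL(2)[of 4] by simp
 qed
 have E23_6: "2 * y 6 * y 9 - y 7 * y 9 + y 9 = 0"
 proof -
  have "q23 t y 6 = 2 * y 6 * y 9 - y 7 * y 9 + y 9"
   unfolding q23_def Let_def by (simp add: sadp_numeral sadp_one tab s12 algebra_simps)
  then show ?thesis using eqL(1)[of 6] by simp
 qed
 have E45_2: "2 * y 2 * y 9 - 5 * y 3 * y 9 + 4 * y 4 * y 9 - y 5 * y 9 + 3 * y 9 = 0"
 proof -
  have "q45 t y 2 = 2 * y 2 * y 9 - 5 * y 3 * y 9 + 4 * y 4 * y 9 - y 5 * y 9 + 3 * y 9"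
   unfolding q45_def Let_def by (simp add: sadp_numeral sadp_one tab s12 algebra_simps)
  then show ?thesis using eqL(3)[of 2] by simp
 qed
 have E23_3: "- y 3 - y 3 * y 5 + 2 * y 3 * y 6 + 3 * y 4 - y 4 * y 6 - 3 * y 5 + y 6 = 0"
 proof -
  have "q23 t y 3 = - y 3 - y 3 * y 5 + 2 * y 3 * y 6 + 3 * y 4 - y 4 * y 6 - 3 * y 5 + y 6"
   unfolding q23_def Let_def by (simp add: sadp_numeral sadp_one tab s12 algebra_simps)
  then show ?thesis using eqL(1)[of 3] by simp
 qed
 have E23_0: "- 1 + 3 * y 1 - y 1 * y 3 - y 2 + 2 * y 3 = 0"
 proof -
  have "q23 t y 0 = - 1 + 3 * y 1 - y 1 * y 3 - y 2 + 2 * y 3"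
   unfolding q23_def Let_def by (simp add: sadp_numeral sadp_one tab s12 algebra_simps)
  then show ?thesis using eqL(1)[of 0] by simp
 qed
 have E34_0: "1 - 5 * y 1 + y 1 * y 3 - 4 * y 1 * y 4 + 3 * y 1 * y 5 - y 3 + 3 * y 4 - 2 * y 5 = 0"
 proof -
  have "q34 t y 0 = 1 - 5 * y 1 + y 1 * y 3 - 4 * y 1 * y 4 + 3 * y 1 * y 5 - y 3 + 3 * y 4 - 2 * y 5"
   unfolding q34_def Let_def by (simp add: sadp_numeral sadp_one tab s12 algebra_simps)
  then show ?thesis using eqL(2)[of 0] by simp
 qed
 have y1: "y 1 \<noteq> 0"
 proof
  assume "y 1 = 0"
  then have 1: "u2 (f 1) \<in> F12 4" using Y[of 1] by simp
  have "u2 (f 1 - kp 1 *s E12 1) \<in> F12 4" using raisesD[OF a.g2D lead[of 1]] by (simp add: s12)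
  from subspace_diff[OF F12_sub 1 this] have "u2 (E 1) \<in> L 3"
   by (simp add: F1 E1 kp_def lin_diff[OF lin_u])
  from subspace_diff[OF subL this Tj(3)[unfolded Sj]] have "Q *s E 2 \<in> L 3" unfolding jj by simp
  from subspace_scale[OF subL this, of "inverse Q"] nE[of 2] jj z show False by simp
 qed
 have y9: "y 9 \<noteq> 0"
 proof
  assume "y 9 = 0"
  then have 1: "u2 (f 9) = 0" using Y[of 9] by (simp add: F1)
  have "u2 (f 9 - kp 9 *s E12 9) = 0" using L9u(2)[of "f 9 - kp 9 *s E12 9"] lead[of 9] by (simp add: F1)
  then have "P *s u2 (E 8) = 0" using 1 by (simp add: E1 kp_def lin_diff[OF lin_u] lin_scale[OF lin_u])
  then have u8: "u2 (E 8) = 0" using z by simp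
  have "u2 (E 8) - b 8 *s E 9 \<in> L 10" using uE[of 8] jj by simp
  then have "b 8 *s E 9 = 0" using u8 L10 by simp
  then have "E 9 = 0" using z by simp
  then show False using nE[of 9] jj subspace_0[OF subL] by simp
 qed
 define q where "q = y 1"
 have e3: "y 3 = 2 * y 4 - 1"
 proof -
  have "y 1 * (2 * y 4 - 1 - y 3) = 0" using E23_1 by Groebner_Basis.algebra
  then show ?thesis using y1 by simp
 qed
 have ea: "1 - y 4 + 3 * y 5 - 2 * y 6 = 0"
 proof -
  have "y 1 * (1 - y 4 + 3 * y 5 - 2 * y 6) = 0" using E34_1 by Groebner_Basis.algebra
  then show ?thesis using y1 by simp
 qed
 have eb: "- 1 - 2 * y 4 + 3 * y 5 - y 6 = 0"
 proof -
  have "y 9 * (- 1 - 2 * y 4 + 3 * y 5 - y 6) = 0" using E34_4 by Groebner_Basis.algebra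
  then show ?thesis using y9 by simp
 qed
 have e6: "y 6 = y 4 + 2" using ea eb by Groebner_Basis.algebra
 have "3 * (y 5 - y 4 - 1) = 0" using eb e6 by Groebner_Basis.algebra
 then have "3 = (0::'a) \<or> y 5 - y 4 - 1 = 0" by (simp only: mult_eq_0_iff)
 then have "y 5 - y 4 - 1 = 0" using char_ne[of 3] by auto
 then have e4: "y 4 = y 5 - 1" by Groebner_Basis.algebra
 have e7: "y 7 = 2 * y 6 + 1"
 proof -
  have "y 9 * (2 * y 6 + 1 - y 7) = 0" using E23_6 by Groebner_Basis.algebra
  then show ?thesis using y9 by simp
 qed
 have e2: "2 * y 2 = 7 * (y 5 - 2)"
 proof -
  have "y 9 * (7 * (y 5 - 2) - 2 * y 2) = 0" using E45_2 e3 e4 by Groebner_Basis.algebra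
  then show ?thesis using y9 by simp
 qed
 have h3: "y 3 = 2 * y 5 - 3" and h6: "y 6 = y 5 + 1" using e3 e4 e6 by Groebner_Basis.algebra+
 have "(y 5 - 2) * (y 5 + 2) = - y 3 - y 3 * y 5 + 2 * y 3 * y 6 + 3 * y 4 - y 4 * y 6 - 3 * y 5 + y 6"
  unfolding h3 h6 e4 by Groebner_Basis.algebra
 also have "\<dots> = 0" by (rule E23_3)
 finally have "y 5 - 2 = 0 \<or> y 5 + 2 = 0" by (simp only: mult_eq_0_iff)
 then have t: "y 5 = 2 \<or> y 5 = - 2" by (auto simp: eq_neg_iff_add_eq_0)
 have eq: "y 5 + q * (12 - 4 * y 5) = 0" using E23_0 e2 e3 e4 unfolding q_def by Groebner_Basis.algebra
 have eq2: "1 - y 3 + 3 * y 4 - 2 * y 5 + q * (- 5 + y 3 - 4 * y 4 + 3 * y 5) = 0" using E34_0 unfolding q_def by Groebner_Basis.algebra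
 \<comment> \<open>The root -2 would require both \<open>20 * q = 2\<close> and
   \<open>6 * q = 3\<close>, hence 24 = 0.\<close>
 have y5: "y 5 = 2"
 proof (rule ccontr)
  assume "y 5 \<noteq> 2"
  then have m: "y 5 = - 2" using t by blast
  have v: "y 4 = - 3" "y 3 = - 7" using e4 e3 m by simp_all
  have c1: "- 2 + q * 20 = 0" using eq unfolding m by simp
  have c2: "3 - 6 * q = 0" using eq2 unfolding v m by (simp add: mult.commute)
  have "3 * 8 = 3 * (- 2 + q * 20) + 10 * (3 - 6 * q)" by Groebner_Basis.algebra
  then have "3 * 8 = (0::'a)" unfolding c1 c2 by simp
  then have "3 = (0::'a) \<or> 8 = (0::'a)" by (simp only: mult_eq_0_iff)
  then show False using char_ne[of 3] char_ne[of 8] by simp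
 qed
 have v: "y 4 = 1" "y 3 = 1" "y 6 = 3" "y 7 = 7" using e4 e3 e6 e7 y5 by simp_all
 have v2: "y 2 = 0" using e2 y5 char_ne[of 2] by simp
 have "2 * (1 + 2 * q) = 0" using eq unfolding y5 by Groebner_Basis.algebra
 then have "1 + 2 * q = 0" using char_ne[of 2] by (simp only: mult_eq_0_iff) simp
 then have q2: "2 * q = - 1" by Groebner_Basis.algebra
 have "\<exists>x. u2 (f n) - y n *s f (n + 2) - x *s f (n + 3) \<in> F12 (n + 4)" for n
 proof -
  have i: "n + 2 + 1 = n + 3" "Suc (n + 3) = n + 4" by simp_all
  show ?thesis using layf[OF Y[of n]] unfolding i .
 qed
 then obtain x0 where x0: "\<And>n. u2 (f n) - y n *s f (n + 2) - x0 n *s f (n + 3) \<in> F12 (n + 4)" by metis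
 \<comment> \<open>The value 0 is chosen where \<open>u2\<close> is exact (\<open>n = 0\<close>) or
   where \<open>f (n + 3)\<close> is the zero vector.\<close>
 define yp where "yp n = (if n = 0 \<or> n = 7 \<or> 9 \<le> n then 0 else x0 n)" for n
 have Yp: "u2 (f n) - (y n *s f (n + 2) + yp n *s f (n + 3)) \<in> F12 (n + 4)" for n
 proof -
  consider "n = 0" | "n = 7" | "n = 9" | "n = 10" | "n = 11" | "12 \<le> n" | "n \<noteq> 0" "n \<noteq> 7" "n \<le> 8" by linarith
  then show ?thesis
  proof cases
   case 1
   then show ?thesis using u20 s0 by (simp add: yp_def y_def numeral_2_eq_2)
  next
   case 2
   then show ?thesis using x0[of 7] by (simp add: yp_def f)
  next
   case 3
   then show ?thesis using x0[of 9] f(6)[of 12] by (simp add: yp_def)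
  next
   case 4
   then show ?thesis using lin_0[OF lin_u] s0 by (simp add: yp_def y_def f)
  next
   case 5
   then show ?thesis using L9u(2)[OF E_L[of 9]] s0 by (simp add: yp_def y_def f)
  next
   case 6
   then show ?thesis using lin_0[OF lin_u] s0 f(6)[of n] by (simp add: yp_def y_def)
  next
   case 7
   then show ?thesis using x0[of n] by (simp add: yp_def diff_diff_eq)
  qed
 qed
 have "?A (f 1) \<in> F12 3" using Tlead[of 1] by (simp add: t_def)
 then obtain s where s: "?A (f 1) - s *s f 3 \<in> F12 4" using layf[of "?A (f 1)" 3] by auto
 have "?A (f 9) \<in> F12 11" using Tlead[of 9] by (simp add: t_def)
 then obtain al where al: "?A (f 9) - al *s f 11 \<in> F12 12" using layf[of "?A (f 9)" 11] by auto
 \<comment> \<open>\<open>Al\<close> is not given exactly by \<open>t\<close> only at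
   \<open>f 1\<close> and \<open>f 9\<close>, so only there can a second-order scalar occur.\<close>
 define tp where "tp n = (if n = 1 then s else if n = 9 then al else 0)" for n :: nat
 have Tp: "?A (f n) - (t n *s f (n + 1) + tp n *s f (n + 2)) \<in> F12 (n + 1 + 2)" for n
 proof -
  consider "n = 0" | "n = 1" | "2 \<le> n" "n \<le> 8" | "n = 9" | "n = 10" | "n = 11" | "12 \<le> n" by linarith
  then show ?thesis
  proof cases
   case 1
   then show ?thesis using Af0 s0 by (simp add: t_def tp_def)
  next
   case 2
   then show ?thesis using s by (simp add: t_def tp_def)
  next
   case 3
   then show ?thesis using Af[of n] s0 by (simp add: t_def tp_def One_nat_def)
  next
   case 4
   then show ?thesis using al by (simp add: t_def tp_def)
  next
   case 5
   then show ?thesis using lin_0[OF lA] s0 by (simp add: t_def tp_def f)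
  next
   case 6
   have "?A (E 9) = 0" using L9u(1)[OF E_L[of 9]] lin_0[OF lin_u] by (simp add: a.Al_def)
   then show ?thesis using 6 s0 by (simp add: t_def tp_def f)
  next
   case 7
   then show ?thesis using lin_0[OF lA] s0 f(6)[of n] by (simp add: t_def tp_def)
  qed
 qed
 \<comment> \<open>A pair \<open>(s, t)\<close> now stands for
   \<open>s *s f n + t *s f (n + 1)\<close>, two orders of one expansion, with errors two degrees
   deeper.\<close>
 let ?g = "\<lambda>n. f (n + 1)"
 let ?T = "\<lambda>n (st :: 'a \<times> 'a). (t n * fst st + 0 * snd st, tp n * fst st + t (n + 1) * snd st)"
 let ?U = "\<lambda>n (st :: 'a \<times> 'a). (y n * fst st + 0 * snd st, yp n * fst st + y (n + 1) * snd st)"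
 have sT: "sym (\<lambda>n. F12 (n + 2)) (pf f ?g) 1 ?A ?T"
 proof (rule sym2I[OF lA F12_filt a.raises_Al])
  show "?A (f n) - (t n *s f (n + 1) + tp n *s f (n + 1 + 1)) \<in> F12 (n + 1 + 2)" for n
  proof -
   have i: "n + 1 + 1 = n + 2" by simp
   show ?thesis unfolding i by (rule Tp)
  qed
  show "?A (f (n + 1)) - (0 *s f (n + 1) + t (n + 1) *s f (n + 1 + 1)) \<in> F12 (n + 1 + 2)" for n
  proof -
   have i: "n + 1 + 1 + 1 = n + 1 + 2" by simp
   show ?thesis using Tlead[of "n + 1"] unfolding i by simp
  qed
 qed
 have sU: "sym (\<lambda>n. F12 (n + 2)) (pf f ?g) 2 u2 ?U"
 proof (rule sym2I[OF lin_u F12_filt a.g2D])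
  show "u2 (f n) - (y n *s f (n + 2) + yp n *s f (n + 2 + 1)) \<in> F12 (n + 2 + 2)" for n
  proof -
   have i: "n + 2 + 1 = n + 3" "n + 2 + 2 = n + 4" by simp_all
   show ?thesis unfolding i by (rule Yp)
  qed
  show "u2 (f (n + 1)) - (0 *s f (n + 2) + y (n + 1) *s f (n + 2 + 1)) \<in> F12 (n + 2 + 2)" for n
  proof -
   have i: "n + 1 + 2 = n + 3" "n + 3 + 1 = n + 4" "n + 2 + 1 = n + 3" "n + 2 + 2 = n + 4" by simp_all
   show ?thesis using Y[of "n + 1"] unfolding i by simp
  qed
 qed
 let ?X = "sadp 1 2 ?T ?U"
 have sX: "sym (\<lambda>n. F12 (n + 2)) (pf f ?g) (n + 2) (a.XA n) (?X n)" for n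
  using sym_adp[OF phi_add_pf sT sU, of n] by simp
 have pF: "pf f ?g k (1, 0) \<in> F12 k" "pf f ?g k (1, 0) = f k" for k using fF by (simp_all add: pf_def)
 \<comment> \<open>The first coordinate may sit in the empty degree 10, where
   \<open>f 10 = 0\<close>; the second one has to sit in an occupied degree.\<close>
 have pair0: "x' = 0" if m: "m \<in> {0..9} \<union> {11} \<or> m = 10" "m + 1 \<in> {0..9} \<union> {11}"
  and x: "x *s f m + x' *s f (m + 1) \<in> F12 (m + 2)" for x x' m
 proof -
  have "x *s f m = 0 \<or> x = 0"
  proof (cases "m = 10")
   case True
   then show ?thesis by (simp add: f)
  next
   case False
   have 1: "x *s f m + x' *s f (m + 1) \<in> F12 (Suc m)" using x F12_Suc[of "Suc m"] by auto
   have 2: "x' *s f (m + 1) \<in> F12 (Suc m)" using fF[of "m + 1"] subspace_scale[OF F12_sub] by (simp add: One_nat_def)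
   from subspace_diff[OF F12_sub 1 2] have "x *s f m \<in> F12 (Suc m)" by simp
   then show ?thesis using nzf[of m x] m False by blast
  qed
  then have z0: "x *s f m = 0" by auto
  have i: "m + 2 = Suc (m + 1)" by simp
  have "x' *s f (m + 1) \<in> F12 (Suc (m + 1))" using x[unfolded i z0] by simp
  then show ?thesis using nzf[OF m(2)] by blast
 qed
 define w23 where "w23 k = snd (?X 0 (k + 3) (?X 1 k (1, 0)) - ?X 1 (k + 2) (?X 0 k (1, 0))) - snd (?X 3 k (1, 0))" for k
 \<comment> \<open>\<open>XA 6\<close> has degree 8, one more than the bracket, so its leading
   scalar enters the second-order equation.\<close>
 define w34 where "w34 k = snd (?X 1 (k + 4) (?X 2 k (1, 0)) - ?X 2 (k + 3) (?X 1 k (1, 0))) + snd (?X 5 k (1, 0)) - fst (?X 6 k (1, 0))" for k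
 have fo23: "w23 k = 0" if k: "k + 5 \<in> {0..9} \<union> {11} \<or> k + 5 = 10" "k + 5 + 1 \<in> {0..9} \<union> {11}" for k
 proof -
  let ?c = "?X 0 (k + (1 + 2)) (?X 1 k (1, 0)) - ?X 1 (k + (0 + 2)) (?X 0 k (1, 0))"
  have i: "0 + 2 + (1 + 2) = (5::nat)" "3 + 2 = (5::nat)" by simp_all
  have r: "raises F12 (5 + 2) (\<lambda>v. cm (a.XA 0) (a.XA 1) v - 1 *s a.XA 3 v)" using a.relA_23 by simp
  have "pf f ?g (k + 5) ?c - 1 *s pf f ?g (k + 5) (?X 3 k (1, 0)) \<in> F12 (k + 5 + 2)"
   by (rule sym_vanish2[OF sym_cm[OF phi_add_pf sX[of 0] sX[of 1], unfolded i] sX[of 3, unfolded i] F12_filt r pF(1)])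
  then have "(fst ?c - fst (?X 3 k (1, 0))) *s f (k + 5) + (snd ?c - snd (?X 3 k (1, 0))) *s f (k + 5 + 1) \<in> F12 (k + 5 + 2)"
   by (simp only: pf_def scale_one scale_left_diff_distrib) (simp add: algebra_simps)
  from pair0[OF k this] show ?thesis by (simp add: w23_def)
 qed
 have fo34: "w34 k = 0" if k: "k + 7 \<in> {0..9} \<union> {11} \<or> k + 7 = 10" "k + 7 + 1 \<in> {0..9} \<union> {11}" for k
 proof -
  let ?c = "?X 1 (k + (2 + 2)) (?X 2 k (1, 0)) - ?X 2 (k + (1 + 2)) (?X 1 k (1, 0))"
  have i: "1 + 2 + (2 + 2) = (7::nat)" "5 + 2 = (7::nat)" "6 + 2 = (8::nat)" by simp_all
  have 1: "cm (a.XA 1) (a.XA 2) (f k) - pf f ?g (k + 7) ?c \<in> F12 (k + 9)"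
   using symD[OF sym_cm[OF phi_add_pf sX[of 1] sX[of 2], unfolded i], of k "(1, 0)"] unfolding pF(2) by (simp add: add.assoc) (simp add: add.commute)
  have 2: "a.XA 5 (f k) - pf f ?g (k + 7) (?X 5 k (1, 0)) \<in> F12 (k + 9)"
   using symD[OF sX[of 5, unfolded i], of k "(1, 0)"] unfolding pF(2) by (simp add: add.assoc) (simp add: add.commute)
  have 3: "a.XA 6 (f k) - pf f ?g (k + 8) (?X 6 k (1, 0)) \<in> F12 (k + 9)"
   using symD[OF sX[of 6, unfolded i], of k "(1, 0)"] filt_mono[OF F12_filt, of "k + 9" "k + 8 + 2"] unfolding pF(2) by auto
  have 4: "cm (a.XA 1) (a.XA 2) (f k) + a.XA 5 (f k) - a.XA 6 (f k) \<in> F12 (k + 9)"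
   using raisesD[OF a.relA_34 fF[of k]] .
  have k9: "k + 8 + 1 = k + 9" "k + 7 + 1 = k + 8" "k + 7 + 2 = k + 9" by simp_all
  have 5: "snd (?X 6 k (1, 0)) *s f (k + 8 + 1) \<in> F12 (k + 9)" unfolding k9 by (intro subspace_scale[OF F12_sub] fF)
  from subspace_add[OF F12_sub subspace_diff[OF F12_sub subspace_add[OF F12_sub 3 4] subspace_add[OF F12_sub 1 2]] 5]
  have "(fst ?c + fst (?X 5 k (1, 0))) *s f (k + 7) + (snd ?c + snd (?X 5 k (1, 0)) - fst (?X 6 k (1, 0))) *s f (k + 7 + 1) \<in> F12 (k + 7 + 2)"
   unfolding pf_def k9 by (simp only: scale_left_distrib scale_left_diff_distrib) (simp add: algebra_simps)
  from pair0[OF k this] show ?thesis by (simp add: w34_def)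
 qed
 have tab2: "y 2 = 0" "y 3 = 1" "y 4 = 1" "y 5 = 2" "y 6 = 3" "y 7 = 7" by fact+
 have tab3: "yp 0 = 0" "yp 7 = 0" "yp 9 = 0" "yp 10 = 0" "yp 11 = 0" "tp 0 = 0" "tp 1 = s" "tp 2 = 0" "tp 3 = 0" "tp 4 = 0"
  "tp 5 = 0" "tp 6 = 0" "tp 7 = 0" "tp 8 = 0" "tp 9 = al" "tp 10 = 0" "tp 11 = 0" "t 12 = 0" "y 12 = 0"
  by (simp_all add: yp_def tp_def t_def y_def)
 have G23_0: "- yp 2 + 2 * yp 3 - yp 3 * y 1 + 2 * yp 1 - 2 * s = 0"
 proof -
  have "w23 0 = - yp 2 + 2 * yp 3 - yp 3 * y 1 + 2 * yp 1 - 2 * s"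
   unfolding w23_def by (simp add: sadp_numeral sadp_one tab tab2 tab3 s12 algebra_simps)
  then show ?thesis using fo23[of 0] by simp
 qed
 have G23_1: "- yp 3 * y 1 + 2 * yp 4 * y 1 + 2 * yp 1 = 0"
 proof -
  have "w23 1 = - yp 3 * y 1 + 2 * yp 4 * y 1 + 2 * yp 1"
   unfolding w23_def by (simp add: sadp_numeral sadp_one tab tab2 tab3 s12 algebra_simps)
  then show ?thesis using fo23[of 1] by simp
 qed
 have G23_2: "3 * yp 2 - 3 * yp 4 = 0"
 proof -
  have "w23 2 = 3 * yp 2 - 3 * yp 4"
   unfolding w23_def by (simp add: sadp_numeral sadp_one tab tab2 tab3 s12 algebra_simps)
  then show ?thesis using fo23[of 2] by simp
 qed
 have G23_3: "10 * yp 3 - 4 * yp 4 - 4 * yp 5 + 2 * yp 6 = 0"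
 proof -
  have "w23 3 = 10 * yp 3 - 4 * yp 4 - 4 * yp 5 + 2 * yp 6"
   unfolding w23_def by (simp add: sadp_numeral sadp_one tab tab2 tab3 s12 algebra_simps)
  then show ?thesis using fo23[of 3] by simp
 qed
 have G23_5: "- 28 * al + 2 * y 9 * yp 5 - y 9 * yp 6 + 2 * yp 8 = 0"
 proof -
  have "w23 5 = - 28 * al + 2 * y 9 * yp 5 - y 9 * yp 6 + 2 * yp 8"
   unfolding w23_def by (simp add: sadp_numeral sadp_one tab tab2 tab3 s12 algebra_simps)
  then show ?thesis using fo23[of 5] by simp
 qed
 have G34_0: "- 1 - yp 3 + yp 3 * y 1 + 3 * yp 4 - 4 * yp 4 * y 1 - 2 * yp 5 + 3 * yp 5 * y 1 + 6 * y 1 - 3 * yp 1 + 6 * s = 0"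
 proof -
  have "w34 0 = - 1 - yp 3 + yp 3 * y 1 + 3 * yp 4 - 4 * yp 4 * y 1 - 2 * yp 5 + 3 * yp 5 * y 1 + 6 * y 1 - 3 * yp 1 + 6 * s"
   unfolding w34_def by (simp add: sadp_numeral sadp_one tab tab2 tab3 s12 algebra_simps)
  then show ?thesis using fo34[of 0] by simp
 qed
 have G34_1: "- yp 4 * y 1 + 3 * yp 5 * y 1 - 2 * yp 6 * y 1 - y 1 - 6 * yp 1 = 0"
 proof -
  have "w34 1 = - yp 4 * y 1 + 3 * yp 5 * y 1 - 2 * yp 6 * y 1 - y 1 - 6 * yp 1"
   unfolding w34_def by (simp add: sadp_numeral sadp_one tab tab2 tab3 s12 algebra_simps)
  then show ?thesis using fo34[of 1] by simp
 qed
 have G34_3: "28 * al - y 9 - 2 * y 9 * yp 3 + 3 * y 9 * yp 4 - y 9 * yp 5 - 2 * yp 8 = 0"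
 proof -
  have "w34 3 = 28 * al - y 9 - 2 * y 9 * yp 3 + 3 * y 9 * yp 4 - y 9 * yp 5 - 2 * yp 8"
   unfolding w34_def by (simp add: sadp_numeral sadp_one tab tab2 tab3 s12 algebra_simps)
  then show ?thesis using fo34[of 3] by simp
 qed
 have 2: "2 * yp 1 = q * (yp 3 - 2 * yp 4)" using G23_1 unfolding q_def by Groebner_Basis.algebra
 have "3 * (yp 2 - yp 4) = 0" using G23_2 by Groebner_Basis.algebra
 then have 3: "yp 2 = yp 4" using char_ne[of 3] by simp
 have "2 * (yp 6 - (2 * yp 4 + 2 * yp 5 - 5 * yp 3)) = 0" using G23_3 by Groebner_Basis.algebra
 then have "2 = (0::'a) \<or> yp 6 - (2 * yp 4 + 2 * yp 5 - 5 * yp 3) = 0" by (simp only: mult_eq_0_iff)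
 then have 4: "yp 6 = 2 * yp 4 + 2 * yp 5 - 5 * yp 3" using char_ne[of 2] by auto
 have "y 9 * (yp 5 - yp 6 - 1 - 2 * yp 3 + 3 * yp 4) = 0" using G23_5 G34_3 by Groebner_Basis.algebra
 then have "yp 5 - yp 6 - 1 - 2 * yp 3 + 3 * yp 4 = 0" using y9 by simp
 then have 5: "yp 5 = 3 * yp 3 + yp 4 - 1" using 4 by Groebner_Basis.algebra
 have "q * (3 * yp 3 - 5 * yp 4 - 3 * yp 5 + 2 * yp 6 + 1) = 0" using G34_1 2 unfolding q_def by Groebner_Basis.algebra
 then have "3 * yp 3 - 5 * yp 4 - 3 * yp 5 + 2 * yp 6 + 1 = 0" using y1 unfolding q_def by simp
 then have "4 * yp 3 = 0" using 4 5 by Groebner_Basis.algebra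
 then have c3: "yp 3 = 0" using char_ne[of 4] by simp
 have 6: "2 * yp 1 = yp 4"
 proof -
  have "2 * yp 1 = - (2 * q) * yp 4" using 2 c3 by Groebner_Basis.algebra
  then show ?thesis unfolding q2 by simp
 qed
 have "2 * s = 0" using G23_0 3 6 c3 by Groebner_Basis.algebra
 then have s0': "s = 0" using char_ne[of 2] by simp
 have "- 1 - yp 3 + yp 3 * q + 3 * yp 4 - 4 * yp 4 * q - 2 * yp 5 + 3 * yp 5 * q + 6 * q - 3 * yp 1 + 6 * s = 0"
  using G34_0 unfolding q_def .
 then have "(1::'a) = 0" using 5 6 c3 s0' q2 by Groebner_Basis.algebra
 then show False by simp
qed

lemma proper_false: False
proof -
 have "j = 1 \<or> j = 2 \<or> j = 3 \<or> j = 4" using j by linarith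
 then show False using j1 j2 j3 j4 by blast
qed

end

section \<open>The dimension of the fifth layer\<close>

context minrep
begin

text \<open>The double layer sits at the last \<open>j\<close> with
  \<open>dim (L j) = 11 - j\<close>. The one-dimensional top layer excludes \<open>j = 0\<close>,
  the two analyses above exclude 1 to 4, and the chain with \<open>w = 0\<close> excludes the
  absence of a double layer. What is left is \<open>j \<ge> 5\<close>.\<close>

lemma dim_L5: "dim V = 11 \<and> 6 \<le> dim (L 5)"
proof -
 have L10: "L 10 = {0}" using caseA by blast
 define d where "d k = dim (L k)" for k
 have lo: "10 - k \<le> d k" and hi: "d k \<le> 11 - k" if "k \<le> 9" for k
  using dimL[of k] that by (auto simp: d_def)
 have st: "d (k + 1) < d k" if "k \<le> 9" for k
  using L_dim[OF L_le9[OF that]] by (simp add: d_def One_nat_def)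
 have d9: "d 9 = 1" using caseB(3)[OF L10] by (simp add: d_def)
 have d10: "d 10 = 0" by (simp add: d_def L10 dim_eq_0)
 have d01: "d 0 \<le> d 1 + 1"
 proof -
  obtain v where v: "\<forall>x\<in>V. \<exists>a. x - a *s v \<in> L (Suc 0)" using ex_v0 by blast
  have "V \<subseteq> span (insert v (L (Suc 0)))"
  proof
   fix x assume "x \<in> V"
   then obtain a where "x - a *s v \<in> L (Suc 0)" using v by blast
   then have "x - a *s v \<in> span (L (Suc 0))" by (rule span_base)
   then show "x \<in> span (insert v (L (Suc 0)))" unfolding span_breakdown_eq by blast
  qed
  then have "dim V \<le> dim (insert v (L (Suc 0)))" using dim_subset[of V "span (insert v (L (Suc 0)))"] by simp
  also have "\<dots> \<le> dim (L (Suc 0)) + 1" by (simp add: dim_insert)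
  finally show ?thesis by (simp add: d_def One_nat_def)
 qed
 have dec: "d (k + n) + n \<le> d k" if "k + n \<le> 9" for k n
  using that
 proof (induction n)
  case (Suc n)
  have "d (k + n + 1) < d (k + n)" using st[of "k + n"] Suc.prems by simp
  moreover have "d (k + n + 1) = d (k + Suc n)" by (simp add: One_nat_def)
  ultimately show ?case using Suc by simp
 qed simp
 have V: "d 0 = dim V" by (simp add: d_def)
 have "d 5 = 6"
 proof (rule ccontr)
  assume n6: "d 5 \<noteq> 6"
  show False
  proof (cases "\<exists>k\<le>9. d k = 11 - k")
   case False
   have dk: "d k = 10 - k" if "k \<le> 9" for k
   proof -
    have "d k \<noteq> 11 - k" using False that by blast
    then show ?thesis using lo[OF that] hi[OF that] by linarith
   qed
   have lay: "dim (L k) \<le> dim (L (Suc k)) + 1" if "k \<le> 9" for k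
   proof (cases "k = 9")
    case True
    then show ?thesis using d9 by (simp add: d_def)
   next
    case False
    then show ?thesis using dk[of k] dk[of "Suc k"] that by (simp add: d_def)
   qed
   have "\<exists>c e w. chain scale Basis G g V \<rho> c e w 1"
   proof (rule chain_data[OF L10, where w = 0])
    have sp: "span (L (Suc 1)) = L (Suc 1)" using subL by (rule span_eq_iff[THEN iffD2])
    show "dim (L 1) = dim (span (insert 0 (L (Suc 1)))) + 1"
     using dk[of 1] dk[of "Suc 1"] by (simp add: d_def dim_insert span_zero)
   qed (use lay lin_0[OF lin_u] subspace_0[OF subL] in auto)
   then show False using no_chain by blast
  next
   case True
   define j where "j = Max {k. k \<le> 9 \<and> d k = 11 - k}"
   have fin: "finite {k. k \<le> 9 \<and> d k = 11 - k}" by (rule finite_subset[of _ "{..9}"]) auto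
   have "j \<in> {k. k \<le> 9 \<and> d k = 11 - k}" unfolding j_def using True fin by (intro Max_in) auto
   then have j9: "j \<le> 9" and dj: "d j = 11 - j" by auto
   have mx: "k \<le> j" if "k \<le> 9" "d k = 11 - k" for k
    unfolding j_def using that fin by (intro Max_ge) auto
   have j8: "j \<le> 8" using d9 dj j9 by (cases "j = 9") auto
   have lowk: "d k = 11 - k" if "k \<le> j" for k
    using dec[of k "j - k"] hi[of k] that dj j9 by simp
   have highk: "d k = 10 - k" if "j < k" "k \<le> 9" for k
   proof -
    have "d k \<noteq> 11 - k" using mx[of k] that by auto
    then show ?thesis using lo[of k] hi[of k] that by linarith
   qed
   have j4: "j \<le> 4"
   proof (rule ccontr)
    assume "\<not> j \<le> 4"
    then show False using lowk[of 5] n6 by simp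
   qed
   have j1: "1 \<le> j"
   proof (rule ccontr)
    assume "\<not> 1 \<le> j"
    then have "j = 0" by simp
    then show False using lowk[of 0] highk[of 1] d01 by simp
   qed
   have lay: "dim (L k) \<le> dim (L (Suc k)) + 1" if kj: "k \<le> 9" "k \<noteq> j" for k
   proof -
    consider "k = 9" | "k < j" | "j < k" "k \<le> 8" using kj by linarith
    then show ?thesis
    proof cases
     case 1
     then show ?thesis using d9 by (simp add: d_def)
    next
     case 2
     then show ?thesis using lowk[of k] lowk[of "Suc k"] by (simp add: d_def)
    next
     case 3
     then show ?thesis using highk[of k] highk[of "Suc k"] by (simp add: d_def)
    qed
   qed
   have layj: "dim (L j) = dim (L (Suc j)) + 2"
    using lowk[of j] highk[of "Suc j"] j4 by (simp add: d_def)
   show False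
   proof (cases "\<exists>w. w \<in> L j \<and> u1 w \<in> L (j + 2) \<and> u2 w \<in> L (j + 2) \<and> w \<notin> L (Suc j)")
    case True
    then obtain w where w: "w \<in> L j" "u1 w \<in> L (j + 2)" "u2 w \<in> L (j + 2)" "w \<notin> L (Suc j)" by blast
    have sp: "span (L (Suc j)) = L (Suc j)" using subL by (rule span_eq_iff[THEN iffD2])
    have "dim (L j) = dim (span (insert w (L (Suc j)))) + 1"
     using layj w(4) unfolding dim_span dim_insert sp by simp
    then have "\<exists>c e w. chain scale Basis G g V \<rho> c e w j"
     using chain_data[OF L10 j1 j8 w(1-3) lay] w(4) by blast
    then show False using no_chain by blast
   next
    case False
    then have "\<exists>c E p2 b th P Q Rr. proper scale Basis G g V \<rho> c E p2 j b th P Q Rr"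
     using proper_data[OF L10 j1 j4 lay layj] by blast
    then show False using proper.proper_false by blast
   qed
  qed
 qed
 moreover have "d 0 = 11" using dec[of 0 5] hi[of 0] \<open>d 5 = 6\<close> by simp
 ultimately show ?thesis using V by (simp add: d_def)
qed

end

context prep
begin

text \<open>The dimension is least among all modules with non-trivial \<open>g 10\<close>, so both a
  proper invariant subspace and a proper quotient are too small for \<open>g 10\<close> to act on
  them.\<close>

lemma minrep_if_least:
 assumes r: "isrep V \<rho>" and z: "\<exists>v\<in>V. U \<rho> (g 10) v \<noteq> 0" and V11: "dim V \<le> 11"
  and m: "\<And>V' \<rho>'. isrep V' \<rho>' ==> \<exists>v\<in>V'. U \<rho>' (g 10) v \<noteq> 0 ==> dim V \<le> dim V'"
 shows "minrep scale Basis G g V \<rho>"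
proof unfold_locales
 fix S s assume S: "inv_sub V \<rho> S" "S \<noteq> V" "s \<in> S"
 show "U \<rho> (g 10) s = 0"
 proof (rule ccontr)
  assume "U \<rho> (g 10) s \<noteq> 0"
  then have "dim V \<le> dim S" using m[OF sub_rep[OF r S(1)]] S(3) by blast
  then show False using dim_strict[of S V] S isrep_sub[OF r] by (auto simp: inv_sub_def)
 qed
next
 fix S v assume S: "inv_sub V \<rho> S" "S \<noteq> {0}" "v \<in> V"
 obtain \<pi> where p: "lin \<pi>" "\<And>v. v \<in> V ==> \<pi> v \<in> V \<and> \<pi> v - v \<in> S" "\<And>n. n \<in> S ==> \<pi> n = 0"
  "isrep (\<pi> ` V) (\<lambda>x v. \<pi> (\<rho> x v))"
  "\<And>x v. x \<in> carrier G ==> v \<in> V ==> U (\<lambda>x v. \<pi> (\<rho> x v)) x (\<pi> v) = \<pi> (U \<rho> x v)"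
  "S \<noteq> {0} ==> dim (\<pi> ` V) < dim V"
  by (rule quot_rep[OF r S(1)]) blast
 have "\<not> (\<exists>v\<in>\<pi> ` V. U (\<lambda>x v. \<pi> (\<rho> x v)) (g 10) v \<noteq> 0)"
  using m[OF p(4)] p(6)[OF S(2)] by force
 then have "\<pi> (U \<rho> (g 10) v) = 0" using p(5)[OF g_closed S(3)] S(3) by auto
 then have "- U \<rho> (g 10) v \<in> S" using p(2)[OF isrep_UV[OF r g_closed S(3)], of 10] by simp
 then show "U \<rho> (g 10) v \<in> S" using S(1) subspace_neg[of S "- U \<rho> (g 10) v"] by (simp add: inv_sub_def)
qed (use r z V11 in auto)

end

section \<open>Duality\<close>

context fvs
begin

text \<open>The coordinate form identifies the space with its dual, so the dual representation lives
  on the same type and the preceding theory applies to it directly.\<close>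

definition form :: "'b \<Rightarrow> 'b \<Rightarrow> 'a" where
 "form x y = (\<Sum>b\<in>Basis. representation Basis x b * representation Basis y b)"

definition adj :: "('b \<Rightarrow> 'b) \<Rightarrow> 'b \<Rightarrow> 'b" where
 "adj f y = (\<Sum>b\<in>Basis. form (f b) y *s b)"

lemma coord_add: "representation Basis (x + y) b = representation Basis x b + representation Basis y b"
 and coord_scale: "representation Basis (c *s x) b = c * representation Basis x b"
 by (simp_all add: representation_add representation_scale independent_Basis span_Basis)

lemma form_add: "form (x + y) z = form x z + form y z" "form z (x + y) = form z x + form z y"
 by (simp_all add: form_def coord_add algebra_simps sum.distrib)

lemma form_scale: "form (c *s x) z = c * form x z" "form z (c *s x) = c * form z x"
 by (simp_all add: form_def coord_scale sum_distrib_left ac_simps)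

lemma form_zero: "form 0 z = 0" "form z 0 = 0"
 using form_scale(1)[of 0 0 z] form_scale(2)[of z 0 0] by simp_all

lemma form_diff: "form (x - y) z = form x z - form y z" "form z (x - y) = form z x - form z y"
 using form_add(1)[of x "(- 1) *s y" z] form_scale(1)[of "- 1" y z]
  form_add(2)[of z x "(- 1) *s y"] form_scale(2)[of z "- 1" y] by simp_all

lemma form_sum: "form (sum f A) z = (\<Sum>a\<in>A. form (f a) z)" "form z (sum f A) = (\<Sum>a\<in>A. form z (f a))"
 by (induction A rule: infinite_finite_induct) (simp_all add: form_zero form_add)

lemma form_Basis: assumes b: "b \<in> Basis" shows "form b y = representation Basis y b"
proof -
 have "form b y = (\<Sum>b'\<in>Basis. if b' = b then representation Basis y b' else 0)"
  unfolding form_def by (rule sum.cong) (auto simp: representation_basis[OF independent_Basis b])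
 then show ?thesis using b by (simp add: finite_Basis)
qed

lemma coord_expand: "(\<Sum>b\<in>Basis. representation Basis x b *s b) = x"
 by (rule sum_representation_eq) (auto simp: independent_Basis span_Basis finite_Basis)

lemma form_nondeg: assumes "\<And>x. form x y = form x z" shows "y = z"
proof -
 have "representation Basis y b = representation Basis z b" if "b \<in> Basis" for b
  using assms[of b] by (simp add: form_Basis that)
 then have "(\<Sum>b\<in>Basis. representation Basis y b *s b) = (\<Sum>b\<in>Basis. representation Basis z b *s b)" by simp
 then show ?thesis by (simp only: coord_expand)
qed

lemma coord_adj: assumes b: "b \<in> Basis" shows "representation Basis (adj f y) b = form (f b) y"
proof -
 have "form b (adj f y) = (\<Sum>b'\<in>Basis. form (f b') y * form b b')"
  by (simp add: adj_def form_sum form_scale)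
 also have "\<dots> = (\<Sum>b'\<in>Basis. if b' = b then form (f b') y else 0)"
  by (rule sum.cong) (auto simp: form_Basis[OF b] representation_basis[OF independent_Basis])
 finally show ?thesis using b by (simp add: finite_Basis form_Basis)
qed

lemma form_adj: assumes f: "lin f" shows "form (f x) y = form x (adj f y)"
proof -
 have "f x = f (\<Sum>b\<in>Basis. representation Basis x b *s b)" by (simp only: coord_expand)
 also have "\<dots> = (\<Sum>b\<in>Basis. representation Basis x b *s f b)" by (simp only: lin_sum[OF f] lin_scale[OF f])
 finally have "form (f x) y = (\<Sum>b\<in>Basis. representation Basis x b * form (f b) y)"
  by (simp add: form_sum form_scale)
 also have "\<dots> = form x (adj f y)" unfolding form_def[of x] by (rule sum.cong) (simp_all add: coord_adj)
 finally show ?thesis .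
qed

lemma lin_adj: "lin (adj f)"
 by (rule linI) (simp_all add: adj_def form_add form_scale scale_left_distrib sum.distrib scale_sum_right)

lemma dim_hyperplane:
 assumes T: "subspace T" shows "dim T \<le> dim {y \<in> T. form c y = 0} + 1"
proof (cases "\<exists>v\<in>T. form c v \<noteq> 0")
 case True
 then obtain v where v: "v \<in> T" "form c v \<noteq> 0" by blast
 have "y \<in> span (insert v {y \<in> T. form c y = 0})" if y: "y \<in> T" for y
 proof -
  have "y - (form c y / form c v) *s v \<in> {y \<in> T. form c y = 0}"
   using v y subspace_diff[OF T y subspace_scale[OF T v(1)]] by (simp add: form_diff form_scale)
  then have "y - (form c y / form c v) *s v \<in> span {y \<in> T. form c y = 0}" by (rule span_base)
  then show ?thesis unfolding span_breakdown_eq by blast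
 qed
 then have "dim T \<le> dim (insert v {y \<in> T. form c y = 0})"
  using dim_subset[of T "span (insert v {y \<in> T. form c y = 0})"] by auto
 also have "\<dots> \<le> dim {y \<in> T. form c y = 0} + 1" by (simp add: dim_insert)
 finally show ?thesis .
next
 case False
 then have "{y \<in> T. form c y = 0} = T" by blast
 then show ?thesis by simp
qed

lemma subspace_orth: "subspace S ==> subspace {y \<in> S. \<forall>c\<in>C. form c y = 0}"
 by (auto simp: subspace_def form_zero form_add form_scale)

lemma dim_orth:
 assumes "finite C" "subspace S" shows "dim S \<le> dim {y \<in> S. \<forall>c\<in>C. form c y = 0} + card C"
 using assms(1)
proof (induction C rule: finite_induct)
 case (insert c C)
 have "{y \<in> {y \<in> S. \<forall>c\<in>C. form c y = 0}. form c y = 0} = {y \<in> S. \<forall>c\<in>insert c C. form c y = 0}" by auto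
 then show ?case using dim_hyperplane[OF subspace_orth[OF assms(2), of C], of c] insert by simp
qed simp

text \<open>A basis \<open>B\<close> of \<open>W\<close> is extended to a basis \<open>C\<close>. A
  vector of \<open>S\<close> orthogonal to \<open>C - B\<close> is orthogonal to everything, hence
  0, and each of these conditions lowers the dimension by at most one.\<close>

lemma orth_dim:
 assumes W: "subspace W" and S: "subspace S" and o: "\<And>x y. x \<in> W ==> y \<in> S ==> form x y = 0"
 shows "dim W + dim S \<le> card Basis"
proof -
 obtain B where B: "B \<subseteq> W" "independent B" "W \<subseteq> span B" "card B = dim W" by (rule basis_exists)
 obtain C where C: "B \<subseteq> C" "independent C" "span C = UNIV"
  using extend_basis_superset[OF B(2)] independent_extend_basis[OF B(2)] span_extend_basis[OF B(2)] by blast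
 have fC: "finite C" using C(2) by (rule finiteI_independent)
 have cC: "card C = card Basis"
  using dim_eq_card[of C UNIV] dim_eq_card[of Basis UNIV] C by (simp add: independent_Basis span_Basis)
 have "y = 0" if y: "y \<in> S" "\<forall>c\<in>C - B. form c y = 0" for y
 proof (rule form_nondeg)
  fix x
  have "form c y = 0" if "c \<in> C" for c using that y o B(1) by blast
  then have "C \<subseteq> {x. form x y = 0}" by blast
  moreover have "subspace {x. form x y = 0}" by (auto simp: subspace_def form_zero form_add form_scale)
  ultimately have "span C \<subseteq> {x. form x y = 0}" by (rule span_minimal)
  then show "form x y = form x 0" using C(3) by (auto simp: form_zero)
 qed
 then have "{y \<in> S. \<forall>c\<in>C - B. form c y = 0} = {0}" using subspace_0[OF S] by (auto simp: form_zero)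
 then have "dim S \<le> card (C - B)" using dim_orth[of "C - B" S] fC S by (simp add: dim_eq_0)
 also have "\<dots> = card Basis - dim W"
  using card_Diff_subset[of B C] finite_subset[OF C(1) fC] C(1) cC B(4) by simp
 also have "dim W \<le> card Basis" using card_mono[OF fC C(1)] cC B(4) by simp
 ultimately show ?thesis by linarith
qed

end

context prep
begin

definition dual :: "('g \<Rightarrow> 'b \<Rightarrow> 'b) \<Rightarrow> 'g \<Rightarrow> 'b \<Rightarrow> 'b" where
 "dual \<rho> x = adj (\<rho> (inv x))"

lemma form_dual: "isrep UNIV \<rho> ==> x \<in> carrier G ==> form a (dual \<rho> x b) = form (\<rho> (inv x) a) b"
 by (simp add: dual_def form_adj isrep_def)

lemma isrep_dual: assumes r: "isrep UNIV \<rho>" shows "isrep UNIV (dual \<rho>)"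
 unfolding isrep_def
proof (intro conjI ballI)
 fix x y v assume xy: "x \<in> carrier G" "y \<in> carrier G"
 show "dual \<rho> (x \<otimes> y) v = dual \<rho> x (dual \<rho> y v)"
 proof (rule form_nondeg)
  fix a
  have "form a (dual \<rho> (x \<otimes> y) v) = form (\<rho> (inv y \<otimes> inv x) a) v"
   using xy by (simp add: form_dual[OF r] inv_mult_group)
  also have "\<rho> (inv y \<otimes> inv x) a = \<rho> (inv y) (\<rho> (inv x) a)" using r xy by (simp add: isrep_def)
  finally show "form a (dual \<rho> (x \<otimes> y) v) = form a (dual \<rho> x (dual \<rho> y v))"
   using xy by (simp add: form_dual[OF r])
 qed
next
 fix v
 show "dual \<rho> \<one> v = v"
  by (rule form_nondeg) (use r in \<open>simp add: form_dual isrep_def\<close>)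
qed (auto simp: dual_def lin_adj)

lemma form_U_dual:
 "isrep UNIV \<rho> ==> x \<in> carrier G ==> form a (U (dual \<rho>) x b) = form (U \<rho> (inv x) a) b"
 by (simp add: U_def form_diff form_dual)

text \<open>With \<open>h\<close> the inverse of \<open>g i\<close>, the identity
  \<open>h - 1 = - ((h - 1)(g i - 1) + (g i - 1))\<close> reduces to \<open>g i\<close>; inverses
  enter through the dual representation.\<close>

lemma U_inv_R:
 assumes r: "isrep V \<rho>" and i: "i = 1 \<or> i = 2" and x: "x \<in> R V \<rho> k"
 shows "U \<rho> (inv (g i)) x \<in> R V \<rho> (Suc k)"
proof -
 have xV: "x \<in> V" using x R_subspace[OF r, of k] by blast
 have ux: "U \<rho> (g i) x \<in> R V \<rho> (Suc k)" using U_R[OF r x] i by auto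
 have inv: "inv_sub V \<rho> (R V \<rho> (Suc k))" unfolding inv_sub_def
  using R_subspace[OF r, of "Suc k"] U_R[OF r, of _ "Suc k"] R_Suc_subset[OF r, of "Suc k"] by blast
 have e: "U \<rho> (inv (g i)) x = - (U \<rho> (inv (g i)) (U \<rho> (g i) x) + U \<rho> (g i) x)"
 proof -
  have "\<rho> (inv (g i)) (\<rho> (g i) x) = x" 
   using isrep_mult[OF r, of "inv (g i)" "g i" x] isrep_one[OF r xV] xV by simp
  moreover have "lin (\<rho> (inv (g i)))" using r by (simp add: isrep_def)
  ultimately show ?thesis by (simp add: U_def lin_diff)
 qed
 have "U \<rho> (inv (g i)) (U \<rho> (g i) x) \<in> R V \<rho> (Suc k)"
  using inv_sub_U[OF r inv _ ux] by simp
 then show ?thesis unfolding e using ux R_subspace[OF r, of "Suc k"] subspace_neg subspace_add by blast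
qed

text \<open>Each letter on the dual side is moved across the form as an inverse letter, which keeps
  the total length \<open>m + k\<close>; words of length 10 act as 0.\<close>

lemma R_dual_orth:
 assumes r: "isrep UNIV \<rho>" and z: "R UNIV \<rho> 10 = {0}"
 shows "x \<in> R UNIV \<rho> k ==> y \<in> R UNIV (dual \<rho>) m ==> 10 \<le> m + k ==> form x y = 0"
proof (induction m arbitrary: k x y)
 case 0
 have "R UNIV \<rho> (10 + n) \<subseteq> R UNIV \<rho> 10" for n
 proof (induction n)
  case (Suc n)
  have "R UNIV \<rho> (Suc (10 + n)) \<subseteq> R UNIV \<rho> (10 + n)" by (rule R_Suc_subset[OF r])
  with Suc show ?case by (metis add_Suc_right order_trans)
 qed simp
 from this[of "k - 10"] have "R UNIV \<rho> k \<subseteq> R UNIV \<rho> 10" using 0(3) by simp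
 then show ?case using 0(1) z form_zero by auto
next
 case (Suc m)
 obtain a b where y: "y = U (dual \<rho>) (g 1) a + U (dual \<rho>) (g 2) b"
  and ab: "a \<in> R UNIV (dual \<rho>) m" "b \<in> R UNIV (dual \<rho>) m"
  using Suc.prems(2) unfolding R.simps by blast
 have "form (U \<rho> (inv (g 1)) x) a = 0" "form (U \<rho> (inv (g 2)) x) b = 0"
  using Suc.IH[OF U_inv_R[OF r _ Suc.prems(1)] ab(1), of 1] Suc.IH[OF U_inv_R[OF r _ Suc.prems(1)] ab(2), of 2] Suc.prems(3) by auto
 then show ?case unfolding y by (simp add: form_add form_U_dual[OF r])
qed

theorem no_small_rep:
 assumes B: "card Basis = 11" and r0: "isrep V0 \<rho>0" and v0: "v0 \<in> V0"
 shows "U \<rho>0 (g 10) v0 = 0"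
proof (rule ccontr)
 assume nz: "U \<rho>0 (g 10) v0 \<noteq> 0"
 have dU: "dim UNIV = 11"
  using dim_eq_card[of Basis UNIV] B by (simp add: independent_Basis span_Basis)
 have d11: "dim S \<le> 11" for S using dim_subset[of S UNIV] dU by simp
 let ?P = "\<lambda>x. isrep (fst x) (snd x) \<and> (\<exists>v\<in>fst x. U (snd x) (g 10) v \<noteq> 0)"
 have "?P (V0, \<rho>0)" using r0 v0 nz by auto
 then have "\<exists>x. ?P x \<and> (\<forall>y. ?P y \<longrightarrow> dim (fst x) \<le> dim (fst y))" by (rule ex_has_least_nat)
 then obtain x where x: "?P x" "\<And>y. ?P y ==> dim (fst x) \<le> dim (fst y)" by blast
 define V \<rho> where "V = fst x" and "\<rho> = snd x"
 have r: "isrep V \<rho>" and z: "\<exists>v\<in>V. U \<rho> (g 10) v \<noteq> 0" using x by (auto simp: V_def \<rho>_def)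
 have m: "dim V \<le> dim V'" if "isrep V' \<rho>'" "\<exists>v\<in>V'. U \<rho>' (g 10) v \<noteq> 0" for V' \<rho>'
  using x(2)[of "(V', \<rho>')"] that by (simp add: V_def)
 interpret a: minrep scale Basis G g V \<rho> by (rule minrep_if_least[OF r z d11 m])
 \<comment> \<open>A minimal module has dimension 11 and therefore fills the space, so that its dual
   can be formed with \<open>form\<close>.\<close>
 have VU: "V = UNIV" using a.dim_L5 dU isrep_sub[OF r] by (intro subspace_dim_equal) auto
 have rU: "isrep UNIV \<rho>" using r VU by simp
 note r' = isrep_dual[OF rU]
 have z': "\<exists>v\<in>UNIV. U (dual \<rho>) (g 10) v \<noteq> 0"
 proof (rule ccontr)
  assume "\<not> ?thesis"
  then have "form x y = form (\<rho> (inv (g 10)) x) y" for x y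
   using form_U_dual[OF rU, of "g 10" x y] by (simp add: U_def form_diff form_zero)
  then have id: "\<rho> (inv (g 10)) x = x" for x
   by (intro form_nondeg) (simp add: form_def mult.commute)
  have "\<rho> (g 10) v = v" for v
   using isrep_mult[OF rU, of "g 10" "inv (g 10)" v] isrep_one[OF rU, of v] by (simp add: id)
  then show False using z by (simp add: U_def)
 qed
 \<comment> \<open>No module with non-trivial \<open>g 10\<close> has dimension below 11, so the
   dual is minimal as well.\<close>
 interpret b: minrep scale Basis G g UNIV "dual \<rho>"
  by (rule minrep_if_least[OF r' z' d11]) (use m VU in auto)
 have L10: "R UNIV \<rho> 10 = {0}" using a.caseA VU by auto
 have "dim (R UNIV \<rho> 5) + dim (R UNIV (dual \<rho>) 5) \<le> card Basis"
  using R_subspace[OF rU, of 5] R_subspace[OF r', of 5] R_dual_orth[OF rU L10, of _ 5 _ 5]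
  by (intro orth_dim) auto
 then show False using a.dim_L5 b.dim_L5 VU B by simp
qed

end

section \<open>The group\<close>

declare One_nat_def [simp]

typedef thirteen = "{0..<13::nat}" by (rule exI[of _ 0]) simp

lemma card_thirteen [simp]: "CARD(thirteen) = 13"
 using type_definition.card[OF type_definition_thirteen] by simp

instance thirteen :: prime_card
 by standard (simp add: card_thirteen)

type_synonym K = "thirteen mod_ring"

lemma K_13: "(13::K) = 0"
 using of_nat_card_eq_0[where 'a = thirteen] by simp

lemma K_inj:
 assumes "0 \<le> a" "a < 13" "0 \<le> b" "b < 13" and e: "of_int a = (of_int b :: K)"
 shows "a = b"
proof -
 have r: "to_int_mod_ring (of_int_mod_ring x :: K) = x" if "0 \<le> x" "x < 13" for x
  by (rule to_int_mod_ring_of_int_mod_ring) (use that in \<open>simp_all add: card_thirteen\<close>)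
 have "of_int_mod_ring a = (of_int_mod_ring b :: K)" using e unfolding of_int_of_int_mod_ring .
 then have "to_int_mod_ring (of_int_mod_ring a :: K) = to_int_mod_ring (of_int_mod_ring b :: K)" by (rule arg_cong)
 then show ?thesis unfolding r[OF assms(1,2)] r[OF assms(3,4)] .
qed

lemma K_nat_inj: "a < 13 ==> b < 13 ==> of_nat a = (of_nat b :: K) ==> a = b"
 using K_inj[of "int a" "int b"] by simp

lemma K_mod: "(of_int (x mod 13) :: K) = of_int x"
proof -
 have "(of_int x :: K) = of_int (13 * (x div 13) + x mod 13)" by simp
 also have "\<dots> = 13 * of_int (x div 13) + of_int (x mod 13)" by (simp only: of_int_add of_int_mult of_int_numeral)
 finally show ?thesis by (simp add: K_13)
qed

text \<open>Meant for an entry of \<open>N^m * A^k\<close> with \<open>A = N + 1\<close>, where the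
  recursion is immediate; it takes the place of a binomial theorem for matrices.\<close>

lemma pascal_expand:
 fixes c :: "nat \<Rightarrow> nat \<Rightarrow> 'a::comm_ring_1"
 assumes c: "\<And>m k. c m (Suc k) = c m k + c (Suc m) k"
 shows "c m k = (\<Sum>i\<le>k. of_nat (k choose i) * c (m + i) 0)"
proof (induction k arbitrary: m)
 case (Suc k)
 have "(\<Sum>i\<le>k. of_nat (k choose i) * c (m + i) 0) = (\<Sum>i\<le>Suc k. of_nat (k choose i) * c (m + i) 0)" by (simp add: binomial_eq_0)
 also have "\<dots> = c m 0 + (\<Sum>i\<le>k. of_nat (k choose Suc i) * c (Suc m + i) 0)"
  by (subst sum.atMost_Suc_shift) simp
 finally have 1: "c m k = c m 0 + (\<Sum>i\<le>k. of_nat (k choose Suc i) * c (Suc m + i) 0)" using Suc[of m] by simp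
 have "(\<Sum>i\<le>Suc k. of_nat (Suc k choose i) * c (m + i) 0) =
   c m 0 + (\<Sum>i\<le>k. of_nat (k choose i) * c (Suc m + i) 0 + of_nat (k choose Suc i) * c (Suc m + i) 0)"
  by (subst sum.atMost_Suc_shift) (simp add: algebra_simps)
 then show ?case using 1 Suc[of "Suc m"] c[of m k] by (simp add: sum.distrib)
qed simp

section \<open>Unipotent matrices compatible with a grading of the coordinates\<close>

definition dg :: "nat list" where "dg = [11,10,9,8,7,7,6,5,4,3,2,0]"

lemma dg_le: "i < 12 ==> dg ! i \<le> 11"
proof -
 assume "i < 12"
 then have "dg ! i \<in> set dg" by (intro nth_mem) (simp add: dg_def)
 then show ?thesis by (auto simp: dg_def)
qed

text \<open>\<open>dg\<close> grades the twelve coordinates for weights (1,2): from coordinate 0, of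
  degree 11, the weights 1, ..., 9 and 11 lead to the degrees 10, ..., 2 and 0; degree 7 occurs
  twice. \<open>Dm m\<close> consists of the matrices that are 1 up to weight
  \<open>m\<close>.\<close>

definition Dm :: "nat \<Rightarrow> K mat set" where
 "Dm m = {A \<in> carrier_mat 12 12. \<forall>i<12. \<forall>j<12. dg ! j < dg ! i + m \<longrightarrow> A $$ (i,j) = (if i = j then 1 else 0)}"

lemma mult_entry:
 "A \<in> carrier_mat 12 12 ==> B \<in> carrier_mat 12 12 ==> i < 12 ==> j < 12 \<Longrightarrow>
  (A * B) $$ (i,j) = (\<Sum>k\<in>{0..<12}. A $$ (i,k) * B $$ (k,j))"
 by (auto simp: scalar_prod_def intro!: sum.cong)

lemma Dm_carrier: "A \<in> Dm m ==> A \<in> carrier_mat 12 12"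
 and DmD: "A \<in> Dm m ==> i < 12 ==> j < 12 ==> dg ! j < dg ! i + m ==> A $$ (i,j) = (if i = j then 1 else 0)"
 by (auto simp: Dm_def)

lemma Dm_mono: "m \<le> n ==> Dm n \<subseteq> Dm m"
 by (auto simp: Dm_def)

lemma Dm_one: "1\<^sub>m 12 \<in> Dm m"
 by (auto simp: Dm_def)

lemma Dm_mult:
 assumes A: "A \<in> Dm m" and B: "B \<in> Dm m" and m: "0 < m"
 shows "A * B \<in> Dm m"
proof -
 have "(A * B) $$ (i,j) = (if i = j then 1 else 0)" if ij: "i < 12" "j < 12" "dg ! j < dg ! i + m" for i j
 proof -
  have "A $$ (i,k) * B $$ (k,j) = (if k = i then (if i = j then 1 else 0) else 0)" if k: "k < 12" for k
  proof (cases "k = i")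
   case True
   then show ?thesis using DmD[OF A ij(1) ij(1)] DmD[OF B ij(1,2,3)] m by simp
  next
   case False
   show ?thesis
   proof (cases "dg ! k < dg ! i + m")
    case True
    then show ?thesis using DmD[OF A ij(1) k] False by simp
   next
    case ge: False
    then have "k \<noteq> j" "dg ! j < dg ! k + m" using ij(3) by auto
    then show ?thesis using DmD[OF B k ij(2)] False by simp
   qed
  qed
  then have "(A * B) $$ (i,j) = (\<Sum>k\<in>{0..<12}. if k = i then (if i = j then 1 else 0) else 0)"
   using mult_entry[OF Dm_carrier[OF A] Dm_carrier[OF B] ij(1,2)] by (simp cong: sum.cong_simp)
  then show ?thesis using ij(1) by simp
 qed
 then show ?thesis using A B by (auto simp: Dm_def)
qed

text \<open>Between coordinates whose degrees differ by exactly \<open>m\<close>, a product of two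
  deviations from 1 cannot contribute.\<close>

lemma Dm_entry_add:
 assumes A: "A \<in> Dm m" and B: "B \<in> Dm m" and m: "0 < m" and ij: "i < 12" "j < 12" "dg ! j = dg ! i + m"
 shows "(A * B) $$ (i,j) = A $$ (i,j) + B $$ (i,j)"
proof -
 have ne: "i \<noteq> j" using ij m by auto
 have "A $$ (i,k) * B $$ (k,j) = (if k = i then B $$ (i,j) else 0) + (if k = j then A $$ (i,j) else 0)" if k: "k < 12" for k
 proof -
  consider "k = i" | "k = j" | "k \<noteq> i" "k \<noteq> j" "dg ! k < dg ! i + m" | "k \<noteq> i" "k \<noteq> j" "dg ! j < dg ! k + m"
   using ij(3) m by linarith
  then show ?thesis
   using DmD[OF A ij(1) ij(1)] DmD[OF B ij(2) ij(2)] DmD[OF A ij(1) k] DmD[OF B k ij(2)] m ne by cases auto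
 qed
 then have "(A * B) $$ (i,j) = (\<Sum>k\<in>{0..<12}. (if k = i then B $$ (i,j) else 0) + (if k = j then A $$ (i,j) else 0))"
  using mult_entry[OF Dm_carrier[OF A] Dm_carrier[OF B] ij(1,2)] by (simp cong: sum.cong_simp)
 then show ?thesis using ij(1,2) by (simp add: sum.distrib)
qed

definition Um :: "K mat monoid" where
 "Um = \<lparr>carrier = Dm 1, monoid.mult = (*), one = 1\<^sub>m 12\<rparr>"

lemma Um_simps [simp]: "carrier Um = Dm 1" "x \<otimes>\<^bsub>Um\<^esub> y = x * y" "\<one>\<^bsub>Um\<^esub> = 1\<^sub>m 12"
 by (simp_all add: Um_def)

lemma monoid_Um: "monoid Um"
 by (rule monoidI) (auto simp: Dm_one Dm_mult dest!: Dm_carrier intro: assoc_mult_mat[of _ 12 12 _ 12 _ 12])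

text \<open>Non-zero entries of \<open>A - 1\<close> lead to strictly larger \<open>dg\<close>,
  which is at most 11, so high powers vanish; the inner binomials of 13 vanish in the field.\<close>

lemma Um_pow13: assumes A: "A \<in> Dm 1" shows "A [^]\<^bsub>Um\<^esub> (13::nat) = 1\<^sub>m 12"
proof -
 interpret monoid Um by (rule monoid_Um)
 have Ac: "A \<in> carrier_mat 12 12" using A by (rule Dm_carrier)
 have Pc: "A [^]\<^bsub>Um\<^esub> (k::nat) \<in> carrier_mat 12 12" for k using nat_pow_closed[of A k] A Dm_carrier by simp
 define N where "N = A - 1\<^sub>m 12"
 have Nc: "N \<in> carrier_mat 12 12" by (intro carrier_matI) (simp_all add: N_def)
 have AN: "A = N + 1\<^sub>m 12" using Ac by (auto simp: N_def intro!: eq_matI)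
 have Nn: "N $$ (i,k) = 0" if "i < 12" "k < 12" "dg ! k \<le> dg ! i" for i k
  using DmD[OF A that(1,2)] that Ac by (simp add: N_def)
 define T where "T m X = ((\<lambda>X. N * X) ^^ m) X" for m X
 have Tc: "T m X \<in> carrier_mat 12 12" if "X \<in> carrier_mat 12 12" for m X
  unfolding T_def using that Nc by (induction m) auto
 have Tadd: "T m (X + Y) = T m X + T m Y" if "X \<in> carrier_mat 12 12" "Y \<in> carrier_mat 12 12" for m X Y
 proof (induction m)
  case (Suc m)
  have "T (Suc m) (X + Y) = N * (T m X + T m Y)" using Suc by (simp add: T_def)
  also have "\<dots> = N * T m X + N * T m Y" using Nc Tc that by (intro mult_add_distrib_mat) auto
  finally show ?case by (simp add: T_def)
 qed (simp add: T_def)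
 have Tz: "T m X $$ (i,j) = 0" if "X \<in> carrier_mat 12 12" "i < 12" "j < 12" "11 < dg ! i + m" for m X i j
  using that(2,4)
 proof (induction m arbitrary: i)
  case 0
  then show ?case using dg_le[of i] by simp
 next
  case (Suc m)
  have "T (Suc m) X $$ (i,j) = (\<Sum>k\<in>{0..<12}. N $$ (i,k) * T m X $$ (k,j))"
   using mult_entry[OF Nc Tc[OF that(1), of m] Suc.prems(1) that(3)] by (simp add: T_def)
  also have "\<dots> = 0"
  proof (rule sum.neutral, rule ballI)
   fix k :: nat assume "k \<in> {0..<12}"
   then have k: "k < 12" by simp
   show "N $$ (i,k) * T m X $$ (k,j) = 0"
    using Nn[OF Suc.prems(1) k] Suc.IH[OF k] Suc.prems(2) by (cases "dg ! k \<le> dg ! i") auto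
  qed
  finally show ?case .
 qed
 show ?thesis
 proof (rule eq_matI)
  fix i j assume "i < dim_row (1\<^sub>m 12 :: K mat)" "j < dim_col (1\<^sub>m 12 :: K mat)"
  then have ij: "i < 12" "j < 12" by auto
  define c where "c m k = T m (A [^]\<^bsub>Um\<^esub> k) $$ (i,j)" for m k :: nat
  have rec: "c m (Suc k) = c m k + c (Suc m) k" for m k
  proof -
   have "A [^]\<^bsub>Um\<^esub> Suc k = A * A [^]\<^bsub>Um\<^esub> k" using nat_pow_Suc2[of A k] A by simp
   also have "\<dots> = N * A [^]\<^bsub>Um\<^esub> k + A [^]\<^bsub>Um\<^esub> k"
    using add_mult_distrib_mat[OF Nc one_carrier_mat Pc[of k]] Pc[of k] AN by simp
   finally have "T m (A [^]\<^bsub>Um\<^esub> Suc k) = T m (N * A [^]\<^bsub>Um\<^esub> k) + T m (A [^]\<^bsub>Um\<^esub> k)"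
    using Tadd[of "N * A [^]\<^bsub>Um\<^esub> k" "A [^]\<^bsub>Um\<^esub> k"] Nc Pc by simp
   moreover have "T m (N * A [^]\<^bsub>Um\<^esub> k) = T (Suc m) (A [^]\<^bsub>Um\<^esub> k)" by (simp add: T_def funpow_swap1)
   ultimately show ?thesis using ij Tc[OF Pc, of m k] Tc[OF Pc, of "Suc m" k] by (simp add: c_def)
  qed
  have "c 0 13 = (\<Sum>l\<le>13. of_nat (13 choose l) * c l 0)" using pascal_expand[of c 0 13, OF rec] by simp
  also have "\<dots> = (\<Sum>l\<le>(13::nat). if l = 0 then c 0 0 else 0)"
  proof (rule sum.cong)
   fix l :: nat assume l: "l \<in> {..13}"
   show "of_nat (13 choose l) * c l 0 = (if l = 0 then c 0 0 else 0)"
   proof (cases "l = 0 \<or> l = 13")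
    case True
    then show ?thesis using Tz[OF Pc ij, of 13 0] by (auto simp: c_def)
   next
    case False
    then have "13 dvd (13 choose l)" using l by (intro dvd_choose_prime) auto
    then obtain q where "(13 choose l) = 13 * q" by blast
    then have "(of_nat (13 choose l) :: K) = 13 * of_nat q" by simp
    then show ?thesis using False by (simp add: K_13)
   qed
  qed simp
  finally show "(A [^]\<^bsub>Um\<^esub> (13::nat)) $$ (i,j) = 1\<^sub>m 12 $$ (i,j)" by (simp add: c_def T_def)
 qed (use Pc[of 13] in auto)
qed

lemma group_Um: "group Um"
proof -
 interpret monoid Um by (rule monoid_Um)
 show ?thesis
 proof (rule groupI)
  fix x assume x: "x \<in> carrier Um"
  have "x [^]\<^bsub>Um\<^esub> (12::nat) \<otimes>\<^bsub>Um\<^esub> x = x [^]\<^bsub>Um\<^esub> (13::nat)" using nat_pow_Suc[of x 12] by simp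
  then show "\<exists>y\<in>carrier Um. y \<otimes>\<^bsub>Um\<^esub> x = \<one>\<^bsub>Um\<^esub>"
   using Um_pow13[of x] x nat_pow_closed[OF x, of 12] by auto
 qed (use m_assoc in \<open>auto simp: Dm_one Dm_mult dest: Dm_carrier\<close>)
qed

text \<open>Elements of the larger group have the form \<open>h \<otimes> a [^] i\<close> with
  \<open>i < 13\<close>: normalisation gives existence, and \<open>inj\<close> gives
  uniqueness.\<close>

lemma (in group) generate_insert_card:
 assumes S: "S \<subseteq> carrier G" and a: "a \<in> carrier G" "a [^] (13::nat) = \<one>"
  and fin: "finite (generate G S)"
  and nrm: "\<And>h. h \<in> generate G S ==> \<exists>h'\<in>generate G S. a \<otimes> h = h' \<otimes> a"
  and inj: "\<And>i j h h'. i < (13::nat) ==> j < (13::nat) ==> h \<in> generate G S ==> h' \<in> generate G S \<Longrightarrow>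
    h \<otimes> a [^] i = h' \<otimes> a [^] j ==> i = j"
 shows "finite (generate G (insert a S)) \<and> card (generate G (insert a S)) = 13 * card (generate G S)"
proof -
 define H where "H = generate G S"
 have sub: "subgroup H G" unfolding H_def using S by (rule generate_is_subgroup)
 have Hc: "h \<in> carrier G" if "h \<in> H" for h using subgroup.mem_carrier[OF sub that] .
 define X where "X = (\<lambda>(h,i). h \<otimes> a [^] i) ` (H \<times> {..<13::nat})"
 have pn: "\<forall>h\<in>H. \<exists>h'\<in>H. a [^] i \<otimes> h = h' \<otimes> a [^] i" for i :: nat
 proof (induction i)
  case 0
  then show ?case using Hc by auto
 next
  case (Suc i)
  show ?case
  proof
   fix h assume h: "h \<in> H"
   obtain h1 where 1: "h1 \<in> H" "a \<otimes> h = h1 \<otimes> a" using nrm h by (auto simp: H_def)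
   obtain h2 where 2: "h2 \<in> H" "a [^] i \<otimes> h1 = h2 \<otimes> a [^] i" using Suc 1 by blast
   have "a [^] Suc i \<otimes> h = a [^] i \<otimes> (a \<otimes> h)" using a h Hc by (simp add: m_assoc)
   also have "\<dots> = (a [^] i \<otimes> h1) \<otimes> a" using 1 a Hc by (simp add: m_assoc)
   also have "\<dots> = h2 \<otimes> a [^] Suc i" using 2 a Hc by (simp add: m_assoc)
   finally show "\<exists>h'\<in>H. a [^] Suc i \<otimes> h = h' \<otimes> a [^] Suc i" using 2 by blast
  qed
 qed
 have red: "a [^] i = a [^] (i mod 13)" for i :: nat
 proof -
  have "a [^] i = a [^] (13 * (i div 13) + i mod 13)" by simp
  also have "\<dots> = (a [^] (13::nat)) [^] (i div 13) \<otimes> a [^] (i mod 13)"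
   using nat_pow_mult[OF a(1), of "13 * (i div 13)" "i mod 13"] nat_pow_pow[OF a(1), of 13 "i div 13"] by simp
  finally show ?thesis using a by simp
 qed
 have XI: "h \<otimes> a [^] i \<in> X" if "h \<in> H" for h and i :: nat
 proof -
  have "h \<otimes> a [^] (i mod 13) \<in> X" unfolding X_def using that by (intro image_eqI[of _ _ "(h, i mod 13)"]) auto
  then show ?thesis using red[of i] by simp
 qed
 have XE: "\<exists>h i. h \<in> H \<and> x = h \<otimes> a [^] (i::nat)" if x: "x \<in> X" for x
 proof -
  obtain p where "p \<in> H \<times> {..<13}" "x = (\<lambda>(h,i). h \<otimes> a [^] (i::nat)) p" using x unfolding X_def by blast
  then show ?thesis by (intro exI[of _ "fst p"] exI[of _ "snd p"]) (auto simp: case_prod_beta)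
 qed
 have one: "\<one> \<in> H" using subgroup.one_closed[OF sub] .
 have subX: "subgroup X G"
 proof (rule subgroupI)
  show "X \<subseteq> carrier G" using a Hc by (auto simp: X_def)
  show "X \<noteq> {}" using XI[OF one] by blast
 next
  fix x assume "x \<in> X"
  then obtain h i where x: "x = h \<otimes> a [^] (i::nat)" "h \<in> H" using XE by blast
  have "a [^] (12 * i) \<otimes> a [^] i = a [^] (13 * i)" using nat_pow_mult[OF a(1), of "12 * i" i] by simp
  also have "\<dots> = \<one>" using nat_pow_pow[OF a(1), of 13 i] a(2) by simp
  finally have ia: "inv (a [^] i) = a [^] (12 * i)" using a by (intro inv_equality) auto
  have ih: "inv h \<in> H" using subgroup.m_inv_closed[OF sub x(2)] .
  obtain h' where h': "h' \<in> H" "a [^] (12 * i) \<otimes> inv h = h' \<otimes> a [^] (12 * i)" using pn ih by blast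
  have "inv x = a [^] (12 * i) \<otimes> inv h" using x a Hc ia by (simp add: inv_mult_group)
  then show "inv x \<in> X" using h' XI by simp
 next
  fix x y assume "x \<in> X" "y \<in> X"
  then obtain h i k j where x: "x = h \<otimes> a [^] (i::nat)" "h \<in> H" and y: "y = k \<otimes> a [^] (j::nat)" "k \<in> H"
   using XE by meson
  obtain h' where h': "h' \<in> H" "a [^] i \<otimes> k = h' \<otimes> a [^] i" using pn y(2) by blast
  have "x \<otimes> y = h \<otimes> (a [^] i \<otimes> k) \<otimes> a [^] j" using x y a Hc by (simp add: m_assoc)
  also have "\<dots> = (h \<otimes> h') \<otimes> a [^] (i + j)" using h' x a Hc by (simp add: m_assoc nat_pow_mult)
  finally show "x \<otimes> y \<in> X" using XI subgroup.m_closed[OF sub x(2) h'(1)] by simp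
 qed
 have "generate G (insert a S) = X"
 proof
  have "S \<subseteq> X" using XI[of _ 0] Hc generate.incl[of _ S G] by (auto simp: H_def)
  moreover have "a \<in> X" using XI[OF one, of 1] a by simp
  ultimately show "generate G (insert a S) \<subseteq> X" using subX by (intro generate_subgroup_incl) auto
  have sg: "subgroup (generate G (insert a S)) G" using S a by (intro generate_is_subgroup) auto
  have HI: "H \<subseteq> generate G (insert a S)" unfolding H_def by (rule mono_generate) auto
  have ai: "a [^] i \<in> generate G (insert a S)" for i :: nat
   by (induction i) (auto intro: generate.one generate.eng generate.incl)
  show "X \<subseteq> generate G (insert a S)" using HI ai subgroup.m_closed[OF sg] by (auto simp: X_def)
 qed
 moreover have "inj_on (\<lambda>(h,i). h \<otimes> a [^] i) (H \<times> {..<13::nat})"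
 proof (rule inj_onI, clarsimp)
  fix h k and i j :: nat assume s: "h \<in> H" "k \<in> H" "i < 13" "j < 13" "h \<otimes> a [^] i = k \<otimes> a [^] j"
  then have ij: "i = j" using inj[of i j h k] by (simp add: H_def)
  then show "h = k \<and> i = j" using s a Hc by simp
 qed
 ultimately show ?thesis using fin by (simp add: X_def card_image card_cartesian_product H_def)
qed

text \<open>The elements that \<open>a\<close> normalises into the subgroup are closed under
  products, hence under 12th powers, that is under inverses; so generators suffice.\<close>

lemma (in group) generate_normalised:
 assumes S: "S \<subseteq> carrier G" and a: "a \<in> carrier G" and p: "\<And>x. x \<in> carrier G ==> inv x = x [^] (12::nat)"
  and s: "\<And>x. x \<in> S ==> \<exists>h'\<in>generate G S. a \<otimes> x = h' \<otimes> a"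
  and h: "h \<in> generate G S"
 shows "\<exists>h'\<in>generate G S. a \<otimes> h = h' \<otimes> a"
proof -
 define N where "N = {h \<in> carrier G. \<exists>h'\<in>generate G S. a \<otimes> h = h' \<otimes> a}"
 have gc: "x \<in> carrier G" if "x \<in> generate G S" for x using generate_in_carrier[OF S that] .
 have one: "\<one> \<in> N" unfolding N_def using a by (auto intro!: bexI[of _ "\<one>"] generate.one)
 have mult: "x \<otimes> y \<in> N" if xy: "x \<in> N" "y \<in> N" for x y
 proof -
  obtain x' y' where 1: "x' \<in> generate G S" "a \<otimes> x = x' \<otimes> a" and 2: "y' \<in> generate G S" "a \<otimes> y = y' \<otimes> a"
   and c: "x \<in> carrier G" "y \<in> carrier G" using xy by (auto simp: N_def)
  have "a \<otimes> (x \<otimes> y) = (a \<otimes> x) \<otimes> y" using a c by (simp add: m_assoc)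
  also have "\<dots> = x' \<otimes> (a \<otimes> y)" using a c gc 1 by (simp add: m_assoc)
  also have "\<dots> = (x' \<otimes> y') \<otimes> a" using a gc 1 2 by (simp add: m_assoc)
  finally show ?thesis using c 1 2 generate.eng[of x' G S y'] by (auto simp: N_def)
 qed
 have pw: "x [^] (n::nat) \<in> N" if "x \<in> N" for x n by (induction n) (auto simp: one mult that)
 have SN: "x \<in> N" if "x \<in> S" for x using s[OF that] S that by (auto simp: N_def)
 from h have "h \<in> N"
 proof (induction rule: generate.induct)
  case (inv h)
  then show ?case using pw[OF SN, of h 12] p[of h] S by auto
 qed (use one mult SN in auto)
 then show ?thesis by (simp add: N_def)
qed

section \<open>Evaluation of the ten matrices and their commutators\<close>

fun rm :: "int list \<Rightarrow> int list list \<Rightarrow> int list" where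
 "rm (x # xs) (b # bs) = (if x = 0 then rm xs bs else map2 (\<lambda>y z. x * y + z) b (rm xs bs))"
| "rm _ _ = [0,0,0,0,0,0,0,0,0,0,0,0]"

definition mm :: "int list list \<Rightarrow> int list list \<Rightarrow> int list list" where
 "mm A B = map (\<lambda>r. map (\<lambda>x. x mod 13) (rm r B)) A"

definition "m1 = [[1,0,0,0,0,0,0,0,0,0,0,0], [1,1,0,0,0,0,0,0,0,0,0,0], [12,0,1,0,0,0,0,0,0,0,0,0], [6,0,1,1,0,0,0,0,0,0,0,0], [1,12,2,1,1,0,0,0,0,0,0,0], [5,0,11,9,0,1,0,0,0,0,0,0], [4,7,9,3,1,0,1,0,0,0,0,0], [11,5,2,3,5,5,1,1,0,0,0,0], [2,4,3,0,9,3,12,1,1,0,0,0], [7,3,8,8,7,5,1,9,1,1,0,0], [8,5,2,0,12,9,2,6,8,1,1,0], [11,1,12,9,7,4,7,0,1,4,8,1] :: int list]"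
definition "m2 = [[1,0,0,0,0,0,0,0,0,0,0,0], [0,1,0,0,0,0,0,0,0,0,0,0], [1,0,1,0,0,0,0,0,0,0,0,0], [0,6,0,1,0,0,0,0,0,0,0,0], [0,0,0,0,1,0,0,0,0,0,0,0], [1,0,2,0,0,1,0,0,0,0,0,0], [0,3,0,1,0,0,1,0,0,0,0,0], [0,0,0,0,1,0,0,1,0,0,0,0], [0,2,0,1,0,0,2,0,1,0,0,0], [0,0,0,0,8,0,0,3,0,1,0,0], [0,10,0,11,0,0,7,0,7,0,1,0], [0,2,0,6,0,0,11,0,10,0,1,1] :: int list]"
text \<open>From here on the matrices are commutators: of \<open>m1\<close> with the preceding one
  up to \<open>m9\<close>, and of \<open>m2\<close> with \<open>m9\<close> for \<open>m10\<close>.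
  They are tabulated, so that all checks are evaluations.\<close>

definition "m3 = [[1,0,0,0,0,0,0,0,0,0,0,0], [0,1,0,0,0,0,0,0,0,0,0,0], [0,0,1,0,0,0,0,0,0,0,0,0], [8,0,0,1,0,0,0,0,0,0,0,0], [9,6,0,0,1,0,0,0,0,0,0,0], [11,2,0,0,0,1,0,0,0,0,0,0], [8,5,12,0,0,0,1,0,0,0,0,0], [10,9,8,0,0,0,0,1,0,0,0,0], [6,5,8,7,12,0,0,0,1,0,0,0], [5,5,9,12,8,11,12,0,0,1,0,0], [10,11,4,4,6,12,1,9,0,0,1,0], [0,11,9,2,10,0,10,11,10,12,0,1] :: int list]"
definition "m4 = [[1,0,0,0,0,0,0,0,0,0,0,0], [0,1,0,0,0,0,0,0,0,0,0,0], [0,0,1,0,0,0,0,0,0,0,0,0], [0,0,0,1,0,0,0,0,0,0,0,0], [2,0,0,0,1,0,0,0,0,0,0,0], [5,0,0,0,0,1,0,0,0,0,0,0], [8,6,0,0,0,0,1,0,0,0,0,0], [7,6,12,0,0,0,0,1,0,0,0,0], [4,11,3,1,0,0,0,0,1,0,0,0], [4,2,10,7,0,0,0,0,0,1,0,0], [3,1,5,10,3,5,3,0,0,0,1,0], [11,9,1,10,2,6,0,5,1,0,0,1] :: int list]"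
definition "m5 = [[1,0,0,0,0,0,0,0,0,0,0,0], [0,1,0,0,0,0,0,0,0,0,0,0], [0,0,1,0,0,0,0,0,0,0,0,0], [0,0,0,1,0,0,0,0,0,0,0,0], [0,0,0,0,1,0,0,0,0,0,0,0], [0,0,0,0,0,1,0,0,0,0,0,0], [9,0,0,0,0,0,1,0,0,0,0,0], [4,6,0,0,0,0,0,1,0,0,0,0], [3,0,11,0,0,0,0,0,1,0,0,0], [2,6,12,1,0,0,0,0,0,1,0,0], [12,0,1,0,10,0,0,0,0,0,1,0], [7,1,11,7,0,4,8,12,0,0,0,1] :: int list]"
definition "m6 = [[1,0,0,0,0,0,0,0,0,0,0,0], [0,1,0,0,0,0,0,0,0,0,0,0], [0,0,1,0,0,0,0,0,0,0,0,0], [0,0,0,1,0,0,0,0,0,0,0,0], [0,0,0,0,1,0,0,0,0,0,0,0], [0,0,0,0,0,1,0,0,0,0,0,0], [0,0,0,0,0,0,1,0,0,0,0,0], [3,0,0,0,0,0,0,1,0,0,0,0], [0,6,0,0,0,0,0,0,1,0,0,0], [4,2,10,0,0,0,0,0,0,1,0,0], [7,0,11,4,0,0,0,0,0,0,1,0], [0,3,11,5,11,5,1,0,0,0,0,1] :: int list]"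
definition "m7 = [[1,0,0,0,0,0,0,0,0,0,0,0], [0,1,0,0,0,0,0,0,0,0,0,0], [0,0,1,0,0,0,0,0,0,0,0,0], [0,0,0,1,0,0,0,0,0,0,0,0], [0,0,0,0,1,0,0,0,0,0,0,0], [0,0,0,0,0,1,0,0,0,0,0,0], [0,0,0,0,0,0,1,0,0,0,0,0], [0,0,0,0,0,0,0,1,0,0,0,0], [10,0,0,0,0,0,0,0,1,0,0,0], [3,6,0,0,0,0,0,0,0,1,0,0], [4,11,6,0,0,0,0,0,0,0,1,0], [7,4,0,0,12,0,0,0,0,0,0,1] :: int list]"
definition "m8 = [[1,0,0,0,0,0,0,0,0,0,0,0], [0,1,0,0,0,0,0,0,0,0,0,0], [0,0,1,0,0,0,0,0,0,0,0,0], [0,0,0,1,0,0,0,0,0,0,0,0], [0,0,0,0,1,0,0,0,0,0,0,0], [0,0,0,0,0,1,0,0,0,0,0,0], [0,0,0,0,0,0,1,0,0,0,0,0], [0,0,0,0,0,0,0,1,0,0,0,0], [0,0,0,0,0,0,0,0,1,0,0,0], [4,0,0,0,0,0,0,0,0,1,0,0], [7,6,0,0,0,0,0,0,0,0,1,0], [9,7,10,1,0,0,0,0,0,0,0,1] :: int list]"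
definition "m9 = [[1,0,0,0,0,0,0,0,0,0,0,0], [0,1,0,0,0,0,0,0,0,0,0,0], [0,0,1,0,0,0,0,0,0,0,0,0], [0,0,0,1,0,0,0,0,0,0,0,0], [0,0,0,0,1,0,0,0,0,0,0,0], [0,0,0,0,0,1,0,0,0,0,0,0], [0,0,0,0,0,0,1,0,0,0,0,0], [0,0,0,0,0,0,0,1,0,0,0,0], [0,0,0,0,0,0,0,0,1,0,0,0], [0,0,0,0,0,0,0,0,0,1,0,0], [11,0,0,0,0,0,0,0,0,0,1,0], [7,9,12,0,0,0,0,0,0,0,0,1] :: int list]"
definition "m10 = [[1,0,0,0,0,0,0,0,0,0,0,0], [0,1,0,0,0,0,0,0,0,0,0,0], [0,0,1,0,0,0,0,0,0,0,0,0], [0,0,0,1,0,0,0,0,0,0,0,0], [0,0,0,0,1,0,0,0,0,0,0,0], [0,0,0,0,0,1,0,0,0,0,0,0], [0,0,0,0,0,0,1,0,0,0,0,0], [0,0,0,0,0,0,0,1,0,0,0,0], [0,0,0,0,0,0,0,0,1,0,0,0], [0,0,0,0,0,0,0,0,0,1,0,0], [0,0,0,0,0,0,0,0,0,0,1,0], [12,0,0,0,0,0,0,0,0,0,0,1] :: int list]"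

definition gl :: "nat \<Rightarrow> int list list" where
 "gl k = (if k = 1 then m1 else if k = 2 then m2 else if k = 3 then m3 else if k = 4 then m4 else if k = 5 then m5
  else if k = 6 then m6 else if k = 7 then m7 else if k = 8 then m8 else if k = 9 then m9 else m10)"

text \<open>The word acts from the left, one factor at a time, so neither inverses nor separate
  powers have to be computed.\<close>

fun act_word :: "(nat \<times> nat) list \<Rightarrow> int list list \<Rightarrow> int list list" where
 "act_word [] X = X"
| "act_word ((k,e) # w) X = (mm (gl k) ^^ e) (act_word w X)"

definition comm_ok :: "nat \<times> nat \<times> (nat \<times> nat) list \<Rightarrow> bool" where
 "comm_ok = (\<lambda>(i,j,w). act_word w (mm (gl j) (gl i)) = mm (gl i) (gl j))"

text \<open>A commutator presentation: in \<open>(i, j, w)\<close> the word \<open>w\<close> in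
  later generators, given by index and exponent, is the commutator of generators \<open>i\<close>
  and \<open>j\<close>. The six lists are evaluated separately.\<close>

definition "comms0 = ([(1,2,[(3,1)]), (1,3,[(4,1)]), (1,4,[(5,1)]), (1,5,[(6,1)]), (1,6,[(7,1)]), (1,7,[(8,1)]), (1,8,[(9,1)]), (1,9,[]), (1,10,[]), (2,3,[(5,1),(6,12),(7,8),(8,6),(9,9),(10,1)])] :: (nat \<times> nat \<times> (nat \<times> nat) list) list)"
definition "comms1 = ([(2,4,[(6,1),(9,11)]), (2,5,[(7,2),(8,5),(9,12),(10,3)])] :: (nat \<times> nat \<times> (nat \<times> nat) list) list)"
definition "comms2 = ([(2,6,[(8,3),(9,3),(10,6)]), (2,7,[(9,7),(10,3)]), (2,8,[(10,3)]), (2,9,[(10,1)]), (2,10,[])] :: (nat \<times> nat \<times> (nat \<times> nat) list) list)"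
definition "comms3 = ([(3,4,[(7,12),(8,9),(9,12),(10,1)]), (3,5,[(8,12),(9,6),(10,4)]), (3,6,[(9,9),(10,2)])] :: (nat \<times> nat \<times> (nat \<times> nat) list) list)"
definition "comms4 = ([(3,7,[(10,11)]), (3,8,[(10,12)]), (3,9,[]), (3,10,[]), (4,5,[(9,3),(10,10)]), (4,6,[(10,1)])] :: (nat \<times> nat \<times> (nat \<times> nat) list) list)"
definition "comms5 = ([(4,7,[(10,1)]), (4,8,[]), (4,9,[]), (4,10,[]), (5,6,[(10,12)]), (5,7,[]), (5,8,[]), (5,9,[]), (5,10,[]), (6,7,[]), (6,8,[]), (6,9,[]), (6,10,[]), (7,8,[]), (7,9,[]), (7,10,[]), (8,9,[]), (8,10,[]), (9,10,[])] :: (nat \<times> nat \<times> (nat \<times> nat) list) list)"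

lemma comms0_ok: "list_all comm_ok comms0" by code_simp
lemma comms1_ok: "list_all comm_ok comms1" by code_simp
lemma comms2_ok: "list_all comm_ok comms2" by code_simp
lemma comms3_ok: "list_all comm_ok comms3" by code_simp
lemma comms4_ok: "list_all comm_ok comms4" by code_simp
lemma comms5_ok: "list_all comm_ok comms5" by code_simp

definition "comms = comms0 @ comms1 @ comms2 @ comms3 @ comms4 @ comms5"

lemma comms_ok: "(i,j,w) \<in> set comms ==> act_word w (mm (gl j) (gl i)) = mm (gl i) (gl j)"
proof -
 assume c: "(i,j,w) \<in> set comms"
 have "list_all comm_ok comms"
  unfolding comms_def using comms0_ok comms1_ok comms2_ok comms3_ok comms4_ok comms5_ok by simp
 then have "comm_ok (i,j,w)" using c unfolding list_all_iff by blast
 then show ?thesis by (simp add: comm_ok_def)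
qed

definition wf_mat :: "int list list \<Rightarrow> bool" where
 "wf_mat A \<longleftrightarrow> length A = 12 \<and> list_all (\<lambda>r. length r = 12) A"

definition wt :: "nat \<Rightarrow> nat" where "wt k = (if k = 10 then 11 else k)"
text \<open>The row of degree \<open>11 - wt k\<close>, where the first column of generator
  \<open>k\<close> is non-zero; this entry detects the generator. The shift after 4 skips the second
  coordinate of degree 7.\<close>

definition ps :: "nat \<Rightarrow> nat" where "ps k = (if k \<le> 4 then k else k + 1)"
definition id12 :: "int list list" where
 "id12 = map (\<lambda>i. map (\<lambda>j. if i = j then 1 else 0) [0..<12]) [0..<12::nat]"

definition deg_ok :: "nat \<Rightarrow> bool" where
 "deg_ok k \<longleftrightarrow> list_all (\<lambda>(d,u,r). list_all (\<lambda>(e,v,x). d + wt k \<le> e \<or> x = v) (zip dg (zip u r))) (zip dg (zip id12 (gl k)))"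

lemma gl_ok: "list_all (\<lambda>k. wf_mat (gl k) \<and> deg_ok k \<and> 0 < gl k ! ps k ! 0 \<and> gl k ! ps k ! 0 < 13 \<and>
  dg ! 0 = dg ! ps k + wt k \<and> ps k < 12) [1,2,3,4,5,6,7,8,9,10]"
 by code_simp

lemma comms_shape: "list_all (\<lambda>(i,j,w). list_all (\<lambda>(k,e). j < k \<and> k \<le> 10) w \<and> 0 < i \<and> i < j \<and> j \<le> 10) comms"
 by code_simp

lemma comms_all: "map (\<lambda>(i,j,w). (i,j)) comms = concat (map (\<lambda>i. map (Pair i) [Suc i..<11]) [1..<10])"
 by code_simp

definition Mt :: "int list list \<Rightarrow> K mat" where
 "Mt L = mat 12 12 (\<lambda>(i,j). of_int (L ! i ! j))"

lemma Mt_carrier: "Mt L \<in> carrier_mat 12 12" by (simp add: Mt_def)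

lemma rm_nth:
 "length xs = length bs ==> list_all (\<lambda>r. length r = 12) bs \<Longrightarrow>
  length (rm xs bs) = 12 \<and> (\<forall>j<12. rm xs bs ! j = (\<Sum>k<length bs. xs ! k * bs ! k ! j))"
proof (induction xs bs rule: list_induct2)
 case Nil
 have "rm [] [] = replicate 12 0" by (simp add: numeral_eq_Suc)
 then show ?case by simp
next
 case (Cons x xs b bs)
 then have l: "length (rm xs bs) = 12" "length b = 12"
  and s: "\<And>j. j < 12 ==> rm xs bs ! j = (\<Sum>k<length bs. xs ! k * bs ! k ! j)" by auto
 have "(\<Sum>k<length (b # bs). (x # xs) ! k * (b # bs) ! k ! j) = x * b ! j + (\<Sum>k<length bs. xs ! k * bs ! k ! j)" for j
  by (simp add: sum.lessThan_Suc_shift del: sum.lessThan_Suc)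
 then show ?case using l s by simp
qed

lemma wf_mm: "wf_mat A ==> wf_mat B ==> wf_mat (mm A B)"
 using rm_nth[of _ B] by (auto simp: wf_mat_def mm_def list_all_iff)

lemma Mt_mm: assumes A: "wf_mat A" and B: "wf_mat B" shows "Mt (mm A B) = Mt A * Mt B"
proof (rule eq_matI)
 fix i j assume "i < dim_row (Mt A * Mt B)" "j < dim_col (Mt A * Mt B)"
 then have ij: "i < 12" "j < 12" by (auto simp: Mt_def)
 have lA: "length A = 12" "length B = 12" using A B by (auto simp: wf_mat_def)
 have "A ! i \<in> set A" using ij lA by simp
 then have "length (A ! i) = 12" using A by (simp add: wf_mat_def list_all_iff)
 then have r: "length (rm (A ! i) B) = 12" "rm (A ! i) B ! j = (\<Sum>k<12. A ! i ! k * B ! k ! j)"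
  using rm_nth[of "A ! i" B] ij lA B by (auto simp: wf_mat_def)
 have "mm A B ! i ! j = (\<Sum>k<12. A ! i ! k * B ! k ! j) mod 13"
  using ij lA r by (simp add: mm_def)
 then have "Mt (mm A B) $$ (i,j) = (\<Sum>k<12. of_int (A ! i ! k) * of_int (B ! k ! j))"
  using ij by (simp add: Mt_def K_mod)
 then show "Mt (mm A B) $$ (i,j) = (Mt A * Mt B) $$ (i,j)"
  using mult_entry[OF Mt_carrier Mt_carrier ij] ij by (simp add: Mt_def lessThan_atLeast0)
qed (auto simp: Mt_def)

section \<open>The generated group and its order\<close>

definition gm :: "nat \<Rightarrow> K mat" where
 "gm k = (if 1 \<le> k \<and> k \<le> 10 then Mt (gl k) else 1\<^sub>m 12)"

lemma gl_facts:
 assumes k: "1 \<le> k" "k \<le> 10"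
 shows "wf_mat (gl k)" "deg_ok k" "0 < gl k ! ps k ! 0" "gl k ! ps k ! 0 < 13" "dg ! 0 = dg ! ps k + wt k" "ps k < 12"
proof -
 have "k \<in> set [1,2,3,4,5,6,7,8,9,10]" using k by (simp, presburger)
 then have "wf_mat (gl k) \<and> deg_ok k \<and> 0 < gl k ! ps k ! 0 \<and> gl k ! ps k ! 0 < 13 \<and>
   dg ! 0 = dg ! ps k + wt k \<and> ps k < 12"
  using gl_ok unfolding list_all_iff by blast
 then show "wf_mat (gl k)" "deg_ok k" "0 < gl k ! ps k ! 0" "gl k ! ps k ! 0 < 13" "dg ! 0 = dg ! ps k + wt k" "ps k < 12"
  by blast+
qed

lemma gm_Dm: assumes k: "1 \<le> k" "k \<le> 10" shows "gm k \<in> Dm (wt k)"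
proof -
 have "Mt (gl k) $$ (i,j) = (if i = j then 1 else 0)" if ij: "i < 12" "j < 12" "dg ! j < dg ! i + wt k" for i j
 proof -
  have l: "length dg = 12" "length id12 = 12" "length (gl k) = 12" "length (gl k ! i) = 12" "length (id12 ! i) = 12"
   using gl_facts(1)[OF k] ij by (auto simp: dg_def id12_def wf_mat_def list_all_length)
  have "list_all (\<lambda>(e,v,x). dg ! i + wt k \<le> e \<or> x = v) (zip dg (zip (id12 ! i) (gl k ! i)))"
   using gl_facts(2)[OF k] ij(1) l unfolding deg_ok_def list_all_length by (auto dest!: spec[of _ i])
  then have "dg ! i + wt k \<le> dg ! j \<or> gl k ! i ! j = id12 ! i ! j"
   using ij(2) l unfolding list_all_length by (auto dest!: spec[of _ j])
  then have "gl k ! i ! j = (if i = j then 1 else 0)" using ij by (auto simp: id12_def)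
  then show ?thesis using ij by (simp add: Mt_def)
 qed
 then show ?thesis using k Mt_carrier by (auto simp: Dm_def gm_def)
qed

lemma gm_Dm1: "gm k \<in> Dm 1"
proof (cases "1 \<le> k \<and> k \<le> 10")
 case True
 then have "1 \<le> wt k" by (simp add: wt_def)
 then show ?thesis using gm_Dm[of k] Dm_mono[of 1 "wt k"] True by blast
next
 case False
 then have "gm k = 1\<^sub>m 12" unfolding gm_def by (rule if_not_P)
 then show ?thesis by (simp add: Dm_one)
qed

lemma gm_entry: assumes k: "1 \<le> k" "k \<le> 10" shows "gm k $$ (ps k, 0) \<noteq> 0"
 using K_inj[of "gl k ! ps k ! 0" 0] gl_facts[OF k] k by (auto simp: gm_def Mt_def)

interpretation Um: group Um by (rule group_Um)

lemma Um_inv: "x \<in> Dm 1 ==> inv\<^bsub>Um\<^esub> x = x [^]\<^bsub>Um\<^esub> (12::nat)"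
proof -
 assume x: "x \<in> Dm 1"
 have "x [^]\<^bsub>Um\<^esub> (12::nat) \<otimes>\<^bsub>Um\<^esub> x = x [^]\<^bsub>Um\<^esub> (13::nat)" using Um.nat_pow_Suc[of x 12] by simp
 then show ?thesis using x Um_pow13[OF x] Um.nat_pow_closed[of x 12] by (intro Um.inv_equality) auto
qed

lemma Dm_pow: "x \<in> Dm m ==> 0 < m ==> x [^]\<^bsub>Um\<^esub> (n::nat) \<in> Dm m"
 by (induction n) (auto simp: Dm_one Dm_mult)

lemma generate_Dm: assumes S: "S \<subseteq> Dm m" and m: "0 < m" shows "generate Um S \<subseteq> Dm m"
proof
 fix x assume "x \<in> generate Um S"
 then show "x \<in> Dm m"
 proof (induction rule: generate.induct)
  case (inv h)
  then have "h \<in> Dm m" "h \<in> Dm 1" using S m Dm_mono[of 1 m] by auto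
  then show ?case using Dm_pow[of h m 12] m by (simp add: Um_inv)
 qed (use S m in \<open>auto simp: Dm_one Dm_mult\<close>)
qed

definition Hg :: "nat \<Rightarrow> K mat set" where "Hg k = generate Um (gm ` {k..10})"

lemma Hg_subgroup: "subgroup (Hg k) Um"
 unfolding Hg_def using gm_Dm1 by (intro Um.generate_is_subgroup) auto

lemma gm_Hg: "m \<le> k ==> k \<le> 10 ==> gm k \<in> Hg m"
 unfolding Hg_def by (intro generate.incl) auto

fun wprod :: "(nat \<times> nat) list \<Rightarrow> K mat" where
 "wprod [] = 1\<^sub>m 12"
| "wprod ((k,e) # w) = gm k [^]\<^bsub>Um\<^esub> e * wprod w"

lemma wprod_Hg: "list_all (\<lambda>(k,e). m \<le> k \<and> k \<le> 10) w ==> wprod w \<in> Hg m"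
proof (induction w rule: wprod.induct)
 case 1
 then show ?case using subgroup.one_closed[OF Hg_subgroup] by simp
next
 case (2 k e w)
 have "gm k [^]\<^bsub>Um\<^esub> e \<in> Hg m" for e :: nat
  using subgroup.one_closed[OF Hg_subgroup[of m]] subgroup.m_closed[OF Hg_subgroup[of m]] gm_Hg[of m k] 2(2)
  by (induction e) auto
 then show ?case using 2 subgroup.m_closed[OF Hg_subgroup[of m]] by auto
qed

lemma Hg_carr: "x \<in> Hg m ==> x \<in> Dm 1"
 using subgroup.mem_carrier[OF Hg_subgroup] by simp

lemma act_wprod:
 assumes "list_all (\<lambda>(k,e). 1 \<le> k \<and> k \<le> 10) w" "wf_mat X"
 shows "wf_mat (act_word w X) \<and> Mt (act_word w X) = wprod w * Mt X"
 using assms(1)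
proof (induction w rule: wprod.induct)
 case 1
 then show ?case using assms(2) Mt_carrier by (simp add: left_mult_one_mat[OF Mt_carrier])
next
 case (2 k e w)
 have k: "1 \<le> k" "k \<le> 10" and w: "list_all (\<lambda>(k,e). 1 \<le> k \<and> k \<le> 10) w" using 2(2) by auto
 let ?Y = "act_word w X"
 have Y: "wf_mat ?Y" "Mt ?Y = wprod w * Mt X" using 2(1)[OF w] by auto
 have P: "gm k [^]\<^bsub>Um\<^esub> n \<in> carrier_mat 12 12" for n :: nat using Dm_pow[OF gm_Dm1] Dm_carrier by auto
 have "wf_mat ((mm (gl k) ^^ n) ?Y) \<and> Mt ((mm (gl k) ^^ n) ?Y) = gm k [^]\<^bsub>Um\<^esub> n * Mt ?Y" for n
 proof (induction n)
  case 0
  then show ?case using Y(1) left_mult_one_mat[OF Mt_carrier] by simp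
 next
  case (Suc n)
  have "Mt ((mm (gl k) ^^ Suc n) ?Y) = gm k * (gm k [^]\<^bsub>Um\<^esub> n * Mt ?Y)"
   using Suc gl_facts(1)[OF k] k by (simp add: Mt_mm gm_def)
  also have "\<dots> = (gm k * gm k [^]\<^bsub>Um\<^esub> n) * Mt ?Y"
   using assoc_mult_mat[OF Dm_carrier[OF gm_Dm1] P Mt_carrier] by simp
  also have "gm k * gm k [^]\<^bsub>Um\<^esub> n = gm k [^]\<^bsub>Um\<^esub> Suc n" using Um.nat_pow_Suc2[of "gm k" n] gm_Dm1 by simp
  finally show ?case using Suc gl_facts(1)[OF k] by (simp add: wf_mm)
 qed
 from this[of e] show ?case
  using Y(2) assoc_mult_mat[OF P[of e] Dm_carrier[OF Hg_carr[OF wprod_Hg[OF w]]] Mt_carrier[of X]] by simp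
qed

lemma comm_gm:
 assumes c: "(i,j,w) \<in> set comms"
 shows "gm i * gm j = wprod w * (gm j * gm i)"
proof -
 have s: "list_all (\<lambda>(k,e). j < k \<and> k \<le> 10) w" "0 < i" "i < j" "j \<le> 10"
  using comms_shape c unfolding list_all_iff[of _ comms] by auto
 then have i: "1 \<le> i" "i \<le> 10" and j: "1 \<le> j" "j \<le> 10" by auto
 have w: "list_all (\<lambda>(k,e). 1 \<le> k \<and> k \<le> 10) w" using s(1) by (auto simp: list_all_iff)
 have "Mt (act_word w (mm (gl j) (gl i))) = wprod w * Mt (mm (gl j) (gl i))"
  using act_wprod[OF w wf_mm[OF gl_facts(1)[OF j] gl_facts(1)[OF i]]] by blast
 then show ?thesis unfolding comms_ok[OF c]
  using Mt_mm[OF gl_facts(1)[OF j] gl_facts(1)[OF i]] Mt_mm[OF gl_facts(1)[OF i] gl_facts(1)[OF j]] i j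
  by (simp add: gm_def)
qed

lemma gm_pair: assumes "1 \<le> i" "i < j" "j \<le> 10" shows "\<exists>s\<in>Hg (Suc j). gm i * gm j = s * (gm j * gm i)"
proof -
 have "(i,j) \<in> set (concat (map (\<lambda>i. map (Pair i) [Suc i..<11]) [1..<10]))"
  using assms by (auto simp: image_iff intro!: bexI[of _ i])
 then have "(i,j) \<in> (\<lambda>(i,j,w). (i,j)) ` set comms" unfolding comms_all[symmetric] by simp
 then obtain w where w: "(i,j,w) \<in> set comms" by auto
 then have "list_all (\<lambda>(k,e). Suc j \<le> k \<and> k \<le> 10) w"
  using comms_shape unfolding list_all_iff[of _ comms] by (auto simp: Suc_le_eq)
 then show ?thesis using comm_gm[OF w] wprod_Hg by blast
qed

lemma Hg_mono: "m \<le> n ==> Hg n \<subseteq> Hg m"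
 unfolding Hg_def by (rule Um.mono_generate) auto

text \<open>Later generators have larger weight and entry 0 at the position
  \<open>(ps k, 0)\<close>, where entries of weight \<open>wt k\<close> add; so this entry reads off
  the exponent of \<open>gm k\<close>.\<close>

lemma Hg_entry:
 assumes k: "1 \<le> k" "k \<le> 10" and h: "h \<in> Hg (Suc k)"
 shows "(h * gm k [^]\<^bsub>Um\<^esub> (n::nat)) $$ (ps k, 0) = of_nat n * gm k $$ (ps k, 0)"
proof -
 note f = gl_facts[OF k]
 have w0: "0 < wt k" using k by (simp add: wt_def)
 have "gm ` {Suc k..10} \<subseteq> Dm (Suc (wt k))"
 proof
  fix x assume "x \<in> gm ` {Suc k..10}"
  then obtain l where l: "x = gm l" "Suc k \<le> l" "l \<le> 10" by auto
  then have "Suc (wt k) \<le> wt l" by (simp add: wt_def)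
  then show "x \<in> Dm (Suc (wt k))" using gm_Dm[of l] Dm_mono[of "Suc (wt k)" "wt l"] l by auto
 qed
 then have hD: "h \<in> Dm (Suc (wt k))" using generate_Dm[of _ "Suc (wt k)"] h by (auto simp: Hg_def)
 have p0: "ps k \<noteq> 0" using f(5) w0 by (cases "ps k = 0") auto
 have h0: "h $$ (ps k, 0) = 0" using DmD[OF hD f(6), of 0] f(5) p0 by simp
 have hD': "h \<in> Dm (wt k)" using hD Dm_mono[of "wt k" "Suc (wt k)"] by auto
 have P: "gm k [^]\<^bsub>Um\<^esub> (n::nat) \<in> Dm (wt k)" for n using Dm_pow[OF gm_Dm[OF k] w0] .
 have "(gm k [^]\<^bsub>Um\<^esub> (n::nat)) $$ (ps k, 0) = of_nat n * gm k $$ (ps k, 0)" for n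
 proof (induction n)
  case 0
  show ?case using f(6) p0 by simp
 next
  case (Suc n)
  then show ?case using Dm_entry_add[OF P[of n] gm_Dm[OF k] w0 f(6) _ f(5)] by (simp add: algebra_simps)
 qed
 then show ?thesis using Dm_entry_add[OF hD' P[of n] w0 f(6) _ f(5)] h0 by simp
qed

text \<open>Generators are adjoined from \<open>gm 10\<close> down to \<open>gm 1\<close>. Each
  normalises the subgroup of the later ones and contributes a factor 13, detected by
  \<open>Hg_entry\<close>.\<close>

lemma Hg_card: "n \<le> 10 ==> finite (Hg (11 - n)) \<and> card (Hg (11 - n)) = 13 ^ n"
proof (induction n)
 case 0
 have "Hg 11 = {1\<^sub>m 12}" by (simp add: Hg_def Um.generate_empty)
 then show ?case by simp
next
 case (Suc n)
 define k where "k = 10 - n"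
 have k: "1 \<le> k" "k \<le> 10" "11 - Suc n = k" "11 - n = Suc k" using Suc.prems by (auto simp: k_def)
 have S: "gm ` {Suc k..10} \<subseteq> carrier Um" using gm_Dm1 by auto
 have ins: "gm ` {k..10} = insert (gm k) (gm ` {Suc k..10})"
  using k by (simp add: atLeastAtMost_insertL[symmetric] del: atLeastAtMost_insertL)
 have "finite (generate Um (insert (gm k) (gm ` {Suc k..10}))) \<and>
   card (generate Um (insert (gm k) (gm ` {Suc k..10}))) = 13 * card (generate Um (gm ` {Suc k..10}))"
 proof (rule Um.generate_insert_card[OF S])
  show "gm k \<in> carrier Um" using gm_Dm1 by simp
  show "gm k [^]\<^bsub>Um\<^esub> (13::nat) = \<one>\<^bsub>Um\<^esub>" using Um_pow13[OF gm_Dm1] by simp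
  show "finite (generate Um (gm ` {Suc k..10}))" using Suc k by (simp add: Hg_def)
 next
  fix h assume h: "h \<in> generate Um (gm ` {Suc k..10})"
  show "\<exists>h'\<in>generate Um (gm ` {Suc k..10}). gm k \<otimes>\<^bsub>Um\<^esub> h = h' \<otimes>\<^bsub>Um\<^esub> gm k"
  proof (rule Um.generate_normalised[OF S _ _ _ h])
   fix x assume "x \<in> gm ` {Suc k..10}"
   then obtain j where j: "x = gm j" "Suc k \<le> j" "j \<le> 10" by auto
   obtain s where s: "s \<in> Hg (Suc j)" "gm k * gm j = s * (gm j * gm k)" using gm_pair[of k j] j k by auto
   have "s * (gm j * gm k) = (s * gm j) * gm k"
    using assoc_mult_mat[OF Dm_carrier[OF Hg_carr[OF s(1)]] Dm_carrier[OF gm_Dm1] Dm_carrier[OF gm_Dm1]] by simp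
   moreover have "s * gm j \<in> Hg (Suc k)"
    using subgroup.m_closed[OF Hg_subgroup, of s "Suc k" "gm j"] s Hg_mono[of "Suc k" "Suc j"] gm_Hg[of "Suc k" j] j by auto
   ultimately show "\<exists>h'\<in>generate Um (gm ` {Suc k..10}). gm k \<otimes>\<^bsub>Um\<^esub> x = h' \<otimes>\<^bsub>Um\<^esub> gm k"
    using s j by (auto simp: Hg_def)
  qed (use gm_Dm1 Um_inv in auto)
 next
  fix i j :: nat and h h'
  assume ij: "i < 13" "j < 13" and h: "h \<in> generate Um (gm ` {Suc k..10})" "h' \<in> generate Um (gm ` {Suc k..10})"
   and e: "h \<otimes>\<^bsub>Um\<^esub> gm k [^]\<^bsub>Um\<^esub> i = h' \<otimes>\<^bsub>Um\<^esub> gm k [^]\<^bsub>Um\<^esub> j"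
  have e': "h * gm k [^]\<^bsub>Um\<^esub> i = h' * gm k [^]\<^bsub>Um\<^esub> j" using e by simp
  have 1: "(h * gm k [^]\<^bsub>Um\<^esub> i) $$ (ps k, 0) = of_nat i * gm k $$ (ps k, 0)"
   and 2: "(h' * gm k [^]\<^bsub>Um\<^esub> j) $$ (ps k, 0) = of_nat j * gm k $$ (ps k, 0)"
   using Hg_entry[OF k(1,2)] h by (simp_all add: Hg_def)
  have "of_nat i * gm k $$ (ps k, 0) = of_nat j * gm k $$ (ps k, 0)"
   by (rule trans[OF sym[OF 1[unfolded e']] 2])
  then have "(of_nat i :: K) = of_nat j" using gm_entry[OF k(1,2)] by simp
  then show "i = j" using K_nat_inj ij by blast
 qed
 then show ?case using Suc k by (simp add: Hg_def ins)
qed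

lemma Hg1: "finite (Hg 1)" "card (Hg 1) = 13 ^ 10"
 using Hg_card[of 10] by simp_all

lemma gm_pow_ne: "0 < n ==> n < 13 ==> 1 \<le> k ==> k \<le> 10 ==> gm k [^]\<^bsub>Um\<^esub> (n::nat) \<noteq> 1\<^sub>m 12"
proof
 assume n: "0 < n" "n < 13" and k: "1 \<le> k" "k \<le> 10" and e: "gm k [^]\<^bsub>Um\<^esub> n = 1\<^sub>m 12"
 have o: "1\<^sub>m 12 \<in> Hg (Suc k)" using subgroup.one_closed[OF Hg_subgroup] by simp
 have "(1\<^sub>m 12 * gm k [^]\<^bsub>Um\<^esub> n) $$ (ps k, 0) = (1\<^sub>m 12 * gm k [^]\<^bsub>Um\<^esub> (0::nat)) $$ (ps k, 0)" using e by simp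
 then have "of_nat n * gm k $$ (ps k, 0) = 0" using Hg_entry[OF k o, of n] Hg_entry[OF k o, of 0] by simp
 then have "(of_nat n :: K) = of_nat 0" using gm_entry[OF k] by simp
 then show False using K_nat_inj[of n 0] n by simp
qed

lemma word_gap: "list_all (\<lambda>(i,j,w). i = 2 \<and> 3 \<le> j \<and> j \<le> 8 \<longrightarrow> list_all (\<lambda>(k,e). j + 2 \<le> k \<and> k \<le> 10) w) comms"
 by code_simp

lemmas comms_unfold = comms_def comms0_def comms1_def comms2_def comms3_def comms4_def comms5_def

section \<open>The group satisfies the relations required of it\<close>

definition Gg :: "K mat monoid" where "Gg = Um\<lparr>carrier := Hg 1\<rparr>"

lemma Gg_simps [simp]: "carrier Gg = Hg 1" "x \<otimes>\<^bsub>Gg\<^esub> y = x * y" "\<one>\<^bsub>Gg\<^esub> = 1\<^sub>m 12"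
 "x [^]\<^bsub>Gg\<^esub> (n::nat) = x [^]\<^bsub>Um\<^esub> n"
 using Um.nat_pow_consistent[of x n "Hg 1"] by (simp_all add: Gg_def)

lemma group_Gg: "group Gg"
 unfolding Gg_def by (rule Um.subgroup_imp_group[OF Hg_subgroup])

lemma gm_in: "gm k \<in> Hg 1"
 using gm_Hg[of 1 k] subgroup.one_closed[OF Hg_subgroup[of 1]] by (cases "1 \<le> k \<and> k \<le> 10") (auto simp: gm_def)

lemma generate_Gg: "S \<subseteq> Hg 1 ==> generate Gg S = generate Um S"
 unfolding Gg_def by (rule Um.generate_consistent[OF _ Hg_subgroup])

lemma generate_Gg_gm: "generate Gg (gm ` {m..10}) = Hg m"
 using generate_Gg[of "gm ` {m..10}"] gm_in by (auto simp: Hg_def)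

lemma gm_pow1: "gm k [^]\<^bsub>Um\<^esub> (1::nat) = gm k"
 using Um.nat_pow_eone[of "gm k"] gm_Dm1 by simp

lemma gm_one: "gm k * 1\<^sub>m 12 = gm k" "gm k [^]\<^bsub>Um\<^esub> (n::nat) * 1\<^sub>m 12 = gm k [^]\<^bsub>Um\<^esub> n" "1\<^sub>m 12 * (gm k * gm l) = gm k * gm l"
 using Dm_carrier[OF gm_Dm1[of k]] Dm_carrier[OF gm_Dm1[of l]] Dm_carrier[OF Dm_pow[OF gm_Dm1[of k], of n]] by auto

lemma rel_1: assumes "2 \<le> k" "k \<le> 8" shows "gm 1 * gm k = gm (Suc k) * (gm k * gm 1)"
proof -
 have "k = 2 \<or> k = 3 \<or> k = 4 \<or> k = 5 \<or> k = 6 \<or> k = 7 \<or> k = 8" using assms by presburger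
 then have "(1, k, [(Suc k, 1)]) \<in> set comms" by (elim disjE) (simp_all add: comms_unfold)
 from comm_gm[OF this] show ?thesis using gm_pow1[of "Suc k"] by (simp add: gm_one)
qed

lemma rel_29: "gm 2 * gm 9 = gm 10 * (gm 9 * gm 2)"
proof -
 have "(2, 9, [(10, 1)]) \<in> set comms" by (simp add: comms_unfold)
 from comm_gm[OF this] show ?thesis using gm_pow1[of 10] by (simp add: gm_one)
qed

text \<open>The relations \<open>rel_1\<close> and \<open>rel_29\<close> can be solved for the
  commutator on the right-hand side, which yields \<open>gm 3\<close>, ..., \<open>gm 10\<close>
  from the first two.\<close>

lemma Hg1_generators: "Hg 1 = generate Um {gm 1, gm 2}"
proof
 let ?E = "generate Um {gm 1, gm 2}"
 have E: "subgroup ?E Um" using gm_Dm1 by (intro Um.generate_is_subgroup) auto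
 have q: "s \<in> ?E" if "a \<in> ?E" "b \<in> ?E" "s \<in> Dm 1" "a = s * b" for s a b
 proof -
  have "b \<in> carrier Um" using subgroup.mem_carrier[OF E that(2)] .
  moreover have "a \<in> carrier Um" using subgroup.mem_carrier[OF E that(1)] .
  ultimately have "s = a \<otimes>\<^bsub>Um\<^esub> inv\<^bsub>Um\<^esub> b" using that Um.inv_solve_right[of s a b] by simp
  then show ?thesis using subgroup.m_closed[OF E that(1) subgroup.m_inv_closed[OF E that(2)]] by (simp only:)
 qed
 have m: "x * y \<in> ?E" if "x \<in> ?E" "y \<in> ?E" for x y using subgroup.m_closed[OF E that] by simp
 have g12: "gm 1 \<in> ?E" "gm 2 \<in> ?E" by (auto intro: generate.incl)
 have up: "n \<le> 7 ==> gm (n + 2) \<in> ?E" for n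
 proof (induction n)
  case 0
  then show ?case using g12 by (simp add: numeral_2_eq_2)
 next
  case (Suc n)
  then have n: "gm (n + 2) \<in> ?E" by simp
  have "gm (Suc (n + 2)) \<in> ?E"
   using q[OF m[OF g12(1) n] m[OF n g12(1)] gm_Dm1 rel_1] Suc.prems by simp
  then show ?case by simp
 qed
 have g10: "gm 10 \<in> ?E"
  using q[OF m[OF g12(2)] m[OF _ g12(2)] gm_Dm1 rel_29] up[of 7] by simp
 have "gm k \<in> ?E" if "k \<in> {1..10}" for k
 proof -
  consider "k = 1" | "k = (k - 2) + 2" "k - 2 \<le> 7" | "k = 10" using \<open>k \<in> {1..10}\<close> by fastforce
  then show ?thesis using up[of "k - 2"] g12 g10 by cases auto
 qed
 then show "Hg 1 \<subseteq> ?E" unfolding Hg_def by (intro Um.generate_subgroup_incl[OF _ E]) auto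
 show "?E \<subseteq> Hg 1" by (intro Um.generate_subgroup_incl[OF _ Hg_subgroup]) (use gm_in in auto)
qed

lemma pgrp_Gg: "pgrp Gg gm"
proof (intro pgrp.intro pgrp_axioms.intro group_Gg)
 show "gm k \<in> carrier Gg" for k using gm_in by simp
 show "x [^]\<^bsub>Gg\<^esub> (13::nat) = \<one>\<^bsub>Gg\<^esub>" if "x \<in> carrier Gg" for x using Um_pow13[of x] Hg_carr[of x 1] that by simp
 show "carrier Gg = generate Gg {gm 1, gm 2}" using generate_Gg[of "{gm 1, gm 2}"] gm_in Hg1_generators by simp
 show "gm 1 \<otimes>\<^bsub>Gg\<^esub> gm k = gm (Suc k) \<otimes>\<^bsub>Gg\<^esub> (gm k \<otimes>\<^bsub>Gg\<^esub> gm 1)" if "2 \<le> k" "k \<le> 8" for k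
  using rel_1[OF that] by simp
 have "(1, 9, []) \<in> set comms" by (simp add: comms_unfold)
 from comm_gm[OF this] show "gm 1 \<otimes>\<^bsub>Gg\<^esub> gm 9 = gm 9 \<otimes>\<^bsub>Gg\<^esub> gm 1" by (simp add: gm_one)
 have "(1, 10, []) \<in> set comms" by (simp add: comms_unfold)
 from comm_gm[OF this] show "gm 1 \<otimes>\<^bsub>Gg\<^esub> gm 10 = gm 10 \<otimes>\<^bsub>Gg\<^esub> gm 1" by (simp add: gm_one)
 have "(2, 10, []) \<in> set comms" by (simp add: comms_unfold)
 from comm_gm[OF this] show "gm 2 \<otimes>\<^bsub>Gg\<^esub> gm 10 = gm 10 \<otimes>\<^bsub>Gg\<^esub> gm 2" by (simp add: gm_one)
 show "gm 2 \<otimes>\<^bsub>Gg\<^esub> gm 9 = gm 10 \<otimes>\<^bsub>Gg\<^esub> (gm 9 \<otimes>\<^bsub>Gg\<^esub> gm 2)" using rel_29 by simp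
 have "(4, 7, [(10, 1)]) \<in> set comms" by (simp add: comms_unfold)
 from comm_gm[OF this] show "gm 4 \<otimes>\<^bsub>Gg\<^esub> gm 7 = gm 10 \<otimes>\<^bsub>Gg\<^esub> (gm 7 \<otimes>\<^bsub>Gg\<^esub> gm 4)"
  using gm_pow1[of 10] by (simp add: gm_one)
 show "\<exists>s\<in>generate Gg (gm ` {k + 2..10}). gm 2 \<otimes>\<^bsub>Gg\<^esub> gm k = s \<otimes>\<^bsub>Gg\<^esub> (gm k \<otimes>\<^bsub>Gg\<^esub> gm 2)"
  if k: "3 \<le> k" "k \<le> 8" for k
 proof -
  have "(2,k) \<in> set (concat (map (\<lambda>i. map (Pair i) [Suc i..<11]) [1..<10]))"
   using k by (auto simp: image_iff intro!: bexI[of _ 2])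
  then have "(2,k) \<in> (\<lambda>(i,j,w). (i,j)) ` set comms" unfolding comms_all[symmetric] by simp
  then obtain w where w: "(2,k,w) \<in> set comms" by auto
  then have "list_all (\<lambda>(l,e). k + 2 \<le> l \<and> l \<le> 10) w"
   using word_gap k unfolding list_all_iff[of _ comms] by auto
  then show ?thesis using comm_gm[OF w] wprod_Hg unfolding generate_Gg_gm by auto
 qed
 have w: "(2, 3, [(5,1),(6,12),(7,8),(8,6),(9,9),(10,1)]) \<in> set comms" by (simp add: comms_unfold)
 show "\<exists>s\<in>generate Gg (gm ` {7..10}). gm 2 \<otimes>\<^bsub>Gg\<^esub> gm 3 = (gm 5 \<otimes>\<^bsub>Gg\<^esub> (gm 6 [^]\<^bsub>Gg\<^esub> (12::nat) \<otimes>\<^bsub>Gg\<^esub> s)) \<otimes>\<^bsub>Gg\<^esub> (gm 3 \<otimes>\<^bsub>Gg\<^esub> gm 2)"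
  using comm_gm[OF w] gm_pow1[of 5] wprod_Hg[of 7 "[(7,8),(8,6),(9,9),(10,1)]"] unfolding generate_Gg_gm
  by (intro bexI[of _ "wprod [(7,8),(8,6),(9,9),(10,1)]"]) auto
 have w: "(3, 4, [(7,12),(8,9),(9,12),(10,1)]) \<in> set comms" by (simp add: comms_unfold)
 show "\<exists>s\<in>generate Gg (gm ` {9..10}). gm 3 \<otimes>\<^bsub>Gg\<^esub> gm 4 = (gm 7 [^]\<^bsub>Gg\<^esub> (12::nat) \<otimes>\<^bsub>Gg\<^esub> (gm 8 [^]\<^bsub>Gg\<^esub> (9::nat) \<otimes>\<^bsub>Gg\<^esub> s)) \<otimes>\<^bsub>Gg\<^esub> (gm 4 \<otimes>\<^bsub>Gg\<^esub> gm 3)"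
  using comm_gm[OF w] wprod_Hg[of 9 "[(9,12),(10,1)]"] unfolding generate_Gg_gm
  by (intro bexI[of _ "wprod [(9,12),(10,1)]"]) auto
 have w: "(4, 5, [(9,3),(10,10)]) \<in> set comms" by (simp add: comms_unfold)
 show "\<exists>s\<in>generate Gg (gm ` {10..10}). gm 4 \<otimes>\<^bsub>Gg\<^esub> gm 5 = (gm 9 [^]\<^bsub>Gg\<^esub> (3::nat) \<otimes>\<^bsub>Gg\<^esub> s) \<otimes>\<^bsub>Gg\<^esub> (gm 5 \<otimes>\<^bsub>Gg\<^esub> gm 4)"
  using comm_gm[OF w] wprod_Hg[of 10 "[(10,10)]"] unfolding generate_Gg_gm
  by (intro bexI[of _ "wprod [(10,10)]"]) auto
 have w: "(2, 4, [(6,1),(9,11)]) \<in> set comms" by (simp add: comms_unfold)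
 show "\<exists>s\<in>generate Gg (gm ` {7..10}). gm 2 \<otimes>\<^bsub>Gg\<^esub> gm 4 = (gm 6 \<otimes>\<^bsub>Gg\<^esub> s) \<otimes>\<^bsub>Gg\<^esub> (gm 4 \<otimes>\<^bsub>Gg\<^esub> gm 2)"
  using comm_gm[OF w] gm_pow1[of 6] wprod_Hg[of 7 "[(9,11)]"] unfolding generate_Gg_gm
  by (intro bexI[of _ "wprod [(9,11)]"]) auto
 have w: "(3, 5, [(8,12),(9,6),(10,4)]) \<in> set comms" by (simp add: comms_unfold)
 show "\<exists>s\<in>generate Gg (gm ` {9..10}). gm 3 \<otimes>\<^bsub>Gg\<^esub> gm 5 = (gm 8 [^]\<^bsub>Gg\<^esub> (12::nat) \<otimes>\<^bsub>Gg\<^esub> s) \<otimes>\<^bsub>Gg\<^esub> (gm 5 \<otimes>\<^bsub>Gg\<^esub> gm 3)"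
  using comm_gm[OF w] wprod_Hg[of 9 "[(9,6),(10,4)]"] unfolding generate_Gg_gm
  by (intro bexI[of _ "wprod [(9,6),(10,4)]"]) auto
qed

section \<open>Representations of degree 11\<close>

typedef eleven = "{0..<11::nat}" by (rule exI[of _ 0]) simp

lemma card_eleven: "CARD(eleven) = 11"
 using type_definition.card[OF type_definition_eleven] by simp

instance eleven :: finite
 by standard (simp add: type_definition.univ[OF type_definition_eleven])

lemma Rep_eleven_less: "Rep_eleven i < 11"
 using Rep_eleven[of i] by simp

lemma sum_eleven: "(\<Sum>i\<in>UNIV. F (Rep_eleven i)) = (\<Sum>k\<in>{0..<11}. F k)"
proof (rule sum.reindex_bij_betw)
 show "bij_betw Rep_eleven UNIV {0..<11}"
  using type_definition.Rep_range[OF type_definition_eleven] by (auto simp: bij_betw_def inj_on_def Rep_eleven_inject)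
qed

definition vsc :: "K \<Rightarrow> (eleven \<Rightarrow> K) \<Rightarrow> eleven \<Rightarrow> K" where "vsc c f = (\<lambda>i. c * f i)"
definition ve :: "eleven \<Rightarrow> eleven \<Rightarrow> K" where "ve i = (\<lambda>k. if k = i then 1 else 0)"

lemma ve_at: "ve i k = (if k = i then 1 else 0)"
 by (simp add: ve_def)

lemma sum_fun_at: "(sum F A) k = (\<Sum>a\<in>A. F a (k :: 'x) :: K)"
 by (induction A rule: infinite_finite_induct) auto

interpretation vs: vector_space vsc
 by unfold_locales (auto simp: vsc_def fun_eq_iff algebra_simps)

lemma inj_ve: "inj ve"
 by (rule injI) (metis ve_def zero_neq_one)

interpretation vs: fvs vsc "range ve"
proof (unfold fvs_def, unfold_locales)
 show "vs.independent (range ve)"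
 proof (rule vs.independent_if_scalars_zero)
  fix f x assume s: "(\<Sum>x\<in>range ve. vsc (f x) x) = 0" and "x \<in> range ve"
  then obtain i where x: "x = ve i" by auto
  have "(\<Sum>y\<in>range ve. vsc (f y) y) i = (\<Sum>y\<in>range ve. if y = ve i then f y else 0)"
   unfolding sum_fun_at by (rule sum.cong) (auto simp: vsc_def ve_at split: if_splits)
  also have "\<dots> = f (ve i)" by simp
  finally show "f x = 0" using s x by simp
 qed simp
 show "vs.span (range ve) = UNIV"
 proof -
  have "f \<in> vs.span (range ve)" for f
  proof -
   have "f = (\<Sum>i\<in>UNIV. vsc (f i) (ve i))"
   proof
    fix k
    have "(\<Sum>i\<in>UNIV. vsc (f i) (ve i)) k = (\<Sum>i\<in>UNIV. if i = k then f i else 0)"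
     unfolding sum_fun_at by (rule sum.cong) (auto simp: vsc_def ve_at)
    then show "f k = (\<Sum>i\<in>UNIV. vsc (f i) (ve i)) k" by simp
   qed
   then show ?thesis by (metis (no_types, lifting) rangeI vs.span_base vs.span_scale vs.span_sum)
  qed
  then show ?thesis by blast
 qed
qed simp

definition mop :: "int mat \<Rightarrow> (eleven \<Rightarrow> K) \<Rightarrow> eleven \<Rightarrow> K" where
 "mop A v = (\<lambda>i. \<Sum>j\<in>UNIV. of_int (A $$ (Rep_eleven i, Rep_eleven j)) * v j)"

lemma mop_ve: "mop A (ve j) i = of_int (A $$ (Rep_eleven i, Rep_eleven j))"
proof -
 have "mop A (ve j) i = (\<Sum>k\<in>UNIV. if k = j then of_int (A $$ (Rep_eleven i, Rep_eleven k)) else 0)"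
  unfolding mop_def by (rule sum.cong) (auto simp: ve_at)
 then show ?thesis by simp
qed

lemma mop_one: "mop (1\<^sub>m 11) v = v"
proof
 fix i
 have "mop (1\<^sub>m 11) v i = (\<Sum>j\<in>UNIV. if j = i then v j else 0)"
  unfolding mop_def by (rule sum.cong) (auto simp: Rep_eleven_less Rep_eleven_inject)
 then show "mop (1\<^sub>m 11) v i = v i" by simp
qed

text \<open>Reduction modulo 13 disappears once entries are read in the field, so the product of
  residue matrices becomes composition of operators.\<close>

lemma mop_mult:
 assumes "A \<in> mat_modp 11 13" "B \<in> mat_modp 11 13"
 shows "mop (mult_modp 13 A B) v = mop A (mop B v)"
proof
 fix i
 have AB: "A \<in> carrier_mat 11 11" "B \<in> carrier_mat 11 11" using assms by (auto simp: mat_modp_def)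
 have e: "(of_int (mult_modp 13 A B $$ (Rep_eleven i, Rep_eleven j)) :: K) =
   (\<Sum>k\<in>UNIV. of_int (A $$ (Rep_eleven i, Rep_eleven k)) * of_int (B $$ (Rep_eleven k, Rep_eleven j)))" for j
 proof -
  have "(A * B) $$ (Rep_eleven i, Rep_eleven j) = (\<Sum>k\<in>{0..<11}. A $$ (Rep_eleven i, k) * B $$ (k, Rep_eleven j))"
   using AB Rep_eleven_less by (auto simp: scalar_prod_def intro!: sum.cong)
  also have "\<dots> = (\<Sum>k\<in>UNIV. A $$ (Rep_eleven i, Rep_eleven k) * B $$ (Rep_eleven k, Rep_eleven j))"
   by (rule sum_eleven[symmetric])
  finally show ?thesis using AB Rep_eleven_less[of i] Rep_eleven_less[of j] by (simp add: mult_modp_def K_mod)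
 qed
 have "mop (mult_modp 13 A B) v i = (\<Sum>j\<in>UNIV. \<Sum>k\<in>UNIV. of_int (A $$ (Rep_eleven i, Rep_eleven k)) * of_int (B $$ (Rep_eleven k, Rep_eleven j)) * v j)"
  unfolding mop_def e by (simp add: sum_distrib_right)
 also have "\<dots> = (\<Sum>k\<in>UNIV. \<Sum>j\<in>UNIV. of_int (A $$ (Rep_eleven i, Rep_eleven k)) * of_int (B $$ (Rep_eleven k, Rep_eleven j)) * v j)"
  by (rule sum.swap)
 finally show "mop (mult_modp 13 A B) v i = mop A (mop B v) i"
  by (simp add: mop_def sum_distrib_left mult.assoc)
qed

lemma mop_inj:
 assumes A: "A \<in> mat_modp 11 13" and B: "B \<in> mat_modp 11 13" and e: "\<And>v. mop A v = mop B v"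
 shows "A = B"
proof (rule eq_matI)
 have c: "A \<in> carrier_mat 11 11" "B \<in> carrier_mat 11 11" using A B by (auto simp: mat_modp_def)
 then show "dim_row A = dim_row B" "dim_col A = dim_col B" by auto
 fix i j assume "i < dim_row B" "j < dim_col B"
 then have ij: "i < 11" "j < 11" using c by auto
 then have R: "Rep_eleven (Abs_eleven i) = i" "Rep_eleven (Abs_eleven j) = j" by (simp_all add: Abs_eleven_inverse)
 have "(of_int (A $$ (i,j)) :: K) = of_int (B $$ (i,j))"
  using e[of "ve (Abs_eleven j)"] mop_ve[of A "Abs_eleven j" "Abs_eleven i"] mop_ve[of B "Abs_eleven j" "Abs_eleven i"] R by simp
 then show "A $$ (i,j) = B $$ (i,j)" using K_inj[of "A $$ (i,j)" "B $$ (i,j)"] A B ij by (auto simp: mat_modp_def)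
qed

lemma one_mat_modp: "1\<^sub>m 11 \<in> mat_modp 11 13"
 by (auto simp: mat_modp_def)

interpretation Gp: prep vsc "range ve" Gg gm
proof (intro prep.intro prep_axioms.intro vs.fvs_axioms pgrp_Gg)
 show "(13::K) = 0" by (rule K_13)
 show "of_nat n \<noteq> (0::K)" if "0 < n" "n \<le> 12" for n using K_nat_inj[of n 0] that by auto
qed

lemma no_embedding:
 assumes h: "h \<in> hom Gg (GL_modp 11 13)" shows "\<not> inj_on h (carrier Gg)"
proof
 assume inj: "inj_on h (carrier Gg)"
 have hc: "h x \<in> carrier (GL_modp 11 13)" if "x \<in> carrier Gg" for x using h that by (rule hom_carrier[THEN subsetD, OF _ imageI])
 have hm: "h x \<in> mat_modp 11 13" if "x \<in> carrier Gg" for x using hc[OF that] by (simp add: GL_modp_def)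
 have mult: "mop (h (x \<otimes>\<^bsub>Gg\<^esub> y)) v = mop (h x) (mop (h y) v)" if "x \<in> carrier Gg" "y \<in> carrier Gg" for x y v
  using hom_mult[OF h that] mop_mult[OF hm[OF that(1)] hm[OF that(2)]] by (simp add: GL_modp_def)
 \<comment> \<open>The image of the unit is idempotent, and by the definition of
   \<open>GL_modp\<close> it has a left inverse \<open>B\<close>; so it acts as the
   identity.\<close>
 have one: "mop (h \<one>\<^bsub>Gg\<^esub>) v = v" for v
 proof -
  obtain B where B: "B \<in> mat_modp 11 13" "mult_modp 13 B (h \<one>\<^bsub>Gg\<^esub>) = 1\<^sub>m 11"
   using hc[OF Gp.one_closed] by (auto simp: GL_modp_def)
  have i: "mop B (mop (h \<one>\<^bsub>Gg\<^esub>) w) = w" for w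
   using mop_mult[OF B(1) hm[OF Gp.one_closed], of w] B(2) by (simp add: mop_one)
  have "mop (h \<one>\<^bsub>Gg\<^esub>) (mop (h \<one>\<^bsub>Gg\<^esub>) v) = mop (h \<one>\<^bsub>Gg\<^esub>) v"
   using mult[OF Gp.one_closed Gp.one_closed, of v] Gp.l_one[OF Gp.one_closed] by simp
  then have "mop B (mop (h \<one>\<^bsub>Gg\<^esub>) (mop (h \<one>\<^bsub>Gg\<^esub>) v)) = mop B (mop (h \<one>\<^bsub>Gg\<^esub>) v)" by simp
  then show ?thesis unfolding i .
 qed
 have lin: "vs.lin (mop A)" for A
  by (rule vs.linI) (auto simp: mop_def vsc_def fun_eq_iff algebra_simps sum.distrib sum_distrib_left)
 have "Gp.isrep UNIV (\<lambda>x. mop (h x))" unfolding Gp.isrep_def using lin mult one by simp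
 moreover have "card (range ve) = 11" using card_image[OF inj_ve] card_eleven by simp
 ultimately have "Gp.U (\<lambda>x. mop (h x)) (gm 10) v = 0" for v using Gp.no_small_rep by blast
 then have "mop (h (gm 10)) v = mop (1\<^sub>m 11) v" for v by (simp add: Gp.U_def mop_one)
 then have 1: "h (gm 10) = 1\<^sub>m 11" using mop_inj[OF hm one_mat_modp] gm_in by simp
 have 2: "h \<one>\<^bsub>Gg\<^esub> = 1\<^sub>m 11" using mop_inj[OF hm[OF Gp.one_closed] one_mat_modp] one mop_one by metis
 have "gm 10 = \<one>\<^bsub>Gg\<^esub>" using inj_onD[OF inj] 1 2 gm_in Gp.one_closed by simp
 then show False using gm_pow_ne[of 1 10] gm_pow1[of 10] by simp
qed

hide_const (open) Polynomial.order

theorem theorem3p1: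
  shows "\<exists>(p::nat) (G::nat monoid). prime p \<and> p \<ge> 12 \<and> group G \<and>
           finite (carrier G) \<and> order G = p ^ 10 \<and> group_exponent G = p \<and>
           \<not> (\<exists>h. h \<in> hom G (GL_modp 11 p) \<and> inj_on h (carrier G))"
proof -
  \<comment> \<open>Finiteness gives an injection into the naturals, along which the group structure
    is transported.\<close>
  obtain \<phi> :: "K mat \<Rightarrow> nat" where inj: "inj_on \<phi> (carrier Gg)"
    using finite_imp_inj_to_nat_seg[OF Hg1(1)] by auto
  define N where "N = image_group \<phi> Gg"
  have gN: "group N" unfolding N_def by (rule Gp.inj_imp_image_group_is_group[OF inj])
  have iso: "\<phi> \<in> iso Gg N" unfolding N_def by (rule inj_imp_image_group_iso[OF inj])
  then have hom: "\<phi> \<in> hom Gg N" and bij: "bij_betw \<phi> (carrier Gg) (carrier N)" by (auto simp: iso_def)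
  interpret h: group_hom Gg N \<phi> by (intro group_hom.intro group_hom_axioms.intro group_Gg gN hom)
  have cN: "carrier N = \<phi> ` carrier Gg" using bij by (simp add: bij_betw_def)
  have fin: "finite (carrier N)" unfolding cN using Hg1(1) by simp
  have ord: "order N = 13 ^ 10" unfolding Coset.order_def cN using card_image[OF inj] Hg1(2) by simp
  have pw: "(\<forall>x\<in>carrier N. x [^]\<^bsub>N\<^esub> n = \<one>\<^bsub>N\<^esub>) \<longleftrightarrow> (\<forall>x\<in>carrier Gg. x [^]\<^bsub>Gg\<^esub> n = \<one>\<^bsub>Gg\<^esub>)" for n :: nat
  proof -
    have "\<phi> x [^]\<^bsub>N\<^esub> n = \<one>\<^bsub>N\<^esub> \<longleftrightarrow> x [^]\<^bsub>Gg\<^esub> n = \<one>\<^bsub>Gg\<^esub>" if x: "x \<in> carrier Gg" for x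
    proof -
      have "\<phi> x [^]\<^bsub>N\<^esub> n = \<phi> (x [^]\<^bsub>Gg\<^esub> n)" using h.hom_nat_pow[OF x] by simp
      moreover have "\<one>\<^bsub>N\<^esub> = \<phi> \<one>\<^bsub>Gg\<^esub>" using h.hom_one by simp
      ultimately show ?thesis
        using inj_on_eq_iff[OF inj Gp.nat_pow_closed[OF x, of n] Gp.one_closed] by simp
    qed
    then show ?thesis unfolding cN by blast
  qed
  have ex: "group_exponent N = 13"
    unfolding group_exponent_def
  proof (rule Least_equality)
    show "0 < (13::nat) \<and> (\<forall>x\<in>carrier N. x [^]\<^bsub>N\<^esub> (13::nat) = \<one>\<^bsub>N\<^esub>)"
      unfolding pw using Um_pow13 Hg_carr[of _ 1] by auto
    \<comment> \<open>No power of \<open>gm 1\<close> with exponent strictly between 0 and 13 is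
      trivial, which bounds the exponent from below.\<close>
    fix n :: nat assume n: "0 < n \<and> (\<forall>x\<in>carrier N. x [^]\<^bsub>N\<^esub> n = \<one>\<^bsub>N\<^esub>)"
    then have "gm 1 [^]\<^bsub>Um\<^esub> n = 1\<^sub>m 12" unfolding pw using gm_in by auto
    then show "13 \<le> n" using gm_pow_ne[of n 1] n by (cases "n < 13") auto
  qed
  have "\<not> (\<exists>h. h \<in> hom N (GL_modp 11 13) \<and> inj_on h (carrier N))"
  proof
    assume "\<exists>h. h \<in> hom N (GL_modp 11 13) \<and> inj_on h (carrier N)"
    then obtain f where f: "f \<in> hom N (GL_modp 11 13)" "inj_on f (carrier N)" by blast
    have "f \<circ> \<phi> \<in> hom Gg (GL_modp 11 13)" using hom f(1) by (auto simp: hom_def Pi_def)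
    moreover have "inj_on (f \<circ> \<phi>) (carrier Gg)" using comp_inj_on[OF inj] f(2) cN by simp
    ultimately show False using no_embedding by blast
  qed
  then show ?thesis using gN fin ord ex by (intro exI[of _ 13] exI[of _ N]) simp
qed

end
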